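(* Let $s\in L_{2,loc}(\mathbb{R}_+)$ be complex-valued, and suppose that for some $\varepsilon>0$ the minimal operator $L_0$ constructed from the function $(1+\varepsilon)s$ is strictly sectorial, with numerical range lying in a sector $\Lambda_{\alpha,\beta}(z_0)$, where $0\le\beta-\alpha<\pi$, $|\alpha|<\pi$, $|\beta|<\pi$, $z_0\in\mathbb{C}$. Then for any $\sigma\in L_{2,loc}(\mathbb{R}_+)$ satisfying $$\sup_{x\in\mathbb{R}_+}\int_x^{x+1}\int_x^{x+1}|\sigma(\xi)-\sigma(\eta)|^2\,d\xi\,d\eta<+\infty,$$ the minimal operator $L_{0,\sigma}$ constructed from $s+\sigma$ is also strictly sectorial. If, moreover, $L_0$ has extensions with compact resolvents, then $L_{0,\sigma}$ also has extensions with compact resolvents.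
   Context: $\mathbb{R}_+=[0,+\infty)$; the subscript "loc" means the property holds on every segment $[0,R]$; functions are complex-valued. Minimal operator constructed from a function $r\in L_{2,loc}(\mathbb{R}_+)$: for $y\in AC_{loc}(\mathbb{R}_+)$ put $y^{[1]}=y'-ry$, and if $y^{[1]}\in AC_{loc}(\mathbb{R}_+)$ put $l(y)=-(y^{[1]})'-ry^{[1]}-r^2y$ (a regularization of $-y''+r'y$). Let $$\mathscr{D}_0=\{y\in L_2(\mathbb{R}_+): y,y^{[1]}\in AC_{loc}(\mathbb{R}_+),\ l(y)\in L_2(\mathbb{R}_+),\ y(0)=y^{[1]}(0)=0,\ \operatorname{supp}y\text{ compact}\}.$$ The minimal operator acts in $L_2(\mathbb{R}_+)$ by $y\mapsto l(y)$ on the domain $\mathscr{D}_0$. Such an operator "has extensions with compact resolvents" if there is a linear operator $L$ in $L_2(\mathbb{R}_+)$ extending it, with non-empty resolvent set and with $(L-\lambda)^{-1}$ compact for $\lambda$ in the resolvent set. For $z_0\in\mathbb{C}$ let $\Lambda_{\alpha,\beta}(z_0)=\{z_0+z: z\in\mathbb{C},\ \arg z\in[\alpha,\beta]\}$, where $\arg z\in[\alpha,\beta]$ means $z=re^{i\varphi}$ with some $r\ge0$, $\varphi\in[\alpha,\beta]$ (vertex included). The numerical range of $L$ is $\{(Ly,y): y\in\mathscr{D}(L),\ \|y\|=1\}$. $L$ is strictly sectorial if its numerical range lies in some $\Lambda_{\alpha,\beta}(z_0)$ with $z_0\in\mathbb{C}$, $0\le\beta-\alpha<\pi$. *)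

theory Defs
  imports "HOL-Analysis.Analysis"
begin

section \<open>The complex Hilbert space $L_2(\mathbb{R}_+)$\<close>

abbreviation halfline :: "real measure" where
  "halfline \<equiv> lebesgue_on {0..}"

text \<open>Functions on the half-line are represented by functions on all of \<^typ>\<open>real\<close>; the values
  at negative arguments never matter.\<close>

definition square_integrable_on :: "(real \<Rightarrow> complex) \<Rightarrow> real set \<Rightarrow> bool" where
  "square_integrable_on f S \<longleftrightarrow>
     f \<in> borel_measurable (lebesgue_on S) \<and> integrable (lebesgue_on S) (\<lambda>x. (norm (f x))\<^sup>2)"

lemma square_integrable_on_zero: "square_integrable_on (\<lambda>_. 0) S"
  by (simp add: square_integrable_on_def)

lemma square_integrable_on_add:
  assumes "square_integrable_on f S" "square_integrable_on g S"
  shows "square_integrable_on (\<lambda>x. f x + g x) S"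
proof -
  have [measurable]: "f \<in> borel_measurable (lebesgue_on S)" "g \<in> borel_measurable (lebesgue_on S)"
    using assms by (auto simp: square_integrable_on_def)
  have "integrable (lebesgue_on S) (\<lambda>x. 2 * (norm (f x))\<^sup>2 + 2 * (norm (g x))\<^sup>2)"
    using assms by (auto simp: square_integrable_on_def)
  moreover have "(norm (f x + g x))\<^sup>2 \<le> 2 * (norm (f x))\<^sup>2 + 2 * (norm (g x))\<^sup>2" for x
  proof -
    have "(norm (f x + g x))\<^sup>2 \<le> (norm (f x) + norm (g x))\<^sup>2"
      by (intro power_mono norm_triangle_ineq) auto
    also have "\<dots> \<le> 2 * (norm (f x))\<^sup>2 + 2 * (norm (g x))\<^sup>2"
      using sum_squares_bound[of "norm (f x)" "norm (g x)"] by (simp add: power2_sum)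
    finally show ?thesis .
  qed
  ultimately have "integrable (lebesgue_on S) (\<lambda>x. (norm (f x + g x))\<^sup>2)"
    by (auto intro!: Bochner_Integration.integrable_bound[where g = "\<lambda>x. (norm (f x + g x))\<^sup>2"])
  then show ?thesis by (simp add: square_integrable_on_def)
qed

lemma square_integrable_on_cmult:
  assumes "square_integrable_on f S"
  shows "square_integrable_on (\<lambda>x. c * f x) S"
  using assms by (auto simp: square_integrable_on_def norm_mult power_mult_distrib)

lemma square_integrable_on_integrable_mult_cnj:
  assumes "square_integrable_on f S" "square_integrable_on g S"
  shows "integrable (lebesgue_on S) (\<lambda>x. f x * cnj (g x))"
proof -
  have [measurable]: "f \<in> borel_measurable (lebesgue_on S)" "g \<in> borel_measurable (lebesgue_on S)"
    using assms by (auto simp: square_integrable_on_def)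
  have cnj_meas: "(\<lambda>x. cnj (g x)) \<in> borel_measurable (lebesgue_on S)"
    by (rule borel_measurable_continuous_on[where f = cnj]) (auto intro: continuous_intros)
  have "integrable (lebesgue_on S) (\<lambda>x. (norm (f x))\<^sup>2 + (norm (g x))\<^sup>2)"
    using assms by (auto simp: square_integrable_on_def)
  moreover have "norm (f x * cnj (g x)) \<le> norm ((norm (f x))\<^sup>2 + (norm (g x))\<^sup>2)" for x
  proof -
    have "norm (f x) * norm (g x) \<le> (norm (f x))\<^sup>2 + (norm (g x))\<^sup>2"
      using sum_squares_bound[of "norm (f x)" "norm (g x)"]
        mult_nonneg_nonneg[OF norm_ge_zero[of "f x"] norm_ge_zero[of "g x"]] by linarith
    then show ?thesis by (simp add: norm_mult)
  qed
  ultimately show ?thesis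
    using cnj_meas by (auto intro!: Bochner_Integration.integrable_bound[where
          g = "\<lambda>x. f x * cnj (g x)" and f = "\<lambda>x. (norm (f x))\<^sup>2 + (norm (g x))\<^sup>2"])
qed

quotient_type L2 = "real \<Rightarrow> complex" / partial:
  "\<lambda>f g. square_integrable_on f {0..} \<and> square_integrable_on g {0..} \<and> (AE x in halfline. f x = g x)"
proof (rule part_equivpI)
  show "\<exists>f. square_integrable_on f {0..} \<and> square_integrable_on f {0..} \<and> (AE x in halfline. f x = f x)"
    by (rule exI[of _ "\<lambda>_. 0"]) (simp add: square_integrable_on_zero)
  show "symp (\<lambda>f g. square_integrable_on f {0..} \<and> square_integrable_on g {0..} \<and> (AE x in halfline. f x = g x))"
    by (auto simp: symp_def eq_commute)
  show "transp (\<lambda>f g. square_integrable_on f {0..} \<and> square_integrable_on g {0..} \<and> (AE x in halfline. f x = g x))"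
    unfolding transp_def
  proof (intro allI impI conjI; (elim conjE)?)
    fix f g h :: "real \<Rightarrow> complex"
    assume "AE x in halfline. f x = g x" "AE x in halfline. g x = h x"
    then show "AE x in halfline. f x = h x" by eventually_elim simp
  qed auto
qed

lift_definition cscale :: "complex \<Rightarrow> L2 \<Rightarrow> L2" is "\<lambda>c f x. c * f x"
  by (auto intro: square_integrable_on_cmult)

lift_definition cinner :: "L2 \<Rightarrow> L2 \<Rightarrow> complex" is "\<lambda>f g. LINT x|halfline. f x * cnj (g x)"
proof -
  fix f f' g g' :: "real \<Rightarrow> complex"
  assume 1: "square_integrable_on f {0..} \<and> square_integrable_on f' {0..} \<and> (AE x in halfline. f x = f' x)"
    and 2: "square_integrable_on g {0..} \<and> square_integrable_on g' {0..} \<and> (AE x in halfline. g x = g' x)"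
  have "AE x in halfline. f x = f' x" "AE x in halfline. g x = g' x" using 1 2 by auto
  then have "AE x in halfline. f x * cnj (g x) = f' x * cnj (g' x)" by eventually_elim simp
  then show "(LINT x|halfline. f x * cnj (g x)) = (LINT x|halfline. f' x * cnj (g' x))"
    using 1 2 by (intro integral_cong_AE borel_measurable_integrable
        square_integrable_on_integrable_mult_cnj) auto
qed

instantiation L2 :: real_inner
begin

lift_definition zero_L2 :: L2 is "\<lambda>_. 0"
  by (simp add: square_integrable_on_zero)

lift_definition plus_L2 :: "L2 \<Rightarrow> L2 \<Rightarrow> L2" is "\<lambda>f g x. f x + g x"
  by (auto intro: square_integrable_on_add)

definition "uminus f = cscale (- 1) f" for f :: L2
definition "f - g = f + - g" for f g :: L2
definition "scaleR a f = cscale (of_real a) f" for f :: L2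
definition "inner f g = Re (cinner f g)" for f g :: L2
definition "norm f = sqrt (inner f f)" for f :: L2
definition "dist f g = norm (f - g)" for f g :: L2
definition "sgn f = scaleR (inverse (norm f)) f" for f :: L2
definition "uniformity = (INF e\<in>{0<..}. principal {(f :: L2, g). dist f g < e})"
definition "open U = (\<forall>f\<in>U. eventually (\<lambda>(f', g). f' = f \<longrightarrow> g \<in> U) uniformity)" for U :: "L2 set"

instance
proof
  fix f g h :: L2 and a b :: real and U :: "L2 set"
  show "f + g + h = f + (g + h)"
    by transfer (auto intro!: square_integrable_on_add simp: add.assoc)
  show "f + g = g + f"
    by transfer (auto intro!: square_integrable_on_add simp: add.commute)
  show "0 + f = f"
    by transfer auto
  show "- f + f = 0"
    unfolding uminus_L2_def
    by transfer (auto intro!: square_integrable_on_add square_integrable_on_cmult square_integrable_on_zero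
        dest: square_integrable_on_cmult[where c = "- 1"])
  show "f - g = f + - g" by (rule minus_L2_def)
  show "scaleR a (f + g) = scaleR a f + scaleR a g"
    unfolding scaleR_L2_def
    by transfer (auto intro!: square_integrable_on_add square_integrable_on_cmult simp: distrib_left)
  show "scaleR (a + b) f = scaleR a f + scaleR b f"
    unfolding scaleR_L2_def
    by transfer (auto intro!: square_integrable_on_add square_integrable_on_cmult simp: distrib_right)
  show "scaleR a (scaleR b f) = scaleR (a * b) f"
    unfolding scaleR_L2_def
    by transfer (auto intro!: square_integrable_on_cmult simp: mult.assoc)
  show "scaleR 1 f = f"
    unfolding scaleR_L2_def by transfer auto
  show "dist f g = norm (f - g)" by (rule dist_L2_def)
  show "sgn f = scaleR (inverse (norm f)) f" by (rule sgn_L2_def)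
  show "uniformity = (INF e\<in>{0<..}. principal {(f :: L2, g). dist f g < e})"
    by (rule uniformity_L2_def)
  show "open U = (\<forall>f\<in>U. eventually (\<lambda>(f', g). f' = f \<longrightarrow> g \<in> U) uniformity)"
    by (rule open_L2_def)
  show "inner f g = inner g f"
    unfolding inner_L2_def
  proof transfer
    fix f g :: "real \<Rightarrow> complex"
    have "(LINT x|halfline. g x * cnj (f x)) = (LINT x|halfline. cnj (f x * cnj (g x)))"
      by (simp add: mult.commute)
    also have "\<dots> = cnj (LINT x|halfline. f x * cnj (g x))" by (rule Bochner_Integration.integral_cnj)
    finally show "Re (LINT x|halfline. f x * cnj (g x)) = Re (LINT x|halfline. g x * cnj (f x))" by simp
  qed
  show "inner (f + g) h = inner f h + inner g h"
    unfolding inner_L2_def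
    by transfer (simp add: distrib_right square_integrable_on_integrable_mult_cnj)
  show "inner (scaleR a f) g = a * inner f g"
    unfolding inner_L2_def scaleR_L2_def by transfer (simp add: mult.assoc)
  have inner_self: "inner f f = (LINT x|halfline. (norm (F x))\<^sup>2)"
    if "square_integrable_on F {0..}" "f = abs_L2 F" for F
  proof -
    have "cinner f f = (LINT x|halfline. F x * cnj (F x))"
      using that by (simp add: cinner.abs_eq)
    also have "\<dots> = of_real (LINT x|halfline. (norm (F x))\<^sup>2)"
      by (simp add: complex_norm_square[symmetric] flip: of_real_power)
    finally show ?thesis by (simp add: inner_L2_def)
  qed
  obtain F where F: "square_integrable_on F {0..}" "f = abs_L2 F"
    by (induction f rule: L2.abs_induct) auto
  show "0 \<le> inner f f" unfolding inner_self[OF F] by simp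
  show "norm f = sqrt (inner f f)" by (rule norm_L2_def)
  have "inner f f = 0 \<longleftrightarrow> (AE x in halfline. (norm (F x))\<^sup>2 = 0)"
    unfolding inner_self[OF F]
    using F(1) by (intro integral_nonneg_eq_0_iff_AE) (auto simp: square_integrable_on_def)
  also have "\<dots> \<longleftrightarrow> f = 0"
    using Quotient3_rel[OF Quotient3_L2, of F "\<lambda>_. 0"] F(1)
    by (simp add: F(2) zero_L2_def square_integrable_on_zero)
  finally show "inner f f = 0 \<longleftrightarrow> f = 0" .
qed

end


section \<open>Linear operators in $L_2(\mathbb{R}_+)$\<close>

text \<open>An operator with a domain is identified with its graph, so that extension is inclusion.\<close>

type_synonym operator_graph = "(L2 \<times> L2) set"

definition linear_operator :: "operator_graph \<Rightarrow> bool" where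
  "linear_operator L \<longleftrightarrow>
     (0, 0) \<in> L \<and>
     (\<forall>f g f' g'. (f, g) \<in> L \<and> (f', g') \<in> L \<longrightarrow> (f + f', g + g') \<in> L) \<and>
     (\<forall>c f g. (f, g) \<in> L \<longrightarrow> (cscale c f, cscale c g) \<in> L) \<and>
     single_valued L"

text \<open>\<open>R\<close> is the everywhere defined bounded inverse of $L - \lambda$: the equation $(L-\lambda)f = h$
  holds if and only if $f = Rh$. (Real linearity of \<open>R\<close> suffices here, since a two-sided inverse
  of a complex linear map is complex linear.)\<close>

definition is_resolvent :: "operator_graph \<Rightarrow> complex \<Rightarrow> (L2 \<Rightarrow> L2) \<Rightarrow> bool" where
  "is_resolvent L lam R \<longleftrightarrow>
     bounded_linear R \<and> (\<forall>f h. (f, h + cscale lam f) \<in> L \<longleftrightarrow> f = R h)"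

definition resolvent_set :: "operator_graph \<Rightarrow> complex set" where
  "resolvent_set L = {lam. \<exists>R. is_resolvent L lam R}"

definition compact_operator :: "(L2 \<Rightarrow> L2) \<Rightarrow> bool" where
  "compact_operator T \<longleftrightarrow> (\<forall>B. bounded B \<longrightarrow> compact (closure (T ` B)))"

definition has_extension_with_compact_resolvent :: "operator_graph \<Rightarrow> bool" where
  "has_extension_with_compact_resolvent L0 \<longleftrightarrow>
     (\<exists>L. linear_operator L \<and> L0 \<subseteq> L \<and> resolvent_set L \<noteq> {} \<and>
          (\<forall>lam R. is_resolvent L lam R \<longrightarrow> compact_operator R))"

definition numerical_range :: "operator_graph \<Rightarrow> complex set" where
  "numerical_range L = {cinner g f | f g. (f, g) \<in> L \<and> norm f = 1}"

definition sector :: "real \<Rightarrow> real \<Rightarrow> complex \<Rightarrow> complex set" where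
  "sector \<alpha> \<beta> z0 = {z0 + of_real r * cis \<phi> | r \<phi>. 0 \<le> r \<and> \<alpha> \<le> \<phi> \<and> \<phi> \<le> \<beta>}"

definition strictly_sectorial :: "operator_graph \<Rightarrow> bool" where
  "strictly_sectorial L \<longleftrightarrow>
     (\<exists>z0 \<alpha> \<beta>. 0 \<le> \<beta> - \<alpha> \<and> \<beta> - \<alpha> < pi \<and> numerical_range L \<subseteq> sector \<alpha> \<beta> z0)"


section \<open>The minimal operator\<close>

definition L2_loc :: "(real \<Rightarrow> complex) set" where
  "L2_loc = {f. \<forall>R\<ge>0. square_integrable_on f {0..R}}"

text \<open>Absolute continuity of functions; the library constant \<^const>\<open>absolutely_continuous\<close> is about
  measures.\<close>

definition AC_on :: "real \<Rightarrow> real \<Rightarrow> (real \<Rightarrow> complex) \<Rightarrow> bool" where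
  "AC_on a b f \<longleftrightarrow>
     (\<forall>\<epsilon>>0. \<exists>\<delta>>0. \<forall>D T. D division_of T \<and> T \<subseteq> {a..b} \<and> (\<Sum>K\<in>D. Sup K - Inf K) < \<delta>
        \<longrightarrow> (\<Sum>K\<in>D. norm (f (Sup K) - f (Inf K))) < \<epsilon>)"

definition AC_loc :: "(real \<Rightarrow> complex) set" where
  "AC_loc = {f. \<forall>R\<ge>0. AC_on 0 R f}"

text \<open>Derivatives of absolutely continuous functions are only determined almost everywhere, so
  $y'$, $y^{[1]}$ and $l(y)$ are given by relations saying that the last argument is a
  representative. In particular, $y^{[1]}\in AC_{loc}$ means that $y^{[1]}$ has a representative
  \<open>u\<close> in \<^const>\<open>AC_loc\<close>; it is then unique on the half-line, and $y^{[1]}(0)$ is \<open>u 0\<close>.\<close>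

definition is_ae_derivative :: "(real \<Rightarrow> complex) \<Rightarrow> (real \<Rightarrow> complex) \<Rightarrow> bool" where
  "is_ae_derivative y y' \<longleftrightarrow> (AE x in halfline. (y has_vector_derivative y' x) (at x))"

definition is_quasi_derivative ::
    "(real \<Rightarrow> complex) \<Rightarrow> (real \<Rightarrow> complex) \<Rightarrow> (real \<Rightarrow> complex) \<Rightarrow> bool" where
  "is_quasi_derivative r y u \<longleftrightarrow>
     (\<exists>y'. is_ae_derivative y y' \<and> (AE x in halfline. u x = y' x - r x * y x))"

definition is_quasi_expression ::
    "(real \<Rightarrow> complex) \<Rightarrow> (real \<Rightarrow> complex) \<Rightarrow> (real \<Rightarrow> complex) \<Rightarrow> (real \<Rightarrow> complex) \<Rightarrow> bool" where
  "is_quasi_expression r y u l \<longleftrightarrow>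
     (\<exists>u'. is_ae_derivative u u' \<and>
           (AE x in halfline. l x = - u' x - r x * u x - (r x)\<^sup>2 * y x))"

definition minimal_operator :: "(real \<Rightarrow> complex) \<Rightarrow> operator_graph" where
  "minimal_operator r = {(abs_L2 y, abs_L2 l) | y u l.
     square_integrable_on y {0..} \<and> y \<in> AC_loc \<and>
     u \<in> AC_loc \<and> is_quasi_derivative r y u \<and>
     is_quasi_expression r y u l \<and> square_integrable_on l {0..} \<and>
     y 0 = 0 \<and> u 0 = 0 \<and> (\<exists>R. \<forall>x>R. 0 \<le> x \<longrightarrow> y x = 0)}"

end

theory Submission
  imports Defs
begin

text \<open>Every function \<open>y\<close> in the domain of a minimal operator vanishes at the origin and has compact support,
  and $y' = y^{[1]} + r y$ is square-integrable. All functions are therefore parametrised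
  by their derivatives \<open>W\<close>, elements of \<open>L\<^sub>2\<close>, with \<open>y = prim W\<close>. Integration by parts turns the operator into the
  form
  \[ a_r(W,Z) = \int W \overline{Z} - \int r\,(y \overline{z})', \qquad y = \mathrm{prim}\,W,\ z = \mathrm{prim}\,Z, \]
  in which the potential is never differentiated. Three facts about this form give the theorem.

  \<^item> The numerical range of the minimal operator only sees the form on the operator domain, but that domain is
  dense, for the norm of \<open>W\<close>, among all functions that vanish at \<open>0\<close> and outside a bounded interval
  (\<open>minimal_domain_dense\<close>). Hence the cone condition expressed by the sector passes to the form
  (\<open>form_in_cone\<close>).

  \<^item> The factor \<open>1 + \<epsilon>\<close> leaves a surplus of \<open>\<integral>\<bar>y'\<bar>\<^sup>2\<close>:
  \[ a_{s+\sigma}(W,W) = \frac{1}{1+\varepsilon}\, a_{(1+\varepsilon)s}(W,W) + \frac{\varepsilon}{1+\varepsilon}\,\|W\|^2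
       + \bigl(a_\sigma(W,W) - \|W\|^2\bigr) , \]
  and the last bracket is bounded by \<open>\<eta>\<integral>\<bar>y'\<bar>\<^sup>2 + K\<integral>\<bar>y\<bar>\<^sup>2\<close> with \<open>\<eta>\<close> as small as desired
  (\<open>form_perturbation_bound\<close>). The reason is that \<open>\<sigma>\<close> is, on the cells of a grid, a constant plus a remainder
  that is bounded in \<open>L\<^sub>2\<close> of the cell; the constants are multiplied by \<open>(\<bar>y\<bar>\<^sup>2)'\<close>, so after summation by parts
  only their jumps matter, and these are bounded. So the form for \<open>s + \<sigma>\<close> lies in a cone again, and it dominates
  both \<open>\<integral>\<bar>y'\<bar>\<^sup>2\<close> and a multiple of the form for \<open>(1 + \<epsilon>)s\<close>.

  \<^item> An extension for \<open>s + \<sigma>\<close> is the operator that the closure of the form defines, obtained from a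
  Lax--Milgram theorem (\<open>friedrichs_extension\<close>). Its resolvents are compact as soon as the functions with form value
  at most one are totally bounded in \<open>L\<^sub>2\<close>. By the domination above it suffices that this holds for
  \<open>(1 + \<epsilon>)s\<close> (\<open>compact_embedding\<close>). There the given extension is an arbitrary operator, but its resolvent inverts a shift of
  the minimal operator on the range of that shift. For a right-hand side \<open>f\<close> in that range with
  solution \<open>y\<close>, the form \<open>b\<close> satisfies \<open>\<bar>\<bar>f\<bar>\<bar>\<^sup>2 = b(y,f)\<close> and \<open>b(y,y) \<le> \<bar>\<bar>f\<bar>\<bar> \<bar>\<bar>y\<bar>\<bar>\<close>, so on
  sets of bounded form value \<open>f\<close> depends with a uniform modulus of continuity on \<open>y\<close>, and \<open>y\<close> runs through a totally bounded set. Finally the admissible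
  right-hand sides have codimension at most two: a Dirichlet solution belongs to the operator domain
  when its quasi-derivative vanishes at both ends of the interval.\<close>

section \<open>Absolutely continuous functions\<close>

lemma AE_lebesgue_on_negligible:
  assumes "S \<in> sets lebesgue"
  shows "(AE x in lebesgue_on S. P x) \<longleftrightarrow> (\<exists>N. negligible N \<and> (\<forall>x\<in>S - N. P x))"
proof -
  have "(AE x in lebesgue_on S. P x) \<longleftrightarrow> (AE x in lebesgue. x \<in> S \<longrightarrow> P x)"
    using assms by (simp add: AE_restrict_space_iff)
  also have "\<dots> \<longleftrightarrow> (\<exists>N. negligible N \<and> {x. \<not> (x \<in> S \<longrightarrow> P x)} \<subseteq> N)"
    by (auto simp: eventually_ae_filter negligible_iff_null_sets)
  finally show ?thesis by blast
qed

lemma negligible_outer_open: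
  assumes "negligible N" "e > (0::real)"
  obtains U where "open U" "N \<subseteq> U" "U \<in> lmeasurable" "measure lebesgue U < e"
proof -
  have "N \<in> sets lebesgue" using assms(1) by (simp add: negligible_imp_sets)
  then obtain U where U: "open U" "N \<subseteq> U" "U - N \<in> lmeasurable" "emeasure lebesgue (U - N) < ennreal e"
    using sets_lebesgue_outer_open assms(2) by blast
  have mN: "N \<in> lmeasurable" using assms(1) by (rule negligible_imp_measurable)
  have Ueq: "U = (U - N) \<union> N" using U(2) by blast
  have "U \<in> lmeasurable" by (subst Ueq) (intro fmeasurable.Un U(3) mN)
  moreover have "measure lebesgue (U - N) < e"
    using U(3,4) assms(2) by (simp add: emeasure_eq_measure2 ennreal_less_iff)
  moreover have "measure lebesgue U \<le> measure lebesgue (U - N) + measure lebesgue N"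
    using Ueq by (metis U(3) mN measure_Un_le fmeasurableD)
  ultimately show ?thesis using that U assms(1) by (simp add: negligible_imp_measure0)
qed

lemma division_of_real_intervalE:
  assumes "D division_of T" "T \<subseteq> {a..b::real}" "K \<in> D"
  obtains u v where "u \<le> v" "K = {u..v}" "a \<le> u" "v \<le> b"
proof -
  obtain u v where K: "K = cbox u v" using division_ofD(4)[OF assms(1,3)] by blast
  have "K \<noteq> {}" "K \<subseteq> {a..b}" using division_ofD(2,3)[OF assms(1,3)] assms(2) by auto
  then show ?thesis using that[of u v] K by auto
qed

lemma AC_onE:
  assumes "AC_on a b f" "0 < e"
  obtains d where "d > 0" "\<And>D T. D division_of T \<Longrightarrow> T \<subseteq> {a..b} \<Longrightarrow> (\<Sum>K\<in>D. Sup K - Inf K) < d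
        \<Longrightarrow> (\<Sum>K\<in>D. norm (f (Sup K) - f (Inf K))) < e"
proof -
  from assms(1)[unfolded AC_on_def, rule_format, OF assms(2)] obtain d where
    "d > 0" "\<forall>D T. D division_of T \<and> T \<subseteq> {a..b} \<and> (\<Sum>K\<in>D. Sup K - Inf K) < d
        \<longrightarrow> (\<Sum>K\<in>D. norm (f (Sup K) - f (Inf K))) < e"
    by (elim exE conjE)
  note d = this
  show ?thesis
    by (rule that[OF d(1)]) (rule d(2)[rule_format], intro conjI)
qed

text \<open>A gauge-integral argument: a fine tagged division splits into the intervals tagged outside \<open>N\<close>, where
  differentiability makes the increment of \<open>f\<close> close to \<open>f' x\<close> times the length, and those tagged in \<open>N\<close>, which
  the gauge keeps inside an open set of small measure, so that absolute continuity bounds their increments.\<close>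

theorem AC_on_has_integral:
  assumes AC: "AC_on a b f" and ab: "a \<le> b" and N: "negligible N"
    and der: "\<And>x. x \<in> {a..b} - N \<Longrightarrow> (f has_vector_derivative f' x) (at x within {a..b})"
  shows "(f' has_integral (f b - f a)) {a..b}"
proof -
  \<comment> \<open>on the null set the integrand may be set to zero, so that only the increments of \<open>f\<close> remain there\<close>
  define g where "g x = (if x \<in> N then 0 else f' x)" for x
  have "(g has_integral (f b - f a)) {a..b}"
    unfolding has_integral_real
  proof (intro allI impI)
    fix e :: real assume e: "e > 0"
    define e' where "e' = e / (2 * (b - a + 1))"
    have e': "e' > 0" using e ab by (simp add: e'_def)
    have e'b: "e' * (b - a) < e / 2" using e ab by (simp add: e'_def field_simps)
    obtain \<delta> where \<delta>: "\<delta> > 0" and acd: "\<And>D T. D division_of T \<Longrightarrow> T \<subseteq> {a..b} \<Longrightarrow> (\<Sum>K\<in>D. Sup K - Inf K) < \<delta>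
        \<Longrightarrow> (\<Sum>K\<in>D. norm (f (Sup K) - f (Inf K))) < e / 2"
      using AC_onE[OF AC, of "e/2"] e half_gt_zero by blast
    obtain U where U: "open U" "N \<subseteq> U" "U \<in> lmeasurable" "measure lebesgue U < \<delta>"
      using negligible_outer_open[OF N \<delta>] by blast
    have "\<exists>d>0. x \<in> {a..b} - N \<longrightarrow>
         (\<forall>y\<in>{a..b}. norm (y-x) < d \<longrightarrow> norm (f y - f x - (y-x) *\<^sub>R f' x) \<le> e' * norm (y-x))" for x
    proof (cases "x \<in> {a..b} - N")
      case True
      then show ?thesis
        using der[OF True, unfolded has_vector_derivative_def has_derivative_within_alt] e' by blast
    qed (auto intro: exI[of _ 1])
    then have "\<exists>d. \<forall>x. d x > 0 \<and> (x \<in> {a..b} - N \<longrightarrow>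
         (\<forall>y\<in>{a..b}. norm (y-x) < d x \<longrightarrow> norm (f y - f x - (y-x) *\<^sub>R f' x) \<le> e' * norm (y-x)))"
      by (intro choice allI)
    then obtain d where dd: "\<forall>x. d x > 0 \<and> (x \<in> {a..b} - N \<longrightarrow>
         (\<forall>y\<in>{a..b}. norm (y-x) < d x \<longrightarrow> norm (f y - f x - (y-x) *\<^sub>R f' x) \<le> e' * norm (y-x)))" ..
    have d: "0 < d x" "\<lbrakk>x \<in> {a..b} - N; y \<in> {a..b}; norm (y-x) < d x\<rbrakk>
                        \<Longrightarrow> norm (f y - f x - (y-x) *\<^sub>R f' x) \<le> e' * norm (y-x)" for x y
      using spec[OF dd, of x] by simp_all
    define \<gamma> where "\<gamma> x = (if x \<in> N then U else ball x (d x))" for x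
    have gauge: "gauge \<gamma>" using U d(1) by (auto simp: gauge_def \<gamma>_def)
    have "norm ((\<Sum>(x, K)\<in>p. measure lborel K *\<^sub>R g x) - (f b - f a)) < e"
      if ptag: "p tagged_division_of {a..b}" and fin: "\<gamma> fine p" for p
    proof -
      have finp: "finite p" using tagged_division_of_finite[OF ptag] .
      have ba: "b - a = (\<Sum>(x,K)\<in>p. Sup K - Inf K)" "f b - f a = (\<Sum>(x,K)\<in>p. f(Sup K) - f(Inf K))"
        using additive_tagged_division_1[where f= "\<lambda>x. x"] additive_tagged_division_1[where f= f]
          ab ptag by auto
      have mem: "\<exists>u v. u \<le> v \<and> K = {u..v} \<and> x \<in> K \<and> K \<subseteq> {a..b} \<and> K \<subseteq> \<gamma> x" if xK: "(x,K) \<in> p" for x K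
      proof -
        obtain u v where K: "K = cbox u v" using tagged_division_ofD(4)[OF ptag xK] by (elim exE)
        have x: "x \<in> K" and Kab: "K \<subseteq> {a..b}" using tagged_division_ofD(2,3)[OF ptag that] .
        have K\<gamma>: "K \<subseteq> \<gamma> x" using fineD[OF fin that] .
        show ?thesis by (rule exI[of _ u], rule exI[of _ v]) (use K x Kab K\<gamma> in auto)
      qed
      define p1 where "p1 = {z\<in>p. fst z \<in> N}"
      define p2 where "p2 = {z\<in>p. fst z \<notin> N}"
      have p12: "p = p1 \<union> p2" "p1 \<inter> p2 = {}" "finite p1" "finite p2"
        using finp by (auto simp: p1_def p2_def)
      have b2: "norm (\<Sum>(x,K)\<in>p2. measure lborel K *\<^sub>R g x - (f (Sup K) - f (Inf K))) \<le> (\<Sum>(x,K)\<in>p2. e' * (Sup K - Inf K))"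
      proof (rule sum_norm_le, safe)
        fix x K assume xK: "(x,K) \<in> p2"
        then have xp: "(x,K) \<in> p" and xN: "x \<notin> N" by (auto simp: p2_def)
        obtain u v where uv: "u \<le> v" "K = {u..v}" "x \<in> K" "K \<subseteq> {a..b}" "K \<subseteq> ball x (d x)"
          using mem[OF xp] xN by (auto simp: \<gamma>_def)
        have xab: "x \<in> {a..b} - N" using uv xN by blast
        have uK: "u \<in> K" "v \<in> K" using uv by auto
        have du: "norm (u - x) < d x" "norm (v - x) < d x"
          using subsetD[OF uv(5) uK(1)] subsetD[OF uv(5) uK(2)] by (simp_all add: dist_real_def)
        have uab: "u \<in> {a..b}" "v \<in> {a..b}" using uv(4) uK by auto
        have "norm ((v - u) *\<^sub>R f' x - (f v - f u)) = norm (f u - f x - (u - x) *\<^sub>R f' x - (f v - f x - (v - x) *\<^sub>R f' x))"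
          by (auto simp: algebra_simps)
        also have "\<dots> \<le> norm (f u - f x - (u - x) *\<^sub>R f' x) + norm (f v - f x - (v - x) *\<^sub>R f' x)"
          by (rule norm_triangle_ineq4)
        also have "\<dots> \<le> e' * norm (u - x) + e' * norm (v - x)"
          by (intro add_mono d(2)[OF xab] du uab)
        also have "\<dots> = e' * (v - u)"
          using uv by (auto simp: algebra_simps)
        finally show "norm (measure lborel K *\<^sub>R g x - (f (Sup K) - f (Inf K))) \<le> e' * (Sup K - Inf K)"
          using uv xN by (simp add: g_def)
      qed
      have ge0: "0 \<le> Sup K - Inf K" if "(x,K) \<in> p" for x K
        using mem[OF that] by auto
      have "(\<Sum>(x,K)\<in>p2. e' * (Sup K - Inf K)) \<le> (\<Sum>(x,K)\<in>p. e' * (Sup K - Inf K))"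
        using finp e' ge0 by (intro sum_mono2) (auto simp: p2_def mult_nonneg_nonneg simp del: right_diff_distrib)
      also have "\<dots> = e' * (b - a)" unfolding ba(1) sum_distrib_left by (simp add: split_def)
      finally have b2': "norm (\<Sum>(x,K)\<in>p2. measure lborel K *\<^sub>R g x - (f (Sup K) - f (Inf K))) < e / 2"
        using b2 e'b by linarith
      have tp1: "p1 tagged_division_of \<Union>(snd ` p1)"
        by (rule tagged_partial_division_of_Union_self[of _ "{a..b}"])
           (rule tagged_partial_division_subset[of p], use ptag p12(1) in \<open>auto simp: tagged_division_of_def\<close>)
      have D: "snd ` p1 division_of \<Union>(snd ` p1)"
        using division_of_tagged_division[OF tp1] .
      have sub: "\<Union>(snd ` p1) \<subseteq> {a..b}" "\<Union>(snd ` p1) \<subseteq> U"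
      proof -
        have "snd z \<subseteq> {a..b} \<and> snd z \<subseteq> U" if "z \<in> p1" for z
          using mem[of "fst z" "snd z"] that by (auto simp: p1_def \<gamma>_def)
        then show "\<Union>(snd ` p1) \<subseteq> {a..b}" "\<Union>(snd ` p1) \<subseteq> U" by blast+
      qed
      have "(\<Sum>K\<in>snd ` p1. Sup K - Inf K) = (\<Sum>K\<in>snd ` p1. measure lebesgue K)"
      proof (rule sum.cong[OF refl])
        fix K assume "K \<in> snd ` p1"
        then obtain x where "(x,K) \<in> p" by (auto simp: p1_def)
        from mem[OF this] show "Sup K - Inf K = measure lebesgue K" by auto
      qed
      also have "\<dots> = measure lebesgue (\<Union>(snd ` p1))" by (rule content_division[OF D])
      also have "\<dots> \<le> measure lebesgue U"
        using sub(2) U(3) lmeasurable_division[OF D] by (intro measure_mono_fmeasurable) auto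
      finally have small: "(\<Sum>K\<in>snd ` p1. norm (f (Sup K) - f (Inf K))) < e / 2"
        using acd[OF D sub(1)] U(4) by simp
      have "norm (\<Sum>(x,K)\<in>p1. measure lborel K *\<^sub>R g x - (f (Sup K) - f (Inf K))) \<le> (\<Sum>(x,K)\<in>p1. norm (f (Sup K) - f (Inf K)))"
        by (rule sum_norm_le) (auto simp: p1_def g_def norm_minus_commute)
      also have "\<dots> = (\<Sum>(x,K)\<in>p1. if K = {} then 0 else norm (f (Sup K) - f (Inf K)))"
      proof (rule sum.cong[OF refl], clarify)
        fix x K assume "(x,K) \<in> p1"
        then have "x \<in> K" using mem[of x K] by (auto simp: p1_def)
        then show "norm (f (Sup K) - f (Inf K)) = (if K = {} then 0 else norm (f (Sup K) - f (Inf K)))" by auto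
      qed
      also have "\<dots> = (\<Sum>K\<in>snd ` p1. if K = {} then 0 else norm (f (Sup K) - f (Inf K)))"
      proof (rule sum.over_tagged_division_lemma[OF tp1])
        fix u v :: real assume "box u v = {}"
        then have "v \<le> u" by simp
        then show "(if cbox u v = {} then 0 else norm (f (Sup (cbox u v)) - f (Inf (cbox u v)))) = 0"
          by (cases "v = u") simp_all
      qed
      also have "\<dots> \<le> (\<Sum>K\<in>snd ` p1. norm (f (Sup K) - f (Inf K)))"
        by (rule sum_mono) auto
      finally have b1: "norm (\<Sum>(x,K)\<in>p1. measure lborel K *\<^sub>R g x - (f (Sup K) - f (Inf K))) < e / 2"
        using small by linarith
      have "(\<Sum>(x, K)\<in>p. measure lborel K *\<^sub>R g x) - (f b - f a) =
            (\<Sum>(x,K)\<in>p. measure lborel K *\<^sub>R g x - (f (Sup K) - f (Inf K)))"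
        unfolding ba(2) by (simp add: split_def sum_subtractf)
      also have "\<dots> = (\<Sum>(x,K)\<in>p1. measure lborel K *\<^sub>R g x - (f (Sup K) - f (Inf K)))
          + (\<Sum>(x,K)\<in>p2. measure lborel K *\<^sub>R g x - (f (Sup K) - f (Inf K)))"
        by (subst p12(1)) (rule sum.union_disjoint[OF p12(3,4,2)])
      finally have "norm ((\<Sum>(x, K)\<in>p. measure lborel K *\<^sub>R g x) - (f b - f a)) \<le>
         norm (\<Sum>(x,K)\<in>p1. measure lborel K *\<^sub>R g x - (f (Sup K) - f (Inf K)))
          + norm (\<Sum>(x,K)\<in>p2. measure lborel K *\<^sub>R g x - (f (Sup K) - f (Inf K)))"
        by (simp add: norm_triangle_ineq)
      then show ?thesis using b1 b2' by linarith
    qed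
    then show "\<exists>\<gamma>. gauge \<gamma> \<and>
      (\<forall>\<D>. \<D> tagged_division_of {a..b} \<and> \<gamma> fine \<D> \<longrightarrow>
        norm ((\<Sum>(x, k)\<in>\<D>. measure lborel k *\<^sub>R g x) - (f b - f a)) < e)"
      using gauge by blast
  qed
  then show ?thesis
    by (rule has_integral_spike[OF N, rotated]) (simp add: g_def)
qed

text \<open>Absolute continuity of the integral: \<open>h\<close> is split into the bounded part \<open>min h n\<close> and a part with small
  integral.\<close>

lemma AC_on_norm_diff_bound:
  fixes F :: "real \<Rightarrow> complex" and h :: "real \<Rightarrow> real"
  assumes h: "integrable (lebesgue_on {a..b}) h" and h0: "\<And>x. 0 \<le> h x"
    and F: "\<And>u v. a \<le> u \<Longrightarrow> u \<le> v \<Longrightarrow> v \<le> b \<Longrightarrow> norm (F v - F u) \<le> integral {u..v} h"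
  shows "AC_on a b F"
  unfolding AC_on_def
proof (intro allI impI)
  fix e :: real assume e: "e > 0"
  have hi: "h integrable_on {a..b}" using h by (simp add: integrable_on_lebesgue_on)
  have hm: "h \<in> borel_measurable (lebesgue_on {a..b})" using h by auto
  have "(\<lambda>n::nat. LINT x|lebesgue_on {a..b}. min (h x) (real n)) \<longlonglongrightarrow> (LINT x|lebesgue_on {a..b}. h x)"
  proof (rule integral_dominated_convergence[where w = h])
    show "AE x in lebesgue_on {a..b}. (\<lambda>n. min (h x) (real n)) \<longlonglongrightarrow> h x"
    proof (rule AE_I2)
      fix x
      have "\<forall>\<^sub>F n in sequentially. min (h x) (real n) = h x"
        using eventually_ge_at_top[of "nat \<lceil>h x\<rceil>"] by eventually_elim linarith
      then show "(\<lambda>n. min (h x) (real n)) \<longlonglongrightarrow> h x" by (rule tendsto_eventually)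
    qed
  qed (use h hm h0 in auto)
  then have "\<forall>\<^sub>F n in sequentially. dist (LINT x|lebesgue_on {a..b}. min (h x) (real n)) (LINT x|lebesgue_on {a..b}. h x) < e/2"
    using e half_gt_zero tendstoD by blast
  then obtain n :: nat where n: "dist (LINT x|lebesgue_on {a..b}. min (h x) (real n)) (LINT x|lebesgue_on {a..b}. h x) < e/2"
    by (auto simp: eventually_sequentially)
  define k where "k x = h x - min (h x) (real n)" for x
  have mi: "integrable (lebesgue_on {a..b}) (\<lambda>x. min (h x) (real n))"
    by (rule Bochner_Integration.integrable_bound[OF h]) (use hm h0 in auto)
  have ki: "integrable (lebesgue_on {a..b}) k" unfolding k_def using h mi by auto
  have k0: "0 \<le> k x" for x by (simp add: k_def)
  have kio: "k integrable_on {a..b}" using ki by (simp add: integrable_on_lebesgue_on)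
  have "integral {a..b} k = (LINT x|lebesgue_on {a..b}. k x)"
    using ki by (simp add: lebesgue_integral_eq_integral)
  also have "\<dots> = (LINT x|lebesgue_on {a..b}. h x) - (LINT x|lebesgue_on {a..b}. min (h x) (real n))"
    unfolding k_def using h mi by simp
  finally have "integral {a..b} k = (LINT x|lebesgue_on {a..b}. h x) - (LINT x|lebesgue_on {a..b}. min (h x) (real n))" .
  then have ksmall: "integral {a..b} k < e/2" using n unfolding dist_real_def by linarith
  define \<delta> where "\<delta> = e / (2 * (real n + 1))"
  have \<delta>: "\<delta> > 0" using e by (simp add: \<delta>_def)
  have "(\<Sum>K\<in>D. norm (F (Sup K) - F (Inf K))) < e"
    if D: "D division_of T" and T: "T \<subseteq> {a..b}" and s: "(\<Sum>K\<in>D. Sup K - Inf K) < \<delta>" for D T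
  proof -
    have bnd: "norm (F (Sup K) - F (Inf K)) \<le> real n * (Sup K - Inf K) + integral K k" if KD: "K \<in> D" for K
    proof -
      obtain u v where uv: "u \<le> v" "K = {u..v}" "a \<le> u" "v \<le> b" using division_of_real_intervalE[OF D T KD] .
      have su: "{u..v} \<subseteq> {a..b}" using uv by auto
      have ku: "k integrable_on {u..v}" using integrable_on_subinterval[OF kio] su by auto
      have hu: "h integrable_on {u..v}" using integrable_on_subinterval[OF hi] su by auto
      have "norm (F v - F u) \<le> integral {u..v} h" using F uv by auto
      also have "\<dots> \<le> integral {u..v} (\<lambda>x. real n + k x)"
      proof (rule integral_le[OF hu])
        show "(\<lambda>x. real n + k x) integrable_on {u..v}" using ku by (intro integrable_add) auto
      qed (auto simp: k_def)
      also have "\<dots> = real n * (v - u) + integral {u..v} k"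
        using ku uv by (subst Henstock_Kurzweil_Integration.integral_add) auto
      finally show ?thesis using uv by simp
    qed
    have kT: "k integrable_on T"
      by (rule integrable_on_subdivision[OF D]) (use kio T in auto)
    have "(\<Sum>K\<in>D. norm (F (Sup K) - F (Inf K))) \<le> (\<Sum>K\<in>D. real n * (Sup K - Inf K) + integral K k)"
      by (rule sum_mono) (rule bnd)
    also have "\<dots> = real n * (\<Sum>K\<in>D. Sup K - Inf K) + (\<Sum>K\<in>D. integral K k)"
      by (simp add: sum.distrib sum_distrib_left)
    also have "(\<Sum>K\<in>D. integral K k) = integral T k"
      using integral_combine_division_topdown[OF kT D] by simp
    also have "integral T k \<le> integral {a..b} k"
      by (rule integral_subset_le[OF T kT kio]) (use k0 in auto)
    also have "real n * (\<Sum>K\<in>D. Sup K - Inf K) \<le> real n * \<delta>"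
      using s by (intro mult_left_mono) auto
    also have "real n * \<delta> \<le> e/2" using e by (simp add: \<delta>_def field_simps)
    finally show ?thesis using ksmall by linarith
  qed
  then show "\<exists>\<delta>>0. \<forall>D T. D division_of T \<and> T \<subseteq> {a..b} \<and> (\<Sum>K\<in>D. Sup K - Inf K) < \<delta>
        \<longrightarrow> (\<Sum>K\<in>D. norm (F (Sup K) - F (Inf K))) < e"
    using \<delta> by blast
qed

lemma AC_on_indefinite_integral:
  fixes g :: "real \<Rightarrow> complex"
  assumes g: "integrable (lebesgue_on {a..b}) g"
  shows "AC_on a b (\<lambda>x. c + integral {a..x} g)"
proof (rule AC_on_norm_diff_bound[where h = "\<lambda>x. norm (g x)"])
  show ni: "integrable (lebesgue_on {a..b}) (\<lambda>x. norm (g x))" using g by simp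
  fix u v assume uv: "a \<le> u" "u \<le> v" "v \<le> b"
  have gi: "g integrable_on {a..b}" "(\<lambda>x. norm (g x)) integrable_on {a..b}"
    using g ni by (simp_all add: integrable_on_lebesgue_on)
  have gu: "g integrable_on {u..v}" "(\<lambda>x. norm (g x)) integrable_on {u..v}" "g integrable_on {a..v}"
    using integrable_on_subinterval[OF gi(1)] integrable_on_subinterval[OF gi(2)] uv by auto
  have "integral {a..v} g = integral {a..u} g + integral {u..v} g"
    using Henstock_Kurzweil_Integration.integral_combine[OF uv(1,2) gu(3)] by simp
  then show "norm (c + integral {a..v} g - (c + integral {a..u} g)) \<le> integral {u..v} (\<lambda>x. norm (g x))"
    using integral_norm_bound_integral[OF gu(1,2)] by simp
qed simp

text \<open>All closure properties of absolute continuity follow from this comparison of increments.\<close>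

lemma AC_on_dominated_increments:
  assumes f: "AC_on a b f" and g: "AC_on a b g"
    and F: "\<And>u v. u \<in> {a..b} \<Longrightarrow> v \<in> {a..b} \<Longrightarrow> norm (F v - F u) \<le> M * (norm (f v - f u) + norm (g v - g u))"
  shows "AC_on a b F"
  unfolding AC_on_def
proof (intro allI impI)
  fix e :: real assume e: "e > 0"
  define e' where "e' = e / (2 * (\<bar>M\<bar> + 1))"
  have e': "e' > 0" using e by (simp add: e'_def)
  obtain d1 where d1: "d1 > 0" "\<And>D T. D division_of T \<Longrightarrow> T \<subseteq> {a..b} \<Longrightarrow> (\<Sum>K\<in>D. Sup K - Inf K) < d1
        \<Longrightarrow> (\<Sum>K\<in>D. norm (f (Sup K) - f (Inf K))) < e'"
    using AC_onE[OF f e'] by blast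
  obtain d2 where d2: "d2 > 0" "\<And>D T. D division_of T \<Longrightarrow> T \<subseteq> {a..b} \<Longrightarrow> (\<Sum>K\<in>D. Sup K - Inf K) < d2
        \<Longrightarrow> (\<Sum>K\<in>D. norm (g (Sup K) - g (Inf K))) < e'"
    using AC_onE[OF g e'] by blast
  have "(\<Sum>K\<in>D. norm (F (Sup K) - F (Inf K))) < e"
    if D: "D division_of T" and T: "T \<subseteq> {a..b}" and s: "(\<Sum>K\<in>D. Sup K - Inf K) < min d1 d2" for D T
  proof -
    have bnd: "norm (F (Sup K) - F (Inf K)) \<le> \<bar>M\<bar> * (norm (f (Sup K) - f (Inf K)) + norm (g (Sup K) - g (Inf K)))"
      if KD: "K \<in> D" for K
    proof -
      obtain u v where K: "u \<le> v" "K = {u..v}" "a \<le> u" "v \<le> b"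
        using division_of_real_intervalE[OF D T KD] .
      then have uv: "u \<le> v" "u \<in> {a..b}" "v \<in> {a..b}" by auto
      have "norm (F v - F u) \<le> M * (norm (f v - f u) + norm (g v - g u))" by (rule F[OF uv(2,3)])
      also have "\<dots> \<le> \<bar>M\<bar> * (norm (f v - f u) + norm (g v - g u))" by (intro mult_right_mono) auto
      finally show ?thesis using K uv by simp
    qed
    have "(\<Sum>K\<in>D. norm (F (Sup K) - F (Inf K)))
      \<le> (\<Sum>K\<in>D. \<bar>M\<bar> * (norm (f (Sup K) - f (Inf K)) + norm (g (Sup K) - g (Inf K))))"
      by (rule sum_mono) (rule bnd)
    also have "\<dots> = \<bar>M\<bar> * ((\<Sum>K\<in>D. norm (f (Sup K) - f (Inf K))) + (\<Sum>K\<in>D. norm (g (Sup K) - g (Inf K))))"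
      by (simp add: sum.distrib flip: sum_distrib_left)
    also have "\<dots> \<le> \<bar>M\<bar> * (e' + e')"
      using d1(2)[OF D T] d2(2)[OF D T] s by (intro mult_left_mono) auto
    also have "\<dots> = e * (\<bar>M\<bar> / (\<bar>M\<bar> + 1))" by (simp add: e'_def divide_simps)
    also have "\<dots> < e" using e by (simp add: field_simps)
    finally show ?thesis .
  qed
  then show "\<exists>\<delta>>0. \<forall>D T. D division_of T \<and> T \<subseteq> {a..b} \<and> (\<Sum>K\<in>D. Sup K - Inf K) < \<delta>
        \<longrightarrow> (\<Sum>K\<in>D. norm (F (Sup K) - F (Inf K))) < e"
    using d1(1) d2(1) by (intro exI[of _ "min d1 d2"]) auto
qed

lemma AC_on_continuous:
  assumes f: "AC_on a b f"
  shows "continuous_on {a..b} f"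
  unfolding continuous_on_iff
proof (intro ballI allI impI)
  fix x and e :: real assume x: "x \<in> {a..b}" and e: "e > 0"
  obtain d where d: "d > 0" "\<And>D T. D division_of T \<Longrightarrow> T \<subseteq> {a..b} \<Longrightarrow> (\<Sum>K\<in>D. Sup K - Inf K) < d
        \<Longrightarrow> (\<Sum>K\<in>D. norm (f (Sup K) - f (Inf K))) < e"
    using AC_onE[OF f e] by blast
  have *: "norm (f v - f u) < e" if "u \<in> {a..b}" "v \<in> {a..b}" "u \<le> v" "v - u < d" for u v
  proof -
    have "{cbox u v} division_of (cbox u v)" using that by (intro division_of_self) auto
    from d(2)[OF this] that show ?thesis by simp
  qed
  have "dist (f y) (f x) < e" if "y \<in> {a..b}" "dist y x < d" for y
    using *[of x y] *[of y x] that x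
    by (cases "x \<le> y") (auto simp: dist_norm norm_minus_commute)
  then show "\<exists>d>0. \<forall>x'\<in>{a..b}. dist x' x < d \<longrightarrow> dist (f x') (f x) < e"
    using d(1) by blast
qed

lemma AC_on_mult:
  assumes f: "AC_on a b f" and g: "AC_on a b g"
  shows "AC_on a b (\<lambda>x. f x * g x)"
proof -
  have "compact (f ` {a..b})" "compact (g ` {a..b})"
    using AC_on_continuous[OF f] AC_on_continuous[OF g] by (auto intro: compact_continuous_image)
  then have "bounded (f ` {a..b})" "bounded (g ` {a..b})" by (auto dest: compact_imp_bounded)
  then obtain B C where B: "\<forall>y\<in>f ` {a..b}. norm y \<le> B" and C: "\<forall>y\<in>g ` {a..b}. norm y \<le> C"
    unfolding bounded_iff by (elim exE)
  show ?thesis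
  proof (rule AC_on_dominated_increments[OF f g, where M = "max B C"])
    fix u v assume u: "u \<in> {a..b}" and v: "v \<in> {a..b}"
    have "f v * g v - f u * g u = (f v - f u) * g v + f u * (g v - g u)" by (simp add: algebra_simps)
    then have "norm (f v * g v - f u * g u) \<le> norm (f v - f u) * norm (g v) + norm (f u) * norm (g v - g u)"
      by (metis norm_mult norm_triangle_ineq)
    also have "\<dots> \<le> norm (f v - f u) * max B C + max B C * norm (g v - g u)"
      using bspec[OF B imageI[OF u]] bspec[OF C imageI[OF v]]
      by (intro add_mono mult_left_mono mult_right_mono) auto
    finally show "norm (f v * g v - f u * g u) \<le> max B C * (norm (f v - f u) + norm (g v - g u))"
      by (simp add: algebra_simps)
  qed
qed

lemma AC_on_cnj: "AC_on a b f \<Longrightarrow> AC_on a b (\<lambda>x. cnj (f x))"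
  by (rule AC_on_dominated_increments[where M = 1 and f = f and g = f])
     (auto simp flip: complex_cnj_diff)

lemma AC_on_add: "AC_on a b f \<Longrightarrow> AC_on a b g \<Longrightarrow> AC_on a b (\<lambda>x. f x + g x)"
  by (rule AC_on_dominated_increments[where M = 1 and f = f and g = g])
     (auto simp: add_diff_add norm_triangle_ineq)

lemma AC_on_lipschitz:
  assumes "\<And>u v. u \<in> {a..b} \<Longrightarrow> v \<in> {a..b} \<Longrightarrow> norm (f v - f u) \<le> M * \<bar>v - u\<bar>"
  shows "AC_on a b f"
proof -
  have "AC_on a b (\<lambda>x. 0 + integral {a..x} (\<lambda>x. 1::complex))"
    by (rule AC_on_indefinite_integral) auto
  then have id: "AC_on a b (\<lambda>x. integral {a..x} (\<lambda>x. 1::complex))" by simp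
  show ?thesis
  proof (rule AC_on_dominated_increments[OF id id, where M = "\<bar>M\<bar>"])
    fix u v assume u: "u \<in> {a..b}" and v: "v \<in> {a..b}"
    have "norm (f v - f u) \<le> M * \<bar>v - u\<bar>" by (rule assms[OF u v])
    also have "\<dots> \<le> \<bar>M\<bar> * \<bar>v - u\<bar>" by (intro mult_right_mono) auto
    also have "\<dots> \<le> \<bar>M\<bar> * (\<bar>v - u\<bar> + \<bar>v - u\<bar>)" by (intro mult_left_mono) auto
    also have "\<bar>v - u\<bar> = norm (integral {a..v} (\<lambda>x. 1::complex) - integral {a..u} (\<lambda>x. 1))"
      using u v by (simp flip: of_real_diff add: scaleR_conv_of_real)
    finally show "norm (f v - f u) \<le> \<bar>M\<bar> * (norm (integral {a..v} (\<lambda>x. 1::complex) - integral {a..u} (\<lambda>x. 1)) +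
       norm (integral {a..v} (\<lambda>x. 1::complex) - integral {a..u} (\<lambda>x. 1)))" .
  qed
qed

lemma AC_on_const: "AC_on a b (\<lambda>x. c)"
  by (rule AC_on_lipschitz[where M = 0]) simp

lemma AC_on_complex_of_real: "AC_on a b (\<lambda>x. complex_of_real x)"
  by (rule AC_on_lipschitz[where M = 1]) (simp add: norm_of_real flip: of_real_diff)

text \<open>Lebesgue's differentiation theorem is available for right difference quotients; applying it to the reflected
  function as well gives two-sided derivatives. The exceptional set depends neither on the lower limit nor on the
  constant.\<close>

lemma indefinite_integral_derivative_ae:
  fixes g :: "real \<Rightarrow> complex"
  assumes g: "\<And>a b. g integrable_on {a..b}"
  obtains N where "negligible N"
    "\<And>a x. x \<notin> N \<Longrightarrow> a < x \<Longrightarrow> ((\<lambda>u. c + integral {a..u} g) has_vector_derivative g x) (at x)"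
proof -
  obtain N1 where N1: "negligible N1" "\<And>x e. \<lbrakk>x \<notin> N1; 0 < e\<rbrakk> \<Longrightarrow>
       \<exists>d>0. \<forall>h. 0 < h \<and> h < d \<longrightarrow> norm(integral (cbox x (x + h *\<^sub>R One)) g /\<^sub>R h ^ DIM(real) - g x) < e"
    by (rule integrable_ccontinuous_explicit[of g]) (use g in auto)
  have g': "(\<lambda>x. g (- x)) integrable_on cbox a b" for a b :: real
    using g[of "-b" "-a"] Henstock_Kurzweil_Integration.integrable_reflect_real[of g "-a" "-b"] by simp
  obtain N2 where N2: "negligible N2" "\<And>x e. \<lbrakk>x \<notin> N2; 0 < e\<rbrakk> \<Longrightarrow>
       \<exists>d>0. \<forall>h. 0 < h \<and> h < d \<longrightarrow> norm(integral (cbox x (x + h *\<^sub>R One)) (\<lambda>x. g (- x)) /\<^sub>R h ^ DIM(real) - g (- x)) < e"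
    by (rule integrable_ccontinuous_explicit[of "\<lambda>x. g (- x)"]) (use g' in auto)
  have "negligible (uminus ` N2)"
    by (rule negligible_differentiable_image_negligible[OF order_refl N2(1)])
       (simp add: differentiable_on_def)
  then have neg: "negligible (N1 \<union> uminus ` N2)"
    using N1(1) by (simp add: negligible_Un)
  have "((\<lambda>u. c + integral {a..u} g) has_vector_derivative g x) (at x)"
    if xN: "x \<notin> N1 \<union> uminus ` N2" and ax: "a < x" for a x
    unfolding has_vector_derivative_def has_derivative_at_alt
  proof (intro conjI allI impI bounded_linear_scaleR_left)
    fix e :: real assume e: "e > 0"
    obtain d1 where d1: "d1 > 0" "\<And>h. 0 < h \<Longrightarrow> h < d1 \<Longrightarrow> norm (integral {x..x+h} g /\<^sub>R h - g x) < e"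
      using N1(2)[of x e] xN e by auto
    have "-x \<notin> N2" using xN by force
    then obtain d2 where d2: "d2 > 0" "\<And>h. 0 < h \<Longrightarrow> h < d2 \<Longrightarrow> norm (integral {-x..-x+h} (\<lambda>x. g (- x)) /\<^sub>R h - g x) < e"
      using N2(2)[of "-x" e] e by auto
    have mul: "norm (I - h *\<^sub>R w) \<le> e * h" if "0 < h" "norm (I /\<^sub>R h - w) < e" for h and I w :: complex
    proof -
      have "I - h *\<^sub>R w = h *\<^sub>R (I /\<^sub>R h - w)" using that(1) by (simp add: scaleR_diff_right)
      then have "norm (I - h *\<^sub>R w) = h * norm (I /\<^sub>R h - w)" using that(1) by simp
      also have "\<dots> \<le> h * e" using that by (intro mult_left_mono) auto
      finally show ?thesis by (simp add: mult.commute)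
    qed
    have "norm (c + integral {a..y} g - (c + integral {a..x} g) - (y - x) *\<^sub>R g x) \<le> e * norm (y - x)"
      if y: "norm (y - x) < min (x - a) (min d1 d2)" for y
    proof (cases y x rule: linorder_cases)
      case greater
      have eq: "integral {a..x} g + integral {x..y} g = integral {a..y} g"
        using ax greater g by (intro Henstock_Kurzweil_Integration.integral_combine) auto
      have "norm (integral {x..y} g - (y - x) *\<^sub>R g x) \<le> e * (y - x)"
        using mul[of "y - x"] d1(2)[of "y - x"] y greater by auto
      then show ?thesis using greater by (simp flip: eq)
    next
      case less
      have "integral {a..y} g + integral {y..x} g = integral {a..x} g"
        using ax less y g by (intro Henstock_Kurzweil_Integration.integral_combine) auto
      moreover have "integral {-x..-x+(x-y)} (\<lambda>x. g (- x)) = integral {y..x} g"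
        using Henstock_Kurzweil_Integration.integral_reflect_real[of x y g] by simp
      then have "norm (integral {y..x} g - (x - y) *\<^sub>R g x) \<le> e * (x - y)"
        using mul[of "x - y" "integral {y..x} g" "g x"] d2(2)[of "x - y"] y less by auto
      moreover have "c + integral {a..y} g - (c + integral {a..x} g) - (y - x) *\<^sub>R g x = - (integral {y..x} g - (x - y) *\<^sub>R g x)"
        using calculation(1) by (simp add: algebra_simps flip: calculation(1))
      moreover have "norm (y - x) = x - y" using less by simp
      ultimately show ?thesis by (simp only: norm_minus_cancel)
    qed simp
    then show "\<exists>d>0. \<forall>y. norm (y - x) < d \<longrightarrow>
         norm (c + integral {a..y} g - (c + integral {a..x} g) - (y - x) *\<^sub>R g x) \<le> e * norm (y - x)"
      using d1(1) d2(1) ax by (intro exI[of _ "min (x - a) (min d1 d2)"]) auto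
  qed
  then show ?thesis using that neg by blast
qed

section \<open>Completeness of $L_2(\mathbb{R}_+)$\<close>

lemma square_integrable_rep_L2: "square_integrable_on (rep_L2 F) {0..}"
  using Quotient3_rep_reflp[OF Quotient3_L2, of F] by simp

lemma abs_L2_rep_L2 [simp]: "abs_L2 (rep_L2 F) = F"
  by (rule Quotient3_abs_rep[OF Quotient3_L2])

lemma abs_L2_eq_iff:
  assumes "square_integrable_on f {0..}" "square_integrable_on g {0..}"
  shows "abs_L2 f = abs_L2 g \<longleftrightarrow> (AE x in halfline. f x = g x)"
  using Quotient3_rel[OF Quotient3_L2, of f g] assms by simp

lemma rep_abs_L2:
  assumes "square_integrable_on f {0..}"
  shows "AE x in halfline. rep_L2 (abs_L2 f) x = f x"
  using abs_L2_eq_iff[of "rep_L2 (abs_L2 f)" f, OF square_integrable_rep_L2 assms] by simp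

lemma L2_eq_iff: "F = G \<longleftrightarrow> (AE x in halfline. rep_L2 F x = rep_L2 G x)"
  using abs_L2_eq_iff[OF square_integrable_rep_L2 square_integrable_rep_L2, of F G] by simp

lemma abs_L2_add:
  assumes "square_integrable_on f {0..}" "square_integrable_on g {0..}"
  shows "abs_L2 f + abs_L2 g = abs_L2 (\<lambda>x. f x + g x)"
  using assms by (subst plus_L2.abs_eq) auto

lemma abs_L2_cscale:
  assumes "square_integrable_on f {0..}"
  shows "cscale c (abs_L2 f) = abs_L2 (\<lambda>x. c * f x)"
  using assms by (subst cscale.abs_eq) auto

lemma cinner_abs_L2:
  assumes "square_integrable_on f {0..}" "square_integrable_on g {0..}"
  shows "cinner (abs_L2 f) (abs_L2 g) = (LINT x|halfline. f x * cnj (g x))"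
  using assms by (subst cinner.abs_eq) auto

lemma cinner_rep: "cinner F G = (LINT x|halfline. rep_L2 F x * cnj (rep_L2 G x))"
  using cinner_abs_L2[OF square_integrable_rep_L2 square_integrable_rep_L2, of F G] by simp

lemma integrable_rep_cnj: "integrable halfline (\<lambda>x. rep_L2 F x * cnj (rep_L2 G x))"
  by (intro square_integrable_on_integrable_mult_cnj square_integrable_rep_L2)

lemma rep_L2_add: "AE x in halfline. rep_L2 (F + G) x = rep_L2 F x + rep_L2 G x"
  using rep_abs_L2[OF square_integrable_on_add[OF square_integrable_rep_L2 square_integrable_rep_L2, of F G]]
    abs_L2_add[OF square_integrable_rep_L2 square_integrable_rep_L2, of F G] by simp

lemma rep_L2_cscale: "AE x in halfline. rep_L2 (cscale c F) x = c * rep_L2 F x"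
  using rep_abs_L2[OF square_integrable_on_cmult[OF square_integrable_rep_L2, of c F]]
    abs_L2_cscale[OF square_integrable_rep_L2, of c F] by simp

lemma scaleR_cscale: "a *\<^sub>R F = cscale (of_real a) F" for F :: L2
  by (rule scaleR_L2_def)

lemma minus_cscale: "F - G = F + cscale (- 1) G" for F :: L2
  by (simp add: minus_L2_def uminus_L2_def)

lemma rep_L2_zero: "AE x in halfline. rep_L2 0 x = 0"
  unfolding zero_L2_def by (rule rep_abs_L2) (rule square_integrable_on_zero)

lemma abs_L2_diff:
  assumes "square_integrable_on f {0..}" "square_integrable_on g {0..}"
  shows "abs_L2 f - abs_L2 g = abs_L2 (\<lambda>x. f x - g x)"
  using abs_L2_add[OF assms(1) square_integrable_on_cmult[OF assms(2), of "-1"]] assms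
  by (simp add: minus_cscale abs_L2_cscale)

lemma cinner_add_left: "cinner (F + G) H = cinner F H + cinner G H"
proof -
  have "cinner (F + G) H = (LINT x|halfline. rep_L2 F x * cnj (rep_L2 H x) + rep_L2 G x * cnj (rep_L2 H x))"
    unfolding cinner_rep
  proof (rule integral_cong_AE)
    show "AE x in halfline. rep_L2 (F + G) x * cnj (rep_L2 H x) = rep_L2 F x * cnj (rep_L2 H x) + rep_L2 G x * cnj (rep_L2 H x)"
      using rep_L2_add[of F G] by eventually_elim (simp add: distrib_right)
  qed (use integrable_rep_cnj in auto)
  then show ?thesis by (simp add: cinner_rep integrable_rep_cnj)
qed

lemma cinner_commute: "cinner G F = cnj (cinner F G)"
proof -
  have "cinner G F = (LINT x|halfline. cnj (rep_L2 F x * cnj (rep_L2 G x)))"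
    by (simp add: mult.commute cinner_rep)
  then show ?thesis by (simp add: cinner_rep del: complex_cnj_mult)
qed

lemma cinner_cscale_left: "cinner (cscale c F) G = c * cinner F G"
proof -
  have "cinner (cscale c F) G = (LINT x|halfline. c * (rep_L2 F x * cnj (rep_L2 G x)))"
    unfolding cinner_rep
  proof (rule integral_cong_AE)
    show "AE x in halfline. rep_L2 (cscale c F) x * cnj (rep_L2 G x) = c * (rep_L2 F x * cnj (rep_L2 G x))"
      using rep_L2_cscale[of c F] by eventually_elim simp
  qed (use integrable_rep_cnj in auto)
  then show ?thesis by (simp add: cinner_rep)
qed

lemma cinner_add_right: "cinner H (F + G) = cinner H F + cinner H G"
  by (metis cinner_add_left cinner_commute complex_cnj_add)

lemma cinner_cscale_right: "cinner F (cscale c G) = cnj c * cinner F G"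
  by (metis cinner_cscale_left cinner_commute complex_cnj_mult)

lemma cscale_add_right: "cscale c (F + G) = cscale c F + cscale c G"
  by transfer (auto intro!: square_integrable_on_add square_integrable_on_cmult simp: distrib_left)

lemma cscale_add_left: "cscale (c + d) F = cscale c F + cscale d F"
  by transfer (auto intro!: square_integrable_on_add square_integrable_on_cmult simp: distrib_right)

lemma cscale_cscale [simp]: "cscale c (cscale d F) = cscale (c * d) F"
  by transfer (auto intro!: square_integrable_on_cmult simp: mult.assoc)

lemma cscale_one [simp]: "cscale 1 F = F"
  by transfer auto

lemma cscale_zero_left [simp]: "cscale 0 F = 0"
  using scaleR_cscale[of 0 F] by simp

lemma cscale_zero_right [simp]: "cscale c 0 = 0"
  using cscale_cscale[of c 0 0] by simp

lemma cscale_minus_one: "cscale (- 1) F = - F"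
  by (simp add: uminus_L2_def)

lemma cscale_diff_right: "cscale c (F - G) = cscale c F - cscale c G"
  by (simp add: minus_cscale cscale_add_right)

lemma cscale_minus_left: "cscale (- c) F = - cscale c F"
  by (simp flip: cscale_minus_one)

lemma cscale_scaleR: "cscale c (a *\<^sub>R F) = a *\<^sub>R cscale c F"
  by (simp add: scaleR_cscale mult.commute)

lemma cinner_diff_left: "cinner (F - G) H = cinner F H - cinner G H"
  by (simp add: minus_cscale cinner_add_left cinner_cscale_left)

lemma cinner_scaleR_left: "cinner (a *\<^sub>R F) G = of_real a * cinner F G"
  by (simp add: scaleR_cscale cinner_cscale_left)

lemma Re_cinner: "Re (cinner F G) = inner F G"
  by (simp add: inner_L2_def)

lemma Im_cinner: "Im (cinner F G) = inner F (cscale \<i> G)"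
  by (simp add: cinner_cscale_right flip: Re_cinner)

lemma cinner_self: "cinner F F = of_real ((norm F)\<^sup>2)"
proof -
  have "Im (cinner F F) = 0" using cinner_commute[of F F] by (metis Reals_cnj_iff complex_is_Real_iff)
  moreover have "Re (cinner F F) = (norm F)\<^sup>2" by (simp add: Re_cinner power2_norm_eq_inner)
  ultimately show ?thesis by (simp add: complex_eq_iff)
qed

lemma norm_cscale: "norm (cscale c F) = norm c * norm F"
proof -
  have "of_real ((norm (cscale c F))\<^sup>2) = (of_real ((norm c * norm F)\<^sup>2) :: complex)"
    by (simp add: cinner_cscale_left cinner_cscale_right complex_norm_square power_mult_distrib
        flip: cinner_self of_real_power)
  then have "(norm (cscale c F))\<^sup>2 = (norm c * norm F)\<^sup>2" using of_real_eq_iff by blast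
  then show ?thesis by (simp add: power2_eq_iff_nonneg)
qed

lemma norm_cinner_le: "norm (cinner F G) \<le> norm F * norm G"
proof -
  define c where "c = cnj (sgn (cinner F G))"
  have c: "c * cinner F G = of_real (norm (cinner F G))"
    unfolding c_def by (simp add: sgn_div_norm scaleR_conv_of_real divide_simps complex_norm_square[symmetric] power2_eq_square mult.commute flip: of_real_mult)
  have "norm (cinner F G) = inner (cscale c F) G"
    using c by (simp add: cinner_cscale_left flip: Re_cinner)
  also have "\<dots> \<le> norm (cscale c F) * norm G" by (rule norm_cauchy_schwarz)
  also have "\<dots> \<le> 1 * norm F * norm G"
    unfolding norm_cscale by (intro mult_right_mono) (auto simp: c_def norm_sgn)
  finally show ?thesis by simp
qed

lemma bounded_linear_cscale: "bounded_linear (cscale c)"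
  by (rule bounded_linear_intro[where K = "norm c"])
     (auto simp: cscale_add_right cscale_scaleR norm_cscale mult.commute)

lemma norm_L2_rep: "(norm F)\<^sup>2 = (LINT x|halfline. (norm (rep_L2 F x))\<^sup>2)"
proof -
  have "complex_of_real ((norm F)\<^sup>2) = (LINT x|halfline. rep_L2 F x * cnj (rep_L2 F x))"
    using cinner_self[of F] cinner_rep[of F F] by simp
  also have "\<dots> = (LINT x|halfline. of_real ((norm (rep_L2 F x))\<^sup>2))"
    by (simp only: complex_norm_square)
  finally show ?thesis using of_real_eq_iff by (metis integral_complex_of_real)
qed

lemma nn_integral_rep_L2: "(\<integral>\<^sup>+x. ennreal ((norm (rep_L2 F x))\<^sup>2) \<partial>halfline) = ennreal ((norm F)\<^sup>2)"
  unfolding norm_L2_rep using square_integrable_rep_L2[of F]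
  by (intro nn_integral_eq_integral) (auto simp: square_integrable_on_def)

text \<open>Distances in \<open>L2\<close> are expressed through non-negative integrals of representatives, where monotone convergence
  and Fatou's lemma apply.\<close>

lemma nn_integral_rep_diff:
  assumes "square_integrable_on f {0..}"
  shows "(\<integral>\<^sup>+x. ennreal ((norm (rep_L2 F x - f x))\<^sup>2) \<partial>halfline) = ennreal ((norm (F - abs_L2 f))\<^sup>2)"
proof -
  have "F - abs_L2 f = abs_L2 (\<lambda>x. rep_L2 F x - f x)"
    using abs_L2_diff[OF square_integrable_rep_L2 assms, of F] by simp
  moreover have sq: "square_integrable_on (\<lambda>x. rep_L2 F x - f x) {0..}"
    using square_integrable_on_add[OF square_integrable_rep_L2 square_integrable_on_cmult[OF assms, of "-1"], of F] by simp
  ultimately have "AE x in halfline. rep_L2 (F - abs_L2 f) x = rep_L2 F x - f x"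
    using rep_abs_L2 by simp
  then have "(\<integral>\<^sup>+x. ennreal ((norm (rep_L2 F x - f x))\<^sup>2) \<partial>halfline) = (\<integral>\<^sup>+x. ennreal ((norm (rep_L2 (F - abs_L2 f) x))\<^sup>2) \<partial>halfline)"
  proof (intro nn_integral_cong_AE)
    assume "AE x in halfline. rep_L2 (F - abs_L2 f) x = rep_L2 F x - f x"
    then show "AE x in halfline. ennreal ((norm (rep_L2 F x - f x))\<^sup>2) = ennreal ((norm (rep_L2 (F - abs_L2 f) x))\<^sup>2)"
      by eventually_elim simp
  qed
  then show ?thesis by (simp add: nn_integral_rep_L2)
qed

lemma sq_integrable_if_nn_integral:
  assumes "f \<in> borel_measurable halfline" "(\<integral>\<^sup>+x. ennreal ((norm (f x))\<^sup>2) \<partial>halfline) < \<infinity>"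
  shows "square_integrable_on f {0..}"
  using assms unfolding square_integrable_on_def
  by (auto intro!: integrableI_bounded)

text \<open>The Riesz--Fischer argument. The increments are summable in \<open>L\<^sub>1\<close> of every bounded interval, hence the
  representatives converge almost everywhere, and Fatou's lemma identifies the limit.\<close>

lemma L2_summable_increments_convergent:
  fixes X :: "nat \<Rightarrow> L2"
  assumes X: "\<And>n. norm (X (Suc n) - X n) \<le> (1/2)^n"
  shows "convergent X"
proof -
  define f where "f n = rep_L2 (X n)" for n
  have sq: "square_integrable_on (f n) {0..}" for n by (simp add: f_def square_integrable_rep_L2)
  have meas[measurable]: "f n \<in> borel_measurable halfline" for n using sq by (simp add: square_integrable_on_def)
  have [measurable]: "(\<lambda>x. x) \<in> borel_measurable halfline"
    by (intro measurable_restrict_space1 measurable_completion) simp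
  have incr: "(\<integral>\<^sup>+x. ennreal ((norm (f (Suc n) x - f n x))\<^sup>2) \<partial>halfline) \<le> ennreal ((1/4)^n)" for n
  proof -
    have "(norm (X (Suc n) - X n))\<^sup>2 \<le> ((1/2)^n)\<^sup>2" using X by (intro power_mono) auto
    also have "\<dots> = (1/4::real)^n" by (simp add: power2_eq_square flip: power_mult_distrib)
    finally show ?thesis using nn_integral_rep_diff[OF sq[of n], of "X (Suc n)"]
      by (simp add: f_def ennreal_leI)
  qed
  have aeK: "AE x in halfline. x \<le> real K \<longrightarrow> summable (\<lambda>n. norm (f (Suc n) x - f n x))" for K :: nat
  proof -
    define h where "h n x = (if x \<le> real K then norm (f (Suc n) x - f n x) else 0)" for n x
    have hm[measurable]: "h n \<in> borel_measurable halfline" for n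
      unfolding h_def by measurable
    have hb: "(\<integral>\<^sup>+x. ennreal (h n x) \<partial>halfline) \<le> ennreal ((real K + 1) * (1/2)^n)" for n
    proof -
      \<comment> \<open>$t \le 2^{-n} + 2^n t^2$ trades the $L_1$ norm on a bounded interval for the $L_2$ norm\<close>
      have "ennreal (h n x) \<le> ennreal ((1/2)^n * indicator {0..real K} x) + ennreal (2^n) * ennreal ((norm (f (Suc n) x - f n x))\<^sup>2)"
        if "0 \<le> x" for x
      proof (cases "x \<le> real K")
        case True
        define t where "t = norm (f (Suc n) x - f n x)"
        have "0 \<le> (2^n * t - 1)\<^sup>2 + 2^n * t" unfolding t_def by (intro add_nonneg_nonneg) auto
        then have "2^n * t \<le> 1 + 2^n * 2^n * t\<^sup>2" by (simp add: power2_eq_square algebra_simps)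
        then have "t \<le> (1/2)^n + 2^n * t\<^sup>2" by (simp add: field_simps power_one_over)
        then show ?thesis using True that
          by (simp add: h_def t_def ennreal_leI flip: ennreal_mult ennreal_plus)
      qed (simp add: h_def)
      then have "(\<integral>\<^sup>+x. ennreal (h n x) \<partial>halfline) \<le> (\<integral>\<^sup>+x. ennreal ((1/2)^n * indicator {0..real K} x) + ennreal (2^n) * ennreal ((norm (f (Suc n) x - f n x))\<^sup>2) \<partial>halfline)"
        by (intro nn_integral_mono) (simp add: space_restrict_space)
      also have "\<dots> = (\<integral>\<^sup>+x. ennreal ((1/2)^n * indicator {0..real K} x) \<partial>halfline) + ennreal (2^n) * (\<integral>\<^sup>+x. ennreal ((norm (f (Suc n) x - f n x))\<^sup>2) \<partial>halfline)"
        by (subst nn_integral_add) (auto simp: nn_integral_cmult)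
      also have "(\<integral>\<^sup>+x. ennreal ((1/2)^n * indicator {0..real K} x) \<partial>halfline) = ennreal ((1/2)^n * real K)"
      proof -
        have "(\<integral>\<^sup>+x. ennreal ((1/2)^n * indicator {0..real K} x) \<partial>halfline) = (\<integral>\<^sup>+x. ennreal ((1/2)^n) * indicator {0..real K} x \<partial>halfline)"
          by (intro nn_integral_cong) (auto simp: indicator_def)
        also have "\<dots> = ennreal ((1/2)^n) * emeasure halfline {0..real K}"
          by (subst nn_integral_cmult_indicator) (auto simp: sets_restrict_space image_iff intro!: bexI[of _ "{0..real K}"])
        also have "emeasure halfline {0..real K} = ennreal (real K)"
          by (subst emeasure_restrict_space) auto
        finally show ?thesis by (simp add: ennreal_mult)
      qed
      also have "ennreal (2^n) * (\<integral>\<^sup>+x. ennreal ((norm (f (Suc n) x - f n x))\<^sup>2) \<partial>halfline) \<le> ennreal (2^n) * ennreal ((1/4)^n)"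
        by (intro mult_left_mono incr) auto
      also have "ennreal (2^n) * ennreal ((1/4)^n) = ennreal ((1/2)^n)"
        by (simp flip: ennreal_mult power_mult_distrib)
      finally show ?thesis by (simp add: ring_distribs mult.commute flip: ennreal_plus)
    qed
    have "(\<integral>\<^sup>+x. (\<Sum>n. ennreal (h n x)) \<partial>halfline) = (\<Sum>n. \<integral>\<^sup>+x. ennreal (h n x) \<partial>halfline)"
      by (rule nn_integral_suminf) simp
    also have "\<dots> \<le> (\<Sum>n. ennreal ((real K + 1) * (1/2)^n))"
      by (intro suminf_le hb) auto
    also have "\<dots> = ennreal (\<Sum>n. (real K + 1) * (1/2)^n)"
      by (intro suminf_ennreal2) (auto intro!: summable_mult)
    also have "\<dots> < \<infinity>" by simp
    finally have "(\<integral>\<^sup>+x. (\<Sum>n. ennreal (h n x)) \<partial>halfline) \<noteq> \<infinity>" by simp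
    then have "AE x in halfline. (\<Sum>n. ennreal (h n x)) \<noteq> \<infinity>"
      by (intro nn_integral_noteq_infinite) auto
    then show ?thesis
    proof eventually_elim
      case (elim x)
      have "summable (\<lambda>n. h n x)"
        by (rule summable_suminf_not_top) (use elim in \<open>auto simp: h_def\<close>)
      then show ?case by (auto simp: h_def)
    qed
  qed
  have "AE x in halfline. \<forall>K::nat. x \<le> real K \<longrightarrow> summable (\<lambda>n. norm (f (Suc n) x - f n x))"
    unfolding AE_all_countable using aeK by blast
  then have aes: "AE x in halfline. convergent (\<lambda>n. f n x)"
  proof eventually_elim
    case (elim x)
    obtain K :: nat where "x \<le> real K" using real_arch_simple by blast
    then have "summable (\<lambda>n. norm (f (Suc n) x - f n x))" using elim by blast
    then have "summable (\<lambda>n. f (Suc n) x - f n x)" by (rule summable_norm_cancel)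
    then have "convergent (\<lambda>n. \<Sum>i<n. f (Suc i) x - f i x)" by (simp add: summable_iff_convergent)
    from convergent_add[OF this convergent_const[of "f 0 x"]] show ?case
      using sum_lessThan_telescope[of "\<lambda>n. f n x"] by simp
  qed
  define g where "g x = lim (\<lambda>n. f n x)" for x
  have gm[measurable]: "g \<in> borel_measurable halfline" unfolding g_def by measurable
  have ae: "AE x in halfline. (\<lambda>n. f n x) \<longlonglongrightarrow> g x"
    using aes by eventually_elim (simp add: g_def convergent_LIMSEQ_iff)
  have tail: "norm (X m - X n) \<le> 2 * (1/2)^n" if "n \<le> m" for n m
  proof -
    have "norm (X (n + k) - X n) \<le> (\<Sum>i<k. (1/2)^(n+i))" for k
    proof (induction k)
      case (Suc k)
      have "norm (X (n + Suc k) - X n) \<le> norm (X (Suc (n + k)) - X (n + k)) + norm (X (n + k) - X n)"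
        using norm_triangle_ineq[of "X (Suc (n + k)) - X (n + k)" "X (n + k) - X n"] by simp
      also have "\<dots> \<le> (1/2)^(n+k) + (\<Sum>i<k. (1/2)^(n+i))" using X Suc by (intro add_mono) auto
      finally show ?case by simp
    qed simp
    also have "(\<Sum>i<k. (1/2)^(n+i)) \<le> 2 * (1/2::real)^n" for k
    proof -
      have "(\<Sum>i<k. (1/2)^(n+i)) = (1/2::real)^n * (\<Sum>i<k. (1/2)^i)" by (simp add: power_add sum_distrib_left)
      also have "(\<Sum>i<k. (1/2::real)^i) \<le> 2" by (simp add: geometric_sum) 
      finally show ?thesis by (simp add: mult.commute)
    qed
    finally show ?thesis using that by (metis le_add_diff_inverse)
  qed
  have fatou: "(\<integral>\<^sup>+x. ennreal ((norm (f n x - g x))\<^sup>2) \<partial>halfline) \<le> ennreal ((2 * (1/2)^n)\<^sup>2)" for n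
  proof -
    have "(\<integral>\<^sup>+x. ennreal ((norm (f n x - g x))\<^sup>2) \<partial>halfline) = (\<integral>\<^sup>+x. liminf (\<lambda>m. ennreal ((norm (f n x - f m x))\<^sup>2)) \<partial>halfline)"
    proof (rule nn_integral_cong_AE)
      show "AE x in halfline. ennreal ((norm (f n x - g x))\<^sup>2) = liminf (\<lambda>m. ennreal ((norm (f n x - f m x))\<^sup>2))"
        using ae
      proof eventually_elim
        case (elim x)
        have "(\<lambda>m. ennreal ((norm (f n x - f m x))\<^sup>2)) \<longlonglongrightarrow> ennreal ((norm (f n x - g x))\<^sup>2)"
          by (intro tendsto_ennrealI tendsto_intros elim)
        from lim_imp_Liminf[OF sequentially_bot this] show ?case by (rule sym)
      qed
    qed
    also have "\<dots> \<le> liminf (\<lambda>m. \<integral>\<^sup>+x. ennreal ((norm (f n x - f m x))\<^sup>2) \<partial>halfline)"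
      by (rule nn_integral_liminf) measurable
    also have "\<dots> \<le> ennreal ((2 * (1/2)^n)\<^sup>2)"
    proof (rule Liminf_le)
      show "\<forall>\<^sub>F m in sequentially. (\<integral>\<^sup>+x. ennreal ((norm (f n x - f m x))\<^sup>2) \<partial>halfline) \<le> ennreal ((2 * (1/2)^n)\<^sup>2)"
        using eventually_ge_at_top[of n]
      proof eventually_elim
        case (elim m)
        have "(\<integral>\<^sup>+x. ennreal ((norm (f n x - f m x))\<^sup>2) \<partial>halfline) = ennreal ((norm (X n - X m))\<^sup>2)"
          using nn_integral_rep_diff[OF sq[of m], of "X n"] by (simp add: f_def)
        also have "\<dots> \<le> ennreal ((2 * (1/2)^n)\<^sup>2)"
          using tail[OF elim] by (intro ennreal_leI power_mono) (auto simp: norm_minus_commute)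
        finally show ?case .
      qed
    qed simp
    finally show ?thesis .
  qed
  have "square_integrable_on (\<lambda>x. f 0 x - g x) {0..}"
  proof (rule sq_integrable_if_nn_integral)
    show "(\<integral>\<^sup>+x. ennreal ((norm (f 0 x - g x))\<^sup>2) \<partial>halfline) < \<infinity>"
      using fatou[of 0] by (simp add: order_le_less_trans)
  qed measurable
  from square_integrable_on_add[OF sq[of 0] square_integrable_on_cmult[OF this, of "-1"]]
  have sqg: "square_integrable_on g {0..}" by simp
  have "norm (X n - abs_L2 g) \<le> 2 * (1/2)^n" for n
  proof -
    have "ennreal ((norm (X n - abs_L2 g))\<^sup>2) \<le> ennreal ((2 * (1/2)^n)\<^sup>2)"
      using fatou[of n] nn_integral_rep_diff[OF sqg, of "X n"] by (simp add: f_def)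
    then have "(norm (X n - abs_L2 g))\<^sup>2 \<le> (2 * (1/2)^n)\<^sup>2" by (subst (asm) ennreal_le_iff) auto
    then show ?thesis by (rule power2_le_imp_le) auto
  qed
  then have ev: "\<forall>\<^sub>F n in sequentially. norm (X n - abs_L2 g) \<le> 2 * (1/2)^n" by (rule always_eventually[OF allI])
  have "(\<lambda>n. 2 * (1/2::real)^n) \<longlonglongrightarrow> 0"
    by (intro tendsto_mult_right_zero LIMSEQ_power_zero) auto
  then have "(\<lambda>n. X n - abs_L2 g) \<longlonglongrightarrow> 0"
    by (rule Lim_null_comparison[OF ev])
  then show ?thesis by (metis LIM_zero_iff convergentI)
qed

instance L2 :: complete_space
proof
  fix X :: "nat \<Rightarrow> L2" assume X: "Cauchy X"
  have "\<exists>N. \<forall>m\<ge>N. \<forall>n\<ge>N. dist (X m) (X n) < (1/2)^k" for k :: nat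
    using X[unfolded Cauchy_def, rule_format, of "(1/2)^k"] by auto
  then obtain N where N: "\<And>k m n. m \<ge> N k \<Longrightarrow> n \<ge> N k \<Longrightarrow> dist (X m) (X n) < (1/2)^k" by metis
  define r where "r k = (\<Sum>i\<le>k. N i) + k" for k
  have rN: "N k \<le> r k" for k unfolding r_def by (simp add: trans_le_add1 member_le_sum)
  have rs: "strict_mono r" by (rule strict_monoI_Suc) (simp add: r_def)
  have "norm ((X \<circ> r) (Suc n) - (X \<circ> r) n) \<le> (1/2)^n" for n
    using N[of n "r (Suc n)" "r n"] rN[of n] strict_monoD[OF rs, of n "Suc n"] by (auto simp: dist_norm)
  then have "convergent (X \<circ> r)" by (rule L2_summable_increments_convergent)
  then obtain l where "(X \<circ> r) \<longlonglongrightarrow> l" by (auto simp: convergent_def)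
  then have "X \<longlonglongrightarrow> l" using Cauchy_converges_subseq[OF X rs] by blast
  then show "convergent X" by (rule convergentI)
qed

instance L2 :: banach ..

section \<open>Totally bounded sets\<close>

lemma totally_bounded_ball:
  "totally_bounded S \<longleftrightarrow> (\<forall>e>0. \<exists>k. finite k \<and> S \<subseteq> (\<Union>x\<in>k. ball x e))"
  by (simp add: totally_bounded_metric ball_def)

lemma totally_bounded_approx:
  assumes "\<And>e. e > 0 \<Longrightarrow> \<exists>T. totally_bounded T \<and> (\<forall>x\<in>S. \<exists>y\<in>T. dist x y < e)"
  shows "totally_bounded S"
  unfolding totally_bounded_ball
proof (intro allI impI)
  fix e :: real assume "e > 0"
  then obtain T where T: "totally_bounded T" "\<And>x. x \<in> S \<Longrightarrow> \<exists>y\<in>T. dist x y < e/2"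
    using assms[of "e/2"] by auto
  then obtain k where k: "finite k" "T \<subseteq> (\<Union>x\<in>k. ball x (e/2))"
    using \<open>e > 0\<close> unfolding totally_bounded_ball by (meson half_gt_zero)
  have "S \<subseteq> (\<Union>x\<in>k. ball x e)"
  proof
    fix x assume "x \<in> S"
    then obtain y where y: "y \<in> T" "dist x y < e/2" using T by blast
    then obtain z where z: "z \<in> k" "dist z y < e/2" using k by auto
    have "dist z x < e" using dist_triangle[of z x y] y z by (simp add: dist_commute)
    then show "x \<in> (\<Union>x\<in>k. ball x e)" using z by auto
  qed
  then show "\<exists>k. finite k \<and> S \<subseteq> (\<Union>x\<in>k. ball x e)" using k by blast
qed

lemma totally_bounded_closure:
  fixes S :: "'a::metric_space set"
  assumes "totally_bounded S"
  shows "totally_bounded (closure S)"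
proof (rule totally_bounded_approx)
  fix e :: real assume "e > 0"
  then show "\<exists>T. totally_bounded T \<and> (\<forall>x\<in>closure S. \<exists>y\<in>T. dist x y < e)"
    using assms closure_approachable[of _ S] by (metis dist_commute)
qed

lemma compact_imp_totally_bounded: "compact S \<Longrightarrow> totally_bounded S" for S :: "'a::metric_space set"
  by (simp add: compact_eq_totally_bounded totally_bounded_ball)

lemma totally_bounded_imp_compact_closure:
  "totally_bounded S \<Longrightarrow> compact (closure S)" for S :: "'a::complete_space set"
  using totally_bounded_closure[of S]
  by (simp add: compact_eq_totally_bounded totally_bounded_ball complete_eq_closed)

text \<open>Uniform continuity on \<open>S\<close> alone suffices: the centres of a net are moved into \<open>S\<close>.\<close>

lemma totally_bounded_modulus_image:
  fixes f :: "'a::metric_space \<Rightarrow> 'b::metric_space"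
  assumes "totally_bounded S"
    and "\<And>e. e > 0 \<Longrightarrow> \<exists>d>0. \<forall>x\<in>S. \<forall>y\<in>S. dist x y < d \<longrightarrow> dist (f x) (f y) < e"
  shows "totally_bounded (f ` S)"
  unfolding totally_bounded_ball
proof (intro allI impI)
  fix e :: real assume "e > 0"
  then obtain d where d: "d > 0" "\<And>x y. x \<in> S \<Longrightarrow> y \<in> S \<Longrightarrow> dist x y < d \<Longrightarrow> dist (f x) (f y) < e"
    using assms(2) by meson
  obtain k where k: "finite k" "S \<subseteq> (\<Union>x\<in>k. ball x (d/2))"
    using assms(1) d(1) unfolding totally_bounded_ball by (meson half_gt_zero)
  define p where "p x = (SOME s. s \<in> S \<inter> ball x (d/2))" for x
  have "f ` S \<subseteq> (\<Union>y\<in>f ` p ` k. ball y e)"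
  proof clarify
    fix s assume s: "s \<in> S"
    then obtain x where x: "x \<in> k" "s \<in> S \<inter> ball x (d/2)" using k by blast
    then have "p x \<in> S \<inter> ball x (d/2)" unfolding p_def by (metis someI)
    then have px: "p x \<in> S" "dist x (p x) < d/2" by simp_all
    have "dist x s < d/2" using x by simp
    with px(2) have "dist (p x) s < d" by (rule dist_triangle_half_r)
    then have "dist (f (p x)) (f s) < e" by (rule d(2)[OF px(1) s])
    then have "f s \<in> ball (f (p x)) e" by simp
    then show "f s \<in> (\<Union>y\<in>f ` p ` k. ball y e)" using x(1) by blast
  qed
  then show "\<exists>k. finite k \<and> f ` S \<subseteq> (\<Union>x\<in>k. ball x e)"
    by (intro exI[of _ "f ` p ` k"] conjI finite_imageI k(1))
qed

lemma totally_bounded_scaleR: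
  fixes S :: "'a::real_normed_vector set"
  assumes "totally_bounded S"
  shows "totally_bounded ((\<lambda>x. c *\<^sub>R x) ` S)"
proof (rule totally_bounded_modulus_image[OF assms])
  fix e :: real assume "e > 0"
  have "norm (c *\<^sub>R x - c *\<^sub>R y) < e" if "norm (x - y) < e / (\<bar>c\<bar> + 1)" for x y :: 'a
  proof -
    have "norm (c *\<^sub>R x - c *\<^sub>R y) = \<bar>c\<bar> * norm (x - y)" by (simp flip: scaleR_diff_right)
    also have "\<dots> \<le> (\<bar>c\<bar> + 1) * norm (x - y)" by (intro mult_right_mono) auto
    also have "\<dots> < e" using that by (simp add: pos_less_divide_eq mult.commute)
    finally show ?thesis .
  qed
  then show "\<exists>d>0. \<forall>x\<in>S. \<forall>y\<in>S. dist x y < d \<longrightarrow> dist (c *\<^sub>R x) (c *\<^sub>R y) < e"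
    using \<open>e > 0\<close> by (intro exI[of _ "e / (\<bar>c\<bar> + 1)"]) (auto simp: dist_norm)
qed

lemma totally_bounded_plus:
  fixes S T :: "'a::real_normed_vector set"
  assumes "totally_bounded S" "totally_bounded T"
  shows "totally_bounded {x + y | x y. x \<in> S \<and> y \<in> T}"
  unfolding totally_bounded_ball
proof (intro allI impI)
  fix e :: real assume "e > 0"
  then obtain k l where k: "finite k" "S \<subseteq> (\<Union>x\<in>k. ball x (e/2))" and l: "finite l" "T \<subseteq> (\<Union>x\<in>l. ball x (e/2))"
    using assms unfolding totally_bounded_ball by (meson half_gt_zero)
  have "{x + y | x y. x \<in> S \<and> y \<in> T} \<subseteq> (\<Union>z\<in>(\<lambda>(x,y). x + y) ` (k \<times> l). ball z e)"
  proof clarify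
    fix x y assume "x \<in> S" "y \<in> T"
    then obtain a c where a: "a \<in> k" "dist a x < e/2" and c: "c \<in> l" "dist c y < e/2" using k l by fastforce
    have "dist (a + c) (x + y) \<le> dist a x + dist c y"
      by (simp add: dist_triangle_add)
    then show "x + y \<in> (\<Union>z\<in>(\<lambda>(x,y). x + y) ` (k \<times> l). ball z e)" using a c by force
  qed
  then show "\<exists>k. finite k \<and> {x + y | x y. x \<in> S \<and> y \<in> T} \<subseteq> (\<Union>x\<in>k. ball x e)"
    by (intro exI[of _ "(\<lambda>(x,y). x + y) ` (k \<times> l)"] conjI finite_imageI finite_SigmaI k(1) l(1))
qed

section \<open>Sectorial forms and the Lax--Milgram theorem\<close>

text \<open>Real bilinear, not necessarily symmetric forms on a real vector space that carries no topology of its own; the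
  last axiom is the sector condition. It is stated without square roots because it is checked in this shape.
  As the space may be incomplete, variational problems are solved by Cauchy sequences.\<close>

locale sectorial_form =
  fixes V :: "'v::real_vector set" and b :: "'v \<Rightarrow> 'v \<Rightarrow> real" and C :: real
  assumes subspace_V: "subspace V"
    and add_left: "\<And>u v w. u \<in> V \<Longrightarrow> v \<in> V \<Longrightarrow> w \<in> V \<Longrightarrow> b (u + v) w = b u w + b v w"
    and add_right: "\<And>u v w. u \<in> V \<Longrightarrow> v \<in> V \<Longrightarrow> w \<in> V \<Longrightarrow> b w (u + v) = b w u + b w v"
    and scale_left: "\<And>c u w. u \<in> V \<Longrightarrow> w \<in> V \<Longrightarrow> b (c *\<^sub>R u) w = c * b u w"
    and scale_right: "\<And>c u w. u \<in> V \<Longrightarrow> w \<in> V \<Longrightarrow> b w (c *\<^sub>R u) = c * b w u"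
    and nonneg: "\<And>u. u \<in> V \<Longrightarrow> 0 \<le> b u u"
    and sectorial: "\<And>u v. u \<in> V \<Longrightarrow> v \<in> V \<Longrightarrow> \<bar>b u v\<bar> \<le> C * (b u u + b v v)"
begin

lemma V_closed [simp, intro]:
  "0 \<in> V" "u \<in> V \<Longrightarrow> v \<in> V \<Longrightarrow> u + v \<in> V" "u \<in> V \<Longrightarrow> c *\<^sub>R u \<in> V" "u \<in> V \<Longrightarrow> v \<in> V \<Longrightarrow> u - v \<in> V" "u \<in> V \<Longrightarrow> - u \<in> V"
  using subspace_V by (auto simp: subspace_0 subspace_add subspace_scale subspace_diff subspace_neg)

lemma minus_left: "u \<in> V \<Longrightarrow> w \<in> V \<Longrightarrow> b (- u) w = - b u w"
  using scale_left[of u w "-1"] by simp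

lemma minus_right: "u \<in> V \<Longrightarrow> w \<in> V \<Longrightarrow> b w (- u) = - b w u"
  using scale_right[of u w "-1"] by simp

lemma diff_left: "u \<in> V \<Longrightarrow> v \<in> V \<Longrightarrow> w \<in> V \<Longrightarrow> b (u - v) w = b u w - b v w"
  using add_left[of u "- v" w] by (simp add: minus_left)

lemma diff_right: "u \<in> V \<Longrightarrow> v \<in> V \<Longrightarrow> w \<in> V \<Longrightarrow> b w (u - v) = b w u - b w v"
  using add_right[of u "- v" w] by (simp add: minus_right)

lemmas form_simps = add_left add_right scale_left scale_right diff_left diff_right minus_left minus_right

lemma zero_left [simp]: "u \<in> V \<Longrightarrow> b 0 u = 0"
  using scale_left[of u u 0] by simp

lemma parallelogram:
  assumes "u \<in> V" "v \<in> V"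
  shows "b (u + v) (u + v) + b (u - v) (u - v) = 2 * b u u + 2 * b v v"
  using assms by (simp add: form_simps)

lemma add_le: "u \<in> V \<Longrightarrow> v \<in> V \<Longrightarrow> b (u + v) (u + v) \<le> 2 * b u u + 2 * b v v"
  using parallelogram[of u v] nonneg[of "u - v"] by simp

lemma diff_le: "u \<in> V \<Longrightarrow> v \<in> V \<Longrightarrow> b (u - v) (u - v) \<le> 2 * b u u + 2 * b v v"
  using parallelogram[of u v] nonneg[of "u + v"] by simp

definition nrm where "nrm u = sqrt (b u u)"

lemma nrm_nonneg [simp]: "u \<in> V \<Longrightarrow> 0 \<le> nrm u"
  by (simp add: nrm_def nonneg)

lemma nrm_sq: "u \<in> V \<Longrightarrow> (nrm u)\<^sup>2 = b u u"
  by (simp add: nrm_def nonneg)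

definition M where "M = 2 * \<bar>C\<bar>"

text \<open>The sector condition for \<open>t u\<close> and \<open>v/t\<close>, optimised over \<open>t\<close>. Both factors are shifted by \<open>e > 0\<close> because
  either of them may vanish.\<close>

lemma bounded_form:
  assumes u: "u \<in> V" and v: "v \<in> V"
  shows "\<bar>b u v\<bar> \<le> M * nrm u * nrm v"
proof -
  have scaled: "\<bar>b u v\<bar> \<le> \<bar>C\<bar> * (t\<^sup>2 * b u u + b v v / t\<^sup>2)" if "t > 0" for t
  proof -
    have "b u v = b (t *\<^sub>R u) ((1/t) *\<^sub>R v)" using u v that by (simp add: form_simps)
    then have "\<bar>b u v\<bar> \<le> C * (b (t *\<^sub>R u) (t *\<^sub>R u) + b ((1/t) *\<^sub>R v) ((1/t) *\<^sub>R v))"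
      using sectorial[of "t *\<^sub>R u" "(1/t) *\<^sub>R v"] u v by simp
    also have "\<dots> \<le> \<bar>C\<bar> * (b (t *\<^sub>R u) (t *\<^sub>R u) + b ((1/t) *\<^sub>R v) ((1/t) *\<^sub>R v))"
      using u v by (intro mult_right_mono add_nonneg_nonneg nonneg) auto
    also have "\<dots> = \<bar>C\<bar> * (t\<^sup>2 * b u u + b v v / t\<^sup>2)"
      using u v by (simp add: form_simps power2_eq_square)
    finally show ?thesis .
  qed
  define x where "x = nrm u"
  define y where "y = nrm v"
  have xy: "x \<ge> 0" "y \<ge> 0" "b u u = x\<^sup>2" "b v v = y\<^sup>2" using u v by (auto simp: x_def y_def nrm_sq)
  have eps: "\<bar>b u v\<bar> \<le> 2 * \<bar>C\<bar> * ((x + e) * (y + e))" if e: "e > 0" for e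
  proof -
    define t where "t = sqrt ((y + e) / (x + e))"
    have t: "t > 0" "t\<^sup>2 = (y + e) / (x + e)" using e xy by (auto simp: t_def)
    have "t\<^sup>2 * b u u \<le> t\<^sup>2 * (x + e)\<^sup>2" "b v v / t\<^sup>2 \<le> (y + e)\<^sup>2 / t\<^sup>2"
      using e xy by (auto intro!: mult_left_mono divide_right_mono power_mono)
    moreover have "t\<^sup>2 * (x + e)\<^sup>2 = (x + e) * (y + e)" "(y + e)\<^sup>2 / t\<^sup>2 = (x + e) * (y + e)"
      using e xy unfolding t(2) by (auto simp: power2_eq_square field_simps)
    ultimately have "t\<^sup>2 * b u u + b v v / t\<^sup>2 \<le> 2 * ((x + e) * (y + e))" by linarith
    then have "\<bar>C\<bar> * (t\<^sup>2 * b u u + b v v / t\<^sup>2) \<le> \<bar>C\<bar> * (2 * ((x + e) * (y + e)))"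
      by (rule mult_left_mono) simp
    then show ?thesis using scaled[OF t(1)] by simp
  qed
  have "((\<lambda>e. 2 * \<bar>C\<bar> * ((x + e) * (y + e))) \<longlongrightarrow> 2 * \<bar>C\<bar> * ((x + 0) * (y + 0))) (at_right 0)"
    by (intro tendsto_intros)
  moreover have "\<forall>\<^sub>F e in at_right 0. \<bar>b u v\<bar> \<le> 2 * \<bar>C\<bar> * ((x + e) * (y + e))"
    using eps by (auto simp: eventually_at_right_field intro!: exI[of _ 1])
  ultimately have "\<bar>b u v\<bar> \<le> 2 * \<bar>C\<bar> * ((x + 0) * (y + 0))"
    by (intro tendsto_lowerbound) auto
  then show ?thesis by (simp add: M_def x_def y_def mult.assoc)
qed

lemma M_nonneg: "0 \<le> M" by (simp add: M_def)

lemma null_right: "u \<in> V \<Longrightarrow> v \<in> V \<Longrightarrow> b v v = 0 \<Longrightarrow> b u v = 0"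
  using bounded_form[of u v] by (simp add: nrm_def)

definition bounded_functional where
  "bounded_functional l K \<longleftrightarrow> (\<forall>u\<in>V. \<forall>v\<in>V. l (u + v) = l u + l v) \<and> (\<forall>c. \<forall>u\<in>V. l (c *\<^sub>R u) = c * l u) \<and>
     (\<forall>u\<in>V. \<bar>l u\<bar> \<le> K * nrm u)"

text \<open>The problem is solvable in finite dimensions even for degenerate forms: a vector on which the form
  vanishes is annihilated by every bounded functional. The induction adds one direction at a time, made orthogonal
  from the left to the previous span.\<close>

lemma galerkin:
  assumes "finite F" "F \<subseteq> V" "bounded_functional l K"
  shows "\<exists>y\<in>span F. \<forall>z\<in>span F. b y z = l z"
  using assms
proof (induction F arbitrary: l K rule: finite_induct)
  case empty
  have "l 0 = 0" using empty(2) unfolding bounded_functional_def by (metis V_closed(1) mult_zero_left scale_zero_left)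
  then show ?case by auto
next
  case (insert e F)
  have e: "e \<in> V" and F: "F \<subseteq> V" using insert by auto
  have sF: "span F \<subseteq> V" using F subspace_V by (rule span_minimal)
  have l: "l (u + v) = l u + l v" "l (c *\<^sub>R u) = c * l u" "\<bar>l u\<bar> \<le> K * nrm u" if "u \<in> V" "v \<in> V" for u v c
    using insert(5) that by (auto simp: bounded_functional_def)
  have "bounded_functional (\<lambda>z. b e z) (M * nrm e)"
    using e bounded_form[OF e] by (auto simp: bounded_functional_def form_simps)
  from insert(3)[OF F this] obtain p where p: "p \<in> span F" "\<And>z. z \<in> span F \<Longrightarrow> b p z = b e z" by blast
  from insert(3)[OF F insert(5)] obtain y where y: "y \<in> span F" "\<And>z. z \<in> span F \<Longrightarrow> b y z = l z" by blast
  define e' where "e' = e - p"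
  have pV: "p \<in> V" and yV: "y \<in> V" and e'V: "e' \<in> V" using p(1) y(1) sF e by (auto simp: e'_def)
  have orth: "b e' z = 0" if "z \<in> span F" for z
    using p(2)[OF that] that sF e pV by (auto simp: e'_def form_simps)
  \<comment> \<open>if the new direction is a null vector, any coefficient works; zero is chosen\<close>
  define t where "t = (if b e' e' = 0 then 0 else (l e' - b y e') / b e' e')"
  define x where "x = y + t *\<^sub>R e'"
  have xV: "x \<in> V" using yV e'V by (simp add: x_def)
  have 1: "b x z = l z" if "z \<in> span F" for z
    using y(2)[OF that] orth[OF that] that sF yV e'V by (auto simp: x_def form_simps)
  have 2: "b x e' = l e'"
  proof (cases "b e' e' = 0")
    case True
    then have "b y e' = 0" using null_right yV e'V by blast
    moreover have "l e' = 0" using l(3)[OF e'V e'V] True by (simp add: nrm_def)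
    ultimately show ?thesis using True yV e'V by (simp add: x_def t_def)
  next
    case False
    then show ?thesis using yV e'V by (simp add: x_def t_def form_simps)
  qed
  have "b x z = l z" if z: "z \<in> span (insert e F)" for z
  proof -
    obtain k where k: "z - k *\<^sub>R e \<in> span F" using z by (auto simp: span_insert)
    define w where "w = z - k *\<^sub>R e + k *\<^sub>R p"
    have w: "w \<in> span F" unfolding w_def by (intro span_add span_scale k p)
    have wV: "w \<in> V" using w sF by auto
    have "z = k *\<^sub>R e' + w" by (simp add: w_def e'_def algebra_simps)
    then show ?thesis using 1[OF w] 2 xV e'V wV l by (simp add: form_simps)
  qed
  moreover have "x \<in> span (insert e F)"
  proof -
    have "span F \<subseteq> span (insert e F)" by (intro span_mono) auto
    moreover have "e \<in> span (insert e F)" by (intro span_base) auto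
    ultimately show ?thesis unfolding x_def e'_def
      using y(1) p(1) by (intro span_add span_scale span_diff) auto
  qed
  ultimately show ?case by blast
qed

definition form_Cauchy :: "(nat \<Rightarrow> 'v) \<Rightarrow> bool" where
  "form_Cauchy v \<longleftrightarrow> (\<forall>e>0. \<exists>N. \<forall>m\<ge>N. \<forall>n\<ge>N. b (v m - v n) (v m - v n) < e)"

text \<open>Lax--Milgram without completeness. \<open>S F\<close> is the affine set of those \<open>y\<close> that solve the problem tested against
  \<open>F\<close>, and \<open>d F\<close> is the infimum of the form on it. By the Galerkin lemma \<open>d\<close> is bounded on finite sets \<open>F\<close>, and it
  increases with \<open>F\<close>; near-minimisers over an exhausting sequence of finite sets are Cauchy by the parallelogram law,
  and adding a further test vector \<open>z\<close> to a set that nearly attains the supremum of \<open>d\<close> moves them only slightly.\<close>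

lemma lax_milgram_sequence:
  assumes l: "bounded_functional l K"
  obtains v where "\<And>n. v n \<in> V" "form_Cauchy v" "\<And>z. z \<in> V \<Longrightarrow> (\<lambda>n. b (v n) z) \<longlonglongrightarrow> l z"
proof -
  define S where "S F = {y\<in>V. \<forall>z\<in>F. b y z = l z}" for F
  define E where "E F = (\<lambda>y. b y y) ` S F" for F
  define d where "d F = Inf (E F)" for F
  define FF where "FF = {F. finite F \<and> F \<subseteq> V}"
  define D where "D = Sup (d ` FF)"
  have good: "\<exists>y\<in>S F. b y y \<le> K\<^sup>2" if F: "F \<in> FF" for F
  proof -
    obtain y where y: "y \<in> span F" "\<And>z. z \<in> span F \<Longrightarrow> b y z = l z"
      using galerkin[OF _ _ l, of F] F by (auto simp: FF_def)
    have yV: "y \<in> V" using y(1) F subspace_V span_minimal[of F V] by (auto simp: FF_def)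
    have "(nrm y)\<^sup>2 = l y" using y yV by (simp add: nrm_sq)
    also have "\<dots> \<le> K * nrm y" using l yV by (auto simp: bounded_functional_def abs_le_iff)
    finally have *: "(nrm y)\<^sup>2 \<le> K * nrm y" .
    have "nrm y \<le> \<bar>K\<bar>"
    proof (cases "nrm y = 0")
      case False
      then have "nrm y > 0" using yV nrm_nonneg[of y] by linarith
      then show ?thesis using * by (simp add: power2_eq_square)
    qed simp
    then have "b y y \<le> K\<^sup>2" using yV nrm_sq[OF yV] by (metis abs_le_square_iff abs_of_nonneg nrm_nonneg)
    moreover have "y \<in> S F" using y yV span_base by (auto simp: S_def)
    ultimately show ?thesis by blast
  qed
  have bb: "bdd_below (E F)" for F by (rule bdd_belowI[of _ 0]) (auto simp: E_def S_def nonneg)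
  have ne: "E F \<noteq> {}" if "F \<in> FF" for F using good[OF that] by (auto simp: E_def)
  have dle: "d F \<le> b y y" if "y \<in> S F" for F y
    unfolding d_def by (rule cInf_lower) (use bb that in \<open>auto simp: E_def\<close>)
  have dK: "d F \<le> K\<^sup>2" if "F \<in> FF" for F using good[OF that] dle by (meson order_trans)
  have dD: "d F \<le> D" if "F \<in> FF" for F unfolding D_def
    by (rule cSup_upper) (use that dK in \<open>auto intro!: bdd_aboveI[of _ "K\<^sup>2"]\<close>)
  have near: "\<exists>y\<in>S F. b y y < d F + e" if "F \<in> FF" "e > 0" for F e
    using cInf_lessD[OF ne[OF that(1)], of "d F + e"] that by (auto simp: d_def E_def)
  have mono: "d F \<le> d G" if "F \<subseteq> G" "G \<in> FF" for F G
    unfolding d_def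
  proof (rule cInf_superset_mono)
    show "E G \<noteq> {}" "bdd_below (E F)" using ne bb that by auto
    show "E G \<subseteq> E F" using that(1) unfolding E_def S_def by blast
  qed
  \<comment> \<open>the midpoint of two near-minimisers is again admissible\<close>
  have close: "b (x - y) (x - y) \<le> 8 * e"
    if "x \<in> S F" "y \<in> S F" "F \<subseteq> V" "D - e \<le> d F" "b x x \<le> D + e" "b y y \<le> D + e" for x y F and e :: real
  proof -
    have xy: "x \<in> V" "y \<in> V" using that by (auto simp: S_def)
    define w where "w = (1/2) *\<^sub>R (x + y)"
    have "w \<in> S F" using that xy by (auto simp: S_def w_def form_simps subset_iff)
    then have "d F \<le> b w w" by (rule dle)
    moreover have "b (x + y) (x + y) = 4 * b w w" using xy by (simp add: w_def form_simps add_divide_distrib)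
    ultimately show ?thesis using parallelogram[OF xy] that(4-6) by linarith
  qed
  have "\<exists>F\<in>FF. D - 1 / (real n + 1) < d F" for n :: nat
  proof -
    have "{} \<in> FF" by (simp add: FF_def)
    then have "\<exists>x\<in>d ` FF. D - 1 / (real n + 1) < x"
      unfolding D_def by (intro less_cSupD) auto
    then show ?thesis by blast
  qed
  then obtain Fs where Fs: "\<And>n. Fs n \<in> FF" "\<And>n. D - 1 / (real n + 1) < d (Fs n)" by metis
  define G where "G n = (\<Union>k\<le>n. Fs k)" for n
  have G: "G n \<in> FF" "G n \<subseteq> V" for n using Fs(1) by (auto simp: G_def FF_def)
  have Gmono: "G n \<subseteq> G m" if "n \<le> m" for n m using that by (force simp: G_def)
  have dG: "D - 1 / (real n + 1) < d (G n)" for n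
    using Fs(2)[of n] mono[OF _ G(1), of "Fs n" n] by (force simp: G_def)
  have "\<exists>y\<in>S (G n). b y y < d (G n) + 1 / (real n + 1)" for n
    by (rule near[OF G(1)]) simp
  then obtain v where v: "\<And>n. v n \<in> S (G n)" "\<And>n. b (v n) (v n) < d (G n) + 1 / (real n + 1)" by metis
  have vV: "v n \<in> V" for n using v(1)[of n] by (simp add: S_def)
  have vD: "b (v m) (v m) \<le> D + 1 / (real n + 1)" if "n \<le> m" for n m
  proof -
    have "1 / (real m + 1) \<le> 1 / (real n + 1)" using that by (intro divide_left_mono) auto
    then show ?thesis using v(2)[of m] dD[OF G(1), of m] by linarith
  qed
  have antiS: "S B \<subseteq> S A" if "A \<subseteq> B" for A B using that by (auto simp: S_def)
  have vv: "b (v m - v k) (v m - v k) \<le> 8 / (real n + 1)" if "n \<le> m" "n \<le> k" for n m k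
    using close[of "v m" "G n" "v k" "1 / (real n + 1)"] v(1) antiS[OF Gmono] that G(2) dG[of n] vD[OF that(1)] vD[OF that(2)]
    by (auto simp: less_imp_le subset_iff)
  have lim0: "(\<lambda>n. 8 / (real n + 1)) \<longlonglongrightarrow> 0"
    using tendsto_mult_right_zero[OF LIMSEQ_inverse_real_of_nat, of 8] by (simp add: field_simps)
  have "form_Cauchy v" unfolding form_Cauchy_def
  proof (intro allI impI)
    fix e :: real assume "e > 0"
    then have "\<forall>\<^sub>F n in sequentially. 8 / (real n + 1) < e" by (rule order_tendstoD(2)[OF lim0])
    then obtain N where "8 / (real N + 1) < e" by (auto simp: eventually_sequentially)
    then show "\<exists>N. \<forall>m\<ge>N. \<forall>n\<ge>N. b (v m - v n) (v m - v n) < e"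
      using vv by (intro exI[of _ N]) (meson le_less_trans)
  qed
  moreover have "(\<lambda>n. b (v n) z) \<longlonglongrightarrow> l z" if z: "z \<in> V" for z
  proof -
    have bound: "\<bar>b (v n) z - l z\<bar> \<le> M * sqrt (8 / (real n + 1)) * nrm z" for n
    proof -
      have zG: "insert z (G n) \<in> FF" using G(1)[of n] z by (simp add: FF_def)
      obtain w where w: "w \<in> S (insert z (G n))" "b w w < d (insert z (G n)) + 1 / (real n + 1)"
        using near[OF zG, of "1 / (real n + 1)"] by auto
      have wz: "b w z = l z" and wV: "w \<in> V" and wG: "w \<in> S (G n)" using w(1) by (auto simp: S_def)
      have "b w w \<le> D + 1 / (real n + 1)" using w(2) dD[OF zG] by linarith
      then have "b (v n - w) (v n - w) \<le> 8 / (real n + 1)"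
        using close[OF v(1) wG G(2), of "1 / (real n + 1)"] dG[of n] vD[of n n] by simp
      then have "nrm (v n - w) \<le> sqrt (8 / (real n + 1))" unfolding nrm_def by (rule real_sqrt_le_mono)
      have "\<bar>b (v n) z - l z\<bar> = \<bar>b (v n - w) z\<bar>" using vV wV z by (simp add: form_simps wz)
      also have "\<dots> \<le> M * nrm (v n - w) * nrm z" using vV wV z by (intro bounded_form) auto
      also have "\<dots> \<le> M * sqrt (8 / (real n + 1)) * nrm z"
        using \<open>nrm (v n - w) \<le> _\<close> z M_nonneg by (intro mult_right_mono mult_left_mono) auto
      finally show ?thesis .
    qed
    have "(\<lambda>n. M * sqrt (8 / (real n + 1)) * nrm z) \<longlonglongrightarrow> M * sqrt 0 * nrm z"
      by (intro tendsto_intros lim0)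
    then have "(\<lambda>n. M * sqrt (8 / (real n + 1)) * nrm z) \<longlonglongrightarrow> 0" by simp
    then have "(\<lambda>n. b (v n) z - l z) \<longlonglongrightarrow> 0"
      by (rule Lim_null_comparison[rotated]) (use bound in auto)
    then show ?thesis by (simp add: LIM_zero_iff)
  qed
  ultimately show ?thesis using that vV by blast
qed

end

theorem lax_milgram:
  fixes V :: "'v::{real_normed_vector, complete_space} set"
  assumes V: "closed V" and form: "sectorial_form V b C"
    and coercive: "c > 0" "\<And>u. u \<in> V \<Longrightarrow> c * (norm u)\<^sup>2 \<le> b u u"
    and bounded: "\<And>u v. u \<in> V \<Longrightarrow> v \<in> V \<Longrightarrow> \<bar>b u v\<bar> \<le> B * norm u * norm v"
    and l_add: "\<And>u v. u \<in> V \<Longrightarrow> v \<in> V \<Longrightarrow> l (u + v) = l u + l v"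
    and l_scale: "\<And>a u. u \<in> V \<Longrightarrow> l (a *\<^sub>R u) = a * l u"
    and l_bounded: "\<And>u. u \<in> V \<Longrightarrow> \<bar>l u\<bar> \<le> L * norm u"
  obtains u where "u \<in> V" "\<And>z. z \<in> V \<Longrightarrow> b u z = l z"
proof -
  interpret sectorial_form V b C by (rule form)
  have normle: "norm u \<le> nrm u / sqrt c" if "u \<in> V" for u
  proof -
    have "sqrt (c * (norm u)\<^sup>2) \<le> nrm u" unfolding nrm_def by (rule real_sqrt_le_mono) (rule coercive(2)[OF that])
    then show ?thesis using coercive(1) by (simp add: real_sqrt_mult field_simps)
  qed
  have "bounded_functional l (\<bar>L\<bar> / sqrt c)"
    unfolding bounded_functional_def
  proof (intro conjI ballI allI)
    fix u assume u: "u \<in> V"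
    have "\<bar>l u\<bar> \<le> L * norm u" by (rule l_bounded[OF u])
    also have "\<dots> \<le> \<bar>L\<bar> * norm u" by (intro mult_right_mono) auto
    also have "\<dots> \<le> \<bar>L\<bar> * (nrm u / sqrt c)" by (intro mult_left_mono normle u) auto
    finally show "\<bar>l u\<bar> \<le> \<bar>L\<bar> / sqrt c * nrm u" by simp
  qed (auto simp: l_add l_scale)
  then obtain v where v: "\<And>n. v n \<in> V" "form_Cauchy v" "\<And>z. z \<in> V \<Longrightarrow> (\<lambda>n. b (v n) z) \<longlonglongrightarrow> l z"
    using lax_milgram_sequence by blast
  have "Cauchy v"
  proof (rule metric_CauchyI)
    fix e :: real assume e: "e > 0"
    then have "c * e\<^sup>2 > 0" using coercive(1) by simp
    then obtain N where N: "\<And>m n. m \<ge> N \<Longrightarrow> n \<ge> N \<Longrightarrow> b (v m - v n) (v m - v n) < c * e\<^sup>2"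
      using v(2) unfolding form_Cauchy_def by meson
    have "dist (v m) (v n) < e" if "m \<ge> N" "n \<ge> N" for m n
    proof -
      have "c * (norm (v m - v n))\<^sup>2 < c * e\<^sup>2"
        using N[OF that] coercive(2)[of "v m - v n"] v(1) by (meson V_closed(4) le_less_trans)
      then have "(norm (v m - v n))\<^sup>2 < e\<^sup>2" using coercive(1) by simp
      then show ?thesis using e by (simp add: dist_norm power2_less_imp_less)
    qed
    then show "\<exists>N. \<forall>m\<ge>N. \<forall>n\<ge>N. dist (v m) (v n) < e" by blast
  qed
  then obtain u where u: "v \<longlonglongrightarrow> u" by (auto simp: Cauchy_convergent_iff convergent_def)
  have uV: "u \<in> V" using closed_sequentially[OF V] v(1) u by blast
  have "b u z = l z" if z: "z \<in> V" for z
  proof -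
    have "(\<lambda>n. b (v n) z - b u z) \<longlonglongrightarrow> 0"
    proof (rule Lim_null_comparison)
      show "\<forall>\<^sub>F n in sequentially. norm (b (v n) z - b u z) \<le> B * norm (v n - u) * norm z"
        using bounded[of "v _ - u" z] v(1) uV z by (auto simp: form_simps)
      have "(\<lambda>n. B * norm (v n - u) * norm z) \<longlonglongrightarrow> B * norm (u - u) * norm z"
        by (intro tendsto_intros u)
      then show "(\<lambda>n. B * norm (v n - u) * norm z) \<longlonglongrightarrow> 0" by simp
    qed
    then have "(\<lambda>n. b (v n) z) \<longlonglongrightarrow> b u z" by (simp add: LIM_zero_iff)
    then show ?thesis using v(3)[OF z] LIMSEQ_unique by blast
  qed
  then show ?thesis using that uV by blast
qed

lemma subspace_closure:
  fixes A :: "'v::real_normed_vector set"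
  assumes "subspace A"
  shows "subspace (closure A)"
  unfolding subspace_def
proof (intro conjI ballI allI)
  show "0 \<in> closure A" using assms closure_subset subspace_0 by blast
  fix x y c assume "x \<in> closure A" "y \<in> closure A"
  then obtain u v where u: "\<And>n. u n \<in> A" "u \<longlonglongrightarrow> x" and v: "\<And>n. v n \<in> A" "v \<longlonglongrightarrow> y"
    unfolding closure_sequential by blast
  have "\<And>n. u n + v n \<in> A" "(\<lambda>n. u n + v n) \<longlonglongrightarrow> x + y"
    using u v assms by (auto simp: subspace_add intro: tendsto_add)
  then show "x + y \<in> closure A" unfolding closure_sequential
    by (intro exI[of _ "\<lambda>n. u n + v n"]) simp
next
  fix x c assume "x \<in> closure A"
  then obtain u where u: "\<And>n. u n \<in> A" "u \<longlonglongrightarrow> x"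
    unfolding closure_sequential by blast
  have "\<And>n. c *\<^sub>R u n \<in> A" "(\<lambda>n. c *\<^sub>R u n) \<longlonglongrightarrow> c *\<^sub>R x"
    using u assms by (auto simp: subspace_scale intro: tendsto_scaleR)
  then show "c *\<^sub>R x \<in> closure A" unfolding closure_sequential
    by (intro exI[of _ "\<lambda>n. c *\<^sub>R u n"]) simp
qed

text \<open>The inner product is itself a coercive form.\<close>

theorem orthogonal_projection:
  fixes A :: "'v::{real_inner, complete_space} set"
  assumes "subspace A" "closed A"
  obtains p where "p \<in> A" "\<And>z. z \<in> A \<Longrightarrow> inner (x - p) z = 0"
proof -
  have "sectorial_form A inner 1"
  proof
    fix u v :: 'v
    have "\<bar>inner u v\<bar> \<le> norm u * norm v" by (rule Cauchy_Schwarz_ineq2)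
    also have "\<dots> \<le> (norm u)\<^sup>2 + (norm v)\<^sup>2"
      using sum_squares_bound[of "norm u" "norm v"] mult_nonneg_nonneg[OF norm_ge_zero norm_ge_zero, of u v]
      by linarith
    finally show "\<bar>inner u v\<bar> \<le> 1 * (inner u u + inner v v)" by (simp add: power2_norm_eq_inner)
  qed (use assms in \<open>auto simp: inner_add_left inner_add_right\<close>)
  then obtain p where "p \<in> A" "\<And>z. z \<in> A \<Longrightarrow> inner p z = inner x z"
    by (rule lax_milgram[OF assms(2), of inner 1 1 1 "inner x" "norm x"])
       (auto simp: inner_add_right power2_norm_eq_inner Cauchy_Schwarz_ineq2)
  then show ?thesis using that by (simp add: inner_diff_left)
qed

text \<open>Density in a closed subspace is proved below by showing that nothing in it is orthogonal; the projection onto the closure is what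
  makes this sufficient.\<close>

lemma subset_closure_if_orthogonal_trivial:
  fixes A :: "'v::{real_inner, complete_space} set"
  assumes A: "subspace A" "A \<subseteq> V" and V: "subspace V" "closed V"
    and triv: "\<And>x. x \<in> V \<Longrightarrow> (\<And>z. z \<in> A \<Longrightarrow> inner x z = 0) \<Longrightarrow> x = 0"
  shows "V \<subseteq> closure A"
proof
  fix x assume x: "x \<in> V"
  obtain p where p: "p \<in> closure A" "\<And>z. z \<in> closure A \<Longrightarrow> inner (x - p) z = 0"
    using orthogonal_projection[OF subspace_closure closed_closure] A(1) by blast
  have "p \<in> V" using p(1) closure_minimal[OF A(2) V(2)] by blast
  then have "x - p = 0"
    using p(2) closure_subset x V(1) by (intro triv) (auto simp: subspace_diff)
  then show "x \<in> closure A" using p(1) by simp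
qed

section \<open>Compactness of the embedding of a form space\<close>

text \<open>The map \<open>j\<close> embeds the form space into a Hilbert space. Here it will send a derivative to its primitive, so that form
  space and Hilbert space have different elements.\<close>

locale embedded_form = sectorial_form V b C for V :: "'v::real_vector set" and b C +
  fixes j :: "'v \<Rightarrow> 'h::{real_inner, complete_space}" and \<kappa> :: real
  assumes j_add: "\<And>u v. u \<in> V \<Longrightarrow> v \<in> V \<Longrightarrow> j (u + v) = j u + j v"
    and j_scale: "\<And>c u. u \<in> V \<Longrightarrow> j (c *\<^sub>R u) = c *\<^sub>R j u"
    and \<kappa>: "\<kappa> > 0" and coercive: "\<And>u. u \<in> V \<Longrightarrow> \<kappa> * (norm (j u))\<^sup>2 \<le> b u u"
begin

lemma j_diff: "u \<in> V \<Longrightarrow> v \<in> V \<Longrightarrow> j (u - v) = j u - j v"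
  using j_add[of u "(-1) *\<^sub>R v"] j_scale[of v "-1"] by simp

definition unit_ball where "unit_ball W = j ` {w\<in>W. b w w \<le> 1}"

lemma unit_ball_mono: "A \<subseteq> B \<Longrightarrow> unit_ball A \<subseteq> unit_ball B"
  unfolding unit_ball_def by (intro image_mono) blast

lemma totally_bounded_ball_scale:
  assumes W: "W \<subseteq> V" "subspace W" and tb: "totally_bounded (unit_ball W)" and r: "r > 0"
  shows "totally_bounded (j ` {w\<in>W. b w w \<le> r})"
proof (rule totally_bounded_subset[OF totally_bounded_scaleR[OF tb, of "sqrt r"]])
  show "j ` {w\<in>W. b w w \<le> r} \<subseteq> (\<lambda>x. sqrt r *\<^sub>R x) ` unit_ball W"
  proof clarify
    fix w assume w: "w \<in> W" "b w w \<le> r"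
    define u where "u = (1 / sqrt r) *\<^sub>R w"
    have "u \<in> W" using w W by (simp add: u_def subspace_scale)
    moreover have "b u u \<le> 1" using w W r by (auto simp: u_def form_simps subset_iff)
    moreover have "j w = sqrt r *\<^sub>R j u" using w W r by (auto simp: u_def j_scale subset_iff)
    ultimately show "j w \<in> (\<lambda>x. sqrt r *\<^sub>R x) ` unit_ball W" by (auto simp: unit_ball_def)
  qed
qed

lemma norm_j_less:
  assumes "u \<in> V" "b u u < \<kappa> * e\<^sup>2" "e > 0"
  shows "norm (j u) < e"
proof -
  have "\<kappa> * (norm (j u))\<^sup>2 < \<kappa> * e\<^sup>2" using coercive[OF assms(1)] assms(2) by linarith
  then have "(norm (j u))\<^sup>2 < e\<^sup>2" using \<kappa> by simp
  then show ?thesis using assms(3) by (simp add: power2_less_imp_less)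
qed

text \<open>If \<open>e\<close> has positive distance to \<open>W\<close> in the form norm, the coefficient of \<open>e\<close> and the component in \<open>W\<close> of a vector in
  the unit ball are bounded. If the distance is zero, multiples of \<open>e\<close> are approximated by elements of \<open>W\<close>, and the
  new unit ball lies in arbitrarily small neighbourhoods of a ball of \<open>W\<close>.\<close>

lemma totally_bounded_add_vector:
  assumes W: "W \<subseteq> V" "subspace W" and e: "e \<in> V" and tb: "totally_bounded (unit_ball W)"
  shows "totally_bounded (unit_ball {w + t *\<^sub>R e | w t. w \<in> W})"
proof (cases "\<exists>\<delta>>0. \<forall>w\<in>W. \<delta> \<le> b (e + w) (e + w)")
  case True
  then obtain \<delta> where \<delta>: "\<delta> > 0" "\<And>w. w \<in> W \<Longrightarrow> \<delta> \<le> b (e + w) (e + w)" by blast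
  define r where "r = 2 + 2 * b e e / \<delta>"
  have r: "r > 0" using \<delta> nonneg[OF e] by (simp add: r_def add_pos_nonneg)
  have tb1: "totally_bounded (j ` {w\<in>W. b w w \<le> r})" by (rule totally_bounded_ball_scale[OF W tb r])
  have "compact ((\<lambda>t. t *\<^sub>R j e) ` {- (1 / sqrt \<delta>) .. 1 / sqrt \<delta>})"
    by (intro compact_continuous_image continuous_intros compact_Icc)
  then have tb2: "totally_bounded ((\<lambda>t. t *\<^sub>R j e) ` {- (1 / sqrt \<delta>) .. 1 / sqrt \<delta>})"
    by (rule compact_imp_totally_bounded)
  show ?thesis
  proof (rule totally_bounded_subset[OF totally_bounded_plus[OF tb1 tb2]])
    show "unit_ball {w + t *\<^sub>R e | w t. w \<in> W} \<subseteq> {x + y |x y. x \<in> j ` {w\<in>W. b w w \<le> r} \<and> y \<in> (\<lambda>t. t *\<^sub>R j e) ` {- (1 / sqrt \<delta>) .. 1 / sqrt \<delta>}}"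
    proof (unfold unit_ball_def, clarify)
      fix w t assume w: "w \<in> W" and b1: "b (w + t *\<^sub>R e) (w + t *\<^sub>R e) \<le> 1"
      have wV: "w \<in> V" using w W by auto
      have t2: "t\<^sup>2 * \<delta> \<le> 1"
      proof (cases "t = 0")
        case False
        have eq: "w + t *\<^sub>R e = t *\<^sub>R (e + (1/t) *\<^sub>R w)" using False by (simp add: scaleR_add_right)
        have "e + (1/t) *\<^sub>R w \<in> V" using e wV by simp
        then have "b (w + t *\<^sub>R e) (w + t *\<^sub>R e) = t\<^sup>2 * b (e + (1/t) *\<^sub>R w) (e + (1/t) *\<^sub>R w)"
          unfolding eq by (simp only: scale_left scale_right V_closed) (simp add: power2_eq_square)
        moreover have "t\<^sup>2 * \<delta> \<le> t\<^sup>2 * b (e + (1/t) *\<^sub>R w) (e + (1/t) *\<^sub>R w)"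
          using w W by (intro mult_left_mono \<delta>) (auto simp: subspace_scale)
        ultimately show ?thesis using b1 by linarith
      qed simp
      then have "t\<^sup>2 \<le> 1 / \<delta>" using \<delta> by (simp add: field_simps)
      then have "\<bar>t\<bar> \<le> sqrt (1 / \<delta>)" by (metis real_sqrt_abs real_sqrt_le_mono)
      then have t: "t \<in> {- (1 / sqrt \<delta>) .. 1 / sqrt \<delta>}" by (auto simp: real_sqrt_divide abs_le_iff)
      have "b w w = b ((w + t *\<^sub>R e) - t *\<^sub>R e) ((w + t *\<^sub>R e) - t *\<^sub>R e)" by simp
      also have "\<dots> \<le> 2 * b (w + t *\<^sub>R e) (w + t *\<^sub>R e) + 2 * b (t *\<^sub>R e) (t *\<^sub>R e)"
        using wV e by (intro diff_le) auto
      also have "b (t *\<^sub>R e) (t *\<^sub>R e) = t\<^sup>2 * b e e" using e by (simp add: form_simps power2_eq_square)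
      also have "\<dots> \<le> (1 / \<delta>) * b e e" using \<open>t\<^sup>2 \<le> 1 / \<delta>\<close> nonneg[OF e] by (intro mult_right_mono)
      finally have "b w w \<le> r" using b1 by (simp add: r_def)
      moreover have "j (w + t *\<^sub>R e) = j w + t *\<^sub>R j e" using wV e by (simp add: j_add j_scale)
      ultimately show "\<exists>x y. j (w + t *\<^sub>R e) = x + y \<and> x \<in> j ` {w\<in>W. b w w \<le> r} \<and> y \<in> (\<lambda>t. t *\<^sub>R j e) ` {- (1 / sqrt \<delta>) .. 1 / sqrt \<delta>}"
        using w t by blast
    qed
  qed
next
  case False
  then have F: "\<exists>w\<in>W. b (e + w) (e + w) < \<delta>" if "\<delta> > 0" for \<delta> using that by (meson not_le)
  show ?thesis
  proof (rule totally_bounded_approx)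
    fix \<epsilon> :: real assume \<epsilon>: "\<epsilon> > 0"
    have "\<exists>y\<in>j ` {w\<in>W. b w w \<le> 4}. dist x y < \<epsilon>" if xU: "x \<in> unit_ball {w + t *\<^sub>R e | w t. w \<in> W}" for x
    proof -
      obtain w t where w: "w \<in> W" and b1: "b (w + t *\<^sub>R e) (w + t *\<^sub>R e) \<le> 1" and x: "x = j (w + t *\<^sub>R e)"
        using xU unfolding unit_ball_def by blast
      have wV: "w \<in> V" using w W by auto
      define m where "m = min 1 (\<kappa> * \<epsilon>\<^sup>2)"
      have m: "m > 0" using \<epsilon> \<kappa> by (simp add: m_def)
      obtain w' where w': "w' \<in> W" "b (e + w') (e + w') < m / (t\<^sup>2 + 1)"
        using F[of "m / (t\<^sup>2 + 1)"] m by (meson divide_pos_pos sum_power2_gt_zero_iff zero_less_one add_nonneg_pos zero_le_power2)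
      have w'V: "w' \<in> V" using w' W by auto
      have "b (t *\<^sub>R (e + w')) (t *\<^sub>R (e + w')) = t\<^sup>2 * b (e + w') (e + w')"
        using e w'V by (simp only: scale_left scale_right V_closed) (simp add: power2_eq_square)
      also have "\<dots> \<le> t\<^sup>2 * (m / (t\<^sup>2 + 1))" using w'(2) by (intro mult_left_mono) auto
      also have "\<dots> < m" using m by (simp add: divide_simps add_pos_nonneg pos_add_strict power2_eq_square)
          (smt (verit) distrib_left mult_nonneg_nonneg zero_le_square)
      finally have small: "b (t *\<^sub>R (e + w')) (t *\<^sub>R (e + w')) < m" .
      define u where "u = w - t *\<^sub>R w'"
      have u: "u \<in> W" using w w' W by (simp add: u_def subspace_diff subspace_scale)
      have eq: "u = (w + t *\<^sub>R e) - t *\<^sub>R (e + w')" by (simp add: u_def algebra_simps)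
      have "b u u \<le> 2 * b (w + t *\<^sub>R e) (w + t *\<^sub>R e) + 2 * b (t *\<^sub>R (e + w')) (t *\<^sub>R (e + w'))"
        unfolding eq using wV e w'V by (intro diff_le) auto
      also have "\<dots> \<le> 4" using b1 small by (simp add: m_def)
      finally have "b u u \<le> 4" .
      moreover have "norm (j (t *\<^sub>R (e + w'))) < \<epsilon>"
        using small \<epsilon> e w'V by (intro norm_j_less) (auto simp: m_def)
      moreover have "j u = x - j (t *\<^sub>R (e + w'))" unfolding eq x using wV e w'V by (intro j_diff) auto
      ultimately have "dist x (j u) < \<epsilon>" "u \<in> {w\<in>W. b w w \<le> 4}" using u by (simp_all add: dist_norm)
      then show ?thesis by (intro bexI[of _ "j u"] imageI)
    qed
    then show "\<exists>T. totally_bounded T \<and> (\<forall>x\<in>unit_ball {w + t *\<^sub>R e | w t. w \<in> W}. \<exists>y\<in>T. dist x y < \<epsilon>)"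
      using totally_bounded_ball_scale[OF W tb, of 4] by (intro exI[of _ "j ` {w\<in>W. b w w \<le> 4}"]) auto
  qed
qed

lemma totally_bounded_finite_codim:
  assumes W: "W \<subseteq> V" "subspace W" and tb: "totally_bounded (unit_ball W)"
    and F: "finite F" "F \<subseteq> V"
  shows "totally_bounded (unit_ball {w + s | w s. w \<in> W \<and> s \<in> span F})"
  using F
proof (induction F rule: finite_induct)
  case empty
  have "{w + s | w s. w \<in> W \<and> s \<in> span {}} = W" by auto
  then show ?case using tb by simp
next
  case (insert e F)
  let ?U = "{w + s | w s. w \<in> W \<and> s \<in> span F}"
  have sF: "span F \<subseteq> V" using insert subspace_V by (intro span_minimal) auto
  have U: "subspace ?U"
    using subspace_sums[OF W(2) subspace_span, of F] by simp
  have UV: "?U \<subseteq> V" using W sF by (auto intro!: V_closed(2))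
  have eq: "{w + s | w s. w \<in> W \<and> s \<in> span (insert e F)} \<subseteq> {u + t *\<^sub>R e | u t. u \<in> ?U}"
  proof clarify
    fix w s assume w: "w \<in> W" and s: "s \<in> span (insert e F)"
    then obtain k where k: "s - k *\<^sub>R e \<in> span F" by (auto simp: span_insert)
    show "\<exists>u t. w + s = u + t *\<^sub>R e \<and> u \<in> ?U"
      by (rule exI[of _ "w + (s - k *\<^sub>R e)"], rule exI[of _ k]) (use w k in auto)
  qed
  have "totally_bounded (unit_ball {u + t *\<^sub>R e | u t. u \<in> ?U})"
    using insert by (intro totally_bounded_add_vector UV U) auto
  then show ?case
    by (rule totally_bounded_subset) (rule unit_ball_mono[OF eq])
qed

lemma form_Cauchy_linear:
  assumes u: "\<And>n. u n \<in> V" "form_Cauchy u" and v: "\<And>n. v n \<in> V" "form_Cauchy v"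
  shows "form_Cauchy (\<lambda>n. u n + c *\<^sub>R v n)"
  unfolding form_Cauchy_def
proof (intro allI impI)
  fix e :: real assume e: "e > 0"
  define d where "d = e / (4 * (c\<^sup>2 + 1))"
  have c1: "c\<^sup>2 + 1 > 0" by (intro add_nonneg_pos) auto
  have d: "d > 0" using e c1 by (simp add: d_def)
  have d1: "2 * d \<le> e / 2" and d2: "2 * c\<^sup>2 * d \<le> e / 2"
    using e c1 by (simp_all add: d_def field_simps)
  obtain N where N: "\<And>m n. m \<ge> N \<Longrightarrow> n \<ge> N \<Longrightarrow> b (u m - u n) (u m - u n) < d"
    using u(2) d unfolding form_Cauchy_def by meson
  obtain N' where N': "\<And>m n. m \<ge> N' \<Longrightarrow> n \<ge> N' \<Longrightarrow> b (v m - v n) (v m - v n) < d"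
    using v(2) d unfolding form_Cauchy_def by meson
  have "b (u m + c *\<^sub>R v m - (u n + c *\<^sub>R v n)) (u m + c *\<^sub>R v m - (u n + c *\<^sub>R v n)) < e"
    if "m \<ge> max N N'" "n \<ge> max N N'" for m n
  proof -
    have eq: "u m + c *\<^sub>R v m - (u n + c *\<^sub>R v n) = (u m - u n) + c *\<^sub>R (v m - v n)"
      by (simp add: scaleR_diff_right)
    have uV: "u m - u n \<in> V" "v m - v n \<in> V" using u(1) v(1) by auto
    have "b ((u m - u n) + c *\<^sub>R (v m - v n)) ((u m - u n) + c *\<^sub>R (v m - v n))
      \<le> 2 * b (u m - u n) (u m - u n) + 2 * b (c *\<^sub>R (v m - v n)) (c *\<^sub>R (v m - v n))"
      using uV by (intro add_le) auto
    also have "b (c *\<^sub>R (v m - v n)) (c *\<^sub>R (v m - v n)) = c\<^sup>2 * b (v m - v n) (v m - v n)"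
      using uV by (simp only: scale_left scale_right V_closed) (simp add: power2_eq_square)
    also have "c\<^sup>2 * b (v m - v n) (v m - v n) \<le> c\<^sup>2 * d"
      using N'[of m n] that by (intro mult_left_mono) auto
    finally show ?thesis unfolding eq using N[of m n] that d1 d2 by simp
  qed
  then show "\<exists>N. \<forall>m\<ge>N. \<forall>n\<ge>N. b (u m + c *\<^sub>R v m - (u n + c *\<^sub>R v n)) (u m + c *\<^sub>R v m - (u n + c *\<^sub>R v n)) < e"
    by blast
qed

text \<open>The vector \<open>y\<close> is the image, in the Hilbert space, of an element of the completion of the form space that solves
  \<open>b(\<cdot>, z) = \<langle>f, j z\<rangle>\<close>; the completion is represented by Cauchy sequences.\<close>

definition weak_solution :: "'h \<Rightarrow> 'h \<Rightarrow> bool" where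
  "weak_solution f y \<longleftrightarrow> (\<exists>v. (\<forall>n. v n \<in> V) \<and> form_Cauchy v \<and> (\<lambda>n. j (v n)) \<longlonglongrightarrow> y \<and>
     (\<forall>z\<in>V. (\<lambda>n. b (v n) z) \<longlonglongrightarrow> inner f (j z)))"

lemma weak_solution_exact:
  assumes "u \<in> V" "\<And>z. z \<in> V \<Longrightarrow> b u z = inner f (j z)"
  shows "weak_solution f (j u)"
  unfolding weak_solution_def using assms
  by (intro exI[of _ "\<lambda>_. u"]) (auto simp: form_Cauchy_def)

lemma weak_solution_linear:
  assumes "weak_solution f y" "weak_solution g x"
  shows "weak_solution (f + c *\<^sub>R g) (y + c *\<^sub>R x)"
proof -
  obtain v where v: "\<And>n. v n \<in> V" "form_Cauchy v" "(\<lambda>n. j (v n)) \<longlonglongrightarrow> y"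
    "\<And>z. z \<in> V \<Longrightarrow> (\<lambda>n. b (v n) z) \<longlonglongrightarrow> inner f (j z)" using assms(1) unfolding weak_solution_def by blast
  obtain w where w: "\<And>n. w n \<in> V" "form_Cauchy w" "(\<lambda>n. j (w n)) \<longlonglongrightarrow> x"
    "\<And>z. z \<in> V \<Longrightarrow> (\<lambda>n. b (w n) z) \<longlonglongrightarrow> inner g (j z)" using assms(2) unfolding weak_solution_def by blast
  have "(\<lambda>n. j (v n) + c *\<^sub>R j (w n)) \<longlonglongrightarrow> y + c *\<^sub>R x"
    by (intro tendsto_intros v w)
  moreover have "(\<lambda>n. b (v n) z + c * b (w n) z) \<longlonglongrightarrow> inner f (j z) + c * inner g (j z)" if "z \<in> V" for z
    by (intro tendsto_intros v w that)
  ultimately show ?thesis unfolding weak_solution_def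
    using v(1,2) w(1,2)
    by (intro exI[of _ "\<lambda>n. v n + c *\<^sub>R w n"])
       (auto simp: j_add j_scale form_simps inner_add_left form_Cauchy_linear)
qed

text \<open>Testing the equation with the approximating vectors themselves; the Cauchy property makes \<open>b (v n) (v m)\<close> and
  \<open>b (v m) (v m)\<close> close.\<close>

lemma weak_solution_energy:
  assumes v: "\<And>n. v n \<in> V" "form_Cauchy v" "\<And>z. z \<in> V \<Longrightarrow> (\<lambda>n. b (v n) z) \<longlonglongrightarrow> inner f (j z)"
    and e: "e > 0"
  shows "\<forall>\<^sub>F m in sequentially. b (v m) (v m) \<le> inner f (j (v m)) + e"
proof -
  obtain N0 where N0: "\<And>m n. m \<ge> N0 \<Longrightarrow> n \<ge> N0 \<Longrightarrow> b (v m - v n) (v m - v n) < 1"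
    using v(2) unfolding form_Cauchy_def by (meson zero_less_one)
  define B where "B = 2 + 2 * b (v N0) (v N0)"
  have B: "b (v m) (v m) \<le> B" if "m \<ge> N0" for m
    using add_le[of "v m - v N0" "v N0"] N0[OF that order_refl] v(1) by (simp add: B_def)
  have B0: "B > 0" using nonneg[OF v(1)] by (simp add: B_def add_pos_nonneg)
  define d where "d = (e / (M * sqrt B + 1))\<^sup>2"
  have den: "M * sqrt B + 1 > 0" using M_nonneg B0 by (intro add_nonneg_pos mult_nonneg_nonneg) auto
  have d: "d > 0" using e den by (simp add: d_def)
  obtain N1 where N1: "\<And>m n. m \<ge> N1 \<Longrightarrow> n \<ge> N1 \<Longrightarrow> b (v m - v n) (v m - v n) < d"
    using v(2) d unfolding form_Cauchy_def by meson
  have "b (v m) (v m) \<le> inner f (j (v m)) + e" if m: "m \<ge> max N0 N1" for m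
  proof -
    have "b (v m) (v m) - e \<le> b (v n) (v m)" if n: "n \<ge> N1" for n
    proof -
      have "nrm (v m - v n) \<le> sqrt d" unfolding nrm_def using N1[of m n] m n by (intro real_sqrt_le_mono) auto
      also have "sqrt d = e / (M * sqrt B + 1)" using e den by (simp add: d_def)
      finally have n1: "nrm (v m - v n) \<le> e / (M * sqrt B + 1)" .
      have n2: "nrm (v m) \<le> sqrt B" unfolding nrm_def using B[of m] m by (intro real_sqrt_le_mono) auto
      have "\<bar>b (v m - v n) (v m)\<bar> \<le> M * nrm (v m - v n) * nrm (v m)"
        using v(1) by (intro bounded_form) auto
      also have "\<dots> \<le> M * (e / (M * sqrt B + 1)) * sqrt B"
        using n1 n2 v(1) M_nonneg e den
        by (intro mult_mono mult_left_mono mult_nonneg_nonneg) auto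
      also have "\<dots> \<le> e" using e den by (simp add: field_simps)
      finally show ?thesis using v(1) by (simp add: form_simps)
    qed
    then have "b (v m) (v m) - e \<le> inner f (j (v m))"
      using v(3)[OF v(1)[of m]] by (intro tendsto_lowerbound[of "\<lambda>n. b (v n) (v m)"])
        (auto simp: eventually_sequentially intro!: exI[of _ N1])
    then show ?thesis by simp
  qed
  then show ?thesis unfolding eventually_sequentially by blast
qed

lemma weak_solution_bound:
  assumes "weak_solution f y"
  shows "\<kappa> * norm y \<le> norm f"
proof -
  obtain v where v: "\<And>n. v n \<in> V" "form_Cauchy v" "(\<lambda>n. j (v n)) \<longlonglongrightarrow> y"
    "\<And>z. z \<in> V \<Longrightarrow> (\<lambda>n. b (v n) z) \<longlonglongrightarrow> inner f (j z)" using assms unfolding weak_solution_def by blast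
  have "\<kappa> * (norm y)\<^sup>2 \<le> inner f y + e" if e: "e > 0" for e
  proof (rule tendsto_le[OF sequentially_bot])
    show "(\<lambda>n. \<kappa> * (norm (j (v n)))\<^sup>2) \<longlonglongrightarrow> \<kappa> * (norm y)\<^sup>2" by (intro tendsto_intros v)
    show "(\<lambda>n. inner f (j (v n)) + e) \<longlonglongrightarrow> inner f y + e" by (intro tendsto_intros v)
    show "\<forall>\<^sub>F n in sequentially. \<kappa> * (norm (j (v n)))\<^sup>2 \<le> inner f (j (v n)) + e"
    proof -
      have "\<forall>\<^sub>F n in sequentially. b (v n) (v n) \<le> inner f (j (v n)) + e"
        by (rule weak_solution_energy[OF v(1,2)]) (use v(4) e in auto)
      then show ?thesis by eventually_elim (meson coercive order_trans v(1))
    qed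
  qed
  then have "\<kappa> * (norm y)\<^sup>2 \<le> inner f y" by (rule field_le_epsilon)
  also have "\<dots> \<le> norm f * norm y" by (rule norm_cauchy_schwarz)
  finally have "(\<kappa> * norm y) * norm y \<le> norm f * norm y" by (simp add: power2_eq_square mult.assoc)
  then show ?thesis by (cases "norm y = 0") (simp_all add: mult_le_cancel_right)
qed

lemma weak_solution_unique: "weak_solution f y \<Longrightarrow> weak_solution f x \<Longrightarrow> y = x"
  using weak_solution_bound[OF weak_solution_linear[of f y f x "-1"]] \<kappa>
  by (simp add: mult_le_0_iff)

lemma weak_solution_exists: "\<exists>y. weak_solution f y"
proof -
  have normle: "norm (j u) \<le> nrm u / sqrt \<kappa>" if "u \<in> V" for u
  proof -
    have "sqrt (\<kappa> * (norm (j u))\<^sup>2) \<le> nrm u" unfolding nrm_def by (rule real_sqrt_le_mono) (rule coercive[OF that])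
    then show ?thesis using \<kappa> by (simp add: real_sqrt_mult field_simps)
  qed
  have "bounded_functional (\<lambda>z. inner f (j z)) (norm f / sqrt \<kappa>)"
    unfolding bounded_functional_def
  proof (intro conjI ballI allI)
    fix u assume u: "u \<in> V"
    have "\<bar>inner f (j u)\<bar> \<le> norm f * norm (j u)" by (rule Cauchy_Schwarz_ineq2)
    also have "\<dots> \<le> norm f * (nrm u / sqrt \<kappa>)" by (intro mult_left_mono normle u) auto
    finally show "\<bar>inner f (j u)\<bar> \<le> norm f / sqrt \<kappa> * nrm u" by simp
  qed (auto simp: j_add j_scale inner_add_right)
  then obtain v where v: "\<And>n. v n \<in> V" "form_Cauchy v" "\<And>z. z \<in> V \<Longrightarrow> (\<lambda>n. b (v n) z) \<longlonglongrightarrow> inner f (j z)"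
    using lax_milgram_sequence by blast
  have "Cauchy (\<lambda>n. j (v n))"
  proof (rule metric_CauchyI)
    fix e :: real assume e: "e > 0"
    then have "\<kappa> * e\<^sup>2 > 0" using \<kappa> by simp
    then obtain N where N: "\<And>m n. m \<ge> N \<Longrightarrow> n \<ge> N \<Longrightarrow> b (v m - v n) (v m - v n) < \<kappa> * e\<^sup>2"
      using v(2) unfolding form_Cauchy_def by meson
    have "dist (j (v m)) (j (v n)) < e" if "m \<ge> N" "n \<ge> N" for m n
      using norm_j_less[OF _ N[OF that] e] v(1) by (simp add: dist_norm j_diff)
    then show "\<exists>N. \<forall>m\<ge>N. \<forall>n\<ge>N. dist (j (v m)) (j (v n)) < e" by blast
  qed
  then obtain y where "(\<lambda>n. j (v n)) \<longlonglongrightarrow> y" by (auto simp: Cauchy_convergent_iff convergent_def)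
  then show ?thesis unfolding weak_solution_def using v by blast
qed

definition solution_operator :: "'h \<Rightarrow> 'h" where
  "solution_operator f = (THE y. weak_solution f y)"

lemma solution_operator_eq_iff: "solution_operator f = y \<longleftrightarrow> weak_solution f y"
proof -
  have "weak_solution f (solution_operator f)"
    unfolding solution_operator_def using weak_solution_exists weak_solution_unique by (metis theI)
  then show ?thesis using weak_solution_unique by blast
qed

lemma bounded_linear_solution_operator: "bounded_linear solution_operator"
proof (rule bounded_linear_intro[where K = "1 / \<kappa>"])
  have sol: "weak_solution f (solution_operator f)" for f using solution_operator_eq_iff by blast
  have z: "weak_solution 0 0" using weak_solution_linear[OF sol[of 0] sol[of 0], of "-1"] by simp
  show "solution_operator (f + g) = solution_operator f + solution_operator g" for f g
    using weak_solution_linear[OF sol sol, of f 1 g] by (simp add: solution_operator_eq_iff)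
  show "solution_operator (c *\<^sub>R f) = c *\<^sub>R solution_operator f" for c f
    using weak_solution_linear[OF z sol, of c f] by (simp add: solution_operator_eq_iff)
  show "norm (solution_operator f) \<le> norm f * (1 / \<kappa>)" for f
    using weak_solution_bound[OF sol, of f] \<kappa> by (simp add: field_simps)
qed

text \<open>This is where closability of the form enters: a solution zero comes from a Cauchy sequence that
  tends to zero in the Hilbert space, and then its form values tend to zero too.\<close>

lemma solution_operator_injective:
  assumes closable: "\<And>v z. (\<And>n. v n \<in> V) \<Longrightarrow> form_Cauchy v \<Longrightarrow> (\<lambda>n. j (v n)) \<longlonglongrightarrow> 0 \<Longrightarrow> z \<in> V \<Longrightarrow> (\<lambda>n. b (v n) z) \<longlonglongrightarrow> 0"
    and dense: "\<And>f. (\<And>z. z \<in> V \<Longrightarrow> inner f (j z) = 0) \<Longrightarrow> f = 0"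
    and "solution_operator f = 0"
  shows "f = 0"
proof (rule dense)
  fix z assume z: "z \<in> V"
  obtain v where v: "\<And>n. v n \<in> V" "form_Cauchy v" "(\<lambda>n. j (v n)) \<longlonglongrightarrow> 0"
    "\<And>z. z \<in> V \<Longrightarrow> (\<lambda>n. b (v n) z) \<longlonglongrightarrow> inner f (j z)"
    using assms(3) unfolding solution_operator_eq_iff weak_solution_def by blast
  show "inner f (j z) = 0" using LIMSEQ_unique[OF v(4)[OF z] closable[OF v(1-3) z]] .
qed

text \<open>By the energy inequality, solutions with bounded right-hand sides are limits of vectors from a fixed form ball.\<close>

lemma totally_bounded_solutions:
  assumes tb: "totally_bounded (unit_ball V)"
  shows "totally_bounded (solution_operator ` cball 0 1)"
proof (rule totally_bounded_approx)
  fix e :: real assume e: "e > 0"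
  define r where "r = 1 / \<kappa> + 2"
  have r: "r > 0" using \<kappa> by (simp add: r_def add_pos_pos)
  have "\<exists>y\<in>j ` {w\<in>V. b w w \<le> r}. dist x y < e" if xS: "x \<in> solution_operator ` cball 0 1" for x
  proof -
    obtain f where "f \<in> cball 0 1" and xf: "x = solution_operator f" using xS by blast
    then have f: "norm f \<le> 1" "weak_solution f x"
      using solution_operator_eq_iff[of f x] by simp_all
    obtain v where v: "\<And>n. v n \<in> V" "form_Cauchy v" "(\<lambda>n. j (v n)) \<longlonglongrightarrow> x"
      "\<And>z. z \<in> V \<Longrightarrow> (\<lambda>n. b (v n) z) \<longlonglongrightarrow> inner f (j z)" using f(2) unfolding weak_solution_def by blast
    have x: "norm x \<le> 1 / \<kappa>" using weak_solution_bound[OF f(2)] f(1) \<kappa> by (simp add: field_simps)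
    have "\<forall>\<^sub>F n in sequentially. dist (j (v n)) x < min e 1" using e by (intro tendstoD[OF v(3)]) simp
    moreover have "\<forall>\<^sub>F n in sequentially. b (v n) (v n) \<le> inner f (j (v n)) + 1"
      by (rule weak_solution_energy[OF v(1,2)]) (use v(4) in auto)
    ultimately have "\<forall>\<^sub>F n in sequentially. dist (j (v n)) x < e \<and> b (v n) (v n) \<le> r"
    proof eventually_elim
      case (elim n)
      have "norm (j (v n)) \<le> norm x + dist (j (v n)) x"
        by (metis dist_norm norm_triangle_sub)
      then have "norm (j (v n)) \<le> 1 / \<kappa> + 1" using x elim by linarith
      moreover have "inner f (j (v n)) \<le> norm f * norm (j (v n))" by (rule norm_cauchy_schwarz)
      moreover have "norm f * norm (j (v n)) \<le> 1 * norm (j (v n))" using f by (intro mult_right_mono) auto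
      ultimately show ?case using elim by (simp add: r_def)
    qed
    then obtain n where "dist (j (v n)) x < e" "b (v n) (v n) \<le> r" by (auto simp: eventually_sequentially)
    then show ?thesis using v(1)[of n] by (intro bexI[of _ "j (v n)"]) (auto simp: dist_commute)
  qed
  then show "\<exists>T. totally_bounded T \<and> (\<forall>x\<in>solution_operator ` cball 0 1. \<exists>y\<in>T. dist x y < e)"
    using totally_bounded_ball_scale[OF order_refl subspace_V tb r] by (intro exI[of _ "j ` {w\<in>V. b w w \<le> r}"]) auto
qed

end

section \<open>Restriction and products of square-integrable functions\<close>

lemma square_integrable_on_subset:
  assumes f: "square_integrable_on f S" and "T \<subseteq> S" "S \<in> sets lebesgue" "T \<in> sets lebesgue"
  shows "square_integrable_on f T"
proof -
  have m: "f \<in> borel_measurable (lebesgue_on S)" and i: "integrable (lebesgue_on S) (\<lambda>x. (norm (f x))\<^sup>2)"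
    using f by (auto simp: square_integrable_on_def)
  have "f \<in> borel_measurable (lebesgue_on T)" by (rule measurable_restrict_mono[OF m assms(2)])
  moreover have "integrable (lebesgue_on T) (\<lambda>x. (norm (f x))\<^sup>2)"
  proof -
    have "integrable lebesgue (\<lambda>x. indicator S x *\<^sub>R (norm (f x))\<^sup>2)"
      using i assms by (simp add: integrable_restrict_space)
    then have "integrable lebesgue (\<lambda>x. indicator T x *\<^sub>R (indicator S x *\<^sub>R (norm (f x))\<^sup>2))"
      by (rule integrable_mult_indicator[OF assms(4)])
    moreover have "(\<lambda>x. indicator T x *\<^sub>R (indicator S x *\<^sub>R (norm (f x))\<^sup>2)) = (\<lambda>x. indicator T x *\<^sub>R (norm (f x))\<^sup>2)"
      by (rule ext) (use assms in \<open>auto split: split_indicator\<close>)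
    ultimately show ?thesis using assms by (simp add: integrable_restrict_space)
  qed
  ultimately show ?thesis by (simp add: square_integrable_on_def)
qed

text \<open>Extension by zero; it makes local statements on \<open>[0,R]\<close> into statements about elements of \<open>L2\<close>.\<close>

definition trunc :: "real set \<Rightarrow> (real \<Rightarrow> complex) \<Rightarrow> real \<Rightarrow> complex" where
  "trunc S f x = (if x \<in> S then f x else 0)"

lemma square_integrable_on_trunc:
  assumes S: "S \<in> sets lebesgue" "S \<subseteq> {0..}" and f: "square_integrable_on f S"
  shows "square_integrable_on (trunc S f) {0..}"
proof -
  have "trunc S f \<in> borel_measurable lebesgue"
    unfolding trunc_def using f S by (subst borel_measurable_if) (auto simp: square_integrable_on_def)
  then have 1: "trunc S f \<in> borel_measurable halfline" by (rule measurable_restrict_space1)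
  have "integrable lebesgue (\<lambda>x. indicator S x *\<^sub>R (norm (f x))\<^sup>2)"
    using f S by (simp add: square_integrable_on_def integrable_restrict_space)
  moreover have "(\<lambda>x. indicator S x *\<^sub>R (norm (f x))\<^sup>2) = (\<lambda>x. indicator {0..} x *\<^sub>R (norm (trunc S f x))\<^sup>2)"
    by (rule ext) (use S in \<open>auto simp: trunc_def split: split_indicator\<close>)
  ultimately have "integrable halfline (\<lambda>x. (norm (trunc S f x))\<^sup>2)"
    by (simp add: integrable_restrict_space)
  then show ?thesis using 1 by (simp add: square_integrable_on_def)
qed

lemma integrable_trunc_halfline:
  assumes S: "S \<in> sets lebesgue" "S \<subseteq> {0..}"
  shows "integrable halfline (trunc S f) \<longleftrightarrow> integrable (lebesgue_on S) f"
    and "(LINT x|halfline. trunc S f x) = (LINT x|lebesgue_on S. f x)"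
proof -
  have eq: "(\<lambda>x. indicat_real S x *\<^sub>R f x) = (\<lambda>x. indicat_real {0..} x *\<^sub>R (trunc S f x))"
    by (rule ext) (use S in \<open>auto simp: trunc_def split: split_indicator\<close>)
  show "integrable halfline (trunc S f) \<longleftrightarrow> integrable (lebesgue_on S) f"
    using S by (simp add: integrable_restrict_space eq)
  show "(LINT x|halfline. trunc S f x) = (LINT x|lebesgue_on S. f x)"
    using S by (simp add: integral_restrict_space eq)
qed

lemma square_integrable_imp_integrable:
  assumes f: "square_integrable_on f {a..b}"
  shows "integrable (lebesgue_on {a..b}) f"
proof (rule Bochner_Integration.integrable_bound[where f = "\<lambda>x. 1 + (norm (f x))\<^sup>2"])
  show "integrable (lebesgue_on {a..b}) (\<lambda>x. 1 + (norm (f x))\<^sup>2)"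
    using f by (auto simp: square_integrable_on_def)
  show "f \<in> borel_measurable (lebesgue_on {a..b})" using f by (simp add: square_integrable_on_def)
  have "norm (f x) \<le> 1 + (norm (f x))\<^sup>2" for x
  proof -
    have "2 * norm (f x) \<le> 1 + (norm (f x))\<^sup>2" using sum_squares_bound[of 1 "norm (f x)"] by simp
    then show ?thesis using norm_ge_zero[of "f x"] by linarith
  qed
  then show "AE x in lebesgue_on {a..b}. norm (f x) \<le> norm (1 + (norm (f x))\<^sup>2)" by (intro AE_I2) (simp add: abs_of_nonneg add_nonneg_nonneg)
qed

lemma square_integrable_mult_integrable:
  assumes "square_integrable_on f {a..b}" "square_integrable_on g {a..b}"
  shows "integrable (lebesgue_on {a..b}) (\<lambda>x. f x * g x)"
proof -
  have m: "f \<in> borel_measurable (lebesgue_on {a..b})" "g \<in> borel_measurable (lebesgue_on {a..b})"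
    using assms by (auto simp: square_integrable_on_def)
  show ?thesis
  proof (rule Bochner_Integration.integrable_bound[where f = "\<lambda>x. (norm (f x))\<^sup>2 + (norm (g x))\<^sup>2"])
    show "integrable (lebesgue_on {a..b}) (\<lambda>x. (norm (f x))\<^sup>2 + (norm (g x))\<^sup>2)"
      using assms by (auto simp: square_integrable_on_def)
    show "(\<lambda>x. f x * g x) \<in> borel_measurable (lebesgue_on {a..b})" using m by measurable
    have "norm (f x) * norm (g x) \<le> (norm (f x))\<^sup>2 + (norm (g x))\<^sup>2" for x
      using sum_squares_bound[of "norm (f x)" "norm (g x)"]
        mult_nonneg_nonneg[OF norm_ge_zero[of "f x"] norm_ge_zero[of "g x"]] by linarith
    then show "AE x in lebesgue_on {a..b}. norm (f x * g x) \<le> norm ((norm (f x))\<^sup>2 + (norm (g x))\<^sup>2)"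
      by (intro AE_I2) (simp add: norm_mult)
  qed
qed

lemma square_integrable_on_bounded_mult:
  assumes f: "square_integrable_on f S" and g: "g \<in> borel_measurable (lebesgue_on S)"
    and B: "\<And>x. x \<in> S \<Longrightarrow> norm (g x) \<le> B" and S: "S \<in> sets lebesgue"
  shows "square_integrable_on (\<lambda>x. f x * g x) S"
proof -
  have m: "f \<in> borel_measurable (lebesgue_on S)" using f by (simp add: square_integrable_on_def)
  have "integrable (lebesgue_on S) (\<lambda>x. (norm (f x * g x))\<^sup>2)"
  proof (rule Bochner_Integration.integrable_bound[where f = "\<lambda>x. B\<^sup>2 * (norm (f x))\<^sup>2"])
    show "integrable (lebesgue_on S) (\<lambda>x. B\<^sup>2 * (norm (f x))\<^sup>2)" using f by (auto simp: square_integrable_on_def)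
    show "(\<lambda>x. (norm (f x * g x))\<^sup>2) \<in> borel_measurable (lebesgue_on S)" using m g by measurable
    show "AE x in lebesgue_on S. norm ((norm (f x * g x))\<^sup>2) \<le> norm (B\<^sup>2 * (norm (f x))\<^sup>2)"
    proof (rule AE_I2)
      fix x assume "x \<in> space (lebesgue_on S)"
      then have "norm (g x) \<le> B" using B by simp
      then have "(norm (g x))\<^sup>2 \<le> B\<^sup>2" by (intro power_mono) auto
      then have "(norm (f x))\<^sup>2 * (norm (g x))\<^sup>2 \<le> (norm (f x))\<^sup>2 * B\<^sup>2" by (rule mult_left_mono) simp
      then show "norm ((norm (f x * g x))\<^sup>2) \<le> norm (B\<^sup>2 * (norm (f x))\<^sup>2)"
        by (simp add: norm_mult power_mult_distrib mult.commute)
    qed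
  qed
  then show ?thesis using m g by (auto simp: square_integrable_on_def)
qed

lemma square_integrable_on_continuous:
  assumes "continuous_on {a..b} g"
  shows "square_integrable_on g {a..b}"
proof -
  have "continuous_on {a..b} (\<lambda>x. (norm (g x))\<^sup>2)" using assms by (intro continuous_intros)
  then show ?thesis unfolding square_integrable_on_def
    using assms by (auto intro: continuous_imp_integrable_real continuous_imp_measurable_on_sets_lebesgue)
qed

lemma square_integrable_rep_L2_on: "0 \<le> a \<Longrightarrow> square_integrable_on (rep_L2 F) {a..b}"
  by (rule square_integrable_on_subset[OF square_integrable_rep_L2[of F]]) auto

lemma AE_halfline_on:
  assumes "AE x in halfline. P x" "0 \<le> a"
  shows "AE x in lebesgue_on {a..b}. P x"
  using assms by (auto simp: AE_restrict_space_iff elim!: eventually_mono)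

section \<open>Primitives\<close>

lemma indefinite_integral_ae_derivative:
  fixes g :: "real \<Rightarrow> complex"
  assumes g: "\<And>R. integrable (lebesgue_on {0..R}) g"
  shows "AE x in halfline. ((\<lambda>u. c + integral {0..u} g) has_vector_derivative g x) (at x)"
proof -
  define h where "h x = (if x \<in> {0..} then g x else 0)" for x
  have "h integrable_on {a..b}" for a b
  proof -
    have "g integrable_on {0..max 0 b}" using g by (simp add: integrable_on_lebesgue_on)
    then have "(\<lambda>x. if x \<in> {0..max 0 b} then g x else 0) integrable_on {a..b}"
      using integrable_on_subinterval[of "\<lambda>x. if x \<in> {0..max 0 b} then g x else 0" UNIV a b]
      by (simp only: integrable_restrict_UNIV subset_UNIV box_real)
    then show ?thesis by (rule integrable_eq) (auto simp: h_def)
  qed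
  then obtain N where N: "negligible N"
    "\<And>a x. x \<notin> N \<Longrightarrow> a < x \<Longrightarrow> ((\<lambda>u. c + integral {a..u} h) has_vector_derivative h x) (at x)"
    using indefinite_integral_derivative_ae by blast
  have "integral {0..u} h = integral {0..u} g" for u
    by (rule integral_cong) (simp add: h_def)
  then have "((\<lambda>u. c + integral {0..u} g) has_vector_derivative g x) (at x)" if "x \<in> {0..} - (insert 0 N)" for x
    using N(2)[of x 0] that by (simp add: h_def)
  then show ?thesis using N(1) by (subst AE_lebesgue_on_negligible) (auto intro!: exI[of _ "insert 0 N"])
qed

text \<open>The parametrisation \<open>y = prim W\<close>: the function that vanishes at the origin and has derivative \<open>W\<close>. For negative
  arguments the interval of integration is empty and the value is zero.\<close>

definition prim :: "L2 \<Rightarrow> real \<Rightarrow> complex" where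
  "prim W x = integral {0..x} (rep_L2 W)"

lemma prim_neg: "x \<le> 0 \<Longrightarrow> prim W x = 0"
  by (cases "x = 0") (simp_all add: prim_def)

lemma prim_AC: "AC_on 0 R (prim W)"
  using AC_on_indefinite_integral[OF square_integrable_imp_integrable[OF square_integrable_rep_L2_on], of 0 R 0 W]
  by (simp add: prim_def[abs_def])

lemma prim_ae_derivative: "AE x in halfline. (prim W has_vector_derivative rep_L2 W x) (at x)"
proof -
  have "AE x in halfline. ((\<lambda>u. 0 + integral {0..u} (rep_L2 W)) has_vector_derivative rep_L2 W x) (at x)"
    by (intro indefinite_integral_ae_derivative square_integrable_imp_integrable square_integrable_rep_L2_on order_refl)
  then show ?thesis by (simp add: prim_def[abs_def])
qed

lemma prim_abs_L2:
  assumes "square_integrable_on f {0..}"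
  shows "prim (abs_L2 f) x = integral {0..x} f"
proof -
  from AE_halfline_on[OF rep_abs_L2[OF assms], of 0 x]
  obtain N where "negligible N" "\<forall>t\<in>{0..x} - N. rep_L2 (abs_L2 f) t = f t"
    by (auto simp: AE_lebesgue_on_negligible)
  then show ?thesis unfolding prim_def by (intro integral_spike[of N]) auto
qed

text \<open>Evaluation of the primitive at \<open>x\<close> is the inner product with the indicator function of \<open>[0,x]\<close>, hence
  continuous.\<close>

definition chi :: "real \<Rightarrow> L2" where "chi x = abs_L2 (trunc {0..x} (\<lambda>_. 1))"

lemma sq_trunc_1: "square_integrable_on (trunc {0..x} (\<lambda>_. 1)) {0..}"
  by (rule square_integrable_on_trunc) (auto intro: square_integrable_on_continuous)

lemma prim_eq_cinner: "prim W x = cinner W (chi x)"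
proof -
  have "cinner W (chi x) = cinner (abs_L2 (rep_L2 W)) (abs_L2 (trunc {0..x} (\<lambda>_. 1)))" by (simp add: chi_def)
  also have "\<dots> = (LINT t|halfline. rep_L2 W t * cnj (trunc {0..x} (\<lambda>_. 1) t))"
    by (rule cinner_abs_L2[OF square_integrable_rep_L2 sq_trunc_1])
  also have "(\<lambda>t. rep_L2 W t * cnj (trunc {0..x} (\<lambda>_. 1) t)) = trunc {0..x} (rep_L2 W)"
    by (auto simp: trunc_def)
  also have "(LINT t|halfline. trunc {0..x} (rep_L2 W) t) = (LINT t|lebesgue_on {0..x}. rep_L2 W t)"
    by (rule integrable_trunc_halfline) auto
  also have "\<dots> = prim W x" unfolding prim_def
    by (rule lebesgue_integral_eq_integral) (auto intro: square_integrable_imp_integrable square_integrable_rep_L2_on)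
  finally show ?thesis ..
qed

lemma prim_add: "prim (F + G) x = prim F x + prim G x"
  and prim_cscale: "prim (cscale c F) x = c * prim F x"
  and prim_scaleR: "prim (a *\<^sub>R F) x = of_real a * prim F x"
  and prim_diff: "prim (F - G) x = prim F x - prim G x"
  and prim_zero: "prim 0 x = 0"
  by (simp_all add: prim_eq_cinner cinner_add_left cinner_cscale_left cinner_scaleR_left cinner_diff_left)
     (metis cinner_diff_left diff_self)

lemma tendsto_cinner:
  assumes "(f \<longlongrightarrow> F) net" "(g \<longlongrightarrow> G) net"
  shows "((\<lambda>n. cinner (f n) (g n)) \<longlongrightarrow> cinner F G) net"
proof -
  have eq: "cinner u v = of_real (inner u v) + \<i> * of_real (inner u (cscale \<i> v))" for u v
    by (simp add: complex_eq_iff Re_cinner Im_cinner)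
  have "((\<lambda>n. cscale \<i> (g n)) \<longlongrightarrow> cscale \<i> G) net"
    using bounded_linear.tendsto[OF bounded_linear_cscale assms(2)] .
  then show ?thesis unfolding eq by (intro tendsto_intros assms)
qed

lemma tendsto_prim: "(f \<longlongrightarrow> F) net \<Longrightarrow> ((\<lambda>n. prim (f n) x) \<longlongrightarrow> prim F x) net"
  unfolding prim_eq_cinner by (intro tendsto_cinner tendsto_const)

lemma continuous_prim: "continuous_on {0..} (prim W)"
proof -
  have "continuous_on {0..R} (prim W)" for R by (rule AC_on_continuous[OF prim_AC])
  then have "continuous (at x within {0..}) (prim W)" if "x \<ge> 0" for x
  proof -
    have "at x within {0..} = at x within {0..x+1}"
      by (rule at_within_nhd[of _ "{x-1<..<x+1}"]) auto
    then show ?thesis using \<open>continuous_on {0..x+1} (prim W)\<close> that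
      by (simp add: continuous_on_eq_continuous_within)
  qed
  then show ?thesis by (simp add: continuous_on_eq_continuous_within)
qed

lemma measurable_prim: "prim W \<in> borel_measurable halfline"
  by (rule continuous_imp_measurable_on_sets_lebesgue[OF continuous_prim]) auto

lemma eq_zero_if_prim_zero:
  assumes "\<And>x. x \<ge> 0 \<Longrightarrow> prim W x = 0"
  shows "W = 0"
proof -
  have z: "prim W x = 0" for x using assms prim_neg[of x W] by (cases "x \<ge> 0") auto
  have "AE x in halfline. rep_L2 W x = rep_L2 0 x"
    using prim_ae_derivative[of W] rep_L2_zero
  proof eventually_elim
    case (elim x)
    have "prim W = (\<lambda>x. 0)" using z by auto
    then have "(prim W has_vector_derivative 0) (at x)" by simp
    then show ?case using elim vector_derivative_unique_at by metis
  qed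
  then show ?thesis by (simp add: L2_eq_iff)
qed

text \<open>The derivatives of functions in \<open>H\<^sup>1\<close> that vanish at \<open>0\<close> and on \<open>[R,\<infinity>)\<close>.\<close>

definition form_domain :: "real \<Rightarrow> L2 set" where
  "form_domain R = {W. \<forall>x\<ge>R. prim W x = 0}"

lemma form_domain_mono: "R \<le> S \<Longrightarrow> form_domain R \<subseteq> form_domain S"
  by (auto simp: form_domain_def)

lemma subspace_form_domain: "subspace (form_domain R)"
  by (auto simp: subspace_def form_domain_def prim_zero prim_add prim_scaleR)

lemma form_domain_cscale: "W \<in> form_domain R \<Longrightarrow> cscale c W \<in> form_domain R"
  by (simp add: form_domain_def prim_cscale)

lemma form_domain_add: "W \<in> form_domain R \<Longrightarrow> Z \<in> form_domain R \<Longrightarrow> W + Z \<in> form_domain R"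
  by (simp add: form_domain_def prim_add)

lemma form_domain_diff: "W \<in> form_domain R \<Longrightarrow> Z \<in> form_domain R \<Longrightarrow> W - Z \<in> form_domain R"
  by (simp add: form_domain_def prim_diff)

lemma closed_form_domain: "closed (form_domain R)"
  unfolding closed_sequential_limits
proof (intro allI impI, elim conjE)
  fix X W assume X: "\<forall>n. X n \<in> form_domain R" "X \<longlonglongrightarrow> W"
  show "W \<in> form_domain R" unfolding form_domain_def
  proof (intro CollectI allI impI)
    fix x assume x: "x \<ge> R"
    have "(\<lambda>n. prim (X n) x) \<longlonglongrightarrow> prim W x" by (rule tendsto_prim[OF X(2)])
    moreover have "(\<lambda>n. prim (X n) x) = (\<lambda>n. 0)" using X(1) x by (auto simp: form_domain_def)
    ultimately show "prim W x = 0" by (metis LIMSEQ_const_iff)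
  qed
qed

text \<open>A representative that vanishes at every point outside \<open>[0,R]\<close>, and not only almost everywhere.\<close>

lemma form_domainE:
  assumes W: "W \<in> form_domain R"
  obtains w where "square_integrable_on w {0..}" "W = abs_L2 w" "\<And>x. x \<notin> {0..R} \<Longrightarrow> w x = 0"
    "\<And>x. prim W x = integral {0..x} w" "AE x in halfline. (prim W has_vector_derivative w x) (at x)"
proof -
  define w where "w = trunc {0..R} (rep_L2 W)"
  have sq: "square_integrable_on w {0..}" unfolding w_def
    by (rule square_integrable_on_trunc) (auto intro: square_integrable_rep_L2_on)
  have ae: "AE x in halfline. rep_L2 W x = w x"
  proof -
    have nz: "AE x in halfline. x \<noteq> R"
      by (subst AE_lebesgue_on_negligible) (auto intro!: exI[of _ "{R}"])
    show ?thesis using prim_ae_derivative[of W] nz AE_space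
    proof eventually_elim
      case (elim x)
      then have x0: "x \<ge> 0" by simp
      show ?case
      proof (cases "x < R")
        case True then show ?thesis using x0 by (simp add: w_def trunc_def)
      next
        case False
        then have xR: "x > R" using elim by simp
        have "(prim W has_vector_derivative 0) (at x)"
        proof (rule has_vector_derivative_transform_within_open[of "\<lambda>_. 0" 0 x "{R<..}"])
          show "0 = prim W y" if "y \<in> {R<..}" for y using that W by (simp add: form_domain_def)
        qed (use xR in auto)
        then have "rep_L2 W x = 0" using elim(1) vector_derivative_unique_at by metis
        then show ?thesis using xR by (simp add: w_def trunc_def)
      qed
    qed
  qed
  have Weq: "W = abs_L2 w"
    using abs_L2_eq_iff[OF square_integrable_rep_L2 sq, of W] ae by simp
  have "prim W x = integral {0..x} w" for x using prim_abs_L2[OF sq] Weq by metis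
  moreover have "AE x in halfline. (prim W has_vector_derivative w x) (at x)"
    using prim_ae_derivative[of W] ae by eventually_elim simp
  moreover have "w x = 0" if "x \<notin> {0..R}" for x using that by (simp only: w_def trunc_def if_False)
  ultimately show ?thesis by (intro that[of w] sq Weq)
qed

lemma AC_on_subset: "AC_on a b f \<Longrightarrow> a \<le> c \<Longrightarrow> d \<le> b \<Longrightarrow> AC_on c d f"
  unfolding AC_on_def by (meson atLeastatMost_subset_iff order_trans)

lemma AC_on_has_integral_ae:
  assumes F: "AC_on 0 R F" and f: "AE x in halfline. (F has_vector_derivative f x) (at x)"
    and ab: "0 \<le> a" "a \<le> b" "b \<le> R"
  shows "(f has_integral F b - F a) {a..b}"
proof -
  obtain N where N: "negligible N" "\<And>x. x \<in> {0..} - N \<Longrightarrow> (F has_vector_derivative f x) (at x)"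
    using f by (auto simp: AE_lebesgue_on_negligible)
  show ?thesis
    by (rule AC_on_has_integral[OF AC_on_subset[OF F] ab(2) N(1)])
       (use ab N(2) in \<open>auto intro: has_vector_derivative_at_within\<close>)
qed

lemma product_rule_has_integral:
  assumes F: "AC_on 0 R F" "AE x in halfline. (F has_vector_derivative f x) (at x)"
    and G: "AC_on 0 R G" "AE x in halfline. (G has_vector_derivative g x) (at x)"
    and ab: "0 \<le> a" "a \<le> b" "b \<le> R"
  shows "((\<lambda>x. f x * G x + F x * g x) has_integral F b * G b - F a * G a) {a..b}"
proof (rule AC_on_has_integral_ae[OF AC_on_mult[OF F(1) G(1)] _ ab])
  show "AE x in halfline. ((\<lambda>x. F x * G x) has_vector_derivative f x * G x + F x * g x) (at x)"
    using F(2) G(2) by eventually_elim (metis add.commute has_vector_derivative_mult)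
qed

lemma ae_derivative_cnj:
  assumes "AE x in halfline. (F has_vector_derivative f x) (at x)"
  shows "AE x in halfline. ((\<lambda>x. cnj (F x)) has_vector_derivative cnj (f x)) (at x)"
  using assms by eventually_elim (rule has_vector_derivative_cnj)

section \<open>Multiplication of primitives by a potential\<close>

lemma norm_abs_L2:
  assumes "square_integrable_on f {0..}"
  shows "(norm (abs_L2 f))\<^sup>2 = (LINT x|halfline. (norm (f x))\<^sup>2)"
proof -
  have m: "f \<in> borel_measurable halfline" "rep_L2 (abs_L2 f) \<in> borel_measurable halfline"
    using assms square_integrable_rep_L2 by (auto simp: square_integrable_on_def)
  show ?thesis unfolding norm_L2_rep
  proof (rule integral_cong_AE)
    show "AE x in halfline. (norm (rep_L2 (abs_L2 f) x))\<^sup>2 = (norm (f x))\<^sup>2"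
      using rep_abs_L2[OF assms] by eventually_elim simp
  qed (use m in measurable)
qed

lemma norm_abs_L2_mono:
  assumes f: "square_integrable_on f {0..}" and g: "square_integrable_on g {0..}"
    and le: "\<And>x. x \<ge> 0 \<Longrightarrow> norm (f x) \<le> c * norm (g x)" and c: "c \<ge> 0"
  shows "norm (abs_L2 f) \<le> c * norm (abs_L2 g)"
proof -
  have "(norm (abs_L2 f))\<^sup>2 \<le> (LINT x|halfline. c\<^sup>2 * (norm (g x))\<^sup>2)"
    unfolding norm_abs_L2[OF f]
  proof (rule integral_mono)
    fix x assume "x \<in> space halfline"
    then have "norm (f x) \<le> c * norm (g x)" using le by simp
    then have "(norm (f x))\<^sup>2 \<le> (c * norm (g x))\<^sup>2" by (intro power_mono) auto
    then show "(norm (f x))\<^sup>2 \<le> c\<^sup>2 * (norm (g x))\<^sup>2" by (simp add: power_mult_distrib)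
  qed (use f g in \<open>auto simp: square_integrable_on_def\<close>)
  also have "\<dots> = (c * norm (abs_L2 g))\<^sup>2" by (simp add: norm_abs_L2[OF g] power_mult_distrib)
  finally show ?thesis by (rule power2_le_imp_le) (use c in auto)
qed

lemma cinner_has_integral:
  assumes f: "square_integrable_on f {0..}" and g: "square_integrable_on g {0..}"
    and z: "\<And>x. x > b \<Longrightarrow> f x * cnj (g x) = 0"
  shows "((\<lambda>x. f x * cnj (g x)) has_integral cinner (abs_L2 f) (abs_L2 g)) {0..b}"
proof -
  have eq: "f x * cnj (g x) = trunc {0..b} (\<lambda>x. f x * cnj (g x)) x" if "x \<in> space halfline" for x
    using z[of x] that by (auto simp: trunc_def)
  have i: "integrable halfline (\<lambda>x. f x * cnj (g x))"
    by (rule square_integrable_on_integrable_mult_cnj[OF f g])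
  have "integrable halfline (\<lambda>x. f x * cnj (g x)) \<longleftrightarrow> integrable halfline (trunc {0..b} (\<lambda>x. f x * cnj (g x)))"
    by (rule Bochner_Integration.integrable_cong[OF refl eq])
  with i have "integrable halfline (trunc {0..b} (\<lambda>x. f x * cnj (g x)))" by simp
  then have ib: "integrable (lebesgue_on {0..b}) (\<lambda>x. f x * cnj (g x))"
    by (subst (asm) integrable_trunc_halfline) auto
  have "cinner (abs_L2 f) (abs_L2 g) = (LINT x|halfline. trunc {0..b} (\<lambda>x. f x * cnj (g x)) x)"
    unfolding cinner_abs_L2[OF f g] by (rule Bochner_Integration.integral_cong[OF refl eq])
  also have "\<dots> = (LINT x|lebesgue_on {0..b}. f x * cnj (g x))"
    by (rule integrable_trunc_halfline) auto
  finally show ?thesis using has_integral_integral_lebesgue_on[OF ib] by simp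
qed

text \<open>The product \<open>r y\<close> for \<open>y = prim W\<close>, as an element of \<open>L\<^sub>2\<close>. With \<open>r = 1\<close> this is the function \<open>y\<close> itself. It is only
  meaningful if \<open>y\<close> has compact support, since \<open>r\<close> is only locally square-integrable.\<close>

definition times_prim :: "(real \<Rightarrow> complex) \<Rightarrow> L2 \<Rightarrow> L2" where
  "times_prim r W = abs_L2 (\<lambda>x. r x * prim W x)"

abbreviation prim_L2 :: "L2 \<Rightarrow> L2" where "prim_L2 W \<equiv> times_prim (\<lambda>_. 1) W"

lemma L2_locD: "r \<in> L2_loc \<Longrightarrow> R \<ge> 0 \<Longrightarrow> square_integrable_on r {0..R}"
  by (simp add: L2_loc_def)

lemma L2_loc_one: "(\<lambda>_. 1) \<in> L2_loc"
  by (auto simp: L2_loc_def intro: square_integrable_on_continuous)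

lemma L2_loc_cnj: "r \<in> L2_loc \<Longrightarrow> (\<lambda>x. cnj (r x)) \<in> L2_loc"
proof -
  assume r: "r \<in> L2_loc"
  have "(\<lambda>x. cnj (r x)) \<in> borel_measurable (lebesgue_on {0..R})" if "R \<ge> 0" for R
    using r that by (intro borel_measurable_continuous_on[where f = cnj])
      (auto intro!: continuous_intros simp: L2_loc_def square_integrable_on_def)
  then show ?thesis using r by (auto simp: L2_loc_def square_integrable_on_def)
qed

lemma L2_loc_add: "r \<in> L2_loc \<Longrightarrow> s \<in> L2_loc \<Longrightarrow> (\<lambda>x. r x + s x) \<in> L2_loc"
  by (auto simp: L2_loc_def intro: square_integrable_on_add)

lemma L2_loc_cmult: "r \<in> L2_loc \<Longrightarrow> (\<lambda>x. c * r x) \<in> L2_loc"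
  by (auto simp: L2_loc_def intro: square_integrable_on_cmult)

lemma sq_trunc_loc: "r \<in> L2_loc \<Longrightarrow> R \<ge> 0 \<Longrightarrow> square_integrable_on (trunc {0..R} r) {0..}"
  by (rule square_integrable_on_trunc) (auto simp: L2_loc_def)

lemma times_prim_trunc:
  assumes "W \<in> form_domain R"
  shows "r x * prim W x = trunc {0..R} r x * prim W x"
  using assms prim_neg[of x W] by (auto simp: trunc_def form_domain_def)

lemma bounded_prim: "\<exists>B. \<forall>x\<in>{0..R}. norm (prim W x) \<le> B"
proof -
  have "compact (prim W ` {0..R})" using AC_on_continuous[OF prim_AC] by (auto intro: compact_continuous_image)
  then have "bounded (prim W ` {0..R})" by (rule compact_imp_bounded)
  then obtain B where "\<forall>y\<in>prim W ` {0..R}. norm y \<le> B" unfolding bounded_iff by (elim exE)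
  then show ?thesis by (intro exI[of _ B]) simp
qed

lemma bounded_prim_form_domain:
  assumes "W \<in> form_domain R" shows "\<exists>B\<ge>0. \<forall>x. norm (prim W x) \<le> B"
proof -
  obtain B where B: "\<forall>x\<in>{0..R}. norm (prim W x) \<le> B" using bounded_prim by blast
  have "norm (prim W x) \<le> max B 0" for x
    using B assms prim_neg[of x W] by (cases "x \<in> {0..R}") (auto simp: form_domain_def le_max_iff_disj)
  then show ?thesis by (intro exI[of _ "max B 0"]) auto
qed

lemma sq_times_prim:
  assumes r: "r \<in> L2_loc" and R: "R \<ge> 0" and W: "W \<in> form_domain R"
  shows "square_integrable_on (\<lambda>x. r x * prim W x) {0..}"
proof -
  obtain B where B: "\<And>x. norm (prim W x) \<le> B" using bounded_prim_form_domain[OF W] by blast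
  show ?thesis unfolding times_prim_trunc[OF W, of r]
    by (rule square_integrable_on_bounded_mult[OF sq_trunc_loc[OF r R] measurable_prim B]) auto
qed

lemma sq_prim: "R \<ge> 0 \<Longrightarrow> W \<in> form_domain R \<Longrightarrow> square_integrable_on (prim W) {0..}"
  using sq_times_prim[OF L2_loc_one, of R W] by simp

lemma prim_L2_eq: "prim_L2 W = abs_L2 (prim W)"
  by (simp add: times_prim_def)

definition loc_norm :: "(real \<Rightarrow> complex) \<Rightarrow> real \<Rightarrow> real" where
  "loc_norm r R = norm (abs_L2 (trunc {0..R} r))"

lemma loc_norm_nonneg [simp]: "0 \<le> loc_norm r R" by (simp add: loc_norm_def)

lemma norm_times_prim_le:
  assumes r: "r \<in> L2_loc" and R: "R \<ge> 0" and W: "W \<in> form_domain R"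
    and B: "\<And>x. norm (prim W x) \<le> B"
  shows "norm (times_prim r W) \<le> B * loc_norm r R"
  unfolding times_prim_def loc_norm_def
proof (rule norm_abs_L2_mono[OF sq_times_prim[OF r R W] sq_trunc_loc[OF r R]])
  show "0 \<le> B" using B[of 0] norm_ge_zero order_trans by blast
  show "norm (r x * prim W x) \<le> B * norm (trunc {0..R} r x)" for x
    unfolding times_prim_trunc[OF W, of r] norm_mult using B[of x]
    by (subst mult.commute) (intro mult_right_mono, auto)
qed

lemma times_prim_add:
  assumes r: "r \<in> L2_loc" and R: "R \<ge> 0" and "W \<in> form_domain R" "Z \<in> form_domain R"
  shows "times_prim r (W + Z) = times_prim r W + times_prim r Z"
  unfolding times_prim_def using abs_L2_add[OF sq_times_prim[OF r R assms(3)] sq_times_prim[OF r R assms(4)]]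
  by (simp add: prim_add distrib_left)

lemma times_prim_cscale:
  assumes r: "r \<in> L2_loc" and R: "R \<ge> 0" and "W \<in> form_domain R"
  shows "times_prim r (cscale c W) = cscale c (times_prim r W)"
  unfolding times_prim_def using abs_L2_cscale[OF sq_times_prim[OF r R assms(3)], of c]
  by (simp add: prim_cscale mult.left_commute)

lemma times_prim_cscale_coeff:
  assumes r: "r \<in> L2_loc" and R: "R \<ge> 0" and "W \<in> form_domain R"
  shows "times_prim (\<lambda>x. c * r x) W = cscale c (times_prim r W)"
  unfolding times_prim_def using abs_L2_cscale[OF sq_times_prim[OF r R assms(3)], of c]
  by (simp add: mult.assoc)

lemma times_prim_add_coeff:
  assumes r: "r \<in> L2_loc" and s: "s \<in> L2_loc" and R: "R \<ge> 0" and "W \<in> form_domain R"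
  shows "times_prim (\<lambda>x. r x + s x) W = times_prim r W + times_prim s W"
  unfolding times_prim_def using abs_L2_add[OF sq_times_prim[OF r R assms(4)] sq_times_prim[OF s R assms(4)]]
  by (simp add: distrib_right)

text \<open>\<open>\<bar>y(x)\<bar>\<^sup>2\<close> is the integral of \<open>2 Re (y' cnj y)\<close> over \<open>[0,x]\<close>. The bound does not involve \<open>R\<close>.\<close>

lemma prim_sup_bound:
  assumes R: "R \<ge> 0" and W: "W \<in> form_domain R"
  shows "(norm (prim W x))\<^sup>2 \<le> 2 * norm (prim_L2 W) * norm W"
proof (cases "x > 0")
  case False
  then show ?thesis using prim_neg[of x W] by simp
next
  case True
  obtain w where w: "square_integrable_on w {0..}" "W = abs_L2 w" "\<And>x. x \<notin> {0..R} \<Longrightarrow> w x = 0"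
    "\<And>x. prim W x = integral {0..x} w" "AE x in halfline. (prim W has_vector_derivative w x) (at x)"
    by (rule form_domainE[OF W], rule that)
  define A where "A = abs_L2 (trunc {0..x} w)"
  have st: "square_integrable_on (trunc {0..x} w) {0..}"
    by (rule square_integrable_on_trunc) (auto intro: square_integrable_on_subset[OF w(1)])
  have nA: "norm A \<le> norm W" unfolding A_def w(2)
    using norm_abs_L2_mono[OF st w(1), of 1] by (simp add: trunc_def)
  have "((\<lambda>t. trunc {0..x} w t * cnj (prim W t)) has_integral cinner A (prim_L2 W)) {0..x}"
    unfolding A_def prim_L2_eq by (rule cinner_has_integral[OF st sq_prim[OF R W]]) (simp add: trunc_def)
  then have h: "((\<lambda>t. w t * cnj (prim W t)) has_integral cinner A (prim_L2 W)) {0..x}"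
    by (rule has_integral_eq[rotated]) (simp add: trunc_def)
  then have hc: "((\<lambda>t. cnj (w t * cnj (prim W t))) has_integral cnj (cinner A (prim_L2 W))) {0..x}"
    using has_integral_linear[OF h bounded_linear_cnj] by (simp only: o_def)
  have s1: "((\<lambda>t. w t * cnj (prim W t) + cnj (w t * cnj (prim W t))) has_integral (cinner A (prim_L2 W) + cnj (cinner A (prim_L2 W)))) {0..x}"
    by (rule has_integral_add[OF h hc])
  have s2: "((\<lambda>t. w t * cnj (prim W t) + prim W t * cnj (w t)) has_integral prim W x * cnj (prim W x) - prim W 0 * cnj (prim W 0)) {0..x}"
    using True by (intro product_rule_has_integral[of x] prim_AC AC_on_cnj w(5) ae_derivative_cnj) auto
  have "((\<lambda>t. w t * cnj (prim W t) + cnj (w t * cnj (prim W t))) has_integral prim W x * cnj (prim W x) - prim W 0 * cnj (prim W 0)) {0..x}"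
    by (rule has_integral_eq[OF _ s2]) simp
  from has_integral_unique[OF s1 this]
  have "cinner A (prim_L2 W) + cnj (cinner A (prim_L2 W)) = prim W x * cnj (prim W x) - prim W 0 * cnj (prim W 0)" .
  then have "prim W x * cnj (prim W x) = cinner A (prim_L2 W) + cnj (cinner A (prim_L2 W))"
    by (simp only: prim_neg[OF order_refl] mult_zero_left diff_zero)
  then have "(norm (prim W x))\<^sup>2 = norm (cinner A (prim_L2 W) + cnj (cinner A (prim_L2 W)))"
    by (simp add: norm_mult power2_eq_square flip: \<open>prim W x * cnj (prim W x) = _\<close>)
  also have "\<dots> \<le> 2 * norm (cinner A (prim_L2 W))"
    using norm_triangle_ineq[of "cinner A (prim_L2 W)" "cnj (cinner A (prim_L2 W))"] by simp
  also have "\<dots> \<le> 2 * (norm A * norm (prim_L2 W))" by (intro mult_left_mono norm_cinner_le) auto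
  also have "\<dots> \<le> 2 * (norm W * norm (prim_L2 W))" using nA by (intro mult_left_mono mult_right_mono) auto
  finally show ?thesis by (simp add: mult_ac)
qed

lemma prim_sup_bound_sqrt:
  assumes "R \<ge> 0" "W \<in> form_domain R"
  shows "norm (prim W x) \<le> sqrt (2 * norm (prim_L2 W) * norm W)"
  using real_sqrt_le_mono[OF prim_sup_bound[OF assms, of x]] by simp

lemma prim_L2_eq_zero: "R \<ge> 0 \<Longrightarrow> W \<in> form_domain R \<Longrightarrow> prim_L2 W = 0 \<Longrightarrow> W = 0"
  using prim_sup_bound[of R W] by (intro eq_zero_if_prim_zero) auto

lemma norm_prim_le: "x \<le> R \<Longrightarrow> R \<ge> 0 \<Longrightarrow> norm (prim W x) \<le> sqrt R * norm W"
proof -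
  assume x: "x \<le> R" "R \<ge> 0"
  have "(norm (chi x))\<^sup>2 \<le> R"
  proof -
    have "(norm (chi x))\<^sup>2 = (LINT t|halfline. trunc {0..x} (\<lambda>_. 1) t * cnj (trunc {0..x} (\<lambda>_. 1) t))"
      using cinner_self[of "chi x"] cinner_abs_L2[OF sq_trunc_1 sq_trunc_1, of x x] by (simp add: chi_def)
    also have "(\<lambda>t. trunc {0..x} (\<lambda>_. 1) t * cnj (trunc {0..x} (\<lambda>_. 1) t)) = trunc {0..x} (\<lambda>_. 1)"
      by (auto simp: trunc_def)
    also have "(LINT t|halfline. trunc {0..x} (\<lambda>_. 1) t) = (LINT t|lebesgue_on {0..x}. (1::complex))"
      by (rule integrable_trunc_halfline) auto
    also have "\<dots> = of_real (max 0 x)" by (auto simp: measure_restrict_space scaleR_conv_of_real)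
    finally have "(norm (chi x))\<^sup>2 = max 0 x" using of_real_eq_iff by blast
    then show ?thesis using x by simp
  qed
  then have "norm (chi x) \<le> sqrt R" by (simp add: real_le_rsqrt)
  then show ?thesis unfolding prim_eq_cinner
    using norm_cinner_le[of W "chi x"] mult_left_mono[of "norm (chi x)" "sqrt R" "norm W"]
    by (simp add: mult.commute)
qed

lemma norm_times_prim_le_norm:
  assumes r: "r \<in> L2_loc" and R: "R \<ge> 0" and W: "W \<in> form_domain R"
  shows "norm (times_prim r W) \<le> sqrt R * norm W * loc_norm r R"
proof (rule norm_times_prim_le[OF r R W])
  show "norm (prim W x) \<le> sqrt R * norm W" for x
    using norm_prim_le[of x R W] R W by (cases "x \<le> R") (auto simp: form_domain_def)
qed

section \<open>The form of the operator\<close>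

text \<open>\<open>\<integral>(y' cnj z' - r y' cnj z - r y cnj z')\<close>, the form of \<open>- y'' + r' y\<close> after integration by parts in the
  potential term.\<close>

definition form :: "(real \<Rightarrow> complex) \<Rightarrow> L2 \<Rightarrow> L2 \<Rightarrow> complex" where
  "form r W Z = cinner W Z - cinner W (times_prim (\<lambda>x. cnj (r x)) Z) - cinner (times_prim r W) Z"

lemma form_has_integral:
  assumes r: "r \<in> L2_loc" and R: "R \<ge> 0" and W: "W \<in> form_domain R" and Z: "Z \<in> form_domain R"
    and w: "square_integrable_on w {0..}" "W = abs_L2 w" "\<And>x. x \<notin> {0..R} \<Longrightarrow> w x = 0"
    and z: "square_integrable_on z {0..}" "Z = abs_L2 z" "\<And>x. x \<notin> {0..R} \<Longrightarrow> z x = 0"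
  shows "((\<lambda>x. w x * cnj (z x) - w x * cnj (cnj (r x) * prim Z x) - r x * prim W x * cnj (z x)) has_integral form r W Z) {0..R}"
proof -
  have rc: "(\<lambda>x. cnj (r x)) \<in> L2_loc" by (rule L2_loc_cnj[OF r])
  have "((\<lambda>x. w x * cnj (z x)) has_integral cinner (abs_L2 w) (abs_L2 z)) {0..R}"
    by (rule cinner_has_integral[OF w(1) z(1)]) (simp add: w(3))
  then have 1: "((\<lambda>x. w x * cnj (z x)) has_integral cinner W Z) {0..R}"
    by (simp only: w(2)[symmetric] z(2)[symmetric])
  have "((\<lambda>x. w x * cnj (cnj (r x) * prim Z x)) has_integral cinner (abs_L2 w) (times_prim (\<lambda>x. cnj (r x)) Z)) {0..R}"
    unfolding times_prim_def by (rule cinner_has_integral[OF w(1) sq_times_prim[OF rc R Z]]) (simp add: w(3))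
  then have 2: "((\<lambda>x. w x * cnj (cnj (r x) * prim Z x)) has_integral cinner W (times_prim (\<lambda>x. cnj (r x)) Z)) {0..R}"
    by (simp only: w(2)[symmetric])
  have "((\<lambda>x. r x * prim W x * cnj (z x)) has_integral cinner (times_prim r W) (abs_L2 z)) {0..R}"
    unfolding times_prim_def by (rule cinner_has_integral[OF sq_times_prim[OF r R W] z(1)]) (simp add: z(3))
  then have 3: "((\<lambda>x. r x * prim W x * cnj (z x)) has_integral cinner (times_prim r W) Z) {0..R}"
    by (simp only: z(2)[symmetric])
  show ?thesis unfolding form_def by (intro has_integral_diff 1 2 3)
qed

lemma times_prim_scaleR:
  assumes "r \<in> L2_loc" "R \<ge> 0" "W \<in> form_domain R"
  shows "times_prim r (a *\<^sub>R W) = a *\<^sub>R times_prim r W"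
  using times_prim_cscale[OF assms, of "of_real a"] by (simp add: scaleR_cscale)

lemma form_domain_scaleR: "W \<in> form_domain R \<Longrightarrow> a *\<^sub>R W \<in> form_domain R"
  by (simp add: form_domain_cscale scaleR_cscale)

context
  fixes r :: "real \<Rightarrow> complex" and R :: real
  assumes r: "r \<in> L2_loc" and R: "R \<ge> 0"
begin

lemma form_add_left:
  "W \<in> form_domain R \<Longrightarrow> W' \<in> form_domain R \<Longrightarrow> Z \<in> form_domain R \<Longrightarrow> form r (W + W') Z = form r W Z + form r W' Z"
  by (simp add: form_def cinner_add_left times_prim_add[OF r R])

lemma form_add_right:
  "W \<in> form_domain R \<Longrightarrow> W' \<in> form_domain R \<Longrightarrow> Z \<in> form_domain R \<Longrightarrow> form r Z (W + W') = form r Z W + form r Z W'"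
  by (simp add: form_def cinner_add_right times_prim_add[OF L2_loc_cnj[OF r] R])

lemma form_cscale_left:
  "W \<in> form_domain R \<Longrightarrow> form r (cscale c W) Z = c * form r W Z"
  by (simp add: form_def cinner_cscale_left times_prim_cscale[OF r R] algebra_simps)

lemma form_cscale_right:
  "Z \<in> form_domain R \<Longrightarrow> form r W (cscale c Z) = cnj c * form r W Z"
  by (simp add: form_def cinner_cscale_right times_prim_cscale[OF L2_loc_cnj[OF r] R] algebra_simps)

lemma form_scaleR_left: "W \<in> form_domain R \<Longrightarrow> form r (a *\<^sub>R W) Z = of_real a * form r W Z"
  by (simp add: scaleR_cscale form_cscale_left)

lemma form_scaleR_right: "Z \<in> form_domain R \<Longrightarrow> form r W (a *\<^sub>R Z) = of_real a * form r W Z"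
  by (simp add: scaleR_cscale form_cscale_right)

lemma form_bounded:
  assumes W: "W \<in> form_domain R" and Z: "Z \<in> form_domain R"
  shows "norm (form r W Z) \<le> (1 + sqrt R * (loc_norm r R + loc_norm (\<lambda>x. cnj (r x)) R)) * norm W * norm Z"
proof -
  let ?rc = "\<lambda>x. cnj (r x)"
  have "norm (form r W Z) \<le> norm (cinner W Z) + norm (cinner W (times_prim ?rc Z)) + norm (cinner (times_prim r W) Z)"
    unfolding form_def using norm_triangle_ineq4[of "cinner W Z - cinner W (times_prim ?rc Z)" "cinner (times_prim r W) Z"]
      norm_triangle_ineq4[of "cinner W Z" "cinner W (times_prim ?rc Z)"] by linarith
  also have "\<dots> \<le> norm W * norm Z + norm W * (sqrt R * norm Z * loc_norm ?rc R) + (sqrt R * norm W * loc_norm r R) * norm Z"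
    using norm_times_prim_le_norm[OF r R W] norm_times_prim_le_norm[OF L2_loc_cnj[OF r] R Z]
    by (intro add_mono order_trans[OF norm_cinner_le] mult_left_mono mult_right_mono) auto
  finally show ?thesis by (simp add: algebra_simps)
qed

text \<open>On a bounded interval the potential contributes less than a full power of \<open>\<bar>\<bar>y'\<bar>\<bar>\<^sup>2\<close>, by the supremum bound.\<close>

lemma form_perturbation:
  assumes W: "W \<in> form_domain R"
  shows "norm (form r W W - of_real ((norm W)\<^sup>2)) \<le>
    (loc_norm r R + loc_norm (\<lambda>x. cnj (r x)) R) * norm W * sqrt (2 * norm (prim_L2 W) * norm W)"
proof -
  let ?rc = "\<lambda>x. cnj (r x)" and ?B = "sqrt (2 * norm (prim_L2 W) * norm W)"
  have "form r W W - of_real ((norm W)\<^sup>2) = - (cinner W (times_prim ?rc W) + cinner (times_prim r W) W)"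
    by (simp add: form_def cinner_self)
  then have "norm (form r W W - of_real ((norm W)\<^sup>2)) \<le> norm (cinner W (times_prim ?rc W)) + norm (cinner (times_prim r W) W)"
    by (metis norm_minus_cancel norm_triangle_ineq)
  also have "\<dots> \<le> norm W * (?B * loc_norm ?rc R) + (?B * loc_norm r R) * norm W"
    by (intro add_mono order_trans[OF norm_cinner_le] mult_left_mono mult_right_mono
        norm_times_prim_le[OF r R W] norm_times_prim_le[OF L2_loc_cnj[OF r] R W] prim_sup_bound_sqrt[OF R W]) auto
  finally show ?thesis by (simp add: algebra_simps)
qed

text \<open>Two applications of Young's inequality to the preceding estimate. The constant \<open>L\<close> depends on \<open>R\<close>;
  bounds for all \<open>R\<close> at once will come from the sector condition.\<close>

lemma garding:
  assumes \<omega>: "Re \<omega> > 0" "norm \<omega> \<le> 1"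
  shows "\<exists>L\<ge>0. \<forall>W\<in>form_domain R. Re \<omega> / 2 * (norm W)\<^sup>2 \<le> Re (\<omega> * form r W W) + L * (norm (prim_L2 W))\<^sup>2"
proof -
  define k where "k = Re \<omega>"
  define c where "c = loc_norm r R + loc_norm (\<lambda>x. cnj (r x)) R"
  define L where "L = (2 * c\<^sup>2 / k)\<^sup>2 / k"
  have k: "k > 0" using \<omega> by (simp add: k_def)
  have c: "c \<ge> 0" by (simp add: c_def)
  have "k / 2 * (norm W)\<^sup>2 \<le> Re (\<omega> * form r W W) + L * (norm (prim_L2 W))\<^sup>2" if W: "W \<in> form_domain R" for W
  proof -
    define a where "a = norm W"
    define t where "t = norm (prim_L2 W)"
    have at: "a \<ge> 0" "t \<ge> 0" by (auto simp: a_def t_def)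
    define D where "D = form r W W - of_real (a\<^sup>2)"
    have D: "norm D \<le> c * a * sqrt (2 * t * a)"
      using form_perturbation[OF W] by (simp add: D_def a_def t_def c_def)
    have y1: "c * a * sqrt (2 * t * a) \<le> k / 4 * a\<^sup>2 + c\<^sup>2 / k * (2 * t * a)"
    proof -
      define s where "s = sqrt (2 * t * a)"
      have s: "s\<^sup>2 = 2 * t * a" using at by (simp add: s_def)
      have "0 \<le> (k / 2 * a - c * s)\<^sup>2" by simp
      then have "k * (c * a * s) \<le> k\<^sup>2 / 4 * a\<^sup>2 + c\<^sup>2 * s\<^sup>2" by (simp add: power2_eq_square algebra_simps)
      then have "c * a * s \<le> (k\<^sup>2 / 4 * a\<^sup>2 + c\<^sup>2 * s\<^sup>2) / k" using k by (simp add: pos_le_divide_eq mult.commute)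
      also have "\<dots> = k / 4 * a\<^sup>2 + c\<^sup>2 / k * s\<^sup>2" using k by (simp add: field_simps power2_eq_square)
      finally show ?thesis by (simp add: s s_def[symmetric])
    qed
    have y2: "c\<^sup>2 / k * (2 * t * a) \<le> k / 4 * a\<^sup>2 + L * t\<^sup>2"
    proof -
      define m where "m = 2 * c\<^sup>2 / k"
      have "0 \<le> (k / 2 * a - m * t)\<^sup>2" by simp
      then have "k * (m * t * a) \<le> k\<^sup>2 / 4 * a\<^sup>2 + m\<^sup>2 * t\<^sup>2" by (simp add: power2_eq_square algebra_simps)
      then have "m * t * a \<le> (k\<^sup>2 / 4 * a\<^sup>2 + m\<^sup>2 * t\<^sup>2) / k" using k by (simp add: pos_le_divide_eq mult.commute)
      also have "\<dots> = k / 4 * a\<^sup>2 + L * t\<^sup>2" using k by (simp add: field_simps power2_eq_square L_def m_def)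
      finally show ?thesis by (simp add: m_def)
    qed
    have "Re (\<omega> * form r W W) = k * a\<^sup>2 + Re (\<omega> * D)" by (simp add: D_def k_def algebra_simps)
    moreover have "\<bar>Re (\<omega> * D)\<bar> \<le> norm D"
      using abs_Re_le_cmod[of "\<omega> * D"] mult_right_mono[OF \<omega>(2), of "norm D"] by (simp add: norm_mult)
    ultimately show ?thesis using D y1 y2 by (simp add: a_def[symmetric] t_def[symmetric] abs_le_iff)
  qed
  then show ?thesis using k by (intro exI[of _ L]) (auto simp: L_def k_def)
qed

end

text \<open>The rotation \<open>\<omega>\<close> turns the cone that contains the form values into one around the positive axis, and the
  shift \<open>\<mu>\<close> makes the real part positive.\<close>

definition real_form :: "complex \<Rightarrow> real \<Rightarrow> (real \<Rightarrow> complex) \<Rightarrow> L2 \<Rightarrow> L2 \<Rightarrow> real" where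
  "real_form \<omega> \<mu> r W Z = Re (\<omega> * form r W Z) + \<mu> * inner (prim_L2 W) (prim_L2 Z)"

section \<open>The minimal operator\<close>

lemma AC_locD: "y \<in> AC_loc \<Longrightarrow> AC_on 0 R y" if "R \<ge> 0"
  using that by (simp add: AC_loc_def)

text \<open>Elements of the operator satisfy the variational equation. The derivative \<open>y' = u + r y\<close> of \<open>y\<close> is square-integrable
  because \<open>u\<close> and \<open>y\<close> are bounded on the support of \<open>y\<close>, and \<open>u' cnj z + u cnj z'\<close> integrates to zero.\<close>

lemma minimal_operatorE:
  assumes r: "r \<in> L2_loc" and fg: "(f, g) \<in> minimal_operator r"
  obtains R W where "R \<ge> 0" "W \<in> form_domain R" "f = prim_L2 W"
    "\<And>S Z. S \<ge> 0 \<Longrightarrow> Z \<in> form_domain S \<Longrightarrow> form r W Z = cinner g (prim_L2 Z)"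
proof -
  obtain y u l R0 where f: "f = abs_L2 y" and g: "g = abs_L2 l" and sqy: "square_integrable_on y {0..}"
    and y: "y \<in> AC_loc" and u: "u \<in> AC_loc" and qd: "is_quasi_derivative r y u"
    and qe: "is_quasi_expression r y u l" and sql: "square_integrable_on l {0..}"
    and y0: "y 0 = 0" and u0: "u 0 = 0" and supp: "\<And>x. x > R0 \<Longrightarrow> 0 \<le> x \<Longrightarrow> y x = 0"
    using fg unfolding minimal_operator_def by blast
  define R where "R = max R0 0"
  have R: "R \<ge> 0" by (simp add: R_def)
  have suppR: "y x = 0" if "x > R" for x using supp[of x] that by (simp add: R_def)
  have ACy: "AC_on 0 b y" and ACu: "AC_on 0 b u" if "b \<ge> 0" for b
    using AC_locD[OF that y] AC_locD[OF that u] .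
  obtain y' where y': "AE x in halfline. (y has_vector_derivative y' x) (at x)"
    and uy': "AE x in halfline. u x = y' x - r x * y x"
    using qd unfolding is_quasi_derivative_def is_ae_derivative_def by blast
  obtain u' where u': "AE x in halfline. (u has_vector_derivative u' x) (at x)"
    and lu': "AE x in halfline. l x = - u' x - r x * u x - (r x)\<^sup>2 * y x"
    using qe unfolding is_quasi_expression_def is_ae_derivative_def by blast
  define w where "w = trunc {0..R} (\<lambda>x. u x + r x * y x)"
  have sqw: "square_integrable_on w {0..}" unfolding w_def
  proof (rule square_integrable_on_trunc)
    have cy: "continuous_on {0..R} y" and cu: "continuous_on {0..R} u"
      using AC_on_continuous[OF ACy[OF R]] AC_on_continuous[OF ACu[OF R]] .
    have "bounded (y ` {0..R})" by (intro compact_imp_bounded compact_continuous_image cy) simp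
    then obtain B where B: "\<forall>z\<in>y ` {0..R}. norm z \<le> B" unfolding bounded_iff by (elim exE)
    have "square_integrable_on (\<lambda>x. r x * y x) {0..R}"
      by (rule square_integrable_on_bounded_mult[OF L2_locD[OF r R], of y B])
        (use B cy in \<open>auto intro: continuous_imp_measurable_on_sets_lebesgue\<close>)
    then show "square_integrable_on (\<lambda>x. u x + r x * y x) {0..R}"
      by (rule square_integrable_on_add[OF square_integrable_on_continuous[OF cu]])
  qed auto
  have nR: "AE x in halfline. x \<noteq> R"
    by (subst AE_lebesgue_on_negligible) (auto intro!: exI[of _ "{R}"])
  have wy': "AE x in halfline. y' x = w x"
    using y' uy' nR AE_space
  proof eventually_elim
    case (elim x)
    show ?case
    proof (cases "x < R")
      case True then show ?thesis using elim by (simp add: w_def trunc_def)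
    next
      case False
      then have xR: "x > R" using elim by simp
      have "(y has_vector_derivative 0) (at x)"
      proof (rule has_vector_derivative_transform_within_open[of "\<lambda>_. 0" 0 x "{R<..}"])
        show "0 = y t" if "t \<in> {R<..}" for t using that suppR by simp
      qed (use xR in auto)
      then have "y' x = 0" using elim(1) vector_derivative_unique_at by metis
      then show ?thesis using xR by (simp add: w_def trunc_def)
    qed
  qed
  have yw: "AE x in halfline. (y has_vector_derivative w x) (at x)"
    using y' wy' by eventually_elim simp
  define W where "W = abs_L2 w"
  have pW: "prim W x = y x" if x: "x \<ge> 0" for x
  proof -
    have "(w has_integral y x - y 0) {0..x}"
      using AC_on_has_integral_ae[OF ACy[OF x] yw, of 0 x] x by simp
    then show ?thesis using prim_abs_L2[OF sqw, of x] y0 by (simp add: W_def integral_unique)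
  qed
  \<comment> \<open>the function vanishes for arguments greater than \<open>R\<close>, whereas the form domain also asks for the right end point\<close>
  have WR: "W \<in> form_domain (R + 1)" using pW suppR R by (auto simp: form_domain_def)
  have fW: "f = prim_L2 W"
    unfolding f prim_L2_eq by (subst abs_L2_eq_iff[OF sqy sq_prim[OF _ WR]]) (use R in \<open>auto simp: pW\<close>)
  have "form r W Z = cinner g (prim_L2 Z)" if S: "S \<ge> 0" and Z: "Z \<in> form_domain S" for S Z
  proof -
    define b where "b = max S (R + 1)"
    have b: "b \<ge> 0" "R + 1 \<le> b" "S \<le> b" using S by (auto simp: b_def)
    have Wb: "W \<in> form_domain b" and Zb: "Z \<in> form_domain b" using WR Z form_domain_mono b by blast+
    obtain z where z: "square_integrable_on z {0..}" "Z = abs_L2 z" "\<And>x. x \<notin> {0..b} \<Longrightarrow> z x = 0"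
      "\<And>x. prim Z x = integral {0..x} z" "AE x in halfline. (prim Z has_vector_derivative z x) (at x)"
      by (rule form_domainE[OF Zb], rule that)
    have w0: "w x = 0" if "x \<notin> {0..b}" for x using that b by (auto simp: w_def trunc_def)
    have 1: "((\<lambda>x. w x * cnj (z x) - w x * cnj (cnj (r x) * prim Z x) - r x * prim W x * cnj (z x)) has_integral form r W Z) {0..b}"
      by (rule form_has_integral[OF r b(1) Wb Zb sqw W_def w0 z(1-3)])
    have 2: "((\<lambda>x. u' x * cnj (prim Z x) + u x * cnj (z x)) has_integral u b * cnj (prim Z b) - u 0 * cnj (prim Z 0)) {0..b}"
      using b by (intro product_rule_has_integral[of b] AC_on_cnj prim_AC ae_derivative_cnj z(5) u' ACu) auto
    have 3: "((\<lambda>x. l x * cnj (prim Z x)) has_integral cinner (abs_L2 l) (abs_L2 (prim Z))) {0..b}"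
      by (rule cinner_has_integral[OF sql sq_prim[OF b(1) Zb]]) (use Zb in \<open>simp add: form_domain_def\<close>)
    have "((\<lambda>x. w x * cnj (z x) - w x * cnj (cnj (r x) * prim Z x) - r x * prim W x * cnj (z x)
        - (u' x * cnj (prim Z x) + u x * cnj (z x)) - l x * cnj (prim Z x))
        has_integral form r W Z - (u b * cnj (prim Z b) - u 0 * cnj (prim Z 0)) - cinner (abs_L2 l) (abs_L2 (prim Z))) {0..b}"
      by (intro has_integral_diff 1 2 3)
    moreover have "AE x in halfline. w x * cnj (z x) - w x * cnj (cnj (r x) * prim Z x) - r x * prim W x * cnj (z x)
        - (u' x * cnj (prim Z x) + u x * cnj (z x)) - l x * cnj (prim Z x) = 0"
      using uy' lu' wy' AE_space
    proof eventually_elim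
      case (elim x)
      have p: "prim W x = y x" using elim by (simp add: pW)
      have wx: "w x = u x + r x * y x" using elim by simp
      show ?case unfolding p wx elim(2) by (simp add: algebra_simps power2_eq_square)
    qed
    then obtain N where N: "negligible N" "\<And>x. x \<in> {0..} - N \<Longrightarrow> w x * cnj (z x) - w x * cnj (cnj (r x) * prim Z x) - r x * prim W x * cnj (z x)
        - (u' x * cnj (prim Z x) + u x * cnj (z x)) - l x * cnj (prim Z x) = 0"
      by (auto simp: AE_lebesgue_on_negligible)
    have "((\<lambda>x. w x * cnj (z x) - w x * cnj (cnj (r x) * prim Z x) - r x * prim W x * cnj (z x)
        - (u' x * cnj (prim Z x) + u x * cnj (z x)) - l x * cnj (prim Z x)) has_integral 0) {0..b}"
      by (rule has_integral_spike[OF N(1) _ has_integral_0]) (use N(2) in auto)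
    ultimately have "form r W Z - (u b * cnj (prim Z b) - u 0 * cnj (prim Z 0)) - cinner (abs_L2 l) (abs_L2 (prim Z)) = 0"
      by (rule has_integral_unique)
    then show ?thesis using Zb by (simp add: g prim_L2_eq form_domain_def prim_neg)
  qed
  then show ?thesis using that[of "R + 1" W] R WR fW by auto
qed

text \<open>The hypotheses \<open>U\<close> and \<open>UR\<close> say that $y^{[1]}$ agrees on \<open>[0,R]\<close> with an absolutely continuous function that vanishes
  at both ends; being zero beyond \<open>R\<close>, the functions \<open>y\<close> and $y^{[1]}$ extend.\<close>

lemma minimal_operatorI:
  assumes r: "r \<in> L2_loc" and R: "R \<ge> 0" and W: "W \<in> form_domain R"
    and w: "square_integrable_on w {0..}" "W = abs_L2 w" "\<And>x. x \<notin> {0..R} \<Longrightarrow> w x = 0"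
    and l: "square_integrable_on l {0..}" "\<And>x. x > R \<Longrightarrow> l x = 0"
    and U: "AE x in lebesgue_on {0..R}. w x - r x * prim W x = - integral {0..x} (\<lambda>x. r x * w x + l x)"
    and UR: "integral {0..R} (\<lambda>x. r x * w x + l x) = 0"
  shows "(prim_L2 W, abs_L2 l) \<in> minimal_operator r"
proof -
  define h where "h x = - (r x * w x + l x)" for x
  define u where "u x = 0 + integral {0..x} h" for x
  have hint: "integrable (lebesgue_on {0..b}) h" for b
  proof (cases "b \<ge> 0")
    case True
    have "square_integrable_on w {0..b}" "square_integrable_on l {0..b}"
      using square_integrable_on_subset[OF w(1)] square_integrable_on_subset[OF l(1)] by auto
    then show ?thesis unfolding h_def
      by (intro Bochner_Integration.integrable_minus Bochner_Integration.integrable_add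
          square_integrable_mult_integrable square_integrable_imp_integrable L2_locD[OF r True])
  next
    case False
    then show ?thesis by (auto simp: integrable_restrict_space)
  qed
  have uint: "u x = - integral {0..x} (\<lambda>x. r x * w x + l x)" for x
    by (simp only: u_def h_def[abs_def] Henstock_Kurzweil_Integration.integral_neg add_0)
  have u_beyond: "u x = 0" if "x \<ge> R" for x
  proof -
    have hi: "h integrable_on {0..x}" using hint by (simp add: integrable_on_lebesgue_on)
    have "integral {0..x} h = integral {0..R} h + integral {R..x} h"
      using Henstock_Kurzweil_Integration.integral_combine[OF R that hi] by simp
    also have "integral {R..x} h = integral {R..x} (\<lambda>_. 0)"
      by (rule integral_spike[of "{R}"]) (use w(3) l(2) in \<open>auto simp: h_def\<close>)
    also have "integral {0..R} h = 0" using uint[of R] UR by (simp add: u_def)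
    finally show ?thesis by (simp add: u_def)
  qed
  have ACu: "u \<in> AC_loc" unfolding AC_loc_def u_def
    using AC_on_indefinite_integral[OF hint] by blast
  have du: "AE x in halfline. (u has_vector_derivative h x) (at x)"
    unfolding u_def by (rule indefinite_integral_ae_derivative) (rule hint)
  have dy: "AE x in halfline. (prim W has_vector_derivative w x) (at x)"
  proof -
    have "AE x in halfline. rep_L2 W x = w x" unfolding w(2) by (rule rep_abs_L2[OF w(1)])
    with prim_ae_derivative[of W] show ?thesis by eventually_elim simp
  qed
  have uw: "AE x in halfline. u x = w x - r x * prim W x"
  proof -
    obtain N where N: "negligible N" "\<And>x. x \<in> {0..R} - N \<Longrightarrow> w x - r x * prim W x = u x"
      using U by (auto simp: AE_lebesgue_on_negligible uint)
    have "u x = w x - r x * prim W x" if "x \<in> {0..} - N" for x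
    proof (cases "x \<le> R")
      case True then show ?thesis using N(2)[of x] that by simp
    next
      case False then show ?thesis using u_beyond[of x] w(3)[of x] W by (simp add: form_domain_def)
    qed
    then show ?thesis using N(1) by (auto simp: AE_lebesgue_on_negligible)
  qed
  have "is_quasi_derivative r (prim W) u"
    unfolding is_quasi_derivative_def is_ae_derivative_def using dy uw by blast
  moreover have "is_quasi_expression r (prim W) u l"
    unfolding is_quasi_expression_def is_ae_derivative_def
  proof (intro exI[of _ h] conjI du)
    show "AE x in halfline. l x = - h x - r x * u x - (r x)\<^sup>2 * prim W x"
      using uw
    proof eventually_elim
      case (elim x)
      then have wx: "w x = u x + r x * prim W x" by simp
      show ?case unfolding h_def wx by (simp add: algebra_simps power2_eq_square)
    qed
  qed
  moreover have "prim W \<in> AC_loc" unfolding AC_loc_def using prim_AC by blast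
  moreover have "\<exists>R. \<forall>x>R. 0 \<le> x \<longrightarrow> prim W x = 0" using W by (auto simp: form_domain_def intro!: exI[of _ R])
  ultimately show ?thesis
    unfolding minimal_operator_def prim_L2_eq
    by (intro CollectI exI[of _ "prim W"] exI[of _ u] exI[of _ l] conjI refl sq_prim[OF R W] ACu l(1))
      (auto simp: prim_neg u_def)
qed

section \<open>Dirichlet problems\<close>

lemma prim_L2_add: "R \<ge> 0 \<Longrightarrow> W \<in> form_domain R \<Longrightarrow> Z \<in> form_domain R \<Longrightarrow> prim_L2 (W + Z) = prim_L2 W + prim_L2 Z"
  by (rule times_prim_add[OF L2_loc_one])

lemma prim_L2_scaleR: "R \<ge> 0 \<Longrightarrow> W \<in> form_domain R \<Longrightarrow> prim_L2 (a *\<^sub>R W) = a *\<^sub>R prim_L2 W"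
  by (rule times_prim_scaleR[OF L2_loc_one])

lemma prim_L2_cscale: "R \<ge> 0 \<Longrightarrow> W \<in> form_domain R \<Longrightarrow> prim_L2 (cscale a W) = cscale a (prim_L2 W)"
  by (rule times_prim_cscale[OF L2_loc_one])

lemma norm_prim_L2_le: "R \<ge> 0 \<Longrightarrow> W \<in> form_domain R \<Longrightarrow> norm (prim_L2 W) \<le> sqrt R * loc_norm (\<lambda>_. 1) R * norm W"
  using norm_times_prim_le_norm[OF L2_loc_one, of R W] by (simp add: mult_ac)

context
  fixes r :: "real \<Rightarrow> complex" and R :: real and \<omega> :: complex and \<mu> :: real
  assumes r: "r \<in> L2_loc" and R: "R \<ge> 0"
begin

lemma real_form_add_left:
  "W \<in> form_domain R \<Longrightarrow> W' \<in> form_domain R \<Longrightarrow> Z \<in> form_domain R \<Longrightarrow>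
     real_form \<omega> \<mu> r (W + W') Z = real_form \<omega> \<mu> r W Z + real_form \<omega> \<mu> r W' Z"
  by (simp add: real_form_def form_add_left[OF r R] prim_L2_add[OF R] inner_add_left algebra_simps)

lemma real_form_add_right:
  "W \<in> form_domain R \<Longrightarrow> W' \<in> form_domain R \<Longrightarrow> Z \<in> form_domain R \<Longrightarrow>
     real_form \<omega> \<mu> r Z (W + W') = real_form \<omega> \<mu> r Z W + real_form \<omega> \<mu> r Z W'"
  by (simp add: real_form_def form_add_right[OF r R] prim_L2_add[OF R] inner_add_right algebra_simps)

lemma real_form_scaleR_left:
  "W \<in> form_domain R \<Longrightarrow> real_form \<omega> \<mu> r (a *\<^sub>R W) Z = a * real_form \<omega> \<mu> r W Z"
  by (simp add: real_form_def form_scaleR_left[OF r R] prim_L2_scaleR[OF R] algebra_simps)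

lemma real_form_scaleR_right:
  "Z \<in> form_domain R \<Longrightarrow> real_form \<omega> \<mu> r W (a *\<^sub>R Z) = a * real_form \<omega> \<mu> r W Z"
  by (simp add: real_form_def form_scaleR_right[OF r R] prim_L2_scaleR[OF R] algebra_simps)

lemma real_form_cscale:
  assumes "W \<in> form_domain R" "Z \<in> form_domain R"
  shows "real_form \<omega> \<mu> r (cscale c W) Z = real_form \<omega> \<mu> r W (cscale (cnj c) Z)"
  using assms by (simp add: real_form_def form_cscale_left[OF r R] form_cscale_right[OF r R]
      prim_L2_cscale[OF R] mult.left_commute cinner_cscale_left cinner_cscale_right flip: Re_cinner)

lemma real_form_bounded:
  "\<exists>K\<ge>0. \<forall>W\<in>form_domain R. \<forall>Z\<in>form_domain R. \<bar>real_form \<omega> \<mu> r W Z\<bar> \<le> K * norm W * norm Z"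
proof -
  define k where "k = 1 + sqrt R * (loc_norm r R + loc_norm (\<lambda>x. cnj (r x)) R)"
  define m where "m = sqrt R * loc_norm (\<lambda>_. 1) R"
  have k: "k \<ge> 0" and m: "m \<ge> 0" using R by (auto simp: k_def m_def)
  have "\<bar>real_form \<omega> \<mu> r W Z\<bar> \<le> (norm \<omega> * k + \<bar>\<mu>\<bar> * m * m) * norm W * norm Z"
    if W: "W \<in> form_domain R" and Z: "Z \<in> form_domain R" for W Z
  proof -
    have "\<bar>real_form \<omega> \<mu> r W Z\<bar> \<le> \<bar>Re (\<omega> * form r W Z)\<bar> + \<bar>\<mu> * inner (prim_L2 W) (prim_L2 Z)\<bar>"
      unfolding real_form_def by (rule abs_triangle_ineq)
    also have "\<bar>Re (\<omega> * form r W Z)\<bar> \<le> norm \<omega> * (k * norm W * norm Z)"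
      using order_trans[OF abs_Re_le_cmod, of "\<omega> * form r W Z"] mult_left_mono[OF form_bounded[OF r R W Z], of "norm \<omega>"]
      by (simp add: norm_mult k_def)
    also have "\<bar>\<mu> * inner (prim_L2 W) (prim_L2 Z)\<bar> \<le> \<bar>\<mu>\<bar> * ((m * norm W) * (m * norm Z))"
      unfolding abs_mult
      using norm_prim_L2_le[OF R W] norm_prim_L2_le[OF R Z] m
      by (intro mult_left_mono order_trans[OF Cauchy_Schwarz_ineq2] mult_mono) (auto simp: m_def)
    finally show ?thesis by (simp add: algebra_simps)
  qed
  moreover have "norm \<omega> * k + \<bar>\<mu>\<bar> * m * m \<ge> 0" using k m by auto
  ultimately show ?thesis by blast
qed

context
  fixes c assumes c: "c > 0" "\<And>W. W \<in> form_domain R \<Longrightarrow> c * (norm W)\<^sup>2 \<le> real_form \<omega> \<mu> r W W"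
begin

lemma sectorial_real_form:
  "\<exists>C. sectorial_form (form_domain R) (real_form \<omega> \<mu> r) C \<and> sectorial_form (form_domain R) (\<lambda>u v. real_form \<omega> \<mu> r v u) C"
proof -
  obtain K where K: "K \<ge> 0" "\<And>W Z. W \<in> form_domain R \<Longrightarrow> Z \<in> form_domain R \<Longrightarrow> \<bar>real_form \<omega> \<mu> r W Z\<bar> \<le> K * norm W * norm Z"
    using real_form_bounded by blast
  have nn: "0 \<le> real_form \<omega> \<mu> r u u" if "u \<in> form_domain R" for u
    using c(2)[OF that] c(1) by (meson less_imp_le mult_nonneg_nonneg order_trans zero_le_power2)
  have sec: "\<bar>real_form \<omega> \<mu> r u v\<bar> \<le> K / c * (real_form \<omega> \<mu> r u u + real_form \<omega> \<mu> r v v)"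
    if "u \<in> form_domain R" "v \<in> form_domain R" for u v
  proof -
    have "norm u * norm v \<le> (norm u)\<^sup>2 + (norm v)\<^sup>2"
      using sum_squares_bound[of "norm u" "norm v"] mult_nonneg_nonneg[OF norm_ge_zero norm_ge_zero, of u v]
      by linarith
    also have "\<dots> \<le> (real_form \<omega> \<mu> r u u + real_form \<omega> \<mu> r v v) / c"
      using c(2)[OF that(1)] c(2)[OF that(2)] c(1) by (simp add: pos_le_divide_eq algebra_simps)
    finally have "K * (norm u * norm v) \<le> K * ((real_form \<omega> \<mu> r u u + real_form \<omega> \<mu> r v v) / c)"
      by (rule mult_left_mono[OF _ K(1)])
    then show ?thesis using K(2)[OF that] by (simp add: mult.assoc)
  qed
  have "sectorial_form (form_domain R) (real_form \<omega> \<mu> r) (K / c)"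
    by unfold_locales
      (use nn sec in \<open>auto simp: subspace_form_domain real_form_add_left real_form_add_right real_form_scaleR_left real_form_scaleR_right\<close>)
  moreover have "sectorial_form (form_domain R) (\<lambda>u v. real_form \<omega> \<mu> r v u) (K / c)"
  proof (unfold_locales, goal_cases)
    case (7 u v)
    then show ?case using sec[of v u] by (simp add: add.commute)
  qed (use nn in \<open>auto simp: subspace_form_domain real_form_add_left real_form_add_right real_form_scaleR_left real_form_scaleR_right\<close>)
  ultimately show ?thesis by blast
qed

lemma dirichlet_problem:
  "\<exists>W\<in>form_domain R. \<forall>Z\<in>form_domain R. real_form \<omega> \<mu> r W Z = inner f (prim_L2 Z)"
proof -
  obtain K where K: "K \<ge> 0" "\<And>W Z. W \<in> form_domain R \<Longrightarrow> Z \<in> form_domain R \<Longrightarrow> \<bar>real_form \<omega> \<mu> r W Z\<bar> \<le> K * norm W * norm Z"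
    using real_form_bounded by blast
  obtain C where C: "sectorial_form (form_domain R) (real_form \<omega> \<mu> r) C" using sectorial_real_form by blast
  have "\<bar>inner f (prim_L2 u)\<bar> \<le> norm f * (sqrt R * loc_norm (\<lambda>_. 1) R) * norm u" if "u \<in> form_domain R" for u
    using order_trans[OF Cauchy_Schwarz_ineq2 mult_left_mono[OF norm_prim_L2_le[OF R that] norm_ge_zero[of f]]]
    by (simp add: mult.assoc)
  note l_bounded = this
  obtain W where "W \<in> form_domain R" "\<And>Z. Z \<in> form_domain R \<Longrightarrow> real_form \<omega> \<mu> r W Z = inner f (prim_L2 Z)"
  proof (rule lax_milgram[OF closed_form_domain C c K(2), of "\<lambda>Z. inner f (prim_L2 Z)"])
    show "inner f (prim_L2 (u + v)) = inner f (prim_L2 u) + inner f (prim_L2 v)"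
      if "u \<in> form_domain R" "v \<in> form_domain R" for u v
      using that by (simp add: prim_L2_add[OF R] inner_add_right)
    show "inner f (prim_L2 (a *\<^sub>R u)) = a * inner f (prim_L2 u)" if "u \<in> form_domain R" for u a
      using that by (simp add: prim_L2_scaleR[OF R])
    show "\<bar>inner f (prim_L2 u)\<bar> \<le> norm f * (sqrt R * loc_norm (\<lambda>_. 1) R) * norm u" if "u \<in> form_domain R" for u
      using that by (rule l_bounded)
  qed auto
  then show ?thesis by blast
qed

text \<open>The right-hand side is measured against \<open>W\<close> itself and not against its primitive, as the density argument requires.\<close>

lemma adjoint_problem:
  "\<exists>Z\<in>form_domain R. \<forall>W\<in>form_domain R. real_form \<omega> \<mu> r W Z = inner g W"
proof -
  obtain K where K: "K \<ge> 0" "\<And>W Z. W \<in> form_domain R \<Longrightarrow> Z \<in> form_domain R \<Longrightarrow> \<bar>real_form \<omega> \<mu> r W Z\<bar> \<le> K * norm W * norm Z"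
    using real_form_bounded by blast
  have K': "\<bar>real_form \<omega> \<mu> r Z W\<bar> \<le> K * norm W * norm Z" if "W \<in> form_domain R" "Z \<in> form_domain R" for W Z
    using K(2)[OF that(2,1)] by (simp add: mult_ac)
  obtain C where C: "sectorial_form (form_domain R) (\<lambda>u v. real_form \<omega> \<mu> r v u) C" using sectorial_real_form by blast
  obtain Z where "Z \<in> form_domain R" "\<And>W. W \<in> form_domain R \<Longrightarrow> real_form \<omega> \<mu> r W Z = inner g W"
  proof (rule lax_milgram[OF closed_form_domain C c K', of "inner g"])
    show "\<bar>inner g u\<bar> \<le> norm g * norm u" for u by (rule Cauchy_Schwarz_ineq2)
  qed (simp_all add: inner_add_right)
  then show ?thesis by blast
qed

text \<open>If \<open>W\<close> is orthogonal to all solutions, let \<open>Z\<close> solve the adjoint problem with right-hand side \<open>W\<close>, and let \<open>W'\<close> solve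
  the Dirichlet problem with right-hand side \<open>prim Z\<close>. Then \<open>0 = \<langle>W, W'\<rangle> = b(W', Z) = \<bar>\<bar>prim Z\<bar>\<bar>\<^sup>2\<close>.\<close>

lemma dirichlet_solutions_dense:
  "form_domain R \<subseteq> closure {W\<in>form_domain R. \<exists>f. \<forall>Z\<in>form_domain R. real_form \<omega> \<mu> r W Z = inner f (prim_L2 Z)}"
    (is "_ \<subseteq> closure ?A")
proof (rule subset_closure_if_orthogonal_trivial)
  show "subspace ?A" unfolding subspace_def
  proof (intro conjI ballI allI)
    show "0 \<in> ?A"
      using real_form_scaleR_left[of 0 0] subspace_0[OF subspace_form_domain] by (auto intro!: exI[of _ 0])
    fix x y a assume x: "x \<in> ?A"
    then obtain f where f: "x \<in> form_domain R" "\<forall>Z\<in>form_domain R. real_form \<omega> \<mu> r x Z = inner f (prim_L2 Z)" by blast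
    show "a *\<^sub>R x \<in> ?A"
      using f by (auto simp: form_domain_scaleR real_form_scaleR_left intro!: exI[of _ "a *\<^sub>R f"])
    assume y: "y \<in> ?A"
    then obtain g where g: "y \<in> form_domain R" "\<forall>Z\<in>form_domain R. real_form \<omega> \<mu> r y Z = inner g (prim_L2 Z)" by blast
    show "x + y \<in> ?A"
      using f g by (auto simp: form_domain_add real_form_add_left inner_add_left intro!: exI[of _ "f + g"])
  qed
  fix W assume W: "W \<in> form_domain R" and orth: "\<And>z. z \<in> ?A \<Longrightarrow> inner W z = 0"
  obtain Z where Z: "Z \<in> form_domain R" "\<And>W'. W' \<in> form_domain R \<Longrightarrow> real_form \<omega> \<mu> r W' Z = inner W W'"
    using adjoint_problem[of W] by blast
  obtain W' where W': "W' \<in> form_domain R" "\<And>Y. Y \<in> form_domain R \<Longrightarrow> real_form \<omega> \<mu> r W' Y = inner (prim_L2 Z) (prim_L2 Y)"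
    using dirichlet_problem[of "prim_L2 Z"] by blast
  have "W' \<in> ?A" using W' by blast
  then have "inner W W' = 0" by (rule orth)
  then have "inner (prim_L2 Z) (prim_L2 Z) = 0" using Z(2)[OF W'(1)] W'(2)[OF Z(1)] by simp
  then have "Z = 0" using prim_L2_eq_zero[OF R Z(1)] by simp
  then have "inner W W = 0" using Z(2)[OF W] real_form_scaleR_right[OF Z(1), of W 0] by simp
  then show "W = 0" by simp
qed (auto simp: subspace_form_domain closed_form_domain)

end

end

section \<open>Regularity of weak solutions\<close>

lemma prim_chi: "0 \<le> x \<Longrightarrow> 0 \<le> R \<Longrightarrow> prim (chi R) x = of_real (min x R)"
proof -
  assume x: "0 \<le> x" "0 \<le> R"
  have "prim (chi R) x = integral {0..x} (trunc {0..R} (\<lambda>_. 1))"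
    unfolding chi_def by (rule prim_abs_L2[OF sq_trunc_1])
  also have "\<dots> = integral ({0..R} \<inter> {0..x}) (\<lambda>_. 1)"
    unfolding trunc_def[abs_def] by (rule integral_restrict_Int)
  also have "{0..R} \<inter> {0..x} = {0..min x R}" by auto
  finally show ?thesis using x by (simp add: scaleR_conv_of_real)
qed

text \<open>The difference of \<open>G\<close> and its mean value has a primitive that vanishes at \<open>R\<close>, so it is an admissible test
  element.\<close>

lemma du_Bois_Reymond:
  assumes R: "R > 0" and G: "\<And>x. x \<ge> R \<Longrightarrow> prim G x = prim G R"
    and orth: "\<And>Z. Z \<in> form_domain R \<Longrightarrow> inner G Z = 0"
  shows "\<exists>c. G = cscale c (chi R)"
proof -
  define m where "m = prim G R / of_real R"
  define W where "W = G - cscale m (chi R)"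
  have W: "W \<in> form_domain R"
    unfolding form_domain_def
  proof (intro CollectI allI impI)
    fix x assume x: "x \<ge> R"
    have "prim (chi R) x = of_real R" using x R by (simp add: prim_chi)
    then show "prim W x = 0" using R unfolding W_def prim_diff prim_cscale G[OF x] by (simp add: m_def)
  qed
  have "cinner (chi R) W = cnj (prim W R)" by (metis prim_eq_cinner cinner_commute)
  then have "cinner (chi R) W = 0" using W by (simp add: form_domain_def)
  then have "inner (cscale m (chi R)) W = 0" by (simp add: cinner_cscale_left flip: Re_cinner)
  then have "inner W W = 0" using orth[OF W] by (simp add: W_def inner_diff_left)
  then show ?thesis by (auto simp: W_def)
qed

text \<open>Minus the derivative of \<open>\<omega>\<close> times the quasi-derivative for the equation \<open>\<omega> l(y) + \<mu> y = f\<close>: since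
  \<open>y' = u + r y\<close> for the quasi-derivative \<open>u\<close>, one has \<open>r u + r\<^sup>2 y = r y'\<close>.\<close>

definition source :: "complex \<Rightarrow> real \<Rightarrow> (real \<Rightarrow> complex) \<Rightarrow> L2 \<Rightarrow> L2 \<Rightarrow> real \<Rightarrow> complex" where
  "source \<omega> \<mu> r f W x = \<omega> * r x * rep_L2 W x - of_real \<mu> * prim W x + rep_L2 f x"

text \<open>The equation in integrated form. The constants record the boundary values of the quasi-derivative \<open>u\<close>:
  \<open>c = \<omega> u(0)\<close> and \<open>c - d = \<omega> u(R)\<close>, so both constants vanish exactly when \<open>y\<close> extends by zero to an element of
  the domain of the minimal operator.\<close>

definition strong_solution :: "complex \<Rightarrow> real \<Rightarrow> (real \<Rightarrow> complex) \<Rightarrow> real \<Rightarrow> L2 \<Rightarrow> L2 \<Rightarrow> complex \<Rightarrow> complex \<Rightarrow> bool" where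
  "strong_solution \<omega> \<mu> r R f W c d \<longleftrightarrow>
     (AE x in lebesgue_on {0..R}. \<omega> * (rep_L2 W x - r x * prim W x) + integral {0..x} (source \<omega> \<mu> r f W) = c) \<and>
     integral {0..R} (source \<omega> \<mu> r f W) = d"

lemma integrable_source:
  assumes "r \<in> L2_loc"
  shows "integrable (lebesgue_on {0..R}) (source \<omega> \<mu> r f W)"
proof (cases "R \<ge> 0")
  case True
  have "integrable (lebesgue_on {0..R}) (\<lambda>x. r x * rep_L2 W x)"
    by (intro square_integrable_mult_integrable L2_locD[OF assms True] square_integrable_rep_L2_on) auto
  moreover have "integrable (lebesgue_on {0..R}) (prim W)"
    by (intro square_integrable_imp_integrable square_integrable_on_continuous AC_on_continuous prim_AC)
  moreover have "integrable (lebesgue_on {0..R}) (rep_L2 f)"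
    by (intro square_integrable_imp_integrable square_integrable_rep_L2_on) auto
  ultimately show ?thesis unfolding source_def[abs_def] by (simp add: mult.assoc)
qed (simp add: integrable_restrict_space)

lemma source_add: "AE x in halfline. source \<omega> \<mu> r (f + f') (W + W') x = source \<omega> \<mu> r f W x + source \<omega> \<mu> r f' W' x"
  using rep_L2_add[of f f'] rep_L2_add[of W W']
  by eventually_elim (simp add: source_def prim_add algebra_simps)

lemma source_cscale: "AE x in halfline. source \<omega> \<mu> r (cscale a f) (cscale a W) x = a * source \<omega> \<mu> r f W x"
  using rep_L2_cscale[of a f] rep_L2_cscale[of a W]
  by eventually_elim (simp add: source_def prim_cscale algebra_simps)

lemma integral_cong_ae_halfline:
  fixes f g :: "real \<Rightarrow> complex"
  assumes "AE x in halfline. f x = g x"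
  shows "integral {0..x} f = integral {0..x} g"
proof -
  obtain N where "negligible N" "\<And>x. x \<in> {0..} - N \<Longrightarrow> f x = g x"
    using assms by (auto simp: AE_lebesgue_on_negligible)
  then show ?thesis by (intro integral_spike[of N]) auto
qed

lemma strong_solution_add:
  assumes r: "r \<in> L2_loc" and 1: "strong_solution \<omega> \<mu> r R f W c d" and 2: "strong_solution \<omega> \<mu> r R f' W' c' d'"
  shows "strong_solution \<omega> \<mu> r R (f + f') (W + W') (c + c') (d + d')"
proof -
  have int: "integral {0..x} (source \<omega> \<mu> r (f + f') (W + W')) = integral {0..x} (source \<omega> \<mu> r f W) + integral {0..x} (source \<omega> \<mu> r f' W')" for x
    unfolding integral_cong_ae_halfline[OF source_add]
    by (intro Henstock_Kurzweil_Integration.integral_add integrable_on_lebesgue_on integrable_source r) auto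
  have "AE x in lebesgue_on {0..R}. rep_L2 (W + W') x = rep_L2 W x + rep_L2 W' x"
    by (rule AE_halfline_on[OF rep_L2_add]) auto
  then have "AE x in lebesgue_on {0..R}. \<omega> * (rep_L2 (W + W') x - r x * prim (W + W') x) + integral {0..x} (source \<omega> \<mu> r (f + f') (W + W')) = c + c'"
    using conjunct1[OF 1[unfolded strong_solution_def]] conjunct1[OF 2[unfolded strong_solution_def]]
    by eventually_elim (simp add: int prim_add algebra_simps)
  then show ?thesis using 1 2 int by (simp add: strong_solution_def)
qed

lemma strong_solution_cscale:
  assumes 1: "strong_solution \<omega> \<mu> r R f W c d"
  shows "strong_solution \<omega> \<mu> r R (cscale a f) (cscale a W) (a * c) (a * d)"
proof -
  have int: "integral {0..x} (source \<omega> \<mu> r (cscale a f) (cscale a W)) = a * integral {0..x} (source \<omega> \<mu> r f W)" for x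
    unfolding integral_cong_ae_halfline[OF source_cscale] by simp
  have "AE x in lebesgue_on {0..R}. rep_L2 (cscale a W) x = a * rep_L2 W x"
    by (rule AE_halfline_on[OF rep_L2_cscale]) auto
  then have "AE x in lebesgue_on {0..R}. \<omega> * (rep_L2 (cscale a W) x - r x * prim (cscale a W) x) + integral {0..x} (source \<omega> \<mu> r (cscale a f) (cscale a W)) = a * c"
    using conjunct1[OF 1[unfolded strong_solution_def]]
  proof eventually_elim
    case (elim x)
    have "a * c = a * (\<omega> * (rep_L2 W x - r x * prim W x) + integral {0..x} (source \<omega> \<mu> r f W))" using elim(2) by simp
    then show ?case by (simp add: int prim_cscale elim(1) algebra_simps)
  qed
  then show ?thesis using 1 int by (simp add: strong_solution_def)
qed

lemma square_integrable_trunc_on: "square_integrable_on f {0..R} \<Longrightarrow> square_integrable_on (trunc {0..R} f) {0..}"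
  by (rule square_integrable_on_trunc) auto

lemma AE_rep_form_domain:
  assumes "W = abs_L2 w" "square_integrable_on w {0..}"
  shows "AE x in halfline. rep_L2 W x = w x"
  using rep_abs_L2[OF assms(2)] assms(1) by simp

lemma source_ae_derivative:
  assumes "r \<in> L2_loc"
  shows "AE x in halfline. ((\<lambda>u. c + integral {0..u} (source \<omega> \<mu> r f W)) has_vector_derivative source \<omega> \<mu> r f W x) (at x)"
  by (rule indefinite_integral_ae_derivative) (rule integrable_source[OF assms])

lemma source_AC:
  assumes "r \<in> L2_loc"
  shows "AC_on 0 R (\<lambda>u. c + integral {0..u} (source \<omega> \<mu> r f W))"
  by (rule AC_on_indefinite_integral) (rule integrable_source[OF assms])

lemma square_integrable_mult_prim:
  assumes "r \<in> L2_loc" "R \<ge> 0"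
  shows "square_integrable_on (\<lambda>x. r x * prim W x) {0..R}"
proof -
  obtain B where B: "\<forall>x\<in>{0..R}. norm (prim W x) \<le> B" using bounded_prim by blast
  show ?thesis
    by (rule square_integrable_on_bounded_mult[OF L2_locD[OF assms], of "prim W" B])
      (use B in \<open>auto intro: continuous_imp_measurable_on_sets_lebesgue AC_on_continuous[OF prim_AC]\<close>)
qed

text \<open>With \<open>H\<close> the primitive of the source term, the weak equation says that \<open>\<omega>(w - r y) + H\<close> is orthogonal to
  the form domain, hence constant by du Bois-Reymond.\<close>

theorem weak_solution_regular:
  assumes r: "r \<in> L2_loc" and R: "R > 0" and W: "W \<in> form_domain R"
    and weak: "\<And>Z. Z \<in> form_domain R \<Longrightarrow> real_form \<omega> \<mu> r W Z = inner f (prim_L2 Z)"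
  shows "\<exists>c d. strong_solution \<omega> \<mu> r R f W c d"
proof -
  have R0: "R \<ge> 0" using R by simp
  define S where "S = source \<omega> \<mu> r f W"
  define H where "H x = 0 + integral {0..x} S" for x
  obtain w where w: "square_integrable_on w {0..}" "W = abs_L2 w" "\<And>x. x \<notin> {0..R} \<Longrightarrow> w x = 0"
    "\<And>x. prim W x = integral {0..x} w" "AE x in halfline. (prim W has_vector_derivative w x) (at x)"
    by (rule form_domainE[OF W], rule that)
  have rw: "AE x in halfline. rep_L2 W x = w x" by (rule AE_rep_form_domain[OF w(2,1)])
  have ACH: "AC_on 0 R H" unfolding H_def S_def by (rule source_AC[OF r])
  have dH: "AE x in halfline. (H has_vector_derivative S x) (at x)"
    unfolding H_def S_def by (rule source_ae_derivative[OF r])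
  define g where "g x = \<omega> * (w x - r x * prim W x) + H x" for x
  have sqg: "square_integrable_on g {0..R}"
  proof -
    have "square_integrable_on w {0..R}" using square_integrable_on_subset[OF w(1)] by auto
    then have "square_integrable_on (\<lambda>x. w x + (- 1) * (r x * prim W x)) {0..R}"
      by (intro square_integrable_on_add square_integrable_on_cmult square_integrable_mult_prim r R0)
    then have "square_integrable_on (\<lambda>x. \<omega> * (w x + (- 1) * (r x * prim W x)) + H x) {0..R}"
      by (rule square_integrable_on_add[OF square_integrable_on_cmult square_integrable_on_continuous[OF AC_on_continuous[OF ACH]]])
    then show ?thesis by (simp add: g_def[abs_def])
  qed
  have sqt: "square_integrable_on (trunc {0..R} g) {0..}" by (rule square_integrable_trunc_on[OF sqg])
  define G where "G = abs_L2 (trunc {0..R} g)"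
  have Gb: "prim G x = prim G R" if x: "x \<ge> R" for x
  proof -
    have "prim G x = integral ({0..R} \<inter> {0..x}) g"
      unfolding G_def prim_abs_L2[OF sqt] unfolding trunc_def[abs_def] by (rule integral_restrict_Int)
    also have "\<dots> = integral ({0..R} \<inter> {0..R}) g" using x by (simp add: Int_absorb2)
    also have "\<dots> = prim G R"
      unfolding G_def prim_abs_L2[OF sqt] unfolding trunc_def[abs_def] by (rule integral_restrict_Int[symmetric])
    finally show ?thesis .
  qed
  have "inner G Z = 0" if Z: "Z \<in> form_domain R" for Z
  proof -
    obtain z where z: "square_integrable_on z {0..}" "Z = abs_L2 z" "\<And>x. x \<notin> {0..R} \<Longrightarrow> z x = 0"
      "\<And>x. prim Z x = integral {0..x} z" "AE x in halfline. (prim Z has_vector_derivative z x) (at x)"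
      by (rule form_domainE[OF Z], rule that)
    have "((\<lambda>x. trunc {0..R} g x * cnj (z x)) has_integral cinner (abs_L2 (trunc {0..R} g)) (abs_L2 z)) {0..R}"
      by (rule cinner_has_integral[OF sqt z(1)]) (simp add: z(3))
    then have 1: "((\<lambda>x. trunc {0..R} g x * cnj (z x)) has_integral cinner G Z) {0..R}"
      by (simp only: G_def z(2)[symmetric])
    have 2: "((\<lambda>x. w x * cnj (z x) - w x * cnj (cnj (r x) * prim Z x) - r x * prim W x * cnj (z x)) has_integral form r W Z) {0..R}"
      by (rule form_has_integral[OF r R0 W Z w(1-3) z(1-3)])
    have 3: "((\<lambda>x. prim W x * cnj (prim Z x)) has_integral cinner (prim_L2 W) (prim_L2 Z)) {0..R}"
      unfolding prim_L2_eq
      by (rule cinner_has_integral[OF sq_prim[OF R0 W] sq_prim[OF R0 Z]]) (use W in \<open>simp add: form_domain_def\<close>)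
    have "((\<lambda>x. rep_L2 f x * cnj (prim Z x)) has_integral cinner (abs_L2 (rep_L2 f)) (abs_L2 (prim Z))) {0..R}"
      by (rule cinner_has_integral[OF square_integrable_rep_L2 sq_prim[OF R0 Z]]) (use Z in \<open>simp add: form_domain_def\<close>)
    then have 4: "((\<lambda>x. rep_L2 f x * cnj (prim Z x)) has_integral cinner f (prim_L2 Z)) {0..R}"
      by (simp add: prim_L2_eq)
    have 5: "((\<lambda>x. S x * cnj (prim Z x) + H x * cnj (z x)) has_integral H R * cnj (prim Z R) - H 0 * cnj (prim Z 0)) {0..R}"
      using R by (intro product_rule_has_integral[of R] ACH dH AC_on_cnj prim_AC ae_derivative_cnj z(5)) auto
    have sum: "((\<lambda>x. trunc {0..R} g x * cnj (z x)
        - \<omega> * (w x * cnj (z x) - w x * cnj (cnj (r x) * prim Z x) - r x * prim W x * cnj (z x))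
        - of_real \<mu> * (prim W x * cnj (prim Z x)) + rep_L2 f x * cnj (prim Z x)
        - (S x * cnj (prim Z x) + H x * cnj (z x)))
      has_integral cinner G Z - \<omega> * form r W Z - of_real \<mu> * cinner (prim_L2 W) (prim_L2 Z) + cinner f (prim_L2 Z)
        - (H R * cnj (prim Z R) - H 0 * cnj (prim Z 0))) {0..R}" (is "(?F has_integral ?I) _")
      by (intro has_integral_diff has_integral_add has_integral_mult_right 1 2 3 4 5)
    obtain N where N: "negligible N" "\<And>x. x \<in> {0..} - N \<Longrightarrow> rep_L2 W x = w x"
      using rw by (auto simp: AE_lebesgue_on_negligible)
    have "?F x = 0" if "x \<in> {0..R} - N" for x
      using that N(2)[of x] by (simp add: trunc_def g_def S_def source_def algebra_simps)
    then have "(?F has_integral 0) {0..R}"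
      by (intro has_integral_spike[OF N(1) _ has_integral_0])
    from has_integral_unique[OF sum this] have "?I = 0" .
    then have "cinner G Z = \<omega> * form r W Z + of_real \<mu> * cinner (prim_L2 W) (prim_L2 Z) - cinner f (prim_L2 Z)"
      using Z R by (simp add: form_domain_def prim_neg algebra_simps)
    then have "inner G Z = real_form \<omega> \<mu> r W Z - inner f (prim_L2 Z)"
      by (simp add: real_form_def flip: Re_cinner)
    then show ?thesis using weak[OF Z] by simp
  qed
  then obtain c where c: "G = cscale c (chi R)" using du_Bois_Reymond[OF R Gb] by blast
  have "abs_L2 (trunc {0..R} g) = abs_L2 (\<lambda>x. c * trunc {0..R} (\<lambda>_. 1) x)"
    using c abs_L2_cscale[OF sq_trunc_1, of c R] by (simp add: G_def chi_def)
  then have "AE x in halfline. trunc {0..R} g x = c * trunc {0..R} (\<lambda>_. 1) x"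
    using abs_L2_eq_iff[OF sqt square_integrable_on_cmult[OF sq_trunc_1]] by blast
  with rw have "AE x in halfline. x \<le> R \<longrightarrow> \<omega> * (rep_L2 W x - r x * prim W x) + integral {0..x} S = c"
    using AE_space by eventually_elim (auto simp: trunc_def g_def H_def)
  then have "AE x in lebesgue_on {0..R}. \<omega> * (rep_L2 W x - r x * prim W x) + integral {0..x} S = c"
    by (auto simp: AE_restrict_space_iff elim!: eventually_mono)
  then show ?thesis unfolding strong_solution_def S_def by blast
qed

text \<open>The right-hand side is taken of the form \<open>prim F\<close> because it will itself be inserted into the form.\<close>

lemma minimal_operator_of_strong_solution:
  assumes r: "r \<in> L2_loc" and R: "R \<ge> 0" and W: "W \<in> form_domain R" and F: "F \<in> form_domain R"
    and \<omega>: "\<omega> \<noteq> 0" and sol: "strong_solution \<omega> \<mu> r R (prim_L2 F) W 0 0"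
  shows "\<exists>g. (prim_L2 W, g) \<in> minimal_operator r \<and> cscale \<omega> g + \<mu> *\<^sub>R prim_L2 W = prim_L2 F"
proof -
  define l where "l x = inverse \<omega> * (prim F x + (- of_real \<mu>) * prim W x)" for x
  have sql: "square_integrable_on l {0..}" unfolding l_def
    by (intro square_integrable_on_cmult square_integrable_on_add sq_prim[OF R] W F)
  have l0: "l x = 0" if "x > R" for x using that W F by (simp add: l_def form_domain_def)
  obtain w where w: "square_integrable_on w {0..}" "W = abs_L2 w" "\<And>x. x \<notin> {0..R} \<Longrightarrow> w x = 0"
    "\<And>x. prim W x = integral {0..x} w" "AE x in halfline. (prim W has_vector_derivative w x) (at x)"
    by (rule form_domainE[OF W], rule that)
  have rw: "AE x in halfline. rep_L2 W x = w x" by (rule AE_rep_form_domain[OF w(2,1)])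
  have rF: "AE x in halfline. rep_L2 (prim_L2 F) x = prim F x"
    by (rule AE_rep_form_domain[OF prim_L2_eq sq_prim[OF R F]])
  have "AE x in halfline. source \<omega> \<mu> r (prim_L2 F) W x = \<omega> * (r x * w x + l x)"
    using rw rF by eventually_elim (use \<omega> in \<open>simp add: source_def l_def field_simps\<close>)
  from integral_cong_ae_halfline[OF this]
  have int: "integral {0..x} (source \<omega> \<mu> r (prim_L2 F) W) = \<omega> * integral {0..x} (\<lambda>x. r x * w x + l x)" for x
    by simp
  have "(prim_L2 W, abs_L2 l) \<in> minimal_operator r"
  proof (rule minimal_operatorI[OF r R W w(1-3) sql l0])
    have rw': "AE x in lebesgue_on {0..R}. rep_L2 W x = w x" by (rule AE_halfline_on[OF rw]) simp
    show "AE x in lebesgue_on {0..R}. w x - r x * prim W x = - integral {0..x} (\<lambda>x. r x * w x + l x)"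
      using conjunct1[OF sol[unfolded strong_solution_def]] rw'
    proof eventually_elim
      case (elim x)
      then have "\<omega> * ((w x - r x * prim W x) + integral {0..x} (\<lambda>x. r x * w x + l x)) = 0"
        by (simp add: int distrib_left)
      then show ?case using \<omega> by (simp add: eq_neg_iff_add_eq_0)
    qed
    show "integral {0..R} (\<lambda>x. r x * w x + l x) = 0"
      using sol \<omega> by (simp add: strong_solution_def int)
  qed
  moreover have "cscale \<omega> (abs_L2 l) + \<mu> *\<^sub>R prim_L2 W = prim_L2 F"
  proof -
    have "cscale \<omega> (abs_L2 l) + \<mu> *\<^sub>R prim_L2 W = abs_L2 (\<lambda>x. \<omega> * l x + of_real \<mu> * prim W x)"
      unfolding scaleR_cscale prim_L2_eq
      by (simp add: abs_L2_cscale sql sq_prim[OF R W] abs_L2_add square_integrable_on_cmult)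
    also have "(\<lambda>x. \<omega> * l x + of_real \<mu> * prim W x) = prim F"
      using \<omega> by (simp add: l_def fun_eq_iff field_simps)
    finally show ?thesis by (simp add: prim_L2_eq)
  qed
  ultimately show ?thesis by blast
qed

section \<open>Density of the minimal domain\<close>

text \<open>The weight \<open>x(R - x)\<close>, which vanishes at both ends of the interval.\<close>

definition bump :: "real \<Rightarrow> real \<Rightarrow> complex" where "bump R x = of_real (x * (R - x))"

definition bump' :: "real \<Rightarrow> real \<Rightarrow> complex" where "bump' R x = of_real (R - 2 * x)"

lemma AC_bump: "AC_on a b (bump R)"
proof -
  have "AC_on a b (\<lambda>x. of_real x * (of_real R + (- 1) * of_real x))"
    by (intro AC_on_mult AC_on_add AC_on_const AC_on_complex_of_real)
  then show ?thesis by (simp add: bump_def[abs_def])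
qed

lemma AC_bump': "AC_on a b (bump' R)"
proof -
  have "AC_on a b (\<lambda>x. of_real R + (- 2) * of_real x)"
    by (intro AC_on_mult AC_on_add AC_on_const AC_on_complex_of_real)
  then show ?thesis by (simp add: bump'_def[abs_def])
qed

lemma bump_derivative: "(bump R has_vector_derivative bump' R x) (at x)"
  unfolding bump_def[abs_def] bump'_def
  by (rule has_vector_derivative_of_real) (auto intro!: derivative_eq_intros simp: algebra_simps)

lemma bump'_derivative: "((bump' R) has_vector_derivative of_real (- 2)) (at x)"
  unfolding bump'_def[abs_def]
  by (rule has_vector_derivative_of_real) (auto intro!: derivative_eq_intros)

lemma bump_bound: "x \<in> {0..R} \<Longrightarrow> norm (bump R x) \<le> R * R"
  by (auto simp: bump_def norm_mult abs_mult simp flip: of_real_mult intro!: mult_mono)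

lemma square_integrable_bump_mult:
  assumes "square_integrable_on f {0..R}"
  shows "square_integrable_on (\<lambda>x. bump R x * f x) {0..R}"
proof -
  have "square_integrable_on (\<lambda>x. f x * bump R x) {0..R}"
    by (rule square_integrable_on_bounded_mult[OF assms, of _ "R * R"])
      (auto intro: bump_bound continuous_imp_measurable_on_sets_lebesgue AC_on_continuous[OF AC_bump])
  then show ?thesis by (simp add: mult.commute)
qed

lemma L2_loc_bump': "(bump' R) \<in> L2_loc"
  unfolding L2_loc_def by (auto intro!: square_integrable_on_continuous AC_on_continuous[OF AC_bump'])

definition bump_part :: "real \<Rightarrow> L2 \<Rightarrow> L2" where
  "bump_part R W = abs_L2 (trunc {0..R} (\<lambda>x. bump R x * rep_L2 W x))"

text \<open>The derivative of \<open>x(R - x) y\<close>: multiplication by the weight, transferred to derivatives.\<close>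

definition cutoff :: "real \<Rightarrow> L2 \<Rightarrow> L2" where
  "cutoff R W = bump_part R W + times_prim (bump' R) W"

lemma sq_bump_part: "square_integrable_on (trunc {0..R} (\<lambda>x. bump R x * rep_L2 W x)) {0..}"
  by (intro square_integrable_trunc_on square_integrable_bump_mult square_integrable_rep_L2_on) auto

lemma bump_part_linear: "bump_part R (W + c *\<^sub>R Z) = bump_part R W + c *\<^sub>R bump_part R Z"
proof -
  define F where "F W = trunc {0..R} (\<lambda>x. bump R x * rep_L2 W x)" for W
  have sqF: "square_integrable_on (F W) {0..}" for W unfolding F_def by (rule sq_bump_part)
  have sq: "square_integrable_on (\<lambda>x. F W x + of_real c * F Z x) {0..}"
    by (intro square_integrable_on_add square_integrable_on_cmult sqF)
  have "bump_part R W + c *\<^sub>R bump_part R Z = abs_L2 (\<lambda>x. F W x + of_real c * F Z x)"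
    by (simp add: bump_part_def scaleR_cscale abs_L2_cscale[OF sqF] abs_L2_add[OF sqF square_integrable_on_cmult[OF sqF]] flip: F_def)
  also have "\<dots> = abs_L2 (F (W + c *\<^sub>R Z))"
  proof (subst abs_L2_eq_iff[OF sq sqF])
    show "AE x in halfline. F W x + of_real c * F Z x = F (W + c *\<^sub>R Z) x"
      using rep_L2_add[of W "c *\<^sub>R Z"] rep_L2_cscale[of "of_real c" Z]
    proof eventually_elim
      case (elim x)
      have "rep_L2 (W + c *\<^sub>R Z) x = rep_L2 W x + of_real c * rep_L2 Z x"
        using elim by (simp add: scaleR_cscale)
      then show ?case by (simp add: F_def trunc_def distrib_left)
    qed
  qed
  finally show ?thesis by (simp add: bump_part_def F_def)
qed

lemma bump_part_diff: "bump_part R (W - Z) = bump_part R W - bump_part R Z"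
  using bump_part_linear[of R W "-1" Z] by simp

lemma norm_bump_part: "R \<ge> 0 \<Longrightarrow> norm (bump_part R W) \<le> R * R * norm W"
proof -
  assume R: "R \<ge> 0"
  have "norm (abs_L2 (trunc {0..R} (\<lambda>x. bump R x * rep_L2 W x))) \<le> R * R * norm (abs_L2 (rep_L2 W))"
  proof (rule norm_abs_L2_mono[OF sq_bump_part square_integrable_rep_L2])
    show "norm (trunc {0..R} (\<lambda>x. bump R x * rep_L2 W x) x) \<le> R * R * norm (rep_L2 W x)" for x
      using bump_bound[of x R] R by (auto simp: trunc_def norm_mult intro!: mult_right_mono)
  qed (use R in auto)
  then show ?thesis by (simp add: bump_part_def)
qed

lemma times_prim_diff:
  assumes "r \<in> L2_loc" "R \<ge> 0" "W \<in> form_domain R" "Z \<in> form_domain R"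
  shows "times_prim r (W - Z) = times_prim r W - times_prim r Z"
  using times_prim_add[OF assms(1,2), of "W - Z" Z] assms by (simp add: form_domain_diff)

lemma tendsto_cutoff:
  assumes R: "R \<ge> 0" and X: "\<And>n. X n \<in> form_domain R" "W \<in> form_domain R" "X \<longlonglongrightarrow> W"
  shows "(\<lambda>n. cutoff R (X n)) \<longlonglongrightarrow> cutoff R W"
proof -
  define K where "K = R * R + sqrt R * loc_norm (bump' R) R"
  have "(\<lambda>n. cutoff R (X n) - cutoff R W) \<longlonglongrightarrow> 0"
  proof (rule Lim_null_comparison)
    have "norm (cutoff R (X n) - cutoff R W) \<le> K * norm (X n - W)" for n
    proof -
      have "cutoff R (X n) - cutoff R W = bump_part R (X n - W) + times_prim (bump' R) (X n - W)"
        by (simp add: cutoff_def bump_part_diff times_prim_diff[OF L2_loc_bump' R X(1) X(2)])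
      then have "norm (cutoff R (X n) - cutoff R W) \<le> norm (bump_part R (X n - W)) + norm (times_prim (bump' R) (X n - W))"
        by (simp only: norm_triangle_ineq)
      also have "\<dots> \<le> R * R * norm (X n - W) + sqrt R * norm (X n - W) * loc_norm (bump' R) R"
        by (intro add_mono norm_bump_part R norm_times_prim_le_norm L2_loc_bump' form_domain_diff X)
      finally show ?thesis by (simp add: K_def algebra_simps)
    qed
    then show "\<forall>\<^sub>F n in sequentially. norm (cutoff R (X n) - cutoff R W) \<le> K * norm (X n - W)"
      by (rule always_eventually[OF allI])
    have "(\<lambda>n. X n - W) \<longlonglongrightarrow> 0" using X(3) by (simp add: LIM_zero)
    then show "(\<lambda>n. K * norm (X n - W)) \<longlonglongrightarrow> 0" by (intro tendsto_mult_right_zero tendsto_norm_zero)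
  qed
  then show ?thesis by (simp add: LIM_zero_iff)
qed

lemma cutoff_props:
  assumes R: "R \<ge> 0" and W: "W \<in> form_domain R"
    and w: "square_integrable_on w {0..}" "W = abs_L2 w" "\<forall>x. x \<notin> {0..R} \<longrightarrow> w x = 0"
  defines "v \<equiv> \<lambda>x. bump R x * w x + bump' R x * prim W x"
  shows "square_integrable_on v {0..}" "cutoff R W = abs_L2 v" "\<And>x. x \<notin> {0..R} \<Longrightarrow> v x = 0"
    and "\<And>x. x \<in> {0..R} \<Longrightarrow> prim (cutoff R W) x = bump R x * prim W x"
    and "cutoff R W \<in> form_domain R"
proof -
  have rw: "AE x in halfline. rep_L2 W x = w x" by (rule AE_rep_form_domain[OF w(2,1)])
  have t: "trunc {0..R} (\<lambda>x. bump R x * w x) = (\<lambda>x. bump R x * w x)"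
    using w(3) by (auto simp: trunc_def)
  have sq1: "square_integrable_on (\<lambda>x. bump R x * w x) {0..}"
    using square_integrable_trunc_on[OF square_integrable_bump_mult[OF square_integrable_on_subset[OF w(1)]], of R]
    by (auto simp: t)
  have sq2: "square_integrable_on (\<lambda>x. bump' R x * prim W x) {0..}"
    by (rule sq_times_prim[OF L2_loc_bump' R W])
  show sqv: "square_integrable_on v {0..}" unfolding v_def by (rule square_integrable_on_add[OF sq1 sq2])
  have "bump_part R W = abs_L2 (\<lambda>x. bump R x * w x)"
    unfolding bump_part_def
  proof (subst abs_L2_eq_iff[OF sq_bump_part sq1])
    show "AE x in halfline. trunc {0..R} (\<lambda>x. bump R x * rep_L2 W x) x = bump R x * w x"
      using rw by eventually_elim (use w(3) in \<open>auto simp: trunc_def\<close>)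
  qed
  then show cv: "cutoff R W = abs_L2 v"
    unfolding cutoff_def times_prim_def v_def using abs_L2_add[OF sq1 sq2] by simp
  show v0: "v x = 0" if "x \<notin> {0..R}" for x
    using that w(3) W prim_neg[of x W] by (auto simp: v_def form_domain_def)
  have dW: "AE x in halfline. (prim W has_vector_derivative w x) (at x)"
    using prim_ae_derivative[of W] rw by eventually_elim simp
  have int: "(v has_integral bump R x * prim W x - bump R 0 * prim W 0) {0..x}" if "x \<ge> 0" for x
  proof -
    have "((\<lambda>x. bump' R x * prim W x + bump R x * w x) has_integral bump R x * prim W x - bump R 0 * prim W 0) {0..x}"
      using that by (intro product_rule_has_integral[of x] AC_bump prim_AC dW AE_I2 bump_derivative) auto
    then show ?thesis by (simp add: v_def[abs_def] add.commute)
  qed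
  have pv: "prim (cutoff R W) x = bump R x * prim W x" if "x \<ge> 0" for x
    unfolding cv prim_abs_L2[OF sqv] using int[OF that] by (simp add: integral_unique prim_neg)
  then show "\<And>x. x \<in> {0..R} \<Longrightarrow> prim (cutoff R W) x = bump R x * prim W x" by simp
  show "cutoff R W \<in> form_domain R" using pv W R by (auto simp: form_domain_def)
qed

lemma cutoff_form_domain:
  assumes R: "R \<ge> 0" and W: "W \<in> form_domain R"
  shows "cutoff R W \<in> form_domain R"
proof -
  obtain w where w: "square_integrable_on w {0..}" "W = abs_L2 w" "\<And>x. x \<notin> {0..R} \<Longrightarrow> w x = 0"
    "\<And>x. prim W x = integral {0..x} w" "AE x in halfline. (prim W has_vector_derivative w x) (at x)"
    by (rule form_domainE[OF W], rule that)
  then show ?thesis using cutoff_props(5)[OF R W w(1,2)] by blast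
qed

text \<open>For \<open>q = x(R - x)\<close>, integration by parts gives
  \<open>Re \<integral> y' cnj (q y)' = \<integral> q \<bar>y'\<bar>\<^sup>2 - \<integral> q'' \<bar>y\<bar>\<^sup>2 / 2\<close>, and \<open>q'' = - 2\<close>.\<close>

lemma cutoff_positive:
  assumes R: "R \<ge> 0" and X: "X \<in> form_domain R" and orth: "inner X (cutoff R X) = 0"
  shows "X = 0"
proof -
  obtain w where w: "square_integrable_on w {0..}" "X = abs_L2 w" "\<And>x. x \<notin> {0..R} \<Longrightarrow> w x = 0"
    "\<And>x. prim X x = integral {0..x} w" "AE x in halfline. (prim X has_vector_derivative w x) (at x)"
    by (rule form_domainE[OF X], rule that)
  define v where "v = (\<lambda>x. bump R x * w x + bump' R x * prim X x)"
  have w3: "\<forall>x. x \<notin> {0..R} \<longrightarrow> w x = 0" using w(3) by blast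
  note v = cutoff_props[OF R X w(1,2) w3, folded v_def]
  have "((\<lambda>x. w x * cnj (v x)) has_integral cinner (abs_L2 w) (abs_L2 v)) {0..R}"
    by (rule cinner_has_integral[OF w(1) v(1)]) (use w(3) in auto)
  moreover have "cinner (abs_L2 w) (abs_L2 v) = cinner X (cutoff R X)"
    by (simp only: v(2) w(2)[symmetric])
  ultimately have 1: "((\<lambda>x. w x * cnj (v x)) has_integral cinner X (cutoff R X)) {0..R}" by simp
  have 1: "((\<lambda>x. Re (w x * cnj (v x))) has_integral 0) {0..R}"
    using has_integral_linear[OF 1 bounded_linear_Re] orth by (simp add: o_def Re_cinner)
  have "((\<lambda>x. prim X x * cnj (prim X x)) has_integral cinner (prim_L2 X) (prim_L2 X)) {0..R}"
    unfolding prim_L2_eq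
    by (rule cinner_has_integral[OF sq_prim[OF R X] sq_prim[OF R X]]) (use X in \<open>simp add: form_domain_def\<close>)
  from has_integral_linear[OF this bounded_linear_Re]
  have 2: "((\<lambda>x. Re (prim X x * cnj (prim X x))) has_integral (norm (prim_L2 X))\<^sup>2) {0..R}"
    by (simp add: o_def cinner_self)
  have d: "AE x in halfline. ((\<lambda>x. bump' R x * prim X x) has_vector_derivative
      (bump' R x * w x + of_real (- 2) * prim X x)) (at x)"
    using w(5) by eventually_elim (rule has_vector_derivative_mult[OF bump'_derivative])
  have "((\<lambda>x. (bump' R x * w x + of_real (- 2) * prim X x) * cnj (prim X x) + (bump' R x * prim X x) * cnj (w x))
     has_integral (bump' R R * prim X R) * cnj (prim X R) - (bump' R 0 * prim X 0) * cnj (prim X 0)) {0..R}"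
    using R by (intro product_rule_has_integral[of R] AC_on_mult AC_bump' prim_AC AC_on_cnj ae_derivative_cnj w(5) d) auto
  from has_integral_linear[OF this bounded_linear_Re]
  have 3: "((\<lambda>x. Re ((bump' R x * w x + of_real (- 2) * prim X x) * cnj (prim X x) + (bump' R x * prim X x) * cnj (w x)))
     has_integral 0) {0..R}"
    by (simp add: o_def prim_neg X[unfolded form_domain_def, simplified])
  have "((\<lambda>x. 2 * Re (w x * cnj (v x)) - 2 * Re (prim X x * cnj (prim X x))
      - Re ((bump' R x * w x + of_real (- 2) * prim X x) * cnj (prim X x) + (bump' R x * prim X x) * cnj (w x)))
      has_integral 2 * 0 - 2 * (norm (prim_L2 X))\<^sup>2 - 0) {0..R}"
    by (intro has_integral_diff has_integral_mult_right 1 2 3)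
  moreover have "0 \<le> 2 * Re (w x * cnj (v x)) - 2 * Re (prim X x * cnj (prim X x))
      - Re ((bump' R x * w x + of_real (- 2) * prim X x) * cnj (prim X x) + (bump' R x * prim X x) * cnj (w x))"
    if x: "x \<in> {0..R}" for x
  proof -
    have "2 * Re (w x * cnj (v x)) - 2 * Re (prim X x * cnj (prim X x))
      - Re ((bump' R x * w x + of_real (- 2) * prim X x) * cnj (prim X x) + (bump' R x * prim X x) * cnj (w x))
      = 2 * (x * (R - x)) * ((Re (w x))\<^sup>2 + (Im (w x))\<^sup>2)"
      by (simp add: v_def bump_def bump'_def power2_eq_square algebra_simps)
    also have "\<dots> \<ge> 0" using x by (intro mult_nonneg_nonneg) auto
    finally show ?thesis .
  qed
  ultimately have "0 \<le> 2 * 0 - 2 * (norm (prim_L2 X))\<^sup>2 - 0" by (rule has_integral_nonneg)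
  then have "prim_L2 X = 0" by simp
  then show ?thesis by (rule prim_L2_eq_zero[OF R X])
qed

text \<open>The quasi-derivative of \<open>q y\<close> is $q y^{[1]} + q' y$. It vanishes at both ends, because \<open>q\<close> and \<open>y\<close> do,
  whatever the boundary values of $y^{[1]}$ are. Thus a Dirichlet solution is pushed into the domain of the minimal
  operator.\<close>

lemma cutoff_strong_solution:
  assumes r: "r \<in> L2_loc" and R: "R \<ge> 0" and W: "W \<in> form_domain R"
    and sol: "strong_solution 1 \<mu> r R f W c d"
  shows "\<exists>g. (prim_L2 (cutoff R W), g) \<in> minimal_operator r"
proof -
  obtain w where w: "square_integrable_on w {0..}" "W = abs_L2 w" "\<And>x. x \<notin> {0..R} \<Longrightarrow> w x = 0"
    "\<And>x. prim W x = integral {0..x} w" "AE x in halfline. (prim W has_vector_derivative w x) (at x)"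
    by (rule form_domainE[OF W], rule that)
  have rw: "AE x in halfline. rep_L2 W x = w x" by (rule AE_rep_form_domain[OF w(2,1)])
  define v where "v = (\<lambda>x. bump R x * w x + bump' R x * prim W x)"
  have w3: "\<forall>x. x \<notin> {0..R} \<longrightarrow> w x = 0" using w(3) by blast
  note v = cutoff_props[OF R W w(1,2) w3, folded v_def]
  define S where "S = source 1 \<mu> r f W"
  define u where "u x = c + (- 1) * (0 + integral {0..x} S)" for x
  have ACu: "AC_on 0 R u" unfolding u_def S_def
    by (intro AC_on_add AC_on_const AC_on_mult source_AC[OF r])
  have du: "AE x in halfline. (u has_vector_derivative - S x) (at x)"
    using source_ae_derivative[OF r, of 0 1 \<mu> f W]
    by eventually_elim (auto simp: u_def[abs_def] S_def intro!: derivative_eq_intros)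
  have wu: "AE x in lebesgue_on {0..R}. w x - r x * prim W x = u x"
    using conjunct1[OF sol[unfolded strong_solution_def]] AE_halfline_on[OF rw order_refl, of R]
    by eventually_elim (auto simp: u_def S_def algebra_simps)
  \<comment> \<open>the quasi-derivative of the weighted function and its derivative\<close>
  define U where "U x = bump R x * u x + bump' R x * prim W x" for x
  define U' where "U' x = (bump' R x * u x + bump R x * (- S x)) + (of_real (- 2) * prim W x + bump' R x * w x)" for x
  have intU: "(U' has_integral U x - U 0) {0..x}" if x: "x \<in> {0..R}" for x
  proof (rule AC_on_has_integral_ae[of R])
    show "AC_on 0 R U" unfolding U_def by (intro AC_on_add AC_on_mult AC_bump AC_bump' prim_AC ACu)
    show "AE x in halfline. (U has_vector_derivative U' x) (at x)"
      using du w(5)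
    proof eventually_elim
      case (elim x)
      have "((\<lambda>x. bump R x * u x) has_vector_derivative bump R x * (- S x) + bump' R x * u x) (at x)"
        by (rule has_vector_derivative_mult[OF bump_derivative elim(1)])
      moreover have "((\<lambda>x. bump' R x * prim W x) has_vector_derivative bump' R x * w x + of_real (- 2) * prim W x) (at x)"
        by (rule has_vector_derivative_mult[OF bump'_derivative elim(2)])
      ultimately have "((\<lambda>x. bump R x * u x + bump' R x * prim W x) has_vector_derivative
          (bump R x * (- S x) + bump' R x * u x) + (bump' R x * w x + of_real (- 2) * prim W x)) (at x)"
        by (rule has_vector_derivative_add)
      then show ?case by (simp only: U_def[abs_def] U'_def add.commute)
    qed
  qed (use x in auto)
  have U0: "U 0 = 0" by (simp add: U_def bump_def prim_neg)
  define l0 where "l0 x = (- 2) * (bump' R x * rep_L2 W x) + (bump R x * (rep_L2 f x + (- of_real \<mu>) * prim W x) + 2 * prim W x)" for x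
  define l where "l = trunc {0..R} l0"
  have sql: "square_integrable_on l {0..}" unfolding l_def
  proof (rule square_integrable_trunc_on)
    have "square_integrable_on (\<lambda>x. rep_L2 W x * bump' R x) {0..R}"
    proof (rule square_integrable_on_bounded_mult[OF square_integrable_rep_L2_on[OF order_refl], where B = R])
      show "bump' R \<in> borel_measurable (lebesgue_on {0..R})"
        by (rule continuous_imp_measurable_on_sets_lebesgue[OF AC_on_continuous[OF AC_bump']]) auto
      show "norm (bump' R x) \<le> R" if "x \<in> {0..R}" for x
        using that unfolding bump'_def norm_of_real by auto
    qed auto
    then have "square_integrable_on (\<lambda>x. bump' R x * rep_L2 W x) {0..R}" by (simp add: mult.commute)
    then show "square_integrable_on l0 {0..R}" unfolding l0_def
      by (intro square_integrable_on_add[OF square_integrable_on_cmult] square_integrable_bump_mult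
          square_integrable_on_add[OF square_integrable_bump_mult] square_integrable_on_add[OF square_integrable_rep_L2_on]
          square_integrable_on_cmult square_integrable_on_continuous[OF AC_on_continuous[OF prim_AC]] order_refl)
  qed
  have intl: "integral {0..x} (\<lambda>x. r x * v x + l x) = - U x" if x: "x \<in> {0..R}" for x
  proof -
    obtain N where N: "negligible N" "\<And>x. x \<in> {0..R} - N \<Longrightarrow> w x - r x * prim W x = u x"
      using wu by (auto simp: AE_lebesgue_on_negligible)
    obtain N' where N': "negligible N'" "\<And>x. x \<in> {0..} - N' \<Longrightarrow> rep_L2 W x = w x"
      using rw by (auto simp: AE_lebesgue_on_negligible)
    have eq: "r t * v t + l t = - U' t" if t: "t \<in> {0..x} - (N \<union> N')" for t
    proof -
      have t1: "rep_L2 W t = w t" and t2: "u t = w t - r t * prim W t" and tR: "t \<in> {0..R}"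
        using N(2)[of t] N'(2)[of t] t x by auto
      show ?thesis using tR
        by (simp add: l_def trunc_def l0_def U'_def v_def S_def source_def t1 t2 algebra_simps)
    qed
    have "((\<lambda>x. - U' x) has_integral - (U x - U 0)) {0..x}" by (rule has_integral_neg[OF intU[OF x]])
    then have "((\<lambda>x. r x * v x + l x) has_integral - (U x - U 0)) {0..x}"
      by (rule has_integral_spike[of "N \<union> N'", rotated 2]) (use N N' eq in \<open>auto simp: negligible_Un\<close>)
    then show ?thesis by (simp add: integral_unique U0)
  qed
  have "(prim_L2 (cutoff R W), abs_L2 l) \<in> minimal_operator r"
  proof (rule minimal_operatorI[OF r R v(5) v(1,2) _ sql])
    show "v x = 0" if "x \<notin> {0..R}" for x using v(3)[OF that] by (simp add: v_def)
    show "AE x in lebesgue_on {0..R}. v x - r x * prim (cutoff R W) x = - integral {0..x} (\<lambda>x. r x * v x + l x)"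
      using wu AE_space
    proof eventually_elim
      case (elim x)
      then have x: "x \<in> {0..R}" by simp
      have "w x = u x + r x * prim W x" using elim(1) unfolding diff_eq_eq .
      then show ?case unfolding v(4)[OF x] intl[OF x] by (simp add: v_def U_def algebra_simps)
    qed
    show "integral {0..R} (\<lambda>x. r x * v x + l x) = 0"
      using intl[of R] R W by (simp add: U_def bump_def form_domain_def)
  qed (use R in \<open>auto simp: l_def trunc_def\<close>)
  then show ?thesis by blast
qed

text \<open>Dirichlet solutions are dense, and multiplication by the weight maps them into the domain of the minimal operator.
  As this multiplication is continuous, it remains to see that its range is dense; by strict positivity nothing is
  orthogonal to the range.\<close>

theorem minimal_domain_dense:
  assumes r: "r \<in> L2_loc" and R: "R > 0"
  shows "form_domain R \<subseteq> closure {W\<in>form_domain R. \<exists>g. (prim_L2 W, g) \<in> minimal_operator r}" (is "_ \<subseteq> closure ?D")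
proof -
  have R0: "R \<ge> 0" using R by simp
  obtain L where L: "L \<ge> 0" "\<And>W. W \<in> form_domain R \<Longrightarrow> 1 / 2 * (norm W)\<^sup>2 \<le> Re (1 * form r W W) + L * (norm (prim_L2 W))\<^sup>2"
    using garding[OF r R0, of 1] by auto
  have coer: "(1/2) * (norm W)\<^sup>2 \<le> real_form 1 L r W W" if "W \<in> form_domain R" for W
    using L(2)[OF that] by (simp add: real_form_def power2_norm_eq_inner)
  let ?A = "{W\<in>form_domain R. \<exists>f. \<forall>Z\<in>form_domain R. real_form 1 L r W Z = inner f (prim_L2 Z)}"
  have dense: "form_domain R \<subseteq> closure ?A"
    by (rule dirichlet_solutions_dense[OF r R0 _ coer]) auto
  have cutA: "cutoff R W \<in> ?D" if "W \<in> ?A" for W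
  proof -
    obtain f where W: "W \<in> form_domain R" and f: "\<And>Z. Z \<in> form_domain R \<Longrightarrow> real_form 1 L r W Z = inner f (prim_L2 Z)"
      using \<open>W \<in> ?A\<close> by blast
    obtain c d where "strong_solution 1 L r R f W c d" using weak_solution_regular[OF r R W f] by blast
    then obtain g where "(prim_L2 (cutoff R W), g) \<in> minimal_operator r"
      using cutoff_strong_solution[OF r R0 W] by blast
    moreover have "cutoff R W \<in> form_domain R"
      by (rule cutoff_form_domain[OF R0 W])
    ultimately show ?thesis by blast
  qed
  have cut: "cutoff R W \<in> closure ?D" if W: "W \<in> form_domain R" for W
  proof -
    obtain X where X: "\<And>n. X n \<in> ?A" "X \<longlonglongrightarrow> W" using subsetD[OF dense W] unfolding closure_sequential by blast
    have "(\<lambda>n. cutoff R (X n)) \<longlonglongrightarrow> cutoff R W" by (rule tendsto_cutoff[OF R0 _ W X(2)]) (use X(1) in auto)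
    then show ?thesis unfolding closure_sequential using cutA[OF X(1)] by (intro exI[of _ "\<lambda>n. cutoff R (X n)"]) auto
  qed
  have "form_domain R \<subseteq> closure (cutoff R ` form_domain R)"
  proof (rule subset_closure_if_orthogonal_trivial[OF _ _ subspace_form_domain closed_form_domain])
    have lin: "cutoff R (W + c *\<^sub>R Z) = cutoff R W + c *\<^sub>R cutoff R Z" if "W \<in> form_domain R" "Z \<in> form_domain R" for W Z c
      using that by (simp add: cutoff_def bump_part_linear times_prim_add[OF L2_loc_bump' R0] times_prim_scaleR[OF L2_loc_bump' R0]
          form_domain_scaleR scaleR_add_right)
    show "subspace (cutoff R ` form_domain R)" unfolding subspace_def
    proof (intro conjI ballI allI)
      have 0: "0 \<in> form_domain R" using subspace_0[OF subspace_form_domain] .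
      have c0: "cutoff R 0 = 0" using lin[OF 0 0, of "-1"] by simp
      then show "0 \<in> cutoff R ` form_domain R" using 0 by (metis imageI)
      fix x y c assume x: "x \<in> cutoff R ` form_domain R"
      then obtain W where W: "W \<in> form_domain R" "x = cutoff R W" by blast
      have "c *\<^sub>R x = cutoff R (c *\<^sub>R W)" using lin[OF 0 W(1), of c] c0 W(2) by simp
      then show "c *\<^sub>R x \<in> cutoff R ` form_domain R" using form_domain_scaleR[OF W(1)] by blast
      assume "y \<in> cutoff R ` form_domain R"
      then obtain Z where Z: "Z \<in> form_domain R" "y = cutoff R Z" by blast
      have "x + y = cutoff R (W + Z)" using lin[OF W(1) Z(1), of 1] W(2) Z(2) by simp
      then show "x + y \<in> cutoff R ` form_domain R" using form_domain_add[OF W(1) Z(1)] by blast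
    qed
    show "cutoff R ` form_domain R \<subseteq> form_domain R"
    proof clarify
      fix W assume W: "W \<in> form_domain R"
      show "cutoff R W \<in> form_domain R" by (rule cutoff_form_domain[OF R0 W])
    qed
    show "x = 0" if "x \<in> form_domain R" "\<And>z. z \<in> cutoff R ` form_domain R \<Longrightarrow> inner x z = 0" for x
      by (rule cutoff_positive[OF R0 that(1)]) (use that in auto)
  qed
  also have "\<dots> \<subseteq> closure ?D" by (rule closure_minimal) (use cut in auto)
  finally show ?thesis .
qed

section \<open>Potentials of bounded local oscillation\<close>

lemma integral_half_grid:
  fixes f :: "real \<Rightarrow> 'a::banach"
  assumes "f integrable_on {0..real n / 2}"
  shows "integral {0..real n / 2} f = (\<Sum>k<n. integral {real k / 2..real (Suc k) / 2} f)"
  using assms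
proof (induction n)
  case (Suc n)
  have "f integrable_on {0..real n / 2}"
    by (rule integrable_on_subinterval[OF Suc.prems]) auto
  moreover have "integral {0..real n / 2} f + integral {real n / 2..real (Suc n) / 2} f = integral {0..real (Suc n) / 2} f"
    by (rule Henstock_Kurzweil_Integration.integral_combine[OF _ _ Suc.prems]) auto
  ultimately show ?case using Suc.IH by simp
qed simp

lemma sum_by_parts:
  fixes c :: "nat \<Rightarrow> complex" and a :: "nat \<Rightarrow> complex"
  assumes "a 0 = 0"
  shows "(\<Sum>k<n. c k * (a (Suc k) - a k)) = c n * a n + (\<Sum>k<n. (c k - c (Suc k)) * a (Suc k))"
  using assms by (induction n) (simp_all add: algebra_simps)

text \<open>If every constant were worse than the bound \<open>M + 1\<close>, the constants \<open>\<sigma> \<xi>\<close> would be too, and integrating over \<open>\<xi>\<close>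
  would contradict the bound for the double integral.\<close>

lemma local_mean:
  assumes \<sigma>: "\<sigma> \<in> L2_loc" and x: "x \<ge> 0"
    and M: "(LINT \<xi>|lebesgue_on {x..x+1}. LINT \<eta>|lebesgue_on {x..x+1}. (norm (\<sigma> \<xi> - \<sigma> \<eta>))\<^sup>2) \<le> M"
  shows "\<exists>c. (LINT \<eta>|lebesgue_on {x..x+1}. (norm (\<sigma> \<eta> - c))\<^sup>2) \<le> M + 1"
proof (rule ccontr)
  assume neg: "\<not> ?thesis"
  let ?J = "lebesgue_on {x..x+1}"
  have sq: "square_integrable_on \<sigma> {x..x+1}"
    by (rule square_integrable_on_subset[OF L2_locD[OF \<sigma>, of "x+1"]]) (use x in auto)
  have i1: "integrable ?J \<sigma>" by (rule square_integrable_imp_integrable[OF sq])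
  have i2: "integrable ?J (\<lambda>\<eta>. (norm (\<sigma> \<eta>))\<^sup>2)" using sq by (simp add: square_integrable_on_def)
  define m where "m = (LINT \<eta>|?J. \<sigma> \<eta>)"
  define q where "q = (LINT \<eta>|?J. (norm (\<sigma> \<eta>))\<^sup>2)"
  define g where "g \<xi> = (LINT \<eta>|?J. (norm (\<sigma> \<xi> - \<sigma> \<eta>))\<^sup>2)" for \<xi>
  have ptw: "(norm (a - b))\<^sup>2 = (norm a)\<^sup>2 - 2 * Re (cnj a * b) + (norm b)\<^sup>2" for a b :: complex
    unfolding cmod_power2 by (simp add: power2_eq_square algebra_simps)
  have geq: "g \<xi> = (norm (\<sigma> \<xi>))\<^sup>2 - 2 * Re (cnj (\<sigma> \<xi>) * m) + q" for \<xi>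
  proof -
    have "g \<xi> = (LINT \<eta>|?J. (norm (\<sigma> \<xi>))\<^sup>2 - 2 * Re (cnj (\<sigma> \<xi>) * \<sigma> \<eta>) + (norm (\<sigma> \<eta>))\<^sup>2)"
      by (simp add: g_def ptw)
    also have "\<dots> = (LINT \<eta>|?J. (norm (\<sigma> \<xi>))\<^sup>2) - 2 * (LINT \<eta>|?J. Re (cnj (\<sigma> \<xi>) * \<sigma> \<eta>)) + q"
      using i1 i2 by (simp add: q_def)
    also have "(LINT \<eta>|?J. Re (cnj (\<sigma> \<xi>) * \<sigma> \<eta>)) = Re (cnj (\<sigma> \<xi>) * m)"
      unfolding m_def using i1 by (subst integral_Re) auto
    finally show ?thesis by (simp add: measure_restrict_space)
  qed
  have gi: "integrable ?J g"
    unfolding geq[abs_def] using i1 i2 by (intro Bochner_Integration.integrable_add Bochner_Integration.integrable_diff) auto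
  have "g \<xi> \<ge> M + 1" for \<xi>
  proof -
    have "\<not> (LINT \<eta>|?J. (norm (\<sigma> \<eta> - \<sigma> \<xi>))\<^sup>2) \<le> M + 1" using neg by blast
    moreover have "(\<lambda>\<eta>. (norm (\<sigma> \<eta> - \<sigma> \<xi>))\<^sup>2) = (\<lambda>\<eta>. (norm (\<sigma> \<xi> - \<sigma> \<eta>))\<^sup>2)"
      by (simp add: norm_minus_commute)
    ultimately show ?thesis by (simp add: g_def)
  qed
  then have "(LINT \<xi>|?J. M + 1) \<le> (LINT \<xi>|?J. g \<xi>)"
    by (intro integral_mono gi) auto
  then show False using M by (simp add: g_def measure_restrict_space)
qed

lemma square_integrable_cnj: "square_integrable_on f {a..b} \<Longrightarrow> square_integrable_on (\<lambda>x. cnj (f x)) {a..b}"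
  unfolding square_integrable_on_def
  by (auto intro: borel_measurable_continuous_on[where f = cnj] continuous_intros)

lemma square_integrable_mult_continuous:
  assumes "square_integrable_on f {a..b}" "continuous_on {a..b} g"
  shows "square_integrable_on (\<lambda>x. f x * g x) {a..b}"
proof -
  have "bounded (g ` {a..b})" by (intro compact_imp_bounded compact_continuous_image assms) simp
  then obtain B where "\<forall>z\<in>g ` {a..b}. norm z \<le> B" unfolding bounded_iff by (elim exE)
  then show ?thesis
    by (intro square_integrable_on_bounded_mult[OF assms(1), where B = B])
      (auto intro: continuous_imp_measurable_on_sets_lebesgue assms(2))
qed

text \<open>Estimates on one cell of length \<open>1/2\<close>, with the function \<open>Y\<close> and its derivative \<open>w\<close>.\<close>

context
  fixes \<sigma> w Y :: "real \<Rightarrow> complex" and a :: real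
  assumes a: "a \<ge> 0"
    and w: "square_integrable_on w {a..a+1/2}" and Y: "AC_on 0 (a+1/2) Y"
    and dY: "AE x in halfline. (Y has_vector_derivative w x) (at x)"
begin

abbreviation (input) "J \<equiv> {a..a+1/2}"

lemma cell_integrable:
  "(\<lambda>x. (norm (w x))\<^sup>2) integrable_on J" "(\<lambda>x. (norm (Y x))\<^sup>2) integrable_on J"
  "continuous_on J Y" "(\<lambda>x. w x * cnj (Y x) + Y x * cnj (w x)) integrable_on J"
proof -
  show c: "continuous_on J Y" using AC_on_continuous[OF Y] by (rule continuous_on_subset) (use a in auto)
  show "(\<lambda>x. (norm (w x))\<^sup>2) integrable_on J"
    using w by (intro integrable_on_lebesgue_on) (auto simp: square_integrable_on_def)
  show "(\<lambda>x. (norm (Y x))\<^sup>2) integrable_on J"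
    by (intro integrable_continuous_real continuous_intros c)
  have sY: "square_integrable_on Y J" by (rule square_integrable_on_continuous[OF c])
  show "(\<lambda>x. w x * cnj (Y x) + Y x * cnj (w x)) integrable_on J"
    by (intro integrable_on_lebesgue_on Bochner_Integration.integrable_add square_integrable_mult_integrable
        square_integrable_cnj w sY) auto
qed

lemma cell_product_rule:
  assumes "a \<le> s" "s \<le> t" "t \<le> a + 1/2"
  shows "((\<lambda>x. w x * cnj (Y x) + Y x * cnj (w x)) has_integral of_real ((norm (Y t))\<^sup>2) - of_real ((norm (Y s))\<^sup>2)) {s..t}"
  using product_rule_has_integral[OF Y dY AC_on_cnj[OF Y] ae_derivative_cnj[OF dY], of s t] assms a
  by (simp only: complex_norm_square)

text \<open>\<open>\<bar>Y\<bar>\<^sup>2\<close> varies on the cell by at most \<open>\<integral> 2 \<bar>w\<bar> \<bar>Y\<bar>\<close>; averaging over the cell, whose length is \<open>1/2\<close>,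
  produces the factor \<open>2\<close>.\<close>

lemma cell_sup_bound:
  assumes x: "x \<in> J" and \<theta>: "\<theta> > 0"
  shows "(norm (Y x))\<^sup>2 \<le> \<theta> * integral J (\<lambda>x. (norm (w x))\<^sup>2) + (2 + 1/\<theta>) * integral J (\<lambda>x. (norm (Y x))\<^sup>2)"
proof -
  define A where "A = integral J (\<lambda>x. (norm (w x))\<^sup>2)"
  define T where "T = integral J (\<lambda>x. (norm (Y x))\<^sup>2)"
  define E where "E = \<theta> * A + (1/\<theta>) * T"
  let ?p = "\<lambda>x. w x * cnj (Y x) + Y x * cnj (w x)"
  let ?b = "\<lambda>x. \<theta> * (norm (w x))\<^sup>2 + (1/\<theta>) * (norm (Y x))\<^sup>2"
  have bi: "?b integrable_on J"
    by (intro integrable_add integrable_on_mult_right cell_integrable)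
  have Eeq: "integral J ?b = E"
    unfolding E_def A_def T_def
    by (subst Henstock_Kurzweil_Integration.integral_add[OF integrable_on_mult_right[OF cell_integrable(1)] integrable_on_mult_right[OF cell_integrable(2)]]) simp
  have pb: "norm (?p x) \<le> ?b x" for x
  proof -
    have "norm (?p x) \<le> 2 * (norm (w x) * norm (Y x))"
      using norm_triangle_ineq[of "w x * cnj (Y x)" "Y x * cnj (w x)"] by (simp add: norm_mult mult.commute)
    moreover have "0 \<le> (\<theta> * norm (w x) - norm (Y x))\<^sup>2 / \<theta>" using \<theta> by simp
    then have "2 * (norm (w x) * norm (Y x)) \<le> ?b x"
      using \<theta> by (simp add: power2_eq_square field_simps)
    ultimately show ?thesis by linarith
  qed
  have diff: "\<bar>(norm (Y t))\<^sup>2 - (norm (Y s))\<^sup>2\<bar> \<le> E" if st: "a \<le> s" "s \<le> t" "t \<le> a + 1/2" for s t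
  proof -
    have sub: "{s..t} \<subseteq> J" using st by auto
    have "norm (integral {s..t} ?p) \<le> integral {s..t} ?b"
      by (rule integral_norm_bound_integral)
        (use pb integrable_on_subinterval[OF cell_integrable(4) sub] integrable_on_subinterval[OF bi sub] in auto)
    also have "\<dots> \<le> integral J ?b"
      by (rule integral_subset_le[OF sub]) (use integrable_on_subinterval[OF bi sub] bi \<theta> in auto)
    finally have "norm (integral {s..t} ?p) \<le> E" unfolding Eeq .
    moreover have "integral {s..t} ?p = of_real ((norm (Y t))\<^sup>2 - (norm (Y s))\<^sup>2)"
      using cell_product_rule[OF st] by (simp add: integral_unique)
    ultimately show ?thesis by (simp only: norm_of_real)
  qed
  have ptw: "(norm (Y x))\<^sup>2 \<le> (norm (Y t))\<^sup>2 + E" if t: "t \<in> J" for t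
    using diff[of x t] diff[of t x] x t by (cases "x \<le> t") (auto simp: abs_le_iff)
  have "integral J (\<lambda>t. (norm (Y x))\<^sup>2) \<le> integral J (\<lambda>t. (norm (Y t))\<^sup>2 + E)"
    by (rule integral_le) (use ptw in \<open>auto intro!: integrable_add cell_integrable\<close>)
  also have "\<dots> = T + E / 2"
    by (subst Henstock_Kurzweil_Integration.integral_add) (auto simp: T_def intro: cell_integrable)
  finally have "(norm (Y x))\<^sup>2 \<le> 2 * T + E" by simp
  then show ?thesis by (simp add: E_def A_def T_def algebra_simps)
qed

lemma cell_potential_bound:
  assumes \<sigma>: "square_integrable_on \<sigma> J" and c: "integral J (\<lambda>x. (norm (\<sigma> x - c))\<^sup>2) \<le> M"
    and S: "\<And>x. x \<in> J \<Longrightarrow> (norm (Y x))\<^sup>2 \<le> S" and \<delta>: "\<delta> > 0"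
  shows "norm (integral J (\<lambda>x. (\<sigma> x - c) * (w x * cnj (Y x) + Y x * cnj (w x))))
    \<le> \<delta> * integral J (\<lambda>x. (norm (w x))\<^sup>2) + M / \<delta> * S"
proof -
  let ?p = "\<lambda>x. (\<sigma> x - c) * (w x * cnj (Y x) + Y x * cnj (w x))"
  have "(norm (Y a))\<^sup>2 \<le> S" by (rule S) simp
  then have S0: "S \<ge> 0" using zero_le_power2[of "norm (Y a)"] by linarith
  have sc: "square_integrable_on (\<lambda>x. \<sigma> x - c) J"
    using square_integrable_on_add[OF \<sigma> square_integrable_on_continuous[of a "a+1/2" "\<lambda>_. - c"]] by simp
  have sci: "(\<lambda>x. (norm (\<sigma> x - c))\<^sup>2) integrable_on J"
    using sc by (intro integrable_on_lebesgue_on) (auto simp: square_integrable_on_def)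
  have pi: "?p integrable_on J"
  proof -
    have "square_integrable_on (\<lambda>x. (\<sigma> x - c) * cnj (Y x)) J" "square_integrable_on (\<lambda>x. (\<sigma> x - c) * Y x) J"
      by (intro square_integrable_mult_continuous sc continuous_intros cell_integrable)+
    then have "integrable (lebesgue_on J) (\<lambda>x. ((\<sigma> x - c) * cnj (Y x)) * w x + ((\<sigma> x - c) * Y x) * cnj (w x))"
      by (intro Bochner_Integration.integrable_add square_integrable_mult_integrable square_integrable_cnj w)
    then have "(\<lambda>x. ((\<sigma> x - c) * cnj (Y x)) * w x + ((\<sigma> x - c) * Y x) * cnj (w x)) integrable_on J"
      by (rule integrable_on_lebesgue_on) auto
    then show ?thesis by (simp add: algebra_simps)
  qed
  have "norm (integral J ?p) \<le> integral J (\<lambda>x. \<delta> * (norm (w x))\<^sup>2 + (S/\<delta>) * (norm (\<sigma> x - c))\<^sup>2)"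
  proof (rule integral_norm_bound_integral[OF pi])
    show "(\<lambda>x. \<delta> * (norm (w x))\<^sup>2 + (S/\<delta>) * (norm (\<sigma> x - c))\<^sup>2) integrable_on J"
      by (intro integrable_add integrable_on_mult_right cell_integrable sci)
    fix x assume x: "x \<in> J"
    have "norm (?p x) \<le> norm (\<sigma> x - c) * (2 * (norm (w x) * norm (Y x)))"
      unfolding norm_mult[of "\<sigma> x - c"]
      using norm_triangle_ineq[of "w x * cnj (Y x)" "Y x * cnj (w x)"]
      by (intro mult_left_mono) (simp_all add: norm_mult mult.commute)
    also have "\<dots> \<le> \<delta> * (norm (w x))\<^sup>2 + (norm (\<sigma> x - c))\<^sup>2 * (norm (Y x))\<^sup>2 / \<delta>"
    proof -
      have "0 \<le> (\<delta> * norm (w x) - norm (\<sigma> x - c) * norm (Y x))\<^sup>2 / \<delta>" using \<delta> by simp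
      then show ?thesis using \<delta> by (simp add: power2_eq_square field_simps)
    qed
    also have "(norm (\<sigma> x - c))\<^sup>2 * (norm (Y x))\<^sup>2 / \<delta> \<le> (norm (\<sigma> x - c))\<^sup>2 * S / \<delta>"
      using S[OF x] \<delta> by (intro divide_right_mono mult_left_mono) auto
    finally show "norm (?p x) \<le> \<delta> * (norm (w x))\<^sup>2 + (S/\<delta>) * (norm (\<sigma> x - c))\<^sup>2" by (simp add: mult.commute)
  qed
  also have "\<dots> = \<delta> * integral J (\<lambda>x. (norm (w x))\<^sup>2) + (S/\<delta>) * integral J (\<lambda>x. (norm (\<sigma> x - c))\<^sup>2)"
    by (subst Henstock_Kurzweil_Integration.integral_add[OF integrable_on_mult_right[OF cell_integrable(1)] integrable_on_mult_right[OF sci]]) simp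
  also have "(S/\<delta>) * integral J (\<lambda>x. (norm (\<sigma> x - c))\<^sup>2) \<le> (S/\<delta>) * M"
    using c S0 \<delta> by (intro mult_left_mono) auto
  finally show ?thesis by (simp add: mult.commute)
qed

end

text \<open>The form differs from \<open>\<bar>\<bar>W\<bar>\<bar>\<^sup>2\<close> by the integral of \<open>\<sigma> (\<bar>Y\<bar>\<^sup>2)'\<close>. On the \<open>k\<close>-th cell \<open>\<sigma>\<close> is replaced by a constant \<open>c k\<close>
  that approximates it on the twice as long interval from \<open>k/2\<close> to \<open>k/2 + 1\<close>. Neighbouring intervals
  overlap in a whole cell, which bounds the jumps of \<open>c\<close>; the constants contribute
  \<open>\<Sum>(c k - c (k + 1)) \<bar>Y\<bar>\<^sup>2\<close> after summation by parts, and the supremum bound on the cells controls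
  this sum by a small multiple of \<open>\<integral>\<bar>w\<bar>\<^sup>2\<close>.\<close>

theorem form_perturbation_bound:
  assumes \<sigma>: "\<sigma> \<in> L2_loc"
    and bdd: "bdd_above ((\<lambda>x. LINT \<xi>|lebesgue_on {x..x+1}. LINT \<eta>|lebesgue_on {x..x+1}. (norm (\<sigma> \<xi> - \<sigma> \<eta>))\<^sup>2) ` {0::real..})"
    and \<eta>: "\<eta> > 0"
  shows "\<exists>K\<ge>0. \<forall>R\<ge>0. \<forall>W\<in>form_domain R.
     norm (of_real ((norm W)\<^sup>2) - form \<sigma> W W) \<le> \<eta> * (norm W)\<^sup>2 + K * (norm (prim_L2 W))\<^sup>2"
proof -
  obtain M0 where M0: "\<And>x. x \<ge> 0 \<Longrightarrow> (LINT \<xi>|lebesgue_on {x..x+1}. LINT \<eta>|lebesgue_on {x..x+1}. (norm (\<sigma> \<xi> - \<sigma> \<eta>))\<^sup>2) \<le> M0"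
    using bdd unfolding bdd_above_def by auto
  define M where "M = M0 + 1"
  have "\<exists>c. (LINT \<eta>|lebesgue_on {x..x+1}. (norm (\<sigma> \<eta> - c))\<^sup>2) \<le> M" if "x \<ge> 0" for x
    unfolding M_def by (rule local_mean[OF \<sigma> that M0[OF that]])
  then have "\<exists>c. (LINT \<eta>|lebesgue_on {real k / 2..real k / 2 + 1}. (norm (\<sigma> \<eta> - c))\<^sup>2) \<le> M" for k :: nat by simp
  then obtain c where c: "\<And>k::nat. (LINT \<eta>|lebesgue_on {real k / 2..real k / 2 + 1}. (norm (\<sigma> \<eta> - c k))\<^sup>2) \<le> M" by metis
  have sq\<sigma>: "square_integrable_on \<sigma> {u..v}" if "u \<ge> 0" "u \<le> v" for u v
    by (rule square_integrable_on_subset[OF L2_locD[OF \<sigma>, of v]]) (use that in auto)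
  have ci: "integrable (lebesgue_on {u..v}) (\<lambda>x. (norm (\<sigma> x - d))\<^sup>2)" if "u \<ge> 0" "u \<le> v" for u v d
    using square_integrable_on_add[OF sq\<sigma>[OF that] square_integrable_on_continuous[of u v "\<lambda>_. - d"]]
    by (simp add: square_integrable_on_def)
  have cint: "(\<lambda>x. (norm (\<sigma> x - d))\<^sup>2) integrable_on {u..v}" if "u \<ge> 0" "u \<le> v" for u v d
    using ci[OF that] by (rule integrable_on_lebesgue_on) auto
  have cell: "integral {u..v} (\<lambda>x. (norm (\<sigma> x - c k))\<^sup>2) \<le> M" if "real k / 2 \<le> u" "u \<le> v" "v \<le> real k / 2 + 1" for u v k
  proof -
    have "integral {u..v} (\<lambda>x. (norm (\<sigma> x - c k))\<^sup>2) \<le> integral {real k / 2..real k / 2 + 1} (\<lambda>x. (norm (\<sigma> x - c k))\<^sup>2)"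
      by (rule integral_subset_le) (use that in \<open>auto intro!: cint\<close>)
    also have "\<dots> = (LINT x|lebesgue_on {real k / 2..real k / 2 + 1}. (norm (\<sigma> x - c k))\<^sup>2)"
      by (rule lebesgue_integral_eq_integral[symmetric]) (auto intro!: ci)
    also have "\<dots> \<le> M" by (rule c)
    finally show ?thesis .
  qed
  define B where "B = sqrt (8 * M)"
  have M: "M \<ge> 0"
  proof -
    have "0 \<le> integral {0..1/2} (\<lambda>x. (norm (\<sigma> x - c 0))\<^sup>2)" by (rule Henstock_Kurzweil_Integration.integral_nonneg) (auto intro: cint)
    then show ?thesis using cell[of 0 0 "1/2"] by simp
  qed
  have jump: "norm (c k - c (Suc k)) \<le> B" for k
  proof -
    let ?J = "{real (Suc k) / 2..real (Suc k) / 2 + 1/2}"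
    have "integral ?J (\<lambda>x. (norm (c k - c (Suc k)))\<^sup>2) \<le> integral ?J (\<lambda>x. 2 * (norm (\<sigma> x - c k))\<^sup>2 + 2 * (norm (\<sigma> x - c (Suc k)))\<^sup>2)"
    proof (rule integral_le)
      fix x
      have "norm (c k - c (Suc k)) \<le> norm (\<sigma> x - c k) + norm (\<sigma> x - c (Suc k))"
        using norm_triangle_ineq4[of "\<sigma> x - c (Suc k)" "\<sigma> x - c k"] by simp
      then have "(norm (c k - c (Suc k)))\<^sup>2 \<le> (norm (\<sigma> x - c k) + norm (\<sigma> x - c (Suc k)))\<^sup>2" by (intro power_mono) auto
      also have "\<dots> \<le> 2 * (norm (\<sigma> x - c k))\<^sup>2 + 2 * (norm (\<sigma> x - c (Suc k)))\<^sup>2"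
        using sum_squares_bound[of "norm (\<sigma> x - c k)" "norm (\<sigma> x - c (Suc k))"] by (simp add: power2_sum)
      finally show "(norm (c k - c (Suc k)))\<^sup>2 \<le> 2 * (norm (\<sigma> x - c k))\<^sup>2 + 2 * (norm (\<sigma> x - c (Suc k)))\<^sup>2" .
    qed (auto intro!: integrable_add integrable_on_mult_right cint)
    also have "\<dots> = 2 * integral ?J (\<lambda>x. (norm (\<sigma> x - c k))\<^sup>2) + 2 * integral ?J (\<lambda>x. (norm (\<sigma> x - c (Suc k)))\<^sup>2)"
    proof -
      have i: "(\<lambda>x. (norm (\<sigma> x - d))\<^sup>2) integrable_on ?J" for d by (rule cint) auto
      show ?thesis
        by (subst Henstock_Kurzweil_Integration.integral_add[OF integrable_on_mult_right[OF i] integrable_on_mult_right[OF i]]) simp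
    qed
    also have "\<dots> \<le> 2 * M + 2 * M"
    proof -
      have "integral ?J (\<lambda>x. (norm (\<sigma> x - c k))\<^sup>2) \<le> M" by (rule cell) (auto simp: field_simps)
      moreover have "integral ?J (\<lambda>x. (norm (\<sigma> x - c (Suc k)))\<^sup>2) \<le> M" by (rule cell) auto
      ultimately show ?thesis by linarith
    qed
    finally have "(norm (c k - c (Suc k)))\<^sup>2 \<le> 8 * M" by simp
    then show ?thesis unfolding B_def by (rule real_le_rsqrt)
  qed
  have B: "B \<ge> 0" using M by (simp add: B_def)
  define \<delta> where "\<delta> = \<eta> / 2"
  define Q where "Q = M / \<delta> + B"
  \<comment> \<open>half of \<open>\<eta>\<close> is spent on \<open>\<delta>\<close>, half on the supremum bounds, whose total weight is \<open>Q\<close>\<close>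
  define \<theta> where "\<theta> = \<eta> / (2 * (Q + 1))"
  have \<delta>: "\<delta> > 0" using \<eta> by (simp add: \<delta>_def)
  have Q: "Q \<ge> 0" using M B \<delta> by (simp add: Q_def)
  have \<theta>: "\<theta> > 0" using \<eta> Q by (simp add: \<theta>_def add_nonneg_pos)
  have Q\<theta>: "Q * \<theta> \<le> \<eta> / 2"
  proof -
    have "Q * \<theta> \<le> (Q + 1) * \<theta>" using \<theta> by (intro mult_right_mono) auto
    also have "\<dots> = \<eta> / 2" using Q by (simp add: \<theta>_def field_simps)
    finally show ?thesis .
  qed
  define K where "K = Q * (2 + 1/\<theta>)"
  have K: "K \<ge> 0" using Q \<theta> by (simp add: K_def)
  have "norm (of_real ((norm W)\<^sup>2) - form \<sigma> W W) \<le> \<eta> * (norm W)\<^sup>2 + K * (norm (prim_L2 W))\<^sup>2"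
    if R: "R \<ge> 0" and W: "W \<in> form_domain R" for R W
  proof -
    define n where "n = nat \<lceil>2 * R\<rceil>"
    define b where "b = real n / 2"
    have Rb: "R \<le> b" unfolding b_def n_def using R by linarith
    have b0: "b \<ge> 0" by (simp add: b_def)
    have Wb: "W \<in> form_domain b" using W form_domain_mono[OF Rb] by blast
    obtain w where w: "square_integrable_on w {0..}" "W = abs_L2 w" "\<And>x. x \<notin> {0..b} \<Longrightarrow> w x = 0"
      "\<And>x. prim W x = integral {0..x} w" "AE x in halfline. (prim W has_vector_derivative w x) (at x)"
      by (rule form_domainE[OF Wb], rule that)
    define Y where "Y = prim W"
    define p where "p x = w x * cnj (Y x) + Y x * cnj (w x)" for x
    have 1: "((\<lambda>x. w x * cnj (w x) - w x * cnj (cnj (\<sigma> x) * prim W x) - \<sigma> x * prim W x * cnj (w x)) has_integral form \<sigma> W W) {0..b}"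
      by (rule form_has_integral[OF \<sigma> b0 Wb Wb w(1-3) w(1-3)])
    have "((\<lambda>x. w x * cnj (w x)) has_integral cinner (abs_L2 w) (abs_L2 w)) {0..b}"
      by (rule cinner_has_integral[OF w(1) w(1)]) (use w(3) in auto)
    then have 2: "((\<lambda>x. w x * cnj (w x)) has_integral of_real ((norm W)\<^sup>2)) {0..b}"
      by (simp only: w(2)[symmetric] cinner_self)
    have "((\<lambda>x. prim W x * cnj (prim W x)) has_integral cinner (prim_L2 W) (prim_L2 W)) {0..b}"
      unfolding prim_L2_eq
      by (rule cinner_has_integral[OF sq_prim[OF b0 Wb] sq_prim[OF b0 Wb]]) (use Wb in \<open>simp add: form_domain_def\<close>)
    then have 3: "((\<lambda>x. Y x * cnj (Y x)) has_integral of_real ((norm (prim_L2 W))\<^sup>2)) {0..b}"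
      by (simp only: cinner_self Y_def)
    have pow: "Re (z * cnj z) = (norm z)\<^sup>2" for z by (simp flip: complex_norm_square)
    have A: "((\<lambda>x. (norm (w x))\<^sup>2) has_integral (norm W)\<^sup>2) {0..b}"
      using has_integral_linear[OF 2 bounded_linear_Re] by (simp only: o_def pow Re_complex_of_real)
    have T: "((\<lambda>x. (norm (Y x))\<^sup>2) has_integral (norm (prim_L2 W))\<^sup>2) {0..b}"
      using has_integral_linear[OF 3 bounded_linear_Re] by (simp only: o_def pow Re_complex_of_real)
    have "((\<lambda>x. w x * cnj (w x) - (w x * cnj (w x) - w x * cnj (cnj (\<sigma> x) * prim W x) - \<sigma> x * prim W x * cnj (w x)))
       has_integral of_real ((norm W)\<^sup>2) - form \<sigma> W W) {0..b}"
      by (rule has_integral_diff[OF 2 1])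
    then have P: "((\<lambda>x. \<sigma> x * p x) has_integral of_real ((norm W)\<^sup>2) - form \<sigma> W W) {0..b}"
      by (rule has_integral_eq[rotated]) (simp add: p_def Y_def algebra_simps)
    define J where "J k = {real k / 2..real k / 2 + 1/2}" for k :: nat
    have JS: "{real k / 2..real (Suc k) / 2} = J k" for k by (simp add: J_def field_simps)
    note grid = integral_half_grid[of _ n, folded b_def, unfolded JS]
    define Ak where "Ak k = integral (J k) (\<lambda>x. (norm (w x))\<^sup>2)" for k
    define Tk where "Tk k = integral (J k) (\<lambda>x. (norm (Y x))\<^sup>2)" for k
    define Sk where "Sk k = \<theta> * Ak k + (2 + 1/\<theta>) * Tk k" for k
    have wJ: "square_integrable_on w {real k / 2..real k / 2 + 1/2}" for k
      by (rule square_integrable_on_subset[OF w(1)]) auto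
    have ACY: "AC_on 0 (real k / 2 + 1/2) Y" for k unfolding Y_def by (rule prim_AC)
    have dY: "AE x in halfline. (Y has_vector_derivative w x) (at x)" unfolding Y_def by (rule w(5))
    have k0: "0 \<le> real k / 2" for k by simp
    have sup: "(norm (Y x))\<^sup>2 \<le> Sk k" if "x \<in> J k" for x k
      using cell_sup_bound[OF k0 wJ ACY dY _ \<theta>, of x k] that unfolding J_def Sk_def Ak_def Tk_def by simp
    have cellk: "norm (integral (J k) (\<lambda>x. \<sigma> x * p x) - c k * (of_real ((norm (Y (real (Suc k) / 2)))\<^sup>2) - of_real ((norm (Y (real k / 2)))\<^sup>2)))
        \<le> \<delta> * Ak k + M / \<delta> * Sk k" if kn: "k < n" for k
    proof -
      have "(p has_integral of_real ((norm (Y (real k / 2 + 1/2)))\<^sup>2) - of_real ((norm (Y (real k / 2)))\<^sup>2)) {real k / 2..real k / 2 + 1/2}"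
        unfolding p_def by (rule cell_product_rule[OF k0[of k] wJ[of k] ACY[of k] dY]) auto
      then have h1: "((\<lambda>x. c k * p x) has_integral c k * (of_real ((norm (Y (real (Suc k) / 2)))\<^sup>2) - of_real ((norm (Y (real k / 2)))\<^sup>2))) (J k)"
        unfolding J_def by (intro has_integral_mult_right) (simp add: field_simps)
      have i: "(\<lambda>x. \<sigma> x * p x) integrable_on J k"
        unfolding J_def
      proof (rule integrable_on_subinterval[of _ "{0..b}"])
        show "(\<lambda>x. \<sigma> x * p x) integrable_on {0..b}" using P by blast
        show "{real k / 2..real k / 2 + 1/2} \<subseteq> {0..b}" using kn by (auto simp: b_def)
      qed
      have "integral (J k) (\<lambda>x. \<sigma> x * p x - c k * p x) = integral (J k) (\<lambda>x. \<sigma> x * p x) - c k * (of_real ((norm (Y (real (Suc k) / 2)))\<^sup>2) - of_real ((norm (Y (real k / 2)))\<^sup>2))"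
        by (rule integral_unique[OF has_integral_diff[OF integrable_integral[OF i] h1]])
      moreover have "norm (integral {real k / 2..real k / 2 + 1/2} (\<lambda>x. (\<sigma> x - c k) * (w x * cnj (Y x) + Y x * cnj (w x))))
          \<le> \<delta> * integral {real k / 2..real k / 2 + 1/2} (\<lambda>x. (norm (w x))\<^sup>2) + M / \<delta> * Sk k"
      proof (rule cell_potential_bound[OF k0 wJ ACY dY _ _ _ \<delta>])
        show "square_integrable_on \<sigma> {real k / 2..real k / 2 + 1/2}" by (rule sq\<sigma>) auto
        show "integral {real k / 2..real k / 2 + 1/2} (\<lambda>x. (norm (\<sigma> x - c k))\<^sup>2) \<le> M" by (rule cell) auto
        show "(norm (Y x))\<^sup>2 \<le> Sk k" if "x \<in> {real k / 2..real k / 2 + 1/2}" for x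
          by (rule sup) (use that in \<open>simp add: J_def\<close>)
      qed
      ultimately show ?thesis by (simp add: J_def Ak_def p_def left_diff_distrib)
    qed
    define a where "a k = complex_of_real ((norm (Y (real k / 2)))\<^sup>2)" for k :: nat
    have a0: "a 0 = 0" "a n = 0" using Wb by (auto simp: a_def Y_def prim_neg form_domain_def b_def)
    have "of_real ((norm W)\<^sup>2) - form \<sigma> W W = (\<Sum>k<n. integral (J k) (\<lambda>x. \<sigma> x * p x))"
      using grid[OF has_integral_integrable[OF P]] by (simp only: integral_unique[OF P])
    also have "\<dots> = (\<Sum>k<n. integral (J k) (\<lambda>x. \<sigma> x * p x) - c k * (a (Suc k) - a k)) + (\<Sum>k<n. c k * (a (Suc k) - a k))"
      by (simp add: sum_subtractf)
    also have "(\<Sum>k<n. c k * (a (Suc k) - a k)) = (\<Sum>k<n. (c k - c (Suc k)) * a (Suc k))"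
      using sum_by_parts[of a c n] a0 by simp
    finally have eq: "of_real ((norm W)\<^sup>2) - form \<sigma> W W =
        (\<Sum>k<n. integral (J k) (\<lambda>x. \<sigma> x * p x) - c k * (a (Suc k) - a k)) + (\<Sum>k<n. (c k - c (Suc k)) * a (Suc k))" .
    have "norm (of_real ((norm W)\<^sup>2) - form \<sigma> W W)
        \<le> (\<Sum>k<n. norm (integral (J k) (\<lambda>x. \<sigma> x * p x) - c k * (a (Suc k) - a k))) + (\<Sum>k<n. norm ((c k - c (Suc k)) * a (Suc k)))"
      unfolding eq by (rule order_trans[OF norm_triangle_ineq add_mono[OF norm_sum norm_sum]])
    also have "\<dots> \<le> (\<Sum>k<n. \<delta> * Ak k + M / \<delta> * Sk k) + (\<Sum>k<n. B * Sk k)"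
    proof (intro add_mono sum_mono)
      fix k assume "k \<in> {..<n}"
      then show "norm (integral (J k) (\<lambda>x. \<sigma> x * p x) - c k * (a (Suc k) - a k)) \<le> \<delta> * Ak k + M / \<delta> * Sk k"
        using cellk by (simp add: a_def)
      have "norm (a (Suc k)) \<le> Sk k"
        unfolding a_def norm_of_real using sup[of "real (Suc k) / 2" k] by (simp add: J_def field_simps)
      then show "norm ((c k - c (Suc k)) * a (Suc k)) \<le> B * Sk k"
        unfolding norm_mult using jump B by (intro mult_mono) auto
    qed
    also have "\<dots> = (\<Sum>k<n. (\<delta> + Q * \<theta>) * Ak k + K * Tk k)"
      unfolding sum.distrib[symmetric] by (rule sum.cong) (simp_all add: Sk_def Q_def K_def algebra_simps)
    also have "\<dots> = (\<delta> + Q * \<theta>) * (\<Sum>k<n. Ak k) + K * (\<Sum>k<n. Tk k)"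
      by (simp add: sum.distrib sum_distrib_left)
    also have "(\<Sum>k<n. Ak k) = (norm W)\<^sup>2"
      unfolding Ak_def using grid[OF has_integral_integrable[OF A]] by (simp only: integral_unique[OF A])
    also have "(\<Sum>k<n. Tk k) = (norm (prim_L2 W))\<^sup>2"
      unfolding Tk_def using grid[OF has_integral_integrable[OF T]] by (simp only: integral_unique[OF T])
    also have "(\<delta> + Q * \<theta>) * (norm W)\<^sup>2 \<le> \<eta> * (norm W)\<^sup>2"
      using Q\<theta> by (intro mult_right_mono) (auto simp: \<delta>_def)
    finally show ?thesis by simp
  qed
  then show ?thesis using K by blast
qed

section \<open>Sectors and cones\<close>

text \<open>The sector is enlarged so that it contains the positive direction; its opening stays below \<open>pi\<close> because both bounding
  angles are smaller than \<open>pi\<close> in absolute value. As \<open>1\<close> then lies in the cone as well, \<open>Re \<omega>\<close> is bounded below,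
  and the rotated form keeps a positive multiple of \<open>\<bar>\<bar>W\<bar>\<bar>\<^sup>2\<close>.\<close>

lemma sector_imp_cone:
  assumes "0 \<le> \<beta> - \<alpha>" "\<beta> - \<alpha> < pi" "\<bar>\<alpha>\<bar> < pi" "\<bar>\<beta>\<bar> < pi"
  obtains \<omega> c where "norm \<omega> = 1" "c > 0" "c \<le> Re \<omega>"
    "\<And>w z0. w \<in> sector \<alpha> \<beta> z0 \<Longrightarrow> c * norm (w - z0) \<le> Re (\<omega> * (w - z0))"
proof -
  define a where "a = min \<alpha> 0"
  define b where "b = max \<beta> 0"
  define \<theta> where "\<theta> = (a + b) / 2"
  define \<gamma> where "\<gamma> = (b - a) / 2"
  have ab: "a \<le> 0" "0 \<le> b" "a \<le> \<alpha>" "\<beta> \<le> b" "b - a < pi"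
    using assms by (auto simp: a_def b_def min_def max_def)
  have \<gamma>: "0 \<le> \<gamma>" "\<gamma> < pi / 2" using ab by (auto simp: \<gamma>_def)
  have cos: "cos \<gamma> \<le> cos (\<phi> - \<theta>)" if "a \<le> \<phi>" "\<phi> \<le> b" for \<phi>
  proof -
    have "\<bar>\<phi> - \<theta>\<bar> \<le> \<gamma>" using that by (auto simp: \<theta>_def \<gamma>_def abs_le_iff field_simps)
    then have "cos \<gamma> \<le> cos \<bar>\<phi> - \<theta>\<bar>" using \<gamma> by (intro cos_monotone_0_pi_le) auto
    then show ?thesis by simp
  qed
  show ?thesis
  proof (rule that[of "cis (- \<theta>)" "cos \<gamma>"])
    show "norm (cis (- \<theta>)) = 1" by simp
    show "cos \<gamma> > 0" using \<gamma> by (intro cos_gt_zero_pi) auto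
    show "cos \<gamma> \<le> Re (cis (- \<theta>))" using cos[of 0] ab by simp
    fix w z0 assume "w \<in> sector \<alpha> \<beta> z0"
    then obtain r \<phi> where w: "w = z0 + of_real r * cis \<phi>" "0 \<le> r" "\<alpha> \<le> \<phi>" "\<phi> \<le> \<beta>"
      unfolding sector_def by blast
    have "cis (- \<theta>) * (w - z0) = of_real r * cis (\<phi> - \<theta>)" by (simp add: w(1) cis_mult algebra_simps)
    then have "Re (cis (- \<theta>) * (w - z0)) = r * cos (\<phi> - \<theta>)" by simp
    moreover have "norm (w - z0) = r" using w by (simp add: norm_mult)
    ultimately show "cos \<gamma> * norm (w - z0) \<le> Re (cis (- \<theta>) * (w - z0))"
      using cos[of \<phi>] w ab mult_right_mono[of "cos \<gamma>" "cos (\<phi> - \<theta>)" r] by (simp add: mult.commute)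
  qed
qed

lemma cone_subset_sector:
  assumes \<omega>: "norm \<omega> = 1" and c: "c > 0"
  shows "\<exists>\<alpha> \<beta>. 0 \<le> \<beta> - \<alpha> \<and> \<beta> - \<alpha> < pi \<and> {w. c * norm (w - z0) \<le> Re (\<omega> * (w - z0))} \<subseteq> sector \<alpha> \<beta> z0"
proof -
  define d where "d = min c 1"
  define \<gamma> where "\<gamma> = arccos d"
  define \<theta> where "\<theta> = - Arg \<omega>"
  have d: "0 < d" "d \<le> 1" using c by (auto simp: d_def)
  have \<gamma>: "0 \<le> \<gamma>" "\<gamma> < pi / 2" "cos \<gamma> = d"
    using d arccos_lt_bounded[of d] arccos_less_arccos[of 0 d] by (auto simp: \<gamma>_def arccos_lbound cos_arccos)
  have \<omega>eq: "\<omega> = cis (- \<theta>)" using \<omega> rcis_cmod_Arg[of \<omega>] by (simp add: \<theta>_def rcis_def)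
  have "w \<in> sector (\<theta> - \<gamma>) (\<theta> + \<gamma>) z0" if w: "c * norm (w - z0) \<le> Re (\<omega> * (w - z0))" for w
  proof (cases "w = z0")
    case True
    then show ?thesis using \<gamma> by (auto simp: sector_def intro!: exI[of _ 0] exI[of _ \<theta>])
  next
    case False
    define u where "u = \<omega> * (w - z0)"
    define \<psi> where "\<psi> = Arg u"
    have nu: "norm u = norm (w - z0)" "norm u > 0" using \<omega> False by (auto simp: u_def norm_mult)
    have u: "u = of_real (norm u) * cis \<psi>" using rcis_cmod_Arg[of u] by (simp add: \<psi>_def rcis_def)
    have \<psi>: "\<bar>\<psi>\<bar> \<le> pi" using Arg_bounded[of u] by (auto simp: \<psi>_def)
    have "d * norm u \<le> c * norm u" by (intro mult_right_mono) (auto simp: d_def)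
    also have "\<dots> \<le> Re u" using w nu(1) by (simp add: u_def)
    also have "Re u = norm u * cos \<psi>" by (subst u) simp
    finally have "cos \<gamma> \<le> cos \<bar>\<psi>\<bar>" using nu(2) \<gamma> by (simp add: mult.commute)
    then have "\<bar>\<psi>\<bar> \<le> \<gamma>" using \<psi> \<gamma> by (subst (asm) cos_mono_le_eq) auto
    moreover have "w = z0 + of_real (norm u) * cis (\<theta> + \<psi>)"
    proof -
      have "w - z0 = cis \<theta> * u" by (simp add: u_def \<omega>eq cis_mult flip: mult.assoc)
      also have "\<dots> = of_real (norm u) * (cis \<theta> * cis \<psi>)" by (subst u) simp
      finally show ?thesis by (simp add: cis_mult algebra_simps)
    qed
    ultimately show ?thesis unfolding sector_def
      by (intro CollectI exI[of _ "norm u"] exI[of _ "\<theta> + \<psi>"]) (auto simp: abs_le_iff)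
  qed
  then show ?thesis using \<gamma> by (intro exI[of _ "\<theta> - \<gamma>"] exI[of _ "\<theta> + \<gamma>"]) auto
qed

section \<open>The form on compactly supported functions\<close>

text \<open>The derivatives of all compactly supported functions in \<open>H\<^sup>1\<close> that vanish at the origin.\<close>

definition form_core :: "L2 set" where "form_core = (\<Union>R\<in>{0<..}. form_domain R)"

lemma form_core_iff: "W \<in> form_core \<longleftrightarrow> (\<exists>R>0. W \<in> form_domain R)"
  by (auto simp: form_core_def)

lemma form_domain_subset_form_core: "R \<ge> 0 \<Longrightarrow> form_domain R \<subseteq> form_core"
  using form_domain_mono[of R "R + 1"] by (auto simp: form_core_iff intro!: exI[of _ "R + 1"])

lemma form_domainD: "W \<in> form_domain R \<Longrightarrow> R \<le> S \<Longrightarrow> W \<in> form_domain S"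
  using form_domain_mono by blast

lemma form_core_common:
  assumes "W \<in> form_core" "Z \<in> form_core"
  obtains R where "R > 0" "W \<in> form_domain R" "Z \<in> form_domain R"
proof -
  obtain R S where R: "R > 0" "W \<in> form_domain R" and S: "S > 0" "Z \<in> form_domain S"
    using assms by (auto simp: form_core_iff)
  show ?thesis
    by (rule that[of "max R S"]) (use R S in \<open>auto intro: form_domainD\<close>)
qed

lemma form_core_common3:
  assumes "W \<in> form_core" "Z \<in> form_core" "Y \<in> form_core"
  obtains R where "R > 0" "W \<in> form_domain R" "Z \<in> form_domain R" "Y \<in> form_domain R"
proof -
  obtain R where R: "R > 0" "W \<in> form_domain R" "Z \<in> form_domain R" by (rule form_core_common[OF assms(1,2)], rule that)
  obtain S where S: "S > 0" "Y \<in> form_domain S" using assms(3) by (auto simp: form_core_iff)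
  show ?thesis
    by (rule that[of "max R S"]) (use R S in \<open>auto intro: form_domainD\<close>)
qed

lemma form_core_cscale: "W \<in> form_core \<Longrightarrow> cscale c W \<in> form_core"
  by (auto simp: form_core_iff form_domain_cscale)

lemma form_core_add: "W \<in> form_core \<Longrightarrow> Z \<in> form_core \<Longrightarrow> W + Z \<in> form_core"
  by (erule (1) form_core_common) (auto simp: form_core_iff intro: form_domain_add)

lemma form_core_diff: "W \<in> form_core \<Longrightarrow> Z \<in> form_core \<Longrightarrow> W - Z \<in> form_core"
  by (erule (1) form_core_common) (auto simp: form_core_iff intro: form_domain_diff)

lemma form_core_zero: "0 \<in> form_core"
  using subspace_0[OF subspace_form_domain] by (auto simp: form_core_iff intro!: exI[of _ 1])

lemma form_core_scaleR: "W \<in> form_core \<Longrightarrow> a *\<^sub>R W \<in> form_core"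
  by (simp add: form_core_cscale scaleR_cscale)

lemma subspace_form_core: "subspace form_core"
  by (auto simp: subspace_def form_core_zero form_core_add form_core_scaleR)

text \<open>Primed names are the versions for elements with unspecified compact support.\<close>

lemma prim_L2_add': "W \<in> form_core \<Longrightarrow> Z \<in> form_core \<Longrightarrow> prim_L2 (W + Z) = prim_L2 W + prim_L2 Z"
  by (rule form_core_common[of W Z], assumption, assumption, rule prim_L2_add[OF less_imp_le])

lemma prim_L2_cscale': "W \<in> form_core \<Longrightarrow> prim_L2 (cscale c W) = cscale c (prim_L2 W)"
  unfolding form_core_iff by (elim exE conjE, rule prim_L2_cscale[OF less_imp_le])

lemma prim_L2_scaleR': "W \<in> form_core \<Longrightarrow> prim_L2 (c *\<^sub>R W) = c *\<^sub>R prim_L2 W"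
  by (simp add: scaleR_cscale prim_L2_cscale')

lemma prim_L2_diff': "W \<in> form_core \<Longrightarrow> Z \<in> form_core \<Longrightarrow> prim_L2 (W - Z) = prim_L2 W - prim_L2 Z"
  using prim_L2_add'[of "W - Z" Z] by (simp add: form_core_diff)

text \<open>The form values lie in a cone around the direction \<open>cnj \<omega>\<close> once they are shifted. The bounds hold for all compactly supported
  functions with constants that do not depend on the support.\<close>

locale sectorial_potential =
  fixes r :: "real \<Rightarrow> complex" and \<omega> :: complex and \<mu> C :: real
  assumes r: "r \<in> L2_loc" and \<omega>: "norm \<omega> = 1" and \<omega>_pos: "Re \<omega> > 0" and \<mu>: "\<mu> \<ge> 0"
    and L2_bound: "\<And>W. W \<in> form_core \<Longrightarrow> (norm (prim_L2 W))\<^sup>2 \<le> real_form \<omega> \<mu> r W W"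
    and form_bound: "\<And>W. W \<in> form_core \<Longrightarrow> norm (form r W W) \<le> C * real_form \<omega> \<mu> r W W"
begin

lemma real_form_linear:
  "W \<in> form_core \<Longrightarrow> W' \<in> form_core \<Longrightarrow> Z \<in> form_core \<Longrightarrow> real_form \<omega> \<mu> r (W + W') Z = real_form \<omega> \<mu> r W Z + real_form \<omega> \<mu> r W' Z"
  "W \<in> form_core \<Longrightarrow> W' \<in> form_core \<Longrightarrow> Z \<in> form_core \<Longrightarrow> real_form \<omega> \<mu> r Z (W + W') = real_form \<omega> \<mu> r Z W + real_form \<omega> \<mu> r Z W'"
  "W \<in> form_core \<Longrightarrow> Z \<in> form_core \<Longrightarrow> real_form \<omega> \<mu> r (a *\<^sub>R W) Z = a * real_form \<omega> \<mu> r W Z"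
  "W \<in> form_core \<Longrightarrow> Z \<in> form_core \<Longrightarrow> real_form \<omega> \<mu> r Z (a *\<^sub>R W) = a * real_form \<omega> \<mu> r Z W"
  "W \<in> form_core \<Longrightarrow> Z \<in> form_core \<Longrightarrow> real_form \<omega> \<mu> r (cscale c W) Z = real_form \<omega> \<mu> r W (cscale (cnj c) Z)"
  subgoal by (rule form_core_common3[of W W' Z], assumption, assumption, assumption, rule real_form_add_left[OF r less_imp_le])
  subgoal by (rule form_core_common3[of W W' Z], assumption, assumption, assumption, rule real_form_add_right[OF r less_imp_le])
  subgoal by (rule form_core_common[of W Z], assumption, assumption, rule real_form_scaleR_left[OF r less_imp_le])
  subgoal by (rule form_core_common[of W Z], assumption, assumption, rule real_form_scaleR_right[OF r less_imp_le])
  subgoal by (rule form_core_common[of W Z], assumption, assumption, rule real_form_cscale[OF r less_imp_le])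
  done

lemma real_form_cscale_diag:
  assumes "W \<in> form_core"
  shows "real_form \<omega> \<mu> r (cscale c W) (cscale c W) = (norm c)\<^sup>2 * real_form \<omega> \<mu> r W W"
proof -
  have "real_form \<omega> \<mu> r (cscale c W) (cscale c W) = real_form \<omega> \<mu> r W (cscale (cnj c * c) W)"
    using assms by (simp add: real_form_linear(5) form_core_cscale)
  also have "cnj c * c = of_real ((norm c)\<^sup>2)" by (simp add: complex_norm_square mult.commute del: of_real_power)
  also have "cscale (of_real ((norm c)\<^sup>2)) W = (norm c)\<^sup>2 *\<^sub>R W" by (rule scaleR_cscale[symmetric])
  finally show ?thesis using assms by (simp add: real_form_linear(4))
qed

text \<open>The bound on the diagonal passes to all pairs by polarisation over the fourth roots of unity and the
  parallelogram law.\<close>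

lemma form_polarisation_bound:
  assumes W: "W \<in> form_core" and Z: "Z \<in> form_core"
  shows "norm (form r W Z) \<le> C * (real_form \<omega> \<mu> r W W + real_form \<omega> \<mu> r Z Z)"
proof -
  obtain R where R: "R > 0" "W \<in> form_domain R" "Z \<in> form_domain R" by (rule form_core_common[OF assms], rule that)
  have R0: "R \<ge> 0" using R by simp
  let ?q = "\<lambda>U. form r U U" and ?b = "\<lambda>U. real_form \<omega> \<mu> r U U"
  note fs = form_add_left[OF r R0] form_add_right[OF r R0] form_cscale_left[OF r R0] form_cscale_right[OF r R0]
    form_domain_add form_domain_cscale
  have pol: "4 * form r W Z = ?q (W + Z) - ?q (W + cscale (- 1) Z) + \<i> * ?q (W + cscale \<i> Z) - \<i> * ?q (W + cscale (- \<i>) Z)"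
    using R by (simp add: fs algebra_simps)
  have par: "?b (W + cscale c Z) + ?b (W + cscale (- c) Z) = 2 * ?b W + 2 * ?b Z" if c: "norm c = 1" for c
  proof -
    have cZ: "cscale c Z \<in> form_core" "cscale (- c) Z = (-1) *\<^sub>R cscale c Z" using Z by (simp_all add: form_core_cscale cscale_minus_left)
    have "?b (cscale c Z) = ?b Z" using real_form_cscale_diag[OF Z, of c] c by simp
    then show ?thesis unfolding cZ(2) using W cZ(1)
      by (simp only: real_form_linear form_core_add form_core_scaleR) simp
  qed
  have tri: "norm (x - y + \<i> * u - \<i> * v) \<le> norm x + norm y + norm u + norm v" for x y u v :: complex
    using norm_triangle_ineq4[of "x - y + \<i> * u" "\<i> * v"] norm_triangle_ineq[of "x - y" "\<i> * u"] norm_triangle_ineq4[of x y]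
    by (simp add: norm_mult)
  have "4 * norm (form r W Z) = norm (4 * form r W Z)" by (simp add: norm_mult)
  also have "\<dots> \<le> norm (?q (W + Z)) + norm (?q (W + cscale (- 1) Z)) + norm (?q (W + cscale \<i> Z)) + norm (?q (W + cscale (- \<i>) Z))"
    unfolding pol by (rule tri)
  also have "\<dots> \<le> C * ?b (W + Z) + C * ?b (W + cscale (- 1) Z) + C * ?b (W + cscale \<i> Z) + C * ?b (W + cscale (- \<i>) Z)"
    by (intro add_mono form_bound form_core_add form_core_cscale W Z)
  also have "\<dots> = C * ((?b (W + cscale 1 Z) + ?b (W + cscale (- 1) Z)) + (?b (W + cscale \<i> Z) + ?b (W + cscale (- \<i>) Z)))"
    by (simp add: algebra_simps)
  also have "\<dots> = 4 * (C * (?b W + ?b Z))" by (subst (1 2) par) (simp_all add: algebra_simps)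
  finally show ?thesis by simp
qed

sublocale F: embedded_form form_core "real_form \<omega> \<mu> r" "C + \<mu>" prim_L2 1
proof
  fix u v assume u: "u \<in> form_core" and v: "v \<in> form_core"
  show "0 \<le> real_form \<omega> \<mu> r u u" using L2_bound[OF u] zero_le_power2 order_trans by blast
  have "\<bar>real_form \<omega> \<mu> r u v\<bar> \<le> \<bar>Re (\<omega> * form r u v)\<bar> + \<bar>\<mu> * inner (prim_L2 u) (prim_L2 v)\<bar>"
    unfolding real_form_def by (rule abs_triangle_ineq)
  also have "\<bar>Re (\<omega> * form r u v)\<bar> \<le> C * (real_form \<omega> \<mu> r u u + real_form \<omega> \<mu> r v v)"
    using abs_Re_le_cmod[of "\<omega> * form r u v"] form_polarisation_bound[OF u v] \<omega> by (simp add: norm_mult)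
  also have "\<bar>\<mu> * inner (prim_L2 u) (prim_L2 v)\<bar> \<le> \<mu> * (real_form \<omega> \<mu> r u u + real_form \<omega> \<mu> r v v)"
  proof -
    have "\<bar>inner (prim_L2 u) (prim_L2 v)\<bar> \<le> norm (prim_L2 u) * norm (prim_L2 v)" by (rule Cauchy_Schwarz_ineq2)
    also have "\<dots> \<le> (norm (prim_L2 u))\<^sup>2 + (norm (prim_L2 v))\<^sup>2"
      using sum_squares_bound[of "norm (prim_L2 u)" "norm (prim_L2 v)"]
        mult_nonneg_nonneg[OF norm_ge_zero norm_ge_zero, of "prim_L2 u" "prim_L2 v"] by linarith
    also have "\<dots> \<le> real_form \<omega> \<mu> r u u + real_form \<omega> \<mu> r v v" by (intro add_mono L2_bound u v)
    finally show ?thesis using \<mu> by (simp add: abs_mult mult_left_mono)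
  qed
  finally show "\<bar>real_form \<omega> \<mu> r u v\<bar> \<le> (C + \<mu>) * (real_form \<omega> \<mu> r u u + real_form \<omega> \<mu> r v v)"
    by (simp add: algebra_simps)
qed (auto simp: subspace_form_core real_form_linear prim_L2_add' prim_L2_scaleR' L2_bound)

end

section \<open>The form extension\<close>

text \<open>An \<open>f\<close> orthogonal to all these primitives is, after integration by parts, one whose own primitive is orthogonal to the form
  domain of every interval, hence constant, hence zero.\<close>

lemma form_range_dense:
  assumes orth: "\<And>Z. Z \<in> form_core \<Longrightarrow> inner f (prim_L2 Z) = 0"
  shows "f = 0"
proof (rule eq_zero_if_prim_zero)
  fix x :: real assume x: "x \<ge> 0"
  define R where "R = x + 1"
  have R: "R > 0" using x by (simp add: R_def)
  define Y where "Y = trunc {0..R} (prim f)"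
  have sqY: "square_integrable_on Y {0..}" unfolding Y_def
    by (intro square_integrable_trunc_on square_integrable_on_continuous AC_on_continuous prim_AC)
  define G where "G = abs_L2 Y"
  have "prim G x = prim G R" if xR: "x \<ge> R" for x
  proof -
    have "prim G x = integral ({0..R} \<inter> {0..x}) (prim f)"
      unfolding G_def prim_abs_L2[OF sqY] unfolding Y_def trunc_def[abs_def] by (rule integral_restrict_Int)
    also have "\<dots> = integral ({0..R} \<inter> {0..R}) (prim f)" using xR by (simp add: Int_absorb2)
    also have "\<dots> = prim G R"
      unfolding G_def prim_abs_L2[OF sqY] unfolding Y_def trunc_def[abs_def] by (rule integral_restrict_Int[symmetric])
    finally show ?thesis .
  qed
  note Gb = this
  have "inner G Z = 0" if Z: "Z \<in> form_domain R" for Z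
  proof -
    have R0: "R \<ge> 0" using R by simp
    obtain z where z: "square_integrable_on z {0..}" "Z = abs_L2 z" "\<And>x. x \<notin> {0..R} \<Longrightarrow> z x = 0"
      "\<And>x. prim Z x = integral {0..x} z" "AE x in halfline. (prim Z has_vector_derivative z x) (at x)"
      by (rule form_domainE[OF Z], rule that)
    have "((\<lambda>x. Y x * cnj (z x)) has_integral cinner (abs_L2 Y) (abs_L2 z)) {0..R}"
      by (rule cinner_has_integral[OF sqY z(1)]) (use z(3) in auto)
    then have "((\<lambda>x. Y x * cnj (z x)) has_integral cinner G Z) {0..R}"
      by (simp only: G_def z(2)[symmetric])
    then have 1: "((\<lambda>x. prim f x * cnj (z x)) has_integral cinner G Z) {0..R}"
      by (rule has_integral_eq[rotated]) (simp add: Y_def trunc_def)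
    have "((\<lambda>x. rep_L2 f x * cnj (prim Z x)) has_integral cinner (abs_L2 (rep_L2 f)) (abs_L2 (prim Z))) {0..R}"
      by (rule cinner_has_integral[OF square_integrable_rep_L2 sq_prim[OF R0 Z]]) (use Z in \<open>simp add: form_domain_def\<close>)
    then have 2: "((\<lambda>x. rep_L2 f x * cnj (prim Z x)) has_integral cinner f (prim_L2 Z)) {0..R}"
      by (simp add: prim_L2_eq)
    have 3: "((\<lambda>x. rep_L2 f x * cnj (prim Z x) + prim f x * cnj (z x)) has_integral prim f R * cnj (prim Z R) - prim f 0 * cnj (prim Z 0)) {0..R}"
      using R by (intro product_rule_has_integral[of R] prim_AC prim_ae_derivative AC_on_cnj ae_derivative_cnj z(5)) auto
    have "cinner f (prim_L2 Z) + cinner G Z = prim f R * cnj (prim Z R) - prim f 0 * cnj (prim Z 0)"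
      by (rule has_integral_unique[OF has_integral_add[OF 2 1] 3])
    also have "\<dots> = 0" using Z by (simp add: form_domain_def prim_neg)
    finally have "inner f (prim_L2 Z) + inner G Z = 0" by (simp flip: Re_cinner add: complex_eq_iff)
    moreover have "Z \<in> form_core" using Z R by (auto simp: form_core_iff)
    ultimately show ?thesis using orth by simp
  qed
  then obtain c where c: "G = cscale c (chi R)" using du_Bois_Reymond[OF R Gb] by blast
  have "abs_L2 Y = abs_L2 (\<lambda>x. c * trunc {0..R} (\<lambda>_. 1) x)"
    using c abs_L2_cscale[OF sq_trunc_1, of c R] by (simp add: G_def chi_def)
  then have "AE x in halfline. Y x = c * trunc {0..R} (\<lambda>_. 1) x"
    using abs_L2_eq_iff[OF sqY square_integrable_on_cmult[OF sq_trunc_1]] by blast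
  then obtain N where N: "negligible N" "\<And>x. x \<in> {0..} - N \<Longrightarrow> Y x = c * trunc {0..R} (\<lambda>_. 1) x"
    by (auto simp: AE_lebesgue_on_negligible)
  have cont: "continuous_on {0..R} (\<lambda>x. norm (prim f x - c))"
    by (intro continuous_intros AC_on_continuous prim_AC)
  have "integral {0..R} (\<lambda>x. norm (prim f x - c)) = integral {0..R} (\<lambda>_. 0)"
  proof (rule integral_spike[OF N(1)])
    fix x assume "x \<in> {0..R} - N"
    then show "0 = norm (prim f x - c)" using N(2)[of x] by (simp add: Y_def trunc_def)
  qed
  then have "\<forall>x\<in>{0..R}. norm (prim f x - c) = 0"
    using integral_eq_0_iff[OF cont R] by simp
  then have pc: "prim f x = c" if "x \<in> {0..R}" for x using that by auto
  have "c = 0" using pc[of 0] R by (simp add: prim_neg)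
  then show "prim f x = 0" using pc[of x] x by (simp add: R_def)
qed

lemma norm_cinner_times_prim_le:
  assumes r: "r \<in> L2_loc" and R: "R \<ge> 0" and S: "S \<ge> 0" and W: "W \<in> form_domain S" and Z: "Z \<in> form_domain R"
    and B: "\<And>x. norm (prim W x) \<le> B"
  shows "norm (cinner (times_prim r W) Z) \<le> B * loc_norm r R * norm Z"
proof -
  obtain z where z: "square_integrable_on z {0..}" "Z = abs_L2 z" "\<And>x. x \<notin> {0..R} \<Longrightarrow> z x = 0"
    "\<And>x. prim Z x = integral {0..x} z" "AE x in halfline. (prim Z has_vector_derivative z x) (at x)"
    by (rule form_domainE[OF Z], rule that)
  define y where "y = trunc {0..R} (\<lambda>x. r x * prim W x)"
  have sqy: "square_integrable_on y {0..}" unfolding y_def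
    by (intro square_integrable_trunc_on square_integrable_mult_prim r R)
  have "cinner (times_prim r W) Z = (LINT x|halfline. r x * prim W x * cnj (z x))"
    unfolding times_prim_def z(2) by (rule cinner_abs_L2[OF sq_times_prim[OF r S W] z(1)])
  also have "\<dots> = (LINT x|halfline. y x * cnj (z x))"
    by (rule Bochner_Integration.integral_cong) (use z(3) in \<open>auto simp: y_def trunc_def\<close>)
  also have "\<dots> = cinner (abs_L2 y) Z" unfolding z(2) by (rule cinner_abs_L2[OF sqy z(1), symmetric])
  finally have "norm (cinner (times_prim r W) Z) \<le> norm (abs_L2 y) * norm Z" by (simp add: norm_cinner_le)
  moreover have "norm (abs_L2 y) \<le> B * loc_norm r R" unfolding loc_norm_def
  proof (rule norm_abs_L2_mono[OF sqy sq_trunc_loc[OF r R]])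
    show "0 \<le> B" using B[of 0] norm_ge_zero order_trans by blast
    show "norm (y x) \<le> B * norm (trunc {0..R} r x)" for x
      using B[of x] mult_right_mono[OF B[of x] norm_ge_zero[of "r x"]] by (auto simp: y_def trunc_def norm_mult mult.commute)
  qed
  ultimately show ?thesis by (meson mult_right_mono norm_ge_zero order_trans)
qed

text \<open>In addition the form controls the derivatives, uniformly in the support. This is what makes the form
  closable.\<close>

locale coercive_potential = sectorial_potential r \<omega> \<mu> C for r \<omega> \<mu> C +
  fixes c :: real
  assumes c: "c > 0" and H1_bound: "\<And>W. W \<in> form_core \<Longrightarrow> c * (norm W)\<^sup>2 \<le> real_form \<omega> \<mu> r W W"
begin

text \<open>A sequence that is Cauchy for the form converges in \<open>L2\<close> together with its derivatives. If the functions tend to zero, so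
  do the derivatives and, by interpolation, the suprema; the latter handle the products with the locally square-integrable
  potential.\<close>

lemma closable:
  assumes v: "\<And>n. v n \<in> form_core" "F.form_Cauchy v" "(\<lambda>n. prim_L2 (v n)) \<longlonglongrightarrow> 0" and z: "z \<in> form_core"
  shows "(\<lambda>n. real_form \<omega> \<mu> r (v n) z) \<longlonglongrightarrow> 0"
proof -
  have "Cauchy v"
  proof (rule metric_CauchyI)
    fix e :: real assume e: "e > 0"
    then have "c * e\<^sup>2 > 0" using c by simp
    then obtain N where N: "\<And>m n. m \<ge> N \<Longrightarrow> n \<ge> N \<Longrightarrow> real_form \<omega> \<mu> r (v m - v n) (v m - v n) < c * e\<^sup>2"
      using v(2) unfolding F.form_Cauchy_def by meson
    have "dist (v m) (v n) < e" if "m \<ge> N" "n \<ge> N" for m n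
    proof -
      have "c * (norm (v m - v n))\<^sup>2 < c * e\<^sup>2"
        using N[OF that] H1_bound[OF form_core_diff[OF v(1) v(1)], of m n] by linarith
      then have "(norm (v m - v n))\<^sup>2 < e\<^sup>2" using c by simp
      then show ?thesis using e by (simp add: dist_norm power2_less_imp_less)
    qed
    then show "\<exists>N. \<forall>m\<ge>N. \<forall>n\<ge>N. dist (v m) (v n) < e" by blast
  qed
  then obtain w where w: "v \<longlonglongrightarrow> w" by (auto simp: Cauchy_convergent_iff convergent_def)
  have sup: "norm (prim (v n) x) \<le> sqrt (2 * norm (prim_L2 (v n)) * norm (v n))" for n x
  proof -
    obtain S where "S > 0" "v n \<in> form_domain S" using v(1) by (auto simp: form_core_iff)
    then show ?thesis by (intro prim_sup_bound_sqrt[of S]) auto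
  qed
  define B where "B n = sqrt (2 * norm (prim_L2 (v n)) * norm (v n))" for n
  have "B \<longlonglongrightarrow> sqrt (2 * norm (0::L2) * norm w)"
    unfolding B_def by (intro tendsto_intros v w)
  then have B: "B \<longlonglongrightarrow> 0" by simp
  have "w = 0"
  proof (rule eq_zero_if_prim_zero)
    fix x :: real
    have "(\<lambda>n. prim (v n) x) \<longlonglongrightarrow> 0"
      by (rule Lim_null_comparison[OF always_eventually[OF allI] B]) (use sup in \<open>simp add: B_def\<close>)
    then show "prim w x = 0" using tendsto_prim[OF w, of x] LIMSEQ_unique by blast
  qed
  then have w0: "v \<longlonglongrightarrow> 0" using w by simp
  obtain R where R: "R > 0" "z \<in> form_domain R" using z by (auto simp: form_core_iff)
  have "(\<lambda>n. cinner (times_prim r (v n)) z) \<longlonglongrightarrow> 0"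
  proof (rule Lim_null_comparison[OF always_eventually[OF allI]])
    show "norm (cinner (times_prim r (v n)) z) \<le> B n * loc_norm r R * norm z" for n
    proof -
      obtain S where "S > 0" "v n \<in> form_domain S" using v(1) by (auto simp: form_core_iff)
      then show ?thesis using R sup by (intro norm_cinner_times_prim_le[OF r, of R S]) (auto simp: B_def)
    qed
    have "(\<lambda>n. B n * loc_norm r R * norm z) \<longlonglongrightarrow> 0 * loc_norm r R * norm z" by (intro tendsto_intros B)
    then show "(\<lambda>n. B n * loc_norm r R * norm z) \<longlonglongrightarrow> 0" by simp
  qed
  then have "(\<lambda>n. cinner (v n) z - cinner (v n) (times_prim (\<lambda>x. cnj (r x)) z) - cinner (times_prim r (v n)) z)
      \<longlonglongrightarrow> cinner 0 z - cinner 0 (times_prim (\<lambda>x. cnj (r x)) z) - 0"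
    by (intro tendsto_intros tendsto_cinner w0)
  then have f: "(\<lambda>n. form r (v n) z) \<longlonglongrightarrow> 0" using cinner_cscale_left[of 0] by (simp add: form_def)
  have "(\<lambda>n. Re (\<omega> * form r (v n) z) + \<mu> * inner (prim_L2 (v n)) (prim_L2 z)) \<longlonglongrightarrow> Re (\<omega> * 0) + \<mu> * inner 0 (prim_L2 z)"
    by (intro tendsto_intros f v)
  then show ?thesis by (simp add: real_form_def)
qed

lemma solution_operator_inj: "F.solution_operator f = 0 \<Longrightarrow> f = 0"
  using F.solution_operator_injective[OF closable form_range_dense] by blast

lemma solution_operator_cscale: "F.solution_operator (cscale a f) = cscale a (F.solution_operator f)"
proof -
  obtain v where v: "\<And>n. v n \<in> form_core" "F.form_Cauchy v" "(\<lambda>n. prim_L2 (v n)) \<longlonglongrightarrow> F.solution_operator f"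
    "\<And>z. z \<in> form_core \<Longrightarrow> (\<lambda>n. real_form \<omega> \<mu> r (v n) z) \<longlonglongrightarrow> inner f (prim_L2 z)"
    using F.solution_operator_eq_iff[of f "F.solution_operator f"] unfolding F.weak_solution_def by blast
  have "F.weak_solution (cscale a f) (cscale a (F.solution_operator f))"
    unfolding F.weak_solution_def
  proof (intro exI[of _ "\<lambda>n. cscale a (v n)"] conjI allI ballI)
    show "cscale a (v n) \<in> form_core" for n by (rule form_core_cscale[OF v(1)])
    show "F.form_Cauchy (\<lambda>n. cscale a (v n))"
      unfolding F.form_Cauchy_def
    proof (intro allI impI)
      fix e :: real assume e: "e > 0"
      have a1: "(norm a)\<^sup>2 + 1 > 0" by (intro add_nonneg_pos) auto
      then have "e / ((norm a)\<^sup>2 + 1) > 0" using e by simp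
      then obtain N where N: "\<And>m n. m \<ge> N \<Longrightarrow> n \<ge> N \<Longrightarrow> real_form \<omega> \<mu> r (v m - v n) (v m - v n) < e / ((norm a)\<^sup>2 + 1)"
        using v(2) unfolding F.form_Cauchy_def by meson
      have "real_form \<omega> \<mu> r (cscale a (v m) - cscale a (v n)) (cscale a (v m) - cscale a (v n)) < e"
        if "m \<ge> N" "n \<ge> N" for m n
      proof -
        let ?b = "real_form \<omega> \<mu> r (v m - v n) (v m - v n)"
        have "real_form \<omega> \<mu> r (cscale a (v m) - cscale a (v n)) (cscale a (v m) - cscale a (v n)) = (norm a)\<^sup>2 * ?b"
          using real_form_cscale_diag[OF form_core_diff[OF v(1) v(1)], of a m n]
          by (simp add: cscale_diff_right)
        also have "\<dots> \<le> ((norm a)\<^sup>2 + 1) * ?b"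
          using F.nonneg[OF form_core_diff[OF v(1) v(1)]] by (intro mult_right_mono) auto
        also have "\<dots> < e" using N[OF that] a1 by (simp add: pos_less_divide_eq mult.commute)
        finally show ?thesis .
      qed
      then show "\<exists>N. \<forall>m\<ge>N. \<forall>n\<ge>N. real_form \<omega> \<mu> r (cscale a (v m) - cscale a (v n)) (cscale a (v m) - cscale a (v n)) < e" by blast
    qed
    show "(\<lambda>n. prim_L2 (cscale a (v n))) \<longlonglongrightarrow> cscale a (F.solution_operator f)"
      using bounded_linear.tendsto[OF bounded_linear_cscale v(3)] by (simp add: prim_L2_cscale'[OF v(1)])
    fix z assume z: "z \<in> form_core"
    have "(\<lambda>n. real_form \<omega> \<mu> r (v n) (cscale (cnj a) z)) \<longlonglongrightarrow> inner f (prim_L2 (cscale (cnj a) z))"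
      by (rule v(4)[OF form_core_cscale[OF z]])
    moreover have "inner f (prim_L2 (cscale (cnj a) z)) = inner (cscale a f) (prim_L2 z)"
      by (simp add: prim_L2_cscale'[OF z] cinner_cscale_left cinner_cscale_right flip: Re_cinner)
    ultimately show "(\<lambda>n. real_form \<omega> \<mu> r (cscale a (v n)) z) \<longlonglongrightarrow> inner (cscale a f) (prim_L2 z)"
      using real_form_linear(5)[OF v(1) z] by simp
  qed
  then show ?thesis by (simp add: F.solution_operator_eq_iff)
qed

text \<open>The operator associated with the closure of the form: \<open>g\<close> is its value at \<open>y\<close> if \<open>y\<close> solves the variational
  problem with right-hand side \<open>\<omega> g + \<mu> y\<close>.\<close>

definition friedrichs_extension :: operator_graph where
  "friedrichs_extension = {(y, g). y = F.solution_operator (cscale \<omega> g + \<mu> *\<^sub>R y)}"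

lemmas sol_add = linear_add[OF bounded_linear.linear[OF F.bounded_linear_solution_operator]]
lemmas sol_diff = linear_diff[OF bounded_linear.linear[OF F.bounded_linear_solution_operator]]
lemmas sol_zero = linear_0[OF bounded_linear.linear[OF F.bounded_linear_solution_operator]]

lemma linear_operator_friedrichs_extension: "linear_operator friedrichs_extension"
  unfolding linear_operator_def
proof (intro conjI allI impI)
  show "(0, 0) \<in> friedrichs_extension" by (simp add: friedrichs_extension_def sol_zero)
  show "(f + f', g + g') \<in> friedrichs_extension"
    if "(f, g) \<in> friedrichs_extension \<and> (f', g') \<in> friedrichs_extension" for f g f' g'
  proof -
    have "f = F.solution_operator (cscale \<omega> g + \<mu> *\<^sub>R f)" "f' = F.solution_operator (cscale \<omega> g' + \<mu> *\<^sub>R f')"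
      using that by (auto simp: friedrichs_extension_def)
    then have "f + f' = F.solution_operator ((cscale \<omega> g + \<mu> *\<^sub>R f) + (cscale \<omega> g' + \<mu> *\<^sub>R f'))"
      by (simp only: sol_add)
    also have "(cscale \<omega> g + \<mu> *\<^sub>R f) + (cscale \<omega> g' + \<mu> *\<^sub>R f') = cscale \<omega> (g + g') + \<mu> *\<^sub>R (f + f')"
      by (simp add: cscale_add_right scaleR_add_right)
    finally show ?thesis by (simp add: friedrichs_extension_def)
  qed
  show "(cscale a f, cscale a g) \<in> friedrichs_extension" if "(f, g) \<in> friedrichs_extension" for a f g
  proof -
    have "f = F.solution_operator (cscale \<omega> g + \<mu> *\<^sub>R f)" using that by (auto simp: friedrichs_extension_def)
    then have "cscale a f = F.solution_operator (cscale a (cscale \<omega> g + \<mu> *\<^sub>R f))"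
      by (simp only: solution_operator_cscale)
    also have "cscale a (cscale \<omega> g + \<mu> *\<^sub>R f) = cscale \<omega> (cscale a g) + \<mu> *\<^sub>R cscale a f"
      by (simp add: cscale_add_right cscale_scaleR mult.commute)
    finally show ?thesis by (simp add: friedrichs_extension_def)
  qed
  show "single_valued friedrichs_extension"
  proof (rule single_valuedI)
    fix y g g' assume "(y, g) \<in> friedrichs_extension" "(y, g') \<in> friedrichs_extension"
    then have "F.solution_operator (cscale \<omega> g + \<mu> *\<^sub>R y) = y" "F.solution_operator (cscale \<omega> g' + \<mu> *\<^sub>R y) = y"
      unfolding friedrichs_extension_def by auto
    then have "F.solution_operator ((cscale \<omega> g + \<mu> *\<^sub>R y) - (cscale \<omega> g' + \<mu> *\<^sub>R y)) = 0"
      by (simp only: sol_diff diff_self)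
    then have "(cscale \<omega> g + \<mu> *\<^sub>R y) - (cscale \<omega> g' + \<mu> *\<^sub>R y) = 0" by (rule solution_operator_inj)
    then have "cscale \<omega> (g - g') = 0" by (simp add: cscale_diff_right)
    then have "norm (g - g') = 0" using norm_cscale[of \<omega> "g - g'"] \<omega> by simp
    then show "g = g'" by simp
  qed
qed

lemma minimal_operator_subset_friedrichs_extension: "minimal_operator r \<subseteq> friedrichs_extension"
proof (rule subrelI)
  fix f g assume fg: "(f, g) \<in> minimal_operator r"
  obtain R W where W: "R \<ge> 0" "W \<in> form_domain R" "f = prim_L2 W"
    "\<And>S Z. S \<ge> 0 \<Longrightarrow> Z \<in> form_domain S \<Longrightarrow> form r W Z = cinner g (prim_L2 Z)"
    by (rule minimal_operatorE[OF r fg], rule that)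
  have WV: "W \<in> form_core" using form_domain_subset_form_core[OF W(1)] W(2) by blast
  have "real_form \<omega> \<mu> r W Z = inner (cscale \<omega> g + \<mu> *\<^sub>R f) (prim_L2 Z)" if "Z \<in> form_core" for Z
  proof -
    obtain S where "S > 0" "Z \<in> form_domain S" using \<open>Z \<in> form_core\<close> by (auto simp: form_core_iff)
    then have "form r W Z = cinner g (prim_L2 Z)" by (intro W(4)) auto
    then show ?thesis by (simp add: real_form_def inner_add_left W(3) cinner_cscale_left cinner_add_left cinner_scaleR_left flip: Re_cinner)
  qed
  then have "F.weak_solution (cscale \<omega> g + \<mu> *\<^sub>R f) (prim_L2 W)" by (rule F.weak_solution_exact[OF WV])
  then have "F.solution_operator (cscale \<omega> g + \<mu> *\<^sub>R f) = f" by (simp add: F.solution_operator_eq_iff W(3))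
  then show "(f, g) \<in> friedrichs_extension" by (simp add: friedrichs_extension_def)
qed

lemma resolvent_friedrichs_extension: "is_resolvent friedrichs_extension (- of_real \<mu> * cnj \<omega>) (\<lambda>h. F.solution_operator (cscale \<omega> h))"
  unfolding is_resolvent_def
proof (intro conjI allI)
  show "bounded_linear (\<lambda>h. F.solution_operator (cscale \<omega> h))"
    using bounded_linear_compose[OF F.bounded_linear_solution_operator bounded_linear_cscale] .
  fix f h
  have "\<omega> * cnj \<omega> = 1" using \<omega> by (simp flip: complex_norm_square)
  then have k: "\<omega> * (- of_real \<mu> * cnj \<omega>) = of_real (- \<mu>)" by (simp add: mult.left_commute)
  have "cscale \<omega> (cscale (- of_real \<mu> * cnj \<omega>) f) = - (\<mu> *\<^sub>R f)"
    by (simp only: cscale_cscale k scaleR_cscale[symmetric] scaleR_minus_left)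
  then have "cscale \<omega> (h + cscale (- of_real \<mu> * cnj \<omega>) f) + \<mu> *\<^sub>R f = cscale \<omega> h"
    by (simp add: cscale_add_right)
  then show "(f, h + cscale (- of_real \<mu> * cnj \<omega>) f) \<in> friedrichs_extension \<longleftrightarrow> f = F.solution_operator (cscale \<omega> h)"
    by (simp add: friedrichs_extension_def)
qed

text \<open>For every resolvent \<open>T\<close>, the vector \<open>T h\<close> is a variational solution with a right-hand side whose norm is bounded in
  terms of \<open>h\<close>.\<close>

theorem has_compact_extension:
  assumes tb: "totally_bounded (F.unit_ball form_core)"
  shows "has_extension_with_compact_resolvent (minimal_operator r)"
  unfolding has_extension_with_compact_resolvent_def
proof (intro exI[of _ friedrichs_extension] conjI allI impI)
  show "linear_operator friedrichs_extension" by (rule linear_operator_friedrichs_extension)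
  show "minimal_operator r \<subseteq> friedrichs_extension" by (rule minimal_operator_subset_friedrichs_extension)
  show "resolvent_set friedrichs_extension \<noteq> {}"
    using resolvent_friedrichs_extension unfolding resolvent_set_def by blast
  fix lam T assume T: "is_resolvent friedrichs_extension lam T"
  then have bl: "bounded_linear T" and eq: "\<And>h. (T h, h + cscale lam (T h)) \<in> friedrichs_extension"
    by (auto simp: is_resolvent_def)
  show "compact_operator T" unfolding compact_operator_def
  proof (intro allI impI)
    fix B :: "L2 set" assume "bounded B"
    then obtain b where b: "b > 0" "\<And>h. h \<in> B \<Longrightarrow> norm h \<le> b" by (auto simp: bounded_pos)
    obtain K where K: "K > 0" "\<And>h. norm (T h) \<le> norm h * K" using bounded_linear.pos_bounded[OF bl] by blast
    define \<rho> where "\<rho> = (b + norm lam * (b * K)) + \<mu> * (b * K)"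
    have \<rho>: "\<rho> > 0" using b(1) K(1) \<mu> by (simp add: \<rho>_def add_pos_nonneg)
    have "T ` B \<subseteq> (\<lambda>x. \<rho> *\<^sub>R x) ` (F.solution_operator ` cball 0 1)"
    proof clarify
      fix h assume h: "h \<in> B"
      define u where "u = cscale \<omega> (h + cscale lam (T h)) + \<mu> *\<^sub>R T h"
      have Tu: "T h = F.solution_operator u" using eq[of h] by (simp add: friedrichs_extension_def u_def)
      have nT: "norm (T h) \<le> b * K"
        using K(2)[of h] mult_right_mono[OF b(2)[OF h], of K] K(1) by linarith
      have "norm u \<le> norm (cscale \<omega> (h + cscale lam (T h))) + norm (\<mu> *\<^sub>R T h)" unfolding u_def by (rule norm_triangle_ineq)
      also have "\<dots> \<le> (norm h + norm lam * norm (T h)) + \<mu> * norm (T h)"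
        using norm_triangle_ineq[of h "cscale lam (T h)"] \<omega> \<mu> by (simp add: norm_cscale)
      also have "\<dots> \<le> \<rho>" unfolding \<rho>_def
        by (intro add_mono mult_left_mono nT b(2)[OF h]) (use \<mu> in auto)
      finally have "norm ((1/\<rho>) *\<^sub>R u) \<le> 1" using \<rho> by (simp add: field_simps)
      moreover have "T h = \<rho> *\<^sub>R F.solution_operator ((1/\<rho>) *\<^sub>R u)"
        using \<rho> by (simp add: Tu linear_scale[OF bounded_linear.linear[OF F.bounded_linear_solution_operator]])
      ultimately show "T h \<in> (\<lambda>x. \<rho> *\<^sub>R x) ` (F.solution_operator ` cball 0 1)" by auto
    qed
    then have "totally_bounded (T ` B)"
      using totally_bounded_subset totally_bounded_scaleR[OF F.totally_bounded_solutions[OF tb]] by blast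
    then show "compact (closure (T ` B))" by (rule totally_bounded_imp_compact_closure)
  qed
qed

end

section \<open>The numerical range and the form\<close>

lemma minimal_operator_lincomb:
  assumes "(f, g) \<in> minimal_operator r" "(f', g') \<in> minimal_operator r"
  shows "(cscale a f + f', cscale a g + g') \<in> minimal_operator r"
proof -
  obtain y u l where f: "f = abs_L2 y" "g = abs_L2 l"
    and y: "square_integrable_on y {0..}" "y \<in> AC_loc" "u \<in> AC_loc" "is_quasi_derivative r y u"
     "is_quasi_expression r y u l" "square_integrable_on l {0..}" "y 0 = 0" "u 0 = 0" "\<exists>R. \<forall>x>R. 0 \<le> x \<longrightarrow> y x = 0"
    using assms(1) unfolding minimal_operator_def by blast
  obtain z v m where f': "f' = abs_L2 z" "g' = abs_L2 m"
    and z: "square_integrable_on z {0..}" "z \<in> AC_loc" "v \<in> AC_loc" "is_quasi_derivative r z v"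
     "is_quasi_expression r z v m" "square_integrable_on m {0..}" "z 0 = 0" "v 0 = 0" "\<exists>R. \<forall>x>R. 0 \<le> x \<longrightarrow> z x = 0"
    using assms(2) unfolding minimal_operator_def by blast
  obtain y' where y': "is_ae_derivative y y'" "AE x in halfline. u x = y' x - r x * y x" using y(4) by (auto simp: is_quasi_derivative_def)
  obtain z' where z': "is_ae_derivative z z'" "AE x in halfline. v x = z' x - r x * z x" using z(4) by (auto simp: is_quasi_derivative_def)
  obtain u' where u': "is_ae_derivative u u'" "AE x in halfline. l x = - u' x - r x * u x - (r x)\<^sup>2 * y x" using y(5) by (auto simp: is_quasi_expression_def)
  obtain v' where v': "is_ae_derivative v v'" "AE x in halfline. m x = - v' x - r x * v x - (r x)\<^sup>2 * z x" using z(5) by (auto simp: is_quasi_expression_def)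
  have der: "is_ae_derivative (\<lambda>x. a * p x + q x) (\<lambda>x. a * p' x + q' x)" if "is_ae_derivative p p'" "is_ae_derivative q q'" for p p' q q'
    using that unfolding is_ae_derivative_def
    by eventually_elim (intro derivative_intros)
  have ac: "(\<lambda>x. a * p x + q x) \<in> AC_loc" if "p \<in> AC_loc" "q \<in> AC_loc" for p q
    using that unfolding AC_loc_def by (auto intro!: AC_on_add AC_on_mult AC_on_const)
  have sq: "square_integrable_on (\<lambda>x. a * p x + q x) {0..}" if "square_integrable_on p {0..}" "square_integrable_on q {0..}" for p q
    using that by (intro square_integrable_on_add square_integrable_on_cmult)
  have L: "cscale a f + f' = abs_L2 (\<lambda>x. a * y x + z x)" "cscale a g + g' = abs_L2 (\<lambda>x. a * l x + m x)"
    unfolding f f' using y z by (simp_all add: abs_L2_cscale abs_L2_add square_integrable_on_cmult)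
  have qd: "is_quasi_derivative r (\<lambda>x. a * y x + z x) (\<lambda>x. a * u x + v x)"
    unfolding is_quasi_derivative_def
  proof (intro exI[of _ "\<lambda>x. a * y' x + z' x"] conjI der y' z')
    show "AE x in halfline. a * u x + v x = a * y' x + z' x - r x * (a * y x + z x)"
      using y'(2) z'(2) by eventually_elim (simp only:, simp add: algebra_simps)
  qed
  have qe: "is_quasi_expression r (\<lambda>x. a * y x + z x) (\<lambda>x. a * u x + v x) (\<lambda>x. a * l x + m x)"
    unfolding is_quasi_expression_def
  proof (intro exI[of _ "\<lambda>x. a * u' x + v' x"] conjI der u' v')
    show "AE x in halfline. a * l x + m x = - (a * u' x + v' x) - r x * (a * u x + v x) - (r x)\<^sup>2 * (a * y x + z x)"
      using u'(2) v'(2) by eventually_elim (simp only:, simp add: algebra_simps)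
  qed
  obtain R1 R2 where R: "\<And>x. x > R1 \<Longrightarrow> 0 \<le> x \<Longrightarrow> y x = 0" "\<And>x. x > R2 \<Longrightarrow> 0 \<le> x \<Longrightarrow> z x = 0" using y(9) z(9) by meson
  have "\<exists>R. \<forall>x>R. 0 \<le> x \<longrightarrow> a * y x + z x = 0"
    using R by (intro exI[of _ "max R1 R2"]) auto
  then show ?thesis unfolding L minimal_operator_def
    using sq[OF y(1) z(1)] sq[OF y(6) z(6)] ac[OF y(2) z(2)] ac[OF y(3) z(3)] qd qe y(7,8) z(7,8)
    by (intro CollectI exI[of _ "\<lambda>x. a * y x + z x"] exI[of _ "\<lambda>x. a * u x + v x"] exI[of _ "\<lambda>x. a * l x + m x"]) simp
qed

lemma minimal_operator_zero: "(0, 0) \<in> minimal_operator r"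
proof -
  have ac: "(\<lambda>_. 0) \<in> AC_loc" by (simp add: AC_loc_def AC_on_const)
  have d: "is_ae_derivative (\<lambda>_. 0) (\<lambda>_. 0)" by (simp add: is_ae_derivative_def)
  have 1: "is_quasi_derivative r (\<lambda>_. 0) (\<lambda>_. 0)" unfolding is_quasi_derivative_def
    by (intro exI[of _ "\<lambda>_. 0"] conjI d) simp
  have 2: "is_quasi_expression r (\<lambda>_. 0) (\<lambda>_. 0) (\<lambda>_. 0)" unfolding is_quasi_expression_def
    by (intro exI[of _ "\<lambda>_. 0"] conjI d) simp
  show ?thesis unfolding minimal_operator_def zero_L2_def
    by (intro CollectI exI[of _ "\<lambda>_. 0"] exI[of _ "\<lambda>_. 0"] conjI refl square_integrable_on_zero ac 1 2) auto
qed

lemma minimal_operator_cscale: "(f, g) \<in> minimal_operator r \<Longrightarrow> (cscale a f, cscale a g) \<in> minimal_operator r"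
  using minimal_operator_lincomb[OF _ minimal_operator_zero] by fastforce

lemma prim_L2_inj:
  assumes "W \<in> form_core" "Z \<in> form_core" "prim_L2 W = prim_L2 Z"
  shows "W = Z"
proof -
  obtain R where "R > 0" "W \<in> form_domain R" "Z \<in> form_domain R" by (rule form_core_common[OF assms(1,2)], rule that)
  moreover have "prim_L2 (W - Z) = 0" using prim_L2_diff'[OF assms(1,2)] assms(3) by simp
  ultimately have "W - Z = 0" using prim_L2_eq_zero[of R "W - Z"] form_domain_diff by auto
  then show ?thesis by simp
qed

lemma minimal_operator_form:
  assumes r: "r \<in> L2_loc" and W: "W \<in> form_core" and g: "(prim_L2 W, g) \<in> minimal_operator r" and Z: "Z \<in> form_core"
  shows "form r W Z = cinner g (prim_L2 Z)"
proof -
  obtain R W' where W': "R \<ge> 0" "W' \<in> form_domain R" "prim_L2 W = prim_L2 W'"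
    "\<And>S Z. S \<ge> 0 \<Longrightarrow> Z \<in> form_domain S \<Longrightarrow> form r W' Z = cinner g (prim_L2 Z)"
    by (rule minimal_operatorE[OF r g], rule that)
  have "W = W'" by (rule prim_L2_inj[OF W _ W'(3)]) (use form_domain_subset_form_core[OF W'(1)] W'(2) in blast)
  moreover obtain S where "S > 0" "Z \<in> form_domain S" using Z by (auto simp: form_core_iff)
  ultimately show ?thesis using W'(4)[of S Z] by simp
qed

lemma tendsto_form_diag:
  assumes r: "r \<in> L2_loc" and R: "R \<ge> 0" and X: "\<And>n. X n \<in> form_domain R" and W: "W \<in> form_domain R" and lim: "X \<longlonglongrightarrow> W"
  shows "(\<lambda>n. form r (X n) (X n)) \<longlonglongrightarrow> form r W W"
proof -
  define K where "K = 1 + sqrt R * (loc_norm r R + loc_norm (\<lambda>x. cnj (r x)) R)"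
  note B = form_bounded[OF r R, folded K_def]
  have d: "X n - W \<in> form_domain R" for n using X W form_domain_diff by blast
  have "(\<lambda>n. form r (X n - W) (X n) + form r W (X n - W)) \<longlonglongrightarrow> 0"
  proof (rule Lim_null_comparison[OF always_eventually[OF allI]])
    show "norm (form r (X n - W) (X n) + form r W (X n - W)) \<le> K * norm (X n - W) * norm (X n) + K * norm W * norm (X n - W)" for n
      using norm_triangle_ineq B[OF d X] B[OF W d] by (rule order_trans[OF _ add_mono])
    have "(\<lambda>n. K * norm (X n - W) * norm (X n) + K * norm W * norm (X n - W)) \<longlonglongrightarrow> K * norm (W - W) * norm W + K * norm W * norm (W - W)"
      by (intro tendsto_intros lim)
    then show "(\<lambda>n. K * norm (X n - W) * norm (X n) + K * norm W * norm (X n - W)) \<longlonglongrightarrow> 0" by simp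
  qed
  moreover have "form r (X n) (X n) = form r W W + (form r (X n - W) (X n) + form r W (X n - W))" for n
    using form_add_left[OF r R d W X, of n n] form_add_right[OF r R d W W, of n] by simp
  ultimately show ?thesis using tendsto_add[OF tendsto_const, of "\<lambda>n. form r (X n - W) (X n) + form r W (X n - W)" 0 sequentially "form r W W"]
    by simp
qed

text \<open>On the domain of the minimal operator the form values are multiples of elements of the numerical range; both sides of the
  inequality are homogeneous of degree two and continuous in \<open>W\<close>.\<close>

theorem form_in_cone:
  assumes r: "r \<in> L2_loc"
    and cone: "\<And>w. w \<in> numerical_range (minimal_operator r) \<Longrightarrow> c * norm (w - z0) \<le> Re (\<omega> * (w - z0))"
    and W: "W \<in> form_core"
  defines "q \<equiv> form r W W - z0 * of_real ((norm (prim_L2 W))\<^sup>2)"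
  shows "c * norm q \<le> Re (\<omega> * q)"
proof -
  let ?q = "\<lambda>W. form r W W - z0 * of_real ((norm (prim_L2 W))\<^sup>2)"
  have core: "c * norm (?q W) \<le> Re (\<omega> * ?q W)" if W: "W \<in> form_core" and g: "(prim_L2 W, g) \<in> minimal_operator r" for W g
  proof (cases "prim_L2 W = 0")
    case True
    have "cinner g 0 = 0" using cinner_cscale_right[of g 0 0] by simp
    then show ?thesis using True minimal_operator_form[OF r W g W] by simp
  next
    case False
    define n where "n = norm (prim_L2 W)"
    have n: "n > 0" using False by (simp add: n_def)
    let ?a = "complex_of_real (1 / n)"
    have "norm (cscale ?a (prim_L2 W)) = 1" using n by (simp add: norm_cscale norm_divide n_def)
    then have "cinner (cscale ?a g) (cscale ?a (prim_L2 W)) \<in> numerical_range (minimal_operator r)"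
      unfolding numerical_range_def using minimal_operator_cscale[OF g] by blast
    moreover have "cinner (cscale ?a g) (cscale ?a (prim_L2 W)) = of_real (1 / n\<^sup>2) * form r W W"
      using minimal_operator_form[OF r W g W] by (simp add: cinner_cscale_left cinner_cscale_right power2_eq_square)
    moreover have "of_real (1 / n\<^sup>2) * form r W W - z0 = of_real (1 / n\<^sup>2) * ?q W"
      using n by (simp add: n_def[symmetric] field_simps)
    ultimately have "c * norm (of_real (1 / n\<^sup>2) * ?q W) \<le> Re (\<omega> * (of_real (1 / n\<^sup>2) * ?q W))"
      using cone by metis
    moreover have "norm (of_real (1 / n\<^sup>2) * ?q W) = norm (?q W) / n\<^sup>2" using n by (simp only: norm_mult norm_of_real) simp
    moreover have "Re (\<omega> * (of_real (1 / n\<^sup>2) * ?q W)) = Re (\<omega> * ?q W) / n\<^sup>2"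
    proof -
      have "\<omega> * (of_real (1 / n\<^sup>2) * ?q W) = of_real (1 / n\<^sup>2) * (\<omega> * ?q W)" by (simp only: mult.left_commute)
      moreover have "Re (of_real a * z) = a * Re z" for a z by simp
      ultimately show ?thesis by (simp only:) simp
    qed
    ultimately show ?thesis using n by (simp add: divide_right_mono divide_le_cancel)
  qed
  obtain R where R: "R > 0" "W \<in> form_domain R" using W by (auto simp: form_core_iff)
  then have R0: "R \<ge> 0" by simp
  have "W \<in> closure {W \<in> form_domain R. \<exists>g. (prim_L2 W, g) \<in> minimal_operator r}"
    using minimal_domain_dense[OF r R(1)] R(2) by (rule subsetD)
  then obtain X where X0: "\<forall>n. X n \<in> {W \<in> form_domain R. \<exists>g. (prim_L2 W, g) \<in> minimal_operator r}" "X \<longlonglongrightarrow> W"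
    unfolding closure_sequential by blast
  then have X: "X n \<in> form_domain R" "\<exists>g. (prim_L2 (X n), g) \<in> minimal_operator r" "X \<longlonglongrightarrow> W" for n by auto
  have XV: "X n \<in> form_core" for n using X(1) form_domain_subset_form_core[OF R0] by blast
  have "(\<lambda>n. prim_L2 (X n)) \<longlonglongrightarrow> prim_L2 W"
  proof -
    have "(\<lambda>n. prim_L2 (X n - W)) \<longlonglongrightarrow> 0"
    proof (rule Lim_null_comparison[OF always_eventually[OF allI]])
      show "norm (prim_L2 (X n - W)) \<le> sqrt R * loc_norm (\<lambda>_. 1) R * norm (X n - W)" for n
        using norm_prim_L2_le[OF R0] form_domain_diff[OF X(1) R(2)] by blast
      have "(\<lambda>n. sqrt R * loc_norm (\<lambda>_. 1) R * norm (X n - W)) \<longlonglongrightarrow> sqrt R * loc_norm (\<lambda>_. 1) R * norm (W - W)" by (intro tendsto_intros X(3))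
      then show "(\<lambda>n. sqrt R * loc_norm (\<lambda>_. 1) R * norm (X n - W)) \<longlonglongrightarrow> 0" by simp
    qed
    then have "(\<lambda>n. prim_L2 (X n) - prim_L2 W) \<longlonglongrightarrow> 0" using prim_L2_diff'[OF XV W] by simp
    then show ?thesis by (simp add: LIM_zero_iff)
  qed
  then have lim: "(\<lambda>n. ?q (X n)) \<longlonglongrightarrow> ?q W"
    by (intro tendsto_diff tendsto_form_diag[OF r R0 X(1) R(2) X(3)] tendsto_mult tendsto_const tendsto_of_real tendsto_power tendsto_norm)
  have "c * norm (?q W) \<le> Re (\<omega> * ?q W)"
  proof (rule LIMSEQ_le)
    show "(\<lambda>n. c * norm (?q (X n))) \<longlonglongrightarrow> c * norm (?q W)" by (intro tendsto_mult tendsto_const tendsto_norm lim)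
    show "(\<lambda>n. Re (\<omega> * ?q (X n))) \<longlonglongrightarrow> Re (\<omega> * ?q W)" by (intro tendsto_Re tendsto_mult tendsto_const lim)
    show "\<exists>N. \<forall>n\<ge>N. c * norm (?q (X n)) \<le> Re (\<omega> * ?q (X n))" using core[OF XV] X(2) by blast
  qed
  then show ?thesis by (simp add: q_def)
qed

text \<open>The part of the form that involves the potential is additive and homogeneous in it, whereas \<open>\<bar>\<bar>W\<bar>\<bar>\<^sup>2\<close> is not:
  hence the surplus.\<close>

lemma form_shift:
  assumes s: "s \<in> L2_loc" and \<sigma>: "\<sigma> \<in> L2_loc" and W: "W \<in> form_core" and \<epsilon>: "\<epsilon> > 0"
  shows "form (\<lambda>x. s x + \<sigma> x) W W = of_real (1 / (1 + \<epsilon>)) * form (\<lambda>x. of_real (1 + \<epsilon>) * s x) W W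
     + of_real (\<epsilon> / (1 + \<epsilon>)) * of_real ((norm W)\<^sup>2) - (of_real ((norm W)\<^sup>2) - form \<sigma> W W)"
proof -
  obtain R where R: "R > 0" "W \<in> form_domain R" using W by (auto simp: form_core_iff)
  have R0: "R \<ge> 0" using R by simp
  have N: "cinner W W = of_real ((norm W)\<^sup>2)" by (simp add: cinner_self)
  have e: "complex_of_real (1 + \<epsilon>) \<noteq> 0" using \<epsilon> by (simp only: of_real_eq_0_iff)
  have 1: "times_prim (\<lambda>x. of_real (1 + \<epsilon>) * s x) W = cscale (of_real (1 + \<epsilon>)) (times_prim s W)"
    by (rule times_prim_cscale_coeff[OF s R0 R(2)])
  have 2: "times_prim (\<lambda>x. cnj (of_real (1 + \<epsilon>) * s x)) W = cscale (of_real (1 + \<epsilon>)) (times_prim (\<lambda>x. cnj (s x)) W)"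
    using times_prim_cscale_coeff[OF L2_loc_cnj[OF s] R0 R(2), of "of_real (1 + \<epsilon>)"] by simp
  have 3: "times_prim (\<lambda>x. s x + \<sigma> x) W = times_prim s W + times_prim \<sigma> W" by (rule times_prim_add_coeff[OF s \<sigma> R0 R(2)])
  have 4: "times_prim (\<lambda>x. cnj (s x + \<sigma> x)) W = times_prim (\<lambda>x. cnj (s x)) W + times_prim (\<lambda>x. cnj (\<sigma> x)) W"
    using times_prim_add_coeff[OF L2_loc_cnj[OF s] L2_loc_cnj[OF \<sigma>] R0 R(2)] by simp
  show ?thesis unfolding form_def N 1 2 3 4
    using e by (simp add: cinner_cscale_left cinner_cscale_right cinner_add_left cinner_add_right field_simps del: of_real_add of_real_power)
      (simp add: algebra_simps)?
qed

section \<open>Compact resolvents and compact embedding of the form domain\<close>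

text \<open>The modulus makes \<open>f\<close> factor through \<open>p\<close>, so this reduces to the image of a totally bounded set.\<close>

lemma totally_bounded_modulus_inverse:
  fixes f :: "'c \<Rightarrow> 'b::metric_space" and p :: "'c \<Rightarrow> 'a::metric_space"
  assumes tb: "totally_bounded (p ` S)"
    and mod: "\<And>e. e > 0 \<Longrightarrow> \<exists>d>0. \<forall>x\<in>S. \<forall>y\<in>S. dist (p x) (p y) < d \<longrightarrow> dist (f x) (f y) < e"
  shows "totally_bounded (f ` S)"
proof -
  let ?h = "\<lambda>z. f (inv_into S p z)"
  have "totally_bounded (?h ` p ` S)"
  proof (rule totally_bounded_modulus_image[OF tb])
    fix e :: real assume "e > 0"
    then obtain d where d: "d > 0" "\<And>x y. x \<in> S \<Longrightarrow> y \<in> S \<Longrightarrow> dist (p x) (p y) < d \<Longrightarrow> dist (f x) (f y) < e" using mod by meson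
    have "dist (?h z) (?h z') < e" if "z \<in> p ` S" "z' \<in> p ` S" "dist z z' < d" for z z'
      using that by (intro d(2)) (auto simp: inv_into_into f_inv_into_f)
    then show "\<exists>d>0. \<forall>x\<in>p ` S. \<forall>y\<in>p ` S. dist x y < d \<longrightarrow> dist (?h x) (?h y) < e" using d(1) by blast
  qed
  moreover have "?h (p x) = f x" if x: "x \<in> S" for x
  proof (rule ccontr)
    assume ne: "?h (p x) \<noteq> f x"
    then obtain d where d: "d > 0" "\<And>u v. u \<in> S \<Longrightarrow> v \<in> S \<Longrightarrow> dist (p u) (p v) < d \<Longrightarrow> dist (f u) (f v) < dist (?h (p x)) (f x)"
      using mod[of "dist (?h (p x)) (f x)"] by auto
    have "inv_into S p (p x) \<in> S" "p (inv_into S p (p x)) = p x" using x by (auto simp: inv_into_into f_inv_into_f)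
    then show False using d(2)[of "inv_into S p (p x)" x] x d(1) by simp
  qed
  then have "f ` S \<subseteq> ?h ` p ` S" by (auto simp: image_iff)
  ultimately show ?thesis using totally_bounded_subset by blast
qed

text \<open>The cross product of \<open>p\<close> and \<open>q\<close>. If it vanishes, every vector of the form \<open>(p2, - p1, 0)\<close> or similar is annihilated by
  both, and one of these is non-zero unless \<open>p = q = 0\<close>.\<close>

lemma common_orthogonal_vector:
  fixes p1 p2 p3 q1 q2 q3 :: complex
  obtains a1 a2 a3 where "\<not> (a1 = 0 \<and> a2 = 0 \<and> a3 = 0)"
    "a1 * p1 + a2 * p2 + a3 * p3 = 0" "a1 * q1 + a2 * q2 + a3 * q3 = 0"
proof (cases "p2 * q3 - p3 * q2 = 0 \<and> p3 * q1 - p1 * q3 = 0 \<and> p1 * q2 - p2 * q1 = 0")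
  case False
  show ?thesis
    by (rule that[of "p2 * q3 - p3 * q2" "p3 * q1 - p1 * q3" "p1 * q2 - p2 * q1"])
      (use False in \<open>simp_all add: algebra_simps\<close>)
next
  case True
  consider "p1 \<noteq> 0" | "p2 \<noteq> 0" | "p3 \<noteq> 0" | "q1 \<noteq> 0" | "q2 \<noteq> 0" | "q3 \<noteq> 0" | "p1 = 0 \<and> q1 = 0" by blast
  then show ?thesis
  proof cases
    case 1 show ?thesis by (rule that[of p2 "- p1" 0]) (use 1 True in \<open>auto simp: algebra_simps\<close>)
  next
    case 2 show ?thesis by (rule that[of p2 "- p1" 0]) (use 2 True in \<open>auto simp: algebra_simps\<close>)
  next
    case 3 show ?thesis by (rule that[of 0 p3 "- p2"]) (use 3 True in \<open>auto simp: algebra_simps\<close>)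
  next
    case 4 show ?thesis by (rule that[of q2 "- q1" 0]) (use 4 True in \<open>auto simp: algebra_simps\<close>)
  next
    case 5 show ?thesis by (rule that[of q2 "- q1" 0]) (use 5 True in \<open>auto simp: algebra_simps\<close>)
  next
    case 6 show ?thesis by (rule that[of 0 q3 "- q2"]) (use 6 True in \<open>auto simp: algebra_simps\<close>)
  next
    case 7 show ?thesis by (rule that[of 1 0 0]) (use 7 in auto)
  qed
qed

context sectorial_potential
begin

text \<open>The primitive of \<open>W\<close> lies in the domain of the minimal operator and satisfies \<open>\<omega> l(y) + \<mu> y = prim Y\<close>. Right-hand sides are
  restricted to primitives of form elements so that they may be inserted into the form.\<close>

definition solves :: "L2 \<Rightarrow> L2 \<Rightarrow> bool" where
  "solves W Y \<longleftrightarrow> W \<in> form_core \<and> Y \<in> form_core \<and>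
     (\<exists>g. (prim_L2 W, g) \<in> minimal_operator r \<and> cscale \<omega> g + \<mu> *\<^sub>R prim_L2 W = prim_L2 Y)"

definition solvable :: "L2 set" where "solvable = {Y. \<exists>W. solves W Y}"

lemma solves_lincomb:
  assumes "solves W Y" "solves W' Y'"
  shows "solves (cscale a W + W') (cscale a Y + Y')"
proof -
  obtain g where g: "W \<in> form_core" "Y \<in> form_core" "(prim_L2 W, g) \<in> minimal_operator r" "cscale \<omega> g + \<mu> *\<^sub>R prim_L2 W = prim_L2 Y"
    using assms(1) by (auto simp: solves_def)
  obtain g' where g': "W' \<in> form_core" "Y' \<in> form_core" "(prim_L2 W', g') \<in> minimal_operator r" "cscale \<omega> g' + \<mu> *\<^sub>R prim_L2 W' = prim_L2 Y'"
    using assms(2) by (auto simp: solves_def)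
  have p: "prim_L2 (cscale a W + W') = cscale a (prim_L2 W) + prim_L2 W'"
    using g g' by (simp add: prim_L2_add' prim_L2_cscale' form_core_cscale)
  have "prim_L2 (cscale a Y + Y') = cscale a (cscale \<omega> g + \<mu> *\<^sub>R prim_L2 W) + (cscale \<omega> g' + \<mu> *\<^sub>R prim_L2 W')"
    using g g' by (simp add: prim_L2_add' prim_L2_cscale' form_core_cscale)
  also have "\<dots> = cscale \<omega> (cscale a g + g') + \<mu> *\<^sub>R prim_L2 (cscale a W + W')"
    by (simp add: p cscale_add_right cscale_scaleR scaleR_add_right mult.commute)
  finally show ?thesis unfolding solves_def
    using minimal_operator_lincomb[OF g(3) g'(3), of a] g g' p
    by (auto intro!: form_core_add form_core_cscale)
qed

lemma solves_zero: "solves 0 0"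
proof -
  have "prim_L2 0 = 0" using prim_L2_scaleR'[OF form_core_zero, of 0] by simp
  then show ?thesis using minimal_operator_zero by (auto simp: solves_def form_core_zero intro!: exI[of _ 0])
qed

lemma solvable_lincomb: "Y \<in> solvable \<Longrightarrow> Y' \<in> solvable \<Longrightarrow> cscale a Y + Y' \<in> solvable"
  unfolding solvable_def using solves_lincomb by blast

lemma solvable_zero: "0 \<in> solvable" using solves_zero by (auto simp: solvable_def)

lemma solvable_cscale: "Y \<in> solvable \<Longrightarrow> cscale a Y \<in> solvable"
  using solvable_lincomb[OF _ solvable_zero] by fastforce

lemma subspace_solvable: "subspace solvable"
proof (rule subspaceI)
  fix x y assume "x \<in> solvable" "y \<in> solvable"
  then show "x + y \<in> solvable" using solvable_lincomb[of x y 1] by (simp add: cscale_one)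
qed (simp_all add: solvable_zero scaleR_cscale solvable_cscale)

lemma solvable_subset: "solvable \<subseteq> form_core" by (auto simp: solvable_def solves_def)

lemma solves_weak:
  assumes "solves W Y" "Z \<in> form_core"
  shows "real_form \<omega> \<mu> r W Z = inner (prim_L2 Y) (prim_L2 Z)"
proof -
  obtain g where g: "W \<in> form_core" "(prim_L2 W, g) \<in> minimal_operator r" "cscale \<omega> g + \<mu> *\<^sub>R prim_L2 W = prim_L2 Y"
    using assms(1) by (auto simp: solves_def)
  have "form r W Z = cinner g (prim_L2 Z)" by (rule minimal_operator_form[OF r g(1,2) assms(2)])
  then show ?thesis
    by (simp add: real_form_def inner_add_left cinner_cscale_left cinner_add_left cinner_scaleR_left flip: Re_cinner g(3))
qed

lemma solves_norm_le:
  assumes "solves W Y"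
  shows "norm (prim_L2 W) \<le> norm (prim_L2 Y)"
proof -
  have W: "W \<in> form_core" using assms by (simp add: solves_def)
  have "norm (prim_L2 W) * norm (prim_L2 W) \<le> norm (prim_L2 Y) * norm (prim_L2 W)"
    using L2_bound[OF W] norm_cauchy_schwarz[of "prim_L2 Y" "prim_L2 W"] solves_weak[OF assms W] by (simp add: power2_eq_square)
  then show ?thesis
    using mult_right_le_imp_le[of "norm (prim_L2 W)" "norm (prim_L2 W)" "norm (prim_L2 Y)"]
    by (cases "norm (prim_L2 W) = 0") auto
qed

text \<open>Let \<open>Y\<close> be solvable with solution \<open>w Y\<close>. The primitives of \<open>w Y\<close> are images under the compact resolvent of a bounded
  set. For differences \<open>Y\<close> and \<open>W\<close> of right-hand sides and solutions, \<open>\<bar>\<bar>prim Y\<bar>\<bar>\<^sup>2 = b W Y\<close> and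
  \<open>b W W = \<langle>prim Y, prim W\<rangle>\<close>, so a small \<open>prim W\<close> forces a small \<open>prim Y\<close>.\<close>

lemma totally_bounded_solvable:
  assumes T: "is_resolvent L lam T" "compact_operator T" and L: "minimal_operator r \<subseteq> L"
  shows "totally_bounded (F.unit_ball solvable)"
proof -
  define S where "S = {Y\<in>solvable. real_form \<omega> \<mu> r Y Y \<le> 1}"
  define w where "w Y = (SOME W. solves W Y)" for Y
  have w: "solves (w Y) Y" if "Y \<in> S" for Y
    using that someI_ex[of "\<lambda>W. solves W Y"] by (auto simp: S_def solvable_def w_def)
  have SV: "Y \<in> form_core" if "Y \<in> S" for Y using that solvable_subset by (auto simp: S_def)
  have nS: "norm (prim_L2 Y) \<le> 1" if "Y \<in> S" for Y
  proof -
    have "(norm (prim_L2 Y))\<^sup>2 \<le> 1\<^sup>2" using L2_bound[OF SV[OF that]] that by (simp add: S_def)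
    then show ?thesis by (rule power2_le_imp_le) simp
  qed
  define \<rho> where "\<rho> = 1 + \<mu> + norm lam"
  have "(\<lambda>Y. prim_L2 (w Y)) ` S \<subseteq> T ` cball 0 \<rho>"
  proof clarify
    fix Y assume Y: "Y \<in> S"
    obtain g where g: "(prim_L2 (w Y), g) \<in> minimal_operator r" "cscale \<omega> g + \<mu> *\<^sub>R prim_L2 (w Y) = prim_L2 Y"
      using w[OF Y] by (auto simp: solves_def)
    have nw: "norm (prim_L2 (w Y)) \<le> 1" using solves_norm_le[OF w[OF Y]] nS[OF Y] by simp
    have "cscale \<omega> g = prim_L2 Y - \<mu> *\<^sub>R prim_L2 (w Y)" using g(2) by (simp add: eq_diff_eq)
    then have "norm g = norm (prim_L2 Y - \<mu> *\<^sub>R prim_L2 (w Y))" using norm_cscale[of \<omega> g] \<omega> by simp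
    also have "\<dots> \<le> norm (prim_L2 Y) + norm (\<mu> *\<^sub>R prim_L2 (w Y))" by (rule norm_triangle_ineq4)
    also have "\<dots> \<le> 1 + \<mu>" using nS[OF Y] mult_left_mono[OF nw \<mu>] \<mu> by simp
    finally have ng: "norm g \<le> 1 + \<mu>" .
    have "norm (g - cscale lam (prim_L2 (w Y))) \<le> norm g + norm (cscale lam (prim_L2 (w Y)))" by (rule norm_triangle_ineq4)
    also have "\<dots> \<le> \<rho>" using ng mult_left_mono[OF nw norm_ge_zero[of lam]] by (simp add: \<rho>_def norm_cscale)
    finally have "g - cscale lam (prim_L2 (w Y)) \<in> cball 0 \<rho>" by simp
    moreover have "prim_L2 (w Y) = T (g - cscale lam (prim_L2 (w Y)))"
    proof -
      have "(prim_L2 (w Y), (g - cscale lam (prim_L2 (w Y))) + cscale lam (prim_L2 (w Y))) \<in> L" using g(1) L by auto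
      then show ?thesis using T(1) unfolding is_resolvent_def by blast
    qed
    ultimately show "prim_L2 (w Y) \<in> T ` cball 0 \<rho>" by blast
  qed
  moreover have "totally_bounded (T ` cball 0 \<rho>)"
  proof (rule totally_bounded_subset[OF compact_imp_totally_bounded closure_subset])
    show "compact (closure (T ` cball 0 \<rho>))" using T(2) bounded_cball unfolding compact_operator_def by blast
  qed
  ultimately have "totally_bounded ((\<lambda>Y. prim_L2 (w Y)) ` S)" by (rule totally_bounded_subset[rotated])
  then have "totally_bounded (prim_L2 ` S)"
  proof (rule totally_bounded_modulus_inverse)
    fix e :: real assume e: "e > 0"
    define M where "M = F.M"
    have M: "M \<ge> 0" by (simp add: M_def F.M_nonneg)
    define k where "k = e\<^sup>2 / (2 * (2 * M + 1))"
    have k: "k > 0" using e M by (simp add: k_def)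
    have "dist (prim_L2 Y) (prim_L2 Y') < e"
      if Y: "Y \<in> S" "Y' \<in> S" and d: "dist (prim_L2 (w Y)) (prim_L2 (w Y')) < k\<^sup>2 / 2" for Y Y'
    proof -
      let ?Y = "Y - Y'" and ?W = "w Y - w Y'"
      have V: "w Y \<in> form_core" "w Y' \<in> form_core" "?Y \<in> form_core" "?W \<in> form_core"
        using w[OF Y(1)] w[OF Y(2)] by (auto simp: solves_def intro!: form_core_diff)
      have jY: "prim_L2 ?Y = prim_L2 Y - prim_L2 Y'" and jW: "prim_L2 ?W = prim_L2 (w Y) - prim_L2 (w Y')"
        using V SV Y by (simp_all add: prim_L2_diff')
      have weak: "real_form \<omega> \<mu> r ?W Z = inner (prim_L2 ?Y) (prim_L2 Z)" if Z: "Z \<in> form_core" for Z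
        using solves_weak[OF w[OF Y(1)] Z] solves_weak[OF w[OF Y(2)] Z] F.form_simps V(1,2) Z
        by (simp add: jY inner_diff_left)
      have nY: "norm (prim_L2 ?Y) \<le> 2" using norm_triangle_ineq4[of "prim_L2 Y" "prim_L2 Y'"] nS[OF Y(1)] nS[OF Y(2)] by (simp add: jY)
      have "(F.nrm ?W)\<^sup>2 = real_form \<omega> \<mu> r ?W ?W" using F.nonneg[OF V(4)] by (simp add: F.nrm_def)
      also have "\<dots> \<le> norm (prim_L2 ?Y) * norm (prim_L2 ?W)" unfolding weak[OF V(4)] by (rule norm_cauchy_schwarz)
      also have "\<dots> \<le> 2 * (k\<^sup>2 / 2)" using nY d by (intro mult_mono) (auto simp: jW dist_norm)
      finally have "(F.nrm ?W)\<^sup>2 \<le> k\<^sup>2" by simp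
      then have nW: "F.nrm ?W \<le> k" by (rule power2_le_imp_le) (use k in simp)
      have "real_form \<omega> \<mu> r ?Y ?Y \<le> 4"
        using F.diff_le[OF SV[OF Y(1)] SV[OF Y(2)]] Y by (simp add: S_def)
      then have "(F.nrm ?Y)\<^sup>2 \<le> 2\<^sup>2" by (simp add: F.nrm_sq[OF V(3)])
      then have nrmY: "F.nrm ?Y \<le> 2" by (rule power2_le_imp_le) simp
      have "(norm (prim_L2 ?Y))\<^sup>2 = real_form \<omega> \<mu> r ?W ?Y" by (simp add: weak[OF V(3)] power2_norm_eq_inner)
      also have "\<dots> \<le> M * F.nrm ?W * F.nrm ?Y" using F.bounded_form[OF V(4,3)] by (simp add: M_def)
      also have "\<dots> \<le> M * k * 2" by (intro mult_mono nW nrmY order_refl M F.nrm_nonneg[OF V(4)] F.nrm_nonneg[OF V(3)] mult_nonneg_nonneg less_imp_le[OF k])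
      also have "\<dots> < (2 * M + 1) * k * 2" using k M by (simp add: algebra_simps add_pos_nonneg)
      also have "\<dots> = e\<^sup>2"
      proof -
        have m: "2 * (2 * M + 1) > 0" using M by (simp add: add_nonneg_pos)
        have "k * (2 * (2 * M + 1)) = e\<^sup>2" unfolding k_def
          by (rule nonzero_eq_divide_eq[OF less_imp_neq[OF m, THEN not_sym], THEN iffD1, OF refl])
        then show ?thesis by (simp add: mult_ac)
      qed
      finally show ?thesis using e by (simp add: jY dist_norm power2_less_imp_less)
    qed
    then show "\<exists>d>0. \<forall>Y\<in>S. \<forall>Y'\<in>S. dist (prim_L2 (w Y)) (prim_L2 (w Y')) < d \<longrightarrow> dist (prim_L2 Y) (prim_L2 Y') < e"
      using k by (intro exI[of _ "k\<^sup>2 / 2"]) auto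
  qed
  then show ?thesis by (simp add: F.unit_ball_def S_def)
qed

text \<open>Coercivity on the fixed interval comes from the Garding inequality, with a constant that depends on \<open>R\<close>.\<close>

lemma dirichlet_strong_solution:
  assumes R: "R > 0" and Y: "Y \<in> form_domain R"
  obtains W c d where "W \<in> form_domain R" "strong_solution \<omega> \<mu> r R (prim_L2 Y) W c d"
proof -
  have R0: "R \<ge> 0" using R by simp
  obtain L where L: "L \<ge> 0" "\<And>W. W \<in> form_domain R \<Longrightarrow> Re \<omega> / 2 * (norm W)\<^sup>2 \<le> Re (\<omega> * form r W W) + L * (norm (prim_L2 W))\<^sup>2"
    using garding[OF r R0 \<omega>_pos] \<omega> by auto
  define c where "c = Re \<omega> / 2 / (1 + L)"
  have c: "c > 0" using L(1) \<omega>_pos by (simp add: c_def)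
  have coer: "c * (norm W)\<^sup>2 \<le> real_form \<omega> \<mu> r W W" if W: "W \<in> form_domain R" for W
  proof -
    have WV: "W \<in> form_core" using W form_domain_subset_form_core[OF R0] by blast
    have "Re \<omega> / 2 * (norm W)\<^sup>2 \<le> real_form \<omega> \<mu> r W W + L * (norm (prim_L2 W))\<^sup>2"
      using L(2)[OF W] \<mu> by (auto simp: real_form_def power2_norm_eq_inner intro: order_trans)
    also have "\<dots> \<le> real_form \<omega> \<mu> r W W + L * real_form \<omega> \<mu> r W W" using L2_bound[OF WV] L(1) by (simp add: mult_left_mono)
    finally show ?thesis using L(1) by (simp add: c_def field_simps)
  qed
  obtain W where W: "W \<in> form_domain R" "\<And>Z. Z \<in> form_domain R \<Longrightarrow> real_form \<omega> \<mu> r W Z = inner (prim_L2 Y) (prim_L2 Z)"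
    using dirichlet_problem[OF r R0 c coer, of "prim_L2 Y"] by auto
  show ?thesis using weak_solution_regular[OF r R W] that[OF W(1)] by blast
qed

text \<open>The boundary values of the quasi-derivatives of the Dirichlet solutions are two linear conditions on the right-hand
  side, taken on an interval that contains all three supports.\<close>

lemma three_dependent_mod_solvable:
  assumes "Y1 \<in> form_core" "Y2 \<in> form_core" "Y3 \<in> form_core"
  obtains a1 a2 a3 where "\<not> (a1 = 0 \<and> a2 = 0 \<and> a3 = 0)" "cscale a1 Y1 + cscale a2 Y2 + cscale a3 Y3 \<in> solvable"
proof -
  obtain R where R: "R > 0" "Y1 \<in> form_domain R" "Y2 \<in> form_domain R" "Y3 \<in> form_domain R"
    by (rule form_core_common3[OF assms], rule that)
  obtain W1 c1 d1 where 1: "W1 \<in> form_domain R" "strong_solution \<omega> \<mu> r R (prim_L2 Y1) W1 c1 d1"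
    by (rule dirichlet_strong_solution[OF R(1,2)])
  obtain W2 c2 d2 where 2: "W2 \<in> form_domain R" "strong_solution \<omega> \<mu> r R (prim_L2 Y2) W2 c2 d2"
    by (rule dirichlet_strong_solution[OF R(1,3)])
  obtain W3 c3 d3 where 3: "W3 \<in> form_domain R" "strong_solution \<omega> \<mu> r R (prim_L2 Y3) W3 c3 d3"
    by (rule dirichlet_strong_solution[OF R(1,4)])
  obtain a1 a2 a3 where a: "\<not> (a1 = 0 \<and> a2 = 0 \<and> a3 = 0)" "a1 * c1 + a2 * c2 + a3 * c3 = 0" "a1 * d1 + a2 * d2 + a3 * d3 = 0"
    by (rule common_orthogonal_vector)
  define W where "W = cscale a1 W1 + cscale a2 W2 + cscale a3 W3"
  define Y where "Y = cscale a1 Y1 + cscale a2 Y2 + cscale a3 Y3"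
  have Y: "Y \<in> form_domain R" and W: "W \<in> form_domain R" unfolding W_def Y_def
    using R 1 2 3 by (auto intro!: form_domain_add form_domain_cscale)
  have "prim_L2 Y = cscale a1 (prim_L2 Y1) + cscale a2 (prim_L2 Y2) + cscale a3 (prim_L2 Y3)"
    using assms by (simp add: Y_def prim_L2_add' prim_L2_cscale' form_core_add form_core_cscale)
  then have sol: "strong_solution \<omega> \<mu> r R (prim_L2 Y) W 0 0"
    using strong_solution_add[OF r strong_solution_add[OF r strong_solution_cscale[OF 1(2), of a1] strong_solution_cscale[OF 2(2), of a2]] strong_solution_cscale[OF 3(2), of a3]]
      a(2,3) by (simp add: W_def)
  have "\<omega> \<noteq> 0" using \<omega> by auto
  then have "\<exists>g. (prim_L2 W, g) \<in> minimal_operator r \<and> cscale \<omega> g + \<mu> *\<^sub>R prim_L2 W = prim_L2 Y"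
    by (rule minimal_operator_of_strong_solution[OF r less_imp_le[OF R(1)] W Y _ sol])
  moreover have "W \<in> form_core" "Y \<in> form_core" using W Y R(1) by (auto simp: form_core_iff)
  ultimately have "solves W Y" unfolding solves_def by blast
  then show ?thesis using that[OF a(1)] by (auto simp: solvable_def Y_def)
qed

text \<open>The space of solvable right-hand sides has complex codimension at most two. The vectors \<open>e1\<close> and \<open>e2\<close> may be zero or
  redundant.\<close>

lemma solvable_codim_2:
  obtains e1 e2 where "e1 \<in> form_core" "e2 \<in> form_core"
    "\<And>v. v \<in> form_core \<Longrightarrow> \<exists>a b. v - (cscale a e1 + cscale b e2) \<in> solvable"
proof -
  consider (a) "form_core \<subseteq> solvable"
    | (b) e1 where "e1 \<in> form_core" "e1 \<notin> solvable" "\<And>v. v \<in> form_core \<Longrightarrow> \<exists>a. v - cscale a e1 \<in> solvable"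
    | (c) e1 e2 where "e1 \<in> form_core" "e1 \<notin> solvable" "e2 \<in> form_core" "\<And>a. e2 - cscale a e1 \<notin> solvable"
  proof (cases "form_core \<subseteq> solvable")
    case False
    then obtain e1 where e1: "e1 \<in> form_core" "e1 \<notin> solvable" by auto
    show ?thesis
    proof (cases "\<forall>v\<in>form_core. \<exists>a. v - cscale a e1 \<in> solvable")
      case True
      then show ?thesis using b[OF e1] by simp
    next
      case False
      then obtain e2 where "e2 \<in> form_core" "\<forall>a. e2 - cscale a e1 \<notin> solvable" by auto
      then show ?thesis using c[OF e1, of e2] by simp
    qed
  qed
  then show ?thesis
  proof cases
    case a
    show ?thesis by (rule that[of 0 0]) (use a in \<open>auto simp: form_core_zero cscale_zero_right\<close>)
  next
    case b
    show ?thesis by (rule that[of e1 0]) (use b in \<open>auto simp: form_core_zero cscale_zero_right\<close>)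
  next
    case c
    show ?thesis
    proof (rule that[OF c(1,3)])
      fix v assume v: "v \<in> form_core"
      obtain a1 a2 a3 where a: "\<not> (a1 = 0 \<and> a2 = 0 \<and> a3 = 0)" "cscale a1 e1 + cscale a2 e2 + cscale a3 v \<in> solvable"
        by (rule three_dependent_mod_solvable[OF c(1,3) v])
      have a3: "a3 \<noteq> 0"
      proof
        assume 0: "a3 = 0"
        show False
        proof (cases "a2 = 0")
          case True
          then have a1: "a1 \<noteq> 0" "cscale a1 e1 \<in> solvable" using a 0 by simp_all
          have "cscale (1 / a1) (cscale a1 e1) = e1" using a1(1) by (simp add: cscale_cscale cscale_one)
          then show False using solvable_cscale[OF a1(2), of "1 / a1"] c(2) by simp
        next
          case False
          have "cscale (1 / a2) (cscale a1 e1 + cscale a2 e2) \<in> solvable" using a 0 by (intro solvable_cscale) simp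
          also have "cscale (1 / a2) (cscale a1 e1 + cscale a2 e2) = e2 - cscale (- (a1 / a2)) e1"
            using False by (simp add: cscale_add_right cscale_one cscale_minus_left)
          finally show False using c(4) by blast
        qed
      qed
      have "cscale (1 / a3) (cscale a1 e1 + cscale a2 e2 + cscale a3 v) \<in> solvable" using a by (intro solvable_cscale)
      also have "cscale (1 / a3) (cscale a1 e1 + cscale a2 e2 + cscale a3 v) = v - (cscale (- (a1 / a3)) e1 + cscale (- (a2 / a3)) e2)"
        using a3 by (simp add: cscale_add_right cscale_one cscale_minus_left)
      finally show "\<exists>a b. v - (cscale a e1 + cscale b e2) \<in> solvable" by blast
    qed
  qed
qed

text \<open>The complement is spanned over the reals by \<open>e1\<close>, \<open>\<i> e1\<close>, \<open>e2\<close> and \<open>\<i> e2\<close>.\<close>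

theorem compact_embedding:
  assumes "has_extension_with_compact_resolvent (minimal_operator r)"
  shows "totally_bounded (F.unit_ball form_core)"
proof -
  obtain L lam T where L: "minimal_operator r \<subseteq> L" "is_resolvent L lam T" "compact_operator T"
    using assms unfolding has_extension_with_compact_resolvent_def resolvent_set_def by blast
  obtain e1 e2 where e: "e1 \<in> form_core" "e2 \<in> form_core"
    "\<And>v. v \<in> form_core \<Longrightarrow> \<exists>a b. v - (cscale a e1 + cscale b e2) \<in> solvable"
    by (rule solvable_codim_2, rule that)
  define E where "E = {e1, cscale \<i> e1, e2, cscale \<i> e2}"
  have E: "finite E" "E \<subseteq> form_core" using e by (auto simp: E_def form_core_cscale)
  have span: "cscale a x \<in> span E" if x: "x \<in> E" "cscale \<i> x \<in> E" for a x
  proof -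
    have "cscale a x = cscale (of_real (Re a) + of_real (Im a) * \<i>) x" by (simp add: complex_eq mult.commute flip: complex_eq)
    also have "\<dots> = Re a *\<^sub>R x + Im a *\<^sub>R cscale \<i> x" by (simp only: cscale_add_left scaleR_cscale cscale_cscale)
    finally show ?thesis using x by (simp add: span_add span_scale span_base)
  qed
  have "form_core \<subseteq> {w + s | w s. w \<in> solvable \<and> s \<in> span E}"
  proof
    fix v assume "v \<in> form_core"
    then obtain a b where ab: "v - (cscale a e1 + cscale b e2) \<in> solvable" using e(3) by blast
    have "cscale a e1 + cscale b e2 \<in> span E" by (intro span_add span) (auto simp: E_def)
    moreover have "v = (v - (cscale a e1 + cscale b e2)) + (cscale a e1 + cscale b e2)" by simp
    ultimately show "v \<in> {w + s | w s. w \<in> solvable \<and> s \<in> span E}" using ab by blast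
  qed
  then show ?thesis
    using totally_bounded_subset[OF F.totally_bounded_finite_codim[OF solvable_subset subspace_solvable totally_bounded_solvable[OF L(2,3,1)] E]
        F.unit_ball_mono] by blast
qed

end

section \<open>Perturbation\<close>

text \<open>A shift by \<open>\<bar>z0\<bar> + 1\<close> moves the vertex of the cone so far that \<open>\<integral>\<bar>y\<bar>\<^sup>2\<close> is dominated.\<close>

lemma L2_form_bounds:
  assumes \<omega>: "norm \<omega> = 1" and c: "c > 0"
    and q: "c * norm (form r W W - z0 * of_real ((norm (prim_L2 W))\<^sup>2)) \<le> Re (\<omega> * (form r W W - z0 * of_real ((norm (prim_L2 W))\<^sup>2)))"
  defines "b \<equiv> real_form \<omega> (norm z0 + 1) r W W"
  shows "(norm (prim_L2 W))\<^sup>2 \<le> b" "norm (form r W W) \<le> (1 / c + norm z0) * b"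
proof -
  let ?p = "(norm (prim_L2 W))\<^sup>2"
  let ?q = "form r W W - z0 * of_real ?p"
  have "norm (\<omega> * z0 * of_real ?p) = norm z0 * ?p" using \<omega> by (simp add: norm_mult norm_power)
  then have "- (norm z0 * ?p) \<le> Re (\<omega> * z0 * of_real ?p)" using abs_Re_le_cmod[of "\<omega> * z0 * of_real ?p"] by linarith
  moreover have "Re (\<omega> * form r W W) = Re (\<omega> * ?q) + Re (\<omega> * z0 * of_real ?p)"
    by (simp only: right_diff_distrib minus_complex.sel mult.assoc)
  moreover have "inner (prim_L2 W) (prim_L2 W) = ?p" by (simp add: power2_norm_eq_inner)
  ultimately have b: "c * norm ?q + ?p \<le> b" using q by (simp only: b_def real_form_def distrib_right)
  have nn: "c * norm ?q \<ge> 0" using c by simp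
  then show p: "?p \<le> b" using b by linarith
  have "norm ?q \<le> b / c" using b c zero_le_power2[of "norm (prim_L2 W)"] by (simp only: pos_le_divide_eq mult.commute[of _ c])
  moreover have "norm (form r W W) \<le> norm ?q + norm (z0 * of_real ?p)" using norm_triangle_ineq[of ?q "z0 * of_real ?p"] by (simp only: diff_add_cancel)
  moreover have "norm (z0 * of_real ?p) \<le> norm z0 * b" using mult_left_mono[OF p norm_ge_zero[of z0]] by (simp only: norm_mult norm_of_real) simp
  ultimately show "norm (form r W W) \<le> (1 / c + norm z0) * b" by (simp add: distrib_right)
qed

text \<open>The arithmetic of the perturbation, with \<open>Q\<close>, \<open>N\<close>, \<open>p\<close> and \<open>P\<close> in the roles of the given form, \<open>\<bar>\<bar>y'\<bar>\<bar>\<^sup>2\<close>,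
  \<open>\<bar>\<bar>y\<bar>\<bar>\<^sup>2\<close> and the error term. The error uses up half of the surplus \<open>\<kappa> c N\<close>.\<close>

lemma perturbed_form_bounds:
  fixes q N p t \<kappa> \<eta> K c \<mu> C :: real
  assumes \<omega>: "norm \<omega> = 1" "c \<le> Re \<omega>" and c: "c > 0" and t: "0 < t" "t \<le> 1" and \<kappa>: "0 < \<kappa>" and \<mu>: "\<mu> \<ge> 0" and K: "K \<ge> 0" and C: "C \<ge> 0"
    and Np: "N \<ge> 0" "p \<ge> 0"
    and b: "p \<le> Re (\<omega> * Q) + \<mu> * p" "norm Q \<le> C * (Re (\<omega> * Q) + \<mu> * p)"
    and P: "norm P \<le> \<kappa> * c / 2 * N + K * p"
  defines "Q1 \<equiv> of_real t * Q + of_real \<kappa> * of_real N - P"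
  defines "b1 \<equiv> Re (\<omega> * Q1) + (K + \<mu> + 1) * p"
  shows "p \<le> b1" "t * (Re (\<omega> * Q) + \<mu> * p) \<le> b1" "\<kappa> * c / 2 * N \<le> b1" "norm Q1 \<le> (C + 2 / c + 1 + K) * b1"
proof -
  define b0 where "b0 = Re (\<omega> * Q) + \<mu> * p"
  define B where "B = \<kappa> * c / 2 * N"
  have B: "B \<ge> 0" unfolding B_def using c \<kappa> Np by (intro mult_nonneg_nonneg) auto
  have P': "norm P \<le> B + K * p" using P by (simp only: B_def)
  have b0: "p \<le> b0" "norm Q \<le> C * b0" "b0 \<ge> 0" using b Np by (auto simp: b0_def)
  have "Re (\<omega> * Q1) = t * Re (\<omega> * Q) + \<kappa> * N * Re \<omega> - Re (\<omega> * P)"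
    by (simp add: Q1_def algebra_simps)
  moreover have "\<kappa> * N * c \<le> \<kappa> * N * Re \<omega>" using \<omega> \<kappa> Np by (intro mult_left_mono) auto
  moreover have "\<kappa> * N * c = 2 * B" by (simp add: B_def)
  moreover have "\<bar>Re (\<omega> * P)\<bar> \<le> norm P" using abs_Re_le_cmod[of "\<omega> * P"] \<omega> by (simp add: norm_mult)
  moreover have "t * (\<mu> * p) \<le> \<mu> * p" using t \<mu> Np by (intro mult_left_le_one_le) auto
  ultimately have b1: "t * b0 + B + p \<le> b1" using P' by (simp add: b1_def b0_def algebra_simps)
  have tb0: "t * b0 \<ge> 0" using t b0 by simp
  show r: "p \<le> b1" "t * (Re (\<omega> * Q) + \<mu> * p) \<le> b1" "\<kappa> * c / 2 * N \<le> b1"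
    using b1 tb0 B Np by (simp_all only: flip: b0_def B_def)
  have "norm Q1 \<le> norm (of_real t * Q) + norm (of_real (\<kappa> * N) :: complex) + norm P"
    unfolding Q1_def using norm_triangle_ineq4[of "of_real t * Q + of_real \<kappa> * of_real N" P] norm_triangle_ineq[of "of_real t * Q" "of_real \<kappa> * of_real N"] by simp
  also have "norm (of_real t * Q) = t * norm Q" using t by (simp add: norm_mult)
  also have "t * norm Q \<le> t * (C * b0)" using b0 t by (intro mult_left_mono) auto
  also have "norm (of_real (\<kappa> * N) :: complex) = \<kappa> * N" using \<kappa> Np by (simp only: norm_of_real abs_of_nonneg mult_nonneg_nonneg less_imp_le)
  also have "\<kappa> * N = 2 / c * B" using c by (simp add: B_def)
  also have "t * (C * b0) \<le> C * b1" using mult_left_mono[OF r(2) C] by (simp add: b0_def mult.left_commute)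
  also have "2 / c * B \<le> 2 / c * b1" using c r(3) by (intro mult_left_mono) (auto simp: B_def)
  also have "norm P \<le> b1 + K * b1" using P' r(3) mult_left_mono[OF r(1) K] by (simp add: B_def)
  finally show "norm Q1 \<le> (C + 2 / c + 1 + K) * b1" by (simp add: algebra_simps)
qed

theorem theorem6:
  fixes s :: "real \<Rightarrow> complex" and \<epsilon> \<alpha> \<beta> :: real and z0 :: complex
  assumes "s \<in> L2_loc"
    and "\<epsilon> > 0"
    and "0 \<le> \<beta> - \<alpha>" and "\<beta> - \<alpha> < pi" and "\<bar>\<alpha>\<bar> < pi" and "\<bar>\<beta>\<bar> < pi"
    and "numerical_range (minimal_operator (\<lambda>x. of_real (1 + \<epsilon>) * s x)) \<subseteq> sector \<alpha> \<beta> z0"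
  shows "\<forall>\<sigma>\<in>L2_loc.
     bdd_above ((\<lambda>x. LINT \<xi>|lebesgue_on {x..x+1}. LINT \<eta>|lebesgue_on {x..x+1}.
                   (norm (\<sigma> \<xi> - \<sigma> \<eta>))\<^sup>2) ` {0::real..}) \<longrightarrow>
     strictly_sectorial (minimal_operator (\<lambda>x. s x + \<sigma> x)) \<and>
     (has_extension_with_compact_resolvent (minimal_operator (\<lambda>x. of_real (1 + \<epsilon>) * s x)) \<longrightarrow>
      has_extension_with_compact_resolvent (minimal_operator (\<lambda>x. s x + \<sigma> x)))"
proof (intro ballI impI)
  fix \<sigma> :: "real \<Rightarrow> complex"
  assume \<sigma>: "\<sigma> \<in> L2_loc"
    and bdd: "bdd_above ((\<lambda>x. LINT \<xi>|lebesgue_on {x..x+1}. LINT \<eta>|lebesgue_on {x..x+1}. (norm (\<sigma> \<xi> - \<sigma> \<eta>))\<^sup>2) ` {0::real..})"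
  note s = assms(1) and \<epsilon> = assms(2)
  define r0 where "r0 = (\<lambda>x. of_real (1 + \<epsilon>) * s x)"
  define r1 where "r1 = (\<lambda>x. s x + \<sigma> x)"
  have r0: "r0 \<in> L2_loc" unfolding r0_def by (rule L2_loc_cmult[OF s])
  have r1: "r1 \<in> L2_loc" unfolding r1_def by (rule L2_loc_add[OF s \<sigma>])
  obtain \<omega> c where \<omega>: "norm \<omega> = 1" "c > 0" "c \<le> Re \<omega>"
    and cone: "\<And>w z0. w \<in> sector \<alpha> \<beta> z0 \<Longrightarrow> c * norm (w - z0) \<le> Re (\<omega> * (w - z0))"
    by (rule sector_imp_cone[OF assms(3-6)], rule that)
  have cone0: "c * norm (form r0 W W - z0 * of_real ((norm (prim_L2 W))\<^sup>2)) \<le> Re (\<omega> * (form r0 W W - z0 * of_real ((norm (prim_L2 W))\<^sup>2)))"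
    if W: "W \<in> form_core" for W
    by (rule form_in_cone[OF r0 _ W]) (use assms(7) cone in \<open>auto simp: r0_def\<close>)
  define \<mu>0 where "\<mu>0 = norm z0 + 1"
  define C0 where "C0 = 1 / c + norm z0"
  have \<mu>0: "\<mu>0 \<ge> 0" and C0: "C0 \<ge> 0" using \<omega>(2) by (auto simp: \<mu>0_def C0_def)
  interpret A: sectorial_potential r0 \<omega> \<mu>0 C0
    using r0 \<omega> \<mu>0 L2_form_bounds[OF \<omega>(1,2) cone0] by unfold_locales (auto simp: \<mu>0_def C0_def)
  define t where "t = 1 / (1 + \<epsilon>)"
  define \<kappa> where "\<kappa> = \<epsilon> / (1 + \<epsilon>)"
  have t: "0 < t" "t \<le> 1" and \<kappa>: "0 < \<kappa>" using \<epsilon> by (auto simp: t_def \<kappa>_def)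
  have \<eta>: "\<kappa> * c / 2 > 0" using \<kappa> \<omega>(2) by simp
  obtain K where K: "K \<ge> 0" "\<And>R W. R \<ge> 0 \<Longrightarrow> W \<in> form_domain R \<Longrightarrow>
     norm (of_real ((norm W)\<^sup>2) - form \<sigma> W W) \<le> \<kappa> * c / 2 * (norm W)\<^sup>2 + K * (norm (prim_L2 W))\<^sup>2"
    using form_perturbation_bound[OF \<sigma> bdd \<eta>] by blast
  define \<mu>1 where "\<mu>1 = K + \<mu>0 + 1"
  define C1 where "C1 = C0 + 2 / c + 1 + K"
  have bounds: "(norm (prim_L2 W))\<^sup>2 \<le> real_form \<omega> \<mu>1 r1 W W" "t * real_form \<omega> \<mu>0 r0 W W \<le> real_form \<omega> \<mu>1 r1 W W"
    "\<kappa> * c / 2 * (norm W)\<^sup>2 \<le> real_form \<omega> \<mu>1 r1 W W" "norm (form r1 W W) \<le> C1 * real_form \<omega> \<mu>1 r1 W W"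
    if W: "W \<in> form_core" for W
  proof -
    have P: "norm (of_real ((norm W)\<^sup>2) - form \<sigma> W W) \<le> \<kappa> * c / 2 * (norm W)\<^sup>2 + K * (norm (prim_L2 W))\<^sup>2"
      using W K(2)[OF less_imp_le] by (auto simp: form_core_iff)
    have eq: "form r1 W W = of_real t * form r0 W W + of_real \<kappa> * of_real ((norm W)\<^sup>2) - (of_real ((norm W)\<^sup>2) - form \<sigma> W W)"
      unfolding r0_def r1_def t_def \<kappa>_def by (rule form_shift[OF s \<sigma> W \<epsilon>])
    have b: "real_form \<omega> m r W W = Re (\<omega> * form r W W) + m * (norm (prim_L2 W))\<^sup>2" for m r
      by (simp add: real_form_def power2_norm_eq_inner)
    note perturbed_form_bounds[OF \<omega>(1,3,2) t \<kappa> \<mu>0 K(1) C0 zero_le_power2 zero_le_power2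
        A.L2_bound[OF W, unfolded b] A.form_bound[OF W, unfolded b] P, folded eq \<mu>1_def C1_def, folded b]
    then show "(norm (prim_L2 W))\<^sup>2 \<le> real_form \<omega> \<mu>1 r1 W W" "t * real_form \<omega> \<mu>0 r0 W W \<le> real_form \<omega> \<mu>1 r1 W W"
    "\<kappa> * c / 2 * (norm W)\<^sup>2 \<le> real_form \<omega> \<mu>1 r1 W W" "norm (form r1 W W) \<le> C1 * real_form \<omega> \<mu>1 r1 W W" .
  qed
  have \<mu>1: "\<mu>1 \<ge> 0" using \<mu>0 K(1) by (simp add: \<mu>1_def)
  have C1: "C1 \<ge> 0" using C0 K(1) \<omega>(2) by (simp add: C1_def)
  interpret B: coercive_potential r1 \<omega> \<mu>1 C1 "\<kappa> * c / 2"
    using r1 \<omega> \<mu>1 bounds \<eta> by unfold_locales auto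
  have "strictly_sectorial (minimal_operator r1)"
  proof -
    define z1 where "z1 = - of_real \<mu>1 * cnj \<omega>"
    have ww: "\<omega> * cnj \<omega> = 1" using \<omega>(1) by (simp flip: complex_norm_square)
    have "1 / (C1 + \<mu>1 + 1) * norm (w - z1) \<le> Re (\<omega> * (w - z1))" if "w \<in> numerical_range (minimal_operator r1)" for w
    proof -
      obtain f g where w: "w = cinner g f" "(f, g) \<in> minimal_operator r1" "norm f = 1"
        using \<open>w \<in> numerical_range (minimal_operator r1)\<close> unfolding numerical_range_def by blast
      obtain R W where RW: "R \<ge> 0" "W \<in> form_domain R" "f = prim_L2 W"
        by (rule minimal_operatorE[OF r1 w(2)], rule that)
      have W: "W \<in> form_core" using form_domain_subset_form_core RW by blast
      have wf: "w = form r1 W W" using minimal_operator_form[OF r1 W w(2)[unfolded RW(3)] W] w(1) RW(3) by simp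
      have "\<omega> * (w - z1) = \<omega> * w + of_real \<mu>1 * (\<omega> * cnj \<omega>)" by (simp add: z1_def algebra_simps)
      then have re: "Re (\<omega> * (w - z1)) = real_form \<omega> \<mu>1 r1 W W"
        using w(3) RW(3) by (simp add: ww wf real_form_def flip: power2_norm_eq_inner)
      have "norm (w - z1) \<le> norm w + norm z1" by (rule norm_triangle_ineq4)
      also have "norm z1 = \<mu>1" using \<mu>1 \<omega>(1) by (simp add: z1_def norm_mult)
      also have "norm w + \<mu>1 \<le> (C1 + \<mu>1) * real_form \<omega> \<mu>1 r1 W W"
        using bounds(4)[OF W] mult_left_mono[OF bounds(1)[OF W] \<mu>1] w(3) RW(3) by (simp add: wf distrib_right)
      also have "\<dots> \<le> (C1 + \<mu>1 + 1) * real_form \<omega> \<mu>1 r1 W W" using B.F.nonneg[OF W] by (intro mult_right_mono) auto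
      finally show ?thesis unfolding re using C1 \<mu>1 by (simp add: pos_divide_le_eq mult.commute)
    qed
    moreover have "1 / (C1 + \<mu>1 + 1) > 0" using C1 \<mu>1 by simp
    ultimately show ?thesis
      using cone_subset_sector[OF \<omega>(1), of "1 / (C1 + \<mu>1 + 1)" z1] unfolding strictly_sectorial_def by blast
  qed
  moreover have "has_extension_with_compact_resolvent (minimal_operator r1)"
    if compact: "has_extension_with_compact_resolvent (minimal_operator r0)"
  proof (rule B.has_compact_extension)
    have "{W\<in>form_core. real_form \<omega> \<mu>1 r1 W W \<le> 1} \<subseteq> {W\<in>form_core. real_form \<omega> \<mu>0 r0 W W \<le> 1 / t}"
      using bounds(2) t by (auto simp: pos_le_divide_eq mult.commute intro: order_trans)
    then have "B.F.unit_ball form_core \<subseteq> prim_L2 ` {W\<in>form_core. real_form \<omega> \<mu>0 r0 W W \<le> 1 / t}"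
      unfolding B.F.unit_ball_def by (rule image_mono)
    moreover have "totally_bounded (prim_L2 ` {W\<in>form_core. real_form \<omega> \<mu>0 r0 W W \<le> 1 / t})"
      using A.F.totally_bounded_ball_scale[OF subset_refl subspace_form_core A.compact_embedding[OF compact]] t by simp
    ultimately show "totally_bounded (B.F.unit_ball form_core)" by (rule totally_bounded_subset[rotated])
  qed
  ultimately show "strictly_sectorial (minimal_operator (\<lambda>x. s x + \<sigma> x)) \<and>
     (has_extension_with_compact_resolvent (minimal_operator (\<lambda>x. of_real (1 + \<epsilon>) * s x)) \<longrightarrow>
      has_extension_with_compact_resolvent (minimal_operator (\<lambda>x. s x + \<sigma> x)))"
    unfolding r0_def r1_def by blast
qed

end
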